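(* Let $X$ be a finite dimensional Banach space with Haar measure $\lambda$, let $U\subset X$ be either $X$ itself or a bounded open subset having the extension property, and let $1<p<\infty$. If $g\in W^1_p(U;\mathcal{Q}_Q(\ell_2^n))$ for some integer $n\ge1$, then $$\mathcal{E}_p^p(g;V)=\int_V|Dg|^p\,d\lambda$$ for every open set $V\subset U$.
   Context: $Q\ge1$ is an integer, $m=\dim X$, $Y=\ell_2^n$ ($\mathbb{R}^n$ with Euclidean norm). $\mathcal{Q}_Q(Y)$ is the quotient of $Y^Q$ by the permutation action of $S_Q$; the class of $(y_1,\dots,y_Q)$ is $[\![y_1,\dots,y_Q]\!]$, $Q[\![0]\!]=[\![0,\dots,0]\!]$, and $\mathcal{G}_2([\![y_1,\dots,y_Q]\!],[\![y_1',\dots,y_Q']\!])=\min_{\sigma\in S_Q}\big(\sum_i\|y_i-y'_{\sigma(i)}\|^2\big)^{1/2}$. $U$ has the extension property if for every $1<p<\infty$ there is a continuous linear extension operator from the classical Sobolev space $W^{1,p}(U)$ to $W^{1,p}(X)$. A basis $u_1,\dots,u_m$ of $X$ is fixed and for linear $L:X\to Y$, $|||L|||=\big(\sum_{j=1}^m\|L(u_j)\|^2\big)^{1/2}$. A Borel map $f:U\to\mathcal{Q}_Q(Y)$ is approximately differentiable at $a\in U$ if there are affine maps $A_1,\dots,A_Q:X\to Y$ such that for every $\varepsilon>0$ the set $E_\varepsilon=\{x:\mathcal{G}_2(f(x),[\![A_1(x),\dots,A_Q(x)]\!])>\varepsilon\|x-a\|\}$ satisfies $\lambda(E_\varepsilon\cap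 B(a,r))/\lambda(B(a,r))\to0$ as $r\to0$; the unordered tuple is unique; with $L_i=A_i-A_i(0)$ put $|Df(a)|=\big(\sum_i|||L_i|||^2\big)^{1/2}$. Lipschitz maps are approximately differentiable $\lambda$-a.e., and so is every $g\in W^1_p(U;\mathcal{Q}_Q(\ell_2^n))$. $L_p(U;\mathcal{Q}_Q(Y))$: Borel maps $f:U\to\mathcal{Q}_Q(Y)$ with $\int_U\mathcal{G}_2(f,Q[\![0]\!])^pd\lambda<\infty$; $d_p(f,g)=(\int_U\mathcal{G}_2(f,g)^pd\lambda)^{1/p}$. $W^1_p(U;\mathcal{Q}_Q(Y))$: those $f\in L_p(U;\mathcal{Q}_Q(Y))$ for which there are Lipschitz maps $f_j:X\to\mathcal{Q}_Q(Y)$ with $f_j|_U\in L_p(U;\mathcal{Q}_Q(Y))$, $\sup_j\int_U|Df_j|^pd\lambda<\infty$ and $d_p(f,f_j)\to0$. For $f\in W^1_p(U;\mathcal{Q}_Q(Y))$ and $V\subset U$ open, the $p$-energy is $\mathcal{E}_p^p(f;V)=\inf\{\liminf_j\int_V|Df_j|^pd\lambda\}$, the infimum over all sequences $\{f_j\}$ of Lipschitz maps $U\to\mathcal{Q}_Q(Y)$ with $d_p(f,f_j)\to0$. *)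

theory Defs
  imports "HOL-Analysis.Analysis" "HOL-Combinatorics.Permutations"
begin

text \<open>The number \<open>Q\<close> of branches is the cardinality of the finite index type \<^typ>\<open>'q\<close>.\<close>

definition perm_rel :: "('q \<Rightarrow> 'y) \<Rightarrow> ('q \<Rightarrow> 'y) \<Rightarrow> bool" where
  "perm_rel y y' \<longleftrightarrow> (\<exists>\<sigma>. \<sigma> permutes UNIV \<and> y' = y \<circ> \<sigma>)"

lemma equivp_perm_rel: "equivp (perm_rel :: ('q \<Rightarrow> 'y) \<Rightarrow> _)"
proof (rule equivpI)
  show "reflp (perm_rel :: ('q \<Rightarrow> 'y) \<Rightarrow> _)"
    unfolding perm_rel_def by (rule reflpI) (metis permutes_id comp_id)
  show "symp (perm_rel :: ('q \<Rightarrow> 'y) \<Rightarrow> _)"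
  proof (rule sympI)
    fix x y :: "'q \<Rightarrow> 'y" assume "perm_rel x y"
    then obtain \<sigma> where s: "\<sigma> permutes UNIV" "y = x \<circ> \<sigma>" unfolding perm_rel_def by blast
    then have "x = y \<circ> inv \<sigma>"
      by (simp add: comp_assoc permutes_inv_o(1))
    then show "perm_rel y x" unfolding perm_rel_def using permutes_inv s(1) by blast
  qed
  show "transp (perm_rel :: ('q \<Rightarrow> 'y) \<Rightarrow> _)"
    unfolding perm_rel_def by (rule transpI) (metis comp_assoc permutes_compose)
qed

quotient_type ('y, 'q) utuple = "'q \<Rightarrow> 'y" / perm_rel
  morphisms rep_utuple utuple
  by (rule equivp_perm_rel)

definition G2_tuple :: "('q::finite \<Rightarrow> 'y::real_normed_vector) \<Rightarrow> ('q \<Rightarrow> 'y) \<Rightarrow> real" where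
  "G2_tuple y y' =
     Min ((\<lambda>\<sigma>. sqrt (\<Sum>i\<in>UNIV. (norm (y i - y' (\<sigma> i)))\<^sup>2)) ` {\<sigma>. \<sigma> permutes UNIV})"

lemma finite_perms: "finite {\<sigma>::'q::finite \<Rightarrow> 'q. \<sigma> permutes UNIV}"
  by simp

lemma G2_tuple_le:
  "\<sigma> permutes UNIV \<Longrightarrow> G2_tuple y y' \<le> sqrt (\<Sum>i\<in>UNIV. (norm (y i - y' (\<sigma> i)))\<^sup>2)"
  unfolding G2_tuple_def by (rule Min_le) (auto simp: finite_perms)

lemma G2_tuple_attained:
  obtains \<sigma> where "\<sigma> permutes UNIV" "G2_tuple y y' = sqrt (\<Sum>i\<in>UNIV. (norm (y i - y' (\<sigma> i)))\<^sup>2)"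
proof -
  have "(\<lambda>\<sigma>. sqrt (\<Sum>i\<in>UNIV. (norm (y i - y' (\<sigma> i)))\<^sup>2)) ` {\<sigma>. \<sigma> permutes UNIV} \<noteq> {}"
    using permutes_id by blast
  from Min_in[OF _ this] show ?thesis
    using that unfolding G2_tuple_def by (auto simp: finite_perms)
qed

lemma G2_tuple_commute_le: "G2_tuple y y' \<le> G2_tuple y' y"
proof -
  obtain \<sigma> where s: "\<sigma> permutes UNIV"
    "G2_tuple y' y = sqrt (\<Sum>i\<in>UNIV. (norm (y' i - y (\<sigma> i)))\<^sup>2)"
    by (rule G2_tuple_attained)
  have "G2_tuple y y' \<le> sqrt (\<Sum>i\<in>UNIV. (norm (y i - y' (inv \<sigma> i)))\<^sup>2)"
    using s(1) by (intro G2_tuple_le permutes_inv)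
  also have "(\<Sum>i\<in>UNIV. (norm (y i - y' (inv \<sigma> i)))\<^sup>2)
      = (\<Sum>i\<in>UNIV. (norm (y (\<sigma> i) - y' (inv \<sigma> (\<sigma> i))))\<^sup>2)"
    using sum.permute[OF s(1), of "\<lambda>i. (norm (y i - y' (inv \<sigma> i)))\<^sup>2"] by (simp add: comp_def)
  also have "\<dots> = (\<Sum>i\<in>UNIV. (norm (y' i - y (\<sigma> i)))\<^sup>2)"
    using permutes_inverses(2)[OF s(1)] by (simp add: norm_minus_commute)
  finally show ?thesis using s(2) by simp
qed

lemma G2_tuple_commute: "G2_tuple y y' = G2_tuple y' y"
  by (intro antisym G2_tuple_commute_le)

lemma G2_tuple_perm_le:
  assumes "\<tau> permutes UNIV"
  shows "G2_tuple y (y' \<circ> \<tau>) \<le> G2_tuple y y'"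
proof -
  obtain \<sigma> where s: "\<sigma> permutes UNIV"
    "G2_tuple y y' = sqrt (\<Sum>i\<in>UNIV. (norm (y i - y' (\<sigma> i)))\<^sup>2)"
    by (rule G2_tuple_attained)
  have "G2_tuple y (y' \<circ> \<tau>) \<le> sqrt (\<Sum>i\<in>UNIV. (norm (y i - (y' \<circ> \<tau>) ((inv \<tau> \<circ> \<sigma>) i)))\<^sup>2)"
    using s(1) assms by (intro G2_tuple_le permutes_compose permutes_inv)
  then show ?thesis using s(2) permutes_inverses(1)[OF assms] by simp
qed

lemma G2_tuple_perm:
  assumes "perm_rel y' y''"
  shows "G2_tuple y y' = G2_tuple y y''"
proof (rule antisym)
  have "perm_rel y'' y'" using assms equivp_perm_rel by (metis equivp_symp)
  then show "G2_tuple y y' \<le> G2_tuple y y''"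
    unfolding perm_rel_def using G2_tuple_perm_le by blast
  show "G2_tuple y y'' \<le> G2_tuple y y'"
    using assms unfolding perm_rel_def using G2_tuple_perm_le by blast
qed

lemma G2_tuple_triangle: "G2_tuple x z \<le> G2_tuple x y + G2_tuple y z"
proof -
  obtain \<sigma> where s: "\<sigma> permutes UNIV"
    "G2_tuple x y = sqrt (\<Sum>i\<in>UNIV. (norm (x i - y (\<sigma> i)))\<^sup>2)"
    by (rule G2_tuple_attained)
  obtain \<tau> where t: "\<tau> permutes UNIV"
    "G2_tuple y z = sqrt (\<Sum>i\<in>UNIV. (norm (y i - z (\<tau> i)))\<^sup>2)"
    by (rule G2_tuple_attained)
  have t': "G2_tuple y z = sqrt (\<Sum>i\<in>UNIV. (norm (y (\<sigma> i) - z (\<tau> (\<sigma> i))))\<^sup>2)"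
    using sum.permute[OF s(1), of "\<lambda>i. (norm (y i - z (\<tau> i)))\<^sup>2"] t(2) by (simp add: comp_def)
  have "G2_tuple x z \<le> sqrt (\<Sum>i\<in>UNIV. (norm (x i - z ((\<tau> \<circ> \<sigma>) i)))\<^sup>2)"
    using s(1) t(1) by (intro G2_tuple_le permutes_compose)
  also have "\<dots> \<le> sqrt (\<Sum>i\<in>UNIV. (norm (x i - y (\<sigma> i)) + norm (y (\<sigma> i) - z (\<tau> (\<sigma> i))))\<^sup>2)"
    by (intro real_sqrt_le_mono sum_mono power_mono)
       (auto intro: order_trans[OF _ norm_triangle_ineq])
  also have "\<dots> \<le> sqrt (\<Sum>i\<in>UNIV. (norm (x i - y (\<sigma> i)))\<^sup>2)
      + sqrt (\<Sum>i\<in>UNIV. (norm (y (\<sigma> i) - z (\<tau> (\<sigma> i))))\<^sup>2)"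
    using L2_set_triangle_ineq[of "\<lambda>i. norm (x i - y (\<sigma> i))" "\<lambda>i. norm (y (\<sigma> i) - z (\<tau> (\<sigma> i)))" UNIV]
    by (simp add: L2_set_def)
  finally show ?thesis using s(2) t' by simp
qed

lemma G2_tuple_eq_0_iff: "G2_tuple y y' = 0 \<longleftrightarrow> perm_rel y y'"
proof
  assume 0: "G2_tuple y y' = 0"
  obtain \<sigma> where s: "\<sigma> permutes UNIV"
    "G2_tuple y y' = sqrt (\<Sum>i\<in>UNIV. (norm (y i - y' (\<sigma> i)))\<^sup>2)"
    by (rule G2_tuple_attained)
  then have "y = y' \<circ> \<sigma>" using 0 by (auto simp: sum_nonneg_eq_0_iff fun_eq_iff)
  then have "perm_rel y' y" unfolding perm_rel_def using s(1) by blast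
  then show "perm_rel y y'" using equivp_perm_rel by (metis equivp_symp)
next
  assume "perm_rel y y'"
  then have "G2_tuple y y' = G2_tuple y y" by (metis G2_tuple_perm)
  also have "\<dots> = 0"
  proof (rule antisym)
    show "G2_tuple y y \<le> 0" using G2_tuple_le[OF permutes_id, of y y] by simp
    show "0 \<le> G2_tuple y y" by (rule G2_tuple_attained[of y y]) (auto intro: sum_nonneg)
  qed
  finally show "G2_tuple y y' = 0" .
qed

lift_definition G2 :: "('y::real_normed_vector, 'q::finite) utuple \<Rightarrow> ('y, 'q) utuple \<Rightarrow> real"
  is G2_tuple
  by (metis G2_tuple_commute G2_tuple_perm)

instantiation utuple :: (real_normed_vector, finite) metric_space
begin

definition dist_utuple :: "('a, 'b) utuple \<Rightarrow> ('a, 'b) utuple \<Rightarrow> real" where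
  "dist_utuple = G2"

definition uniformity_utuple :: "(('a, 'b) utuple \<times> ('a, 'b) utuple) filter" where
  "uniformity_utuple = (INF e\<in>{0 <..}. principal {(x, y). dist x y < e})"

definition open_utuple :: "('a, 'b) utuple set \<Rightarrow> bool" where
  "open_utuple S = (\<forall>x\<in>S. eventually (\<lambda>(x', y). x' = x \<longrightarrow> y \<in> S) uniformity)"

instance
proof
  fix x y z :: "('a, 'b) utuple"
  show "(dist x y = 0) = (x = y)"
    unfolding dist_utuple_def by transfer (rule G2_tuple_eq_0_iff)
  show "dist x y \<le> dist x z + dist y z"
    unfolding dist_utuple_def by transfer (metis G2_tuple_commute G2_tuple_triangle)
qed (simp_all add: uniformity_utuple_def open_utuple_def)

end

definition utuple_zero :: "('y::real_normed_vector, 'q) utuple" where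
  "utuple_zero = utuple (\<lambda>_. 0)"

definition haar_measure :: "'a::real_normed_vector measure \<Rightarrow> bool" where
  "haar_measure \<mu> \<longleftrightarrow>
     sets \<mu> = sets borel \<and>
     emeasure \<mu> UNIV \<noteq> 0 \<and>
     (\<forall>K. compact K \<longrightarrow> emeasure \<mu> K < \<infinity>) \<and>
     (\<forall>a. distr \<mu> borel (\<lambda>x. a + x) = \<mu>)"

definition finite_basis :: "'a::real_vector set \<Rightarrow> bool" where
  "finite_basis B \<longleftrightarrow> finite B \<and> independent B \<and> span B = UNIV"

definition tri_norm :: "'a::real_normed_vector set \<Rightarrow> ('a \<Rightarrow> 'y::real_normed_vector) \<Rightarrow> real" where
  "tri_norm B L = sqrt (\<Sum>u\<in>B. (norm (L u))\<^sup>2)"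

text \<open>
  Functions on \<open>U\<close> are represented by total functions, of which only the values on \<open>U\<close> matter.
  They are not identified when they agree almost everywhere; this is accounted for in the
  definition of an extension operator.
\<close>

primrec Ck :: "nat \<Rightarrow> ('a::real_normed_vector \<Rightarrow> real) \<Rightarrow> bool" where
  "Ck 0 \<phi> \<longleftrightarrow> continuous_on UNIV \<phi>"
| "Ck (Suc k) \<phi> \<longleftrightarrow>
     (\<exists>\<phi>'. (\<forall>x. (\<phi> has_derivative \<phi>' x) (at x)) \<and> (\<forall>v. Ck k (\<lambda>x. \<phi>' x v)))"

definition test_function :: "'a::real_normed_vector set \<Rightarrow> ('a \<Rightarrow> real) \<Rightarrow> bool" where
  "test_function U \<phi> \<longleftrightarrow>
     (\<forall>k. Ck k \<phi>) \<and> (\<exists>K. compact K \<and> K \<subseteq> U \<and> (\<forall>x. x \<notin> K \<longrightarrow> \<phi> x = 0))"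

definition Lp_real :: "'a::real_normed_vector measure \<Rightarrow> real \<Rightarrow> 'a set \<Rightarrow> ('a \<Rightarrow> real) set" where
  "Lp_real \<mu> p U =
     {f. f \<in> borel_measurable (restrict_space borel U) \<and> set_integrable \<mu> U (\<lambda>x. \<bar>f x\<bar> powr p)}"

definition weak_deriv_in_Lp ::
  "'a::real_normed_vector measure \<Rightarrow> real \<Rightarrow> 'a set \<Rightarrow> 'a \<Rightarrow> ('a \<Rightarrow> real) \<Rightarrow> ('a \<Rightarrow> real) \<Rightarrow> bool" where
  "weak_deriv_in_Lp \<mu> p U v f g \<longleftrightarrow>
     g \<in> Lp_real \<mu> p U \<and>
     (\<forall>\<phi>. test_function U \<phi> \<longrightarrow>
       (LINT x:U|\<mu>. f x * frechet_derivative \<phi> (at x) v) = - (LINT x:U|\<mu>. g x * \<phi> x))"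

definition sobolev ::
  "'a::real_normed_vector measure \<Rightarrow> 'a set \<Rightarrow> real \<Rightarrow> 'a set \<Rightarrow> ('a \<Rightarrow> real) set" where
  "sobolev \<mu> B p U = {f \<in> Lp_real \<mu> p U. \<forall>u\<in>B. \<exists>g. weak_deriv_in_Lp \<mu> p U u f g}"

text \<open>Weak derivatives are unique up to null sets, so the choice of \<open>g\<close> below is immaterial.\<close>

definition sobolev_norm ::
  "'a::real_normed_vector measure \<Rightarrow> 'a set \<Rightarrow> real \<Rightarrow> 'a set \<Rightarrow> ('a \<Rightarrow> real) \<Rightarrow> real" where
  "sobolev_norm \<mu> B p U f =
     ((LINT x:U|\<mu>. \<bar>f x\<bar> powr p) +
      (\<Sum>u\<in>B. LINT x:U|\<mu>. \<bar>(SOME g. weak_deriv_in_Lp \<mu> p U u f g) x\<bar> powr p)) powr (1 / p)"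

text \<open>
  Equalities hold almost everywhere because Sobolev functions are equivalence classes;
  linearity and the norm bound imply that \<open>T\<close> is well defined on these classes.
\<close>

definition extension_operator ::
  "'a::real_normed_vector measure \<Rightarrow> 'a set \<Rightarrow> real \<Rightarrow> 'a set \<Rightarrow> (('a \<Rightarrow> real) \<Rightarrow> 'a \<Rightarrow> real) \<Rightarrow> bool" where
  "extension_operator \<mu> B p U T \<longleftrightarrow>
     (\<forall>f \<in> sobolev \<mu> B p U. T f \<in> sobolev \<mu> B p UNIV \<and> (AE x in \<mu>. x \<in> U \<longrightarrow> T f x = f x)) \<and>
     (\<forall>f \<in> sobolev \<mu> B p U. \<forall>g \<in> sobolev \<mu> B p U. \<forall>s t.
        AE x in \<mu>. T (\<lambda>x. s * f x + t * g x) x = s * T f x + t * T g x) \<and>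
     (\<exists>C. \<forall>f \<in> sobolev \<mu> B p U. sobolev_norm \<mu> B p UNIV (T f) \<le> C * sobolev_norm \<mu> B p U f)"

definition extension_property :: "'a::real_normed_vector measure \<Rightarrow> 'a set \<Rightarrow> 'a set \<Rightarrow> bool" where
  "extension_property \<mu> B U \<longleftrightarrow> (\<forall>p>1. \<exists>T. extension_operator \<mu> B p U T)"

definition affine_map :: "('a::real_vector \<Rightarrow> 'y::real_vector) \<Rightarrow> bool" where
  "affine_map A \<longleftrightarrow> linear (\<lambda>x. A x - A 0)"

definition approx_differential ::
  "'a::real_normed_vector measure \<Rightarrow> 'a set \<Rightarrow> ('a \<Rightarrow> ('y::real_normed_vector, 'q::finite) utuple) \<Rightarrow>
   'a \<Rightarrow> ('q \<Rightarrow> 'a \<Rightarrow> 'y) \<Rightarrow> bool" where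
  "approx_differential \<mu> U f a A \<longleftrightarrow>
     f \<in> borel_measurable (restrict_space borel U) \<and> a \<in> U \<and> (\<forall>i. affine_map (A i)) \<and>
     (\<forall>\<epsilon>>0.
       ((\<lambda>r. measure \<mu> ({x \<in> U. dist (f x) (utuple (\<lambda>i. A i x)) > \<epsilon> * norm (x - a)} \<inter> ball a r)
             / measure \<mu> (ball a r)) \<longlongrightarrow> 0) (at_right 0))"

text \<open>
  The approximating tuple is unique up to order and the norm does not depend on the order.
  Outside the points of approximate differentiability, the value is set to \<open>0\<close>.
\<close>

definition Df_norm ::
  "'a::real_normed_vector measure \<Rightarrow> 'a set \<Rightarrow> 'a set \<Rightarrow>
   ('a \<Rightarrow> ('y::real_normed_vector, 'q::finite) utuple) \<Rightarrow> 'a \<Rightarrow> real" where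
  "Df_norm \<mu> B U f a =
     (if \<exists>A. approx_differential \<mu> U f a A
      then let A = (SOME A. approx_differential \<mu> U f a A)
           in sqrt (\<Sum>i\<in>UNIV. (tri_norm B (\<lambda>x. A i x - A i 0))\<^sup>2)
      else 0)"

definition Df_integral ::
  "'a::real_normed_vector measure \<Rightarrow> 'a set \<Rightarrow> real \<Rightarrow> 'a set \<Rightarrow>
   ('a \<Rightarrow> ('y::real_normed_vector, 'q::finite) utuple) \<Rightarrow> 'a set \<Rightarrow> ennreal" where
  "Df_integral \<mu> B p U f V = (\<integral>\<^sup>+x\<in>V. ennreal (Df_norm \<mu> B U f x powr p) \<partial>\<mu>)"

definition Lp_Q ::
  "'a::real_normed_vector measure \<Rightarrow> real \<Rightarrow> 'a set \<Rightarrow>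
   ('a \<Rightarrow> ('y::real_normed_vector, 'q::finite) utuple) set" where
  "Lp_Q \<mu> p U =
     {f. f \<in> borel_measurable (restrict_space borel U) \<and>
         (\<integral>\<^sup>+x\<in>U. ennreal (dist (f x) utuple_zero powr p) \<partial>\<mu>) < \<infinity>}"

definition dp ::
  "'a::real_normed_vector measure \<Rightarrow> real \<Rightarrow> 'a set \<Rightarrow>
   ('a \<Rightarrow> ('y::real_normed_vector, 'q::finite) utuple) \<Rightarrow> ('a \<Rightarrow> ('y, 'q) utuple) \<Rightarrow> ennreal" where
  "dp \<mu> p U f g =
     (let I = (\<integral>\<^sup>+x\<in>U. ennreal (dist (f x) (g x) powr p) \<partial>\<mu>)
      in if I = \<infinity> then \<infinity> else ennreal (enn2real I powr (1 / p)))"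

definition lipschitz_map :: "'a::metric_space set \<Rightarrow> ('a \<Rightarrow> 'b::metric_space) \<Rightarrow> bool" where
  "lipschitz_map U f \<longleftrightarrow> (\<exists>C. C-lipschitz_on U f)"

definition W1p ::
  "'a::real_normed_vector measure \<Rightarrow> 'a set \<Rightarrow> real \<Rightarrow> 'a set \<Rightarrow>
   ('a \<Rightarrow> ('y::real_normed_vector, 'q::finite) utuple) set" where
  "W1p \<mu> B p U =
     {f \<in> Lp_Q \<mu> p U. \<exists>F :: nat \<Rightarrow> 'a \<Rightarrow> ('y, 'q) utuple.
        (\<forall>j. lipschitz_map UNIV (F j) \<and> F j \<in> Lp_Q \<mu> p U) \<and>
        (SUP j. Df_integral \<mu> B p UNIV (F j) U) < \<infinity> \<and>
        (\<lambda>j. dp \<mu> p U f (F j)) \<longlonglongrightarrow> 0}"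

definition p_energy ::
  "'a::real_normed_vector measure \<Rightarrow> 'a set \<Rightarrow> real \<Rightarrow> 'a set \<Rightarrow>
   ('a \<Rightarrow> ('y::real_normed_vector, 'q::finite) utuple) \<Rightarrow> 'a set \<Rightarrow> ennreal" where
  "p_energy \<mu> B p U f V =
     Inf {liminf (\<lambda>j. Df_integral \<mu> B p U (F j) V) | F :: nat \<Rightarrow> 'a \<Rightarrow> ('y, 'q) utuple.
            (\<forall>j. lipschitz_map U (F j)) \<and> (\<lambda>j. dp \<mu> p U f (F j)) \<longlonglongrightarrow> 0}"

end

theory Submission
  imports Defs
begin

text \<open>
  Unordered \<open>Q\<close>-tuples are the orbits of a finite group of linear isometries of \<open>(\<real>\<^sup>n)\<^sup>Q\<close>. Such an
  orbit space is an absolute Lipschitz retract, and finitely many functions \<open>\<xi> v\<close>, each a maximum of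
  linear functionals over an orbit, embed it bilipschitzly with a Lipschitz left inverse \<open>\<rho>\<close>. A
  Lipschitz map into it is differentiable almost everywhere, and \<open>\<bar>DF\<bar>\<close> is the length of the vector of
  its directional metric slopes.

  By uniform convexity, midpoint combinations of the coordinates of a bounded-energy sequence tending
  to \<open>g\<close> have gradients that converge strongly. Their common \<open>L\<^sup>p\<close> majorant and the maximal
  inequality show that \<open>g\<close> agrees with Lipschitz maps \<open>T l\<close> on compact sets \<open>K l\<close> that exhaust \<open>U\<close> up to
  a null set, so \<open>\<bar>Dg\<bar> = \<bar>DT l\<bar>\<close> at almost every point of \<open>K l\<close>.

  Lower bound: integrating slopes along segments makes each directional slope lower semicontinuous on
  small open sets around compact pieces of the \<open>K l\<close>, and Young's inequality recombines the directions.
  Upper bound: near \<open>K l\<close>, squeeze the coordinates of the strong approximation towards those of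
  \<open>T l\<close>, and apply \<open>\<rho>\<close>.
\<close>

text \<open>An orbit space has neither sums nor averages, and the coordinates \<open>\<xi> v\<close>
  determine \<open>\<bar>DF\<bar>\<close> only up to bounded factors. They yield compactness and
  majorants, never the exact value of an energy. Exactness comes from coincidence sets: Lipschitz
  maps that agree on a set have the same slopes at almost every density point of it. On
  \<open>K l\<close> both bounds therefore compare with one fixed Lipschitz map, and on the small
  remainder a constant times a small integral is affordable. For the same reason the recovery maps
  have to equal \<open>g\<close> on \<open>K l\<close>; being close to it there would not control
  slopes.

  The retraction property rests on an induction over the order of the group. Near a vector the orbit
  distance is that of the stabiliser, which is a proper subgroup unless the whole group fixes the
  vector, and the component fixed by the group can be split off and extended linearly. Slopes are
  limits of quotients of distances, so lower semicontinuity can be tested in the target metric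
  itself, without choosing branches.\<close>

abbreviation lint where "lint f \<equiv> \<integral>\<^sup>+x. f x \<partial>lborel"
abbreviation sint where "sint S f \<equiv> \<integral>\<^sup>+x\<in>S. f x \<partial>lborel"
abbreviation pint where "pint p S f \<equiv> \<integral>\<^sup>+x\<in>S. ennreal (f x powr p) \<partial>lborel"
abbreviation vol where "vol \<equiv> emeasure lborel"

section \<open>Orbit spaces of finite isometry groups\<close>

text \<open>Pseudometrics on an arbitrary type absorb Lipschitz constants, and they admit the source
  \<open>'w => real\<close>, where functions that differ only outside a finite index set are at
  distance 0.\<close>

definition pseudometric :: "('m => 'm => real) => bool" where
 "pseudometric d \<longleftrightarrow>
  (ALL x. d x x = 0) & (ALL x y. d x y = d y x) & (ALL x y z. d x z <= d x y + d y z)"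

lemma pseudometricD:
 assumes "pseudometric d"
 shows "d x x = 0" "d x y = d y x" "d x z <= d x y + d y z" "0 <= d x y"
proof -
 show *: "d x x = 0" "d x y = d y x" "d x z <= d x y + d y z" using assms unfolding pseudometric_def by blast+
 have "d x x <= d x y + d y x" "d x x = 0" "d x y = d y x" using assms unfolding pseudometric_def by blast+
 then show "0 <= d x y" by linarith
qed

lemma pseudometric_scale: "pseudometric d ==> 0 <= c ==> pseudometric (%x y. c * d x y)"
 unfolding pseudometric_def by (simp add: distrib_left[symmetric] mult_left_mono)

text \<open>The infimum of the cones \<open>f a + d a x\<close> is the largest extension with the
  same constant; a single point \<open>a0\<close> already bounds the cones from below.\<close>

lemma McShane_extension:
 fixes f :: "'m => real"
 assumes d: "pseudometric d" and f: "!!a b. a : A ==> b : A ==> \<bar>f a - f b\<bar> <= d a b"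
 obtains F where "!!a. a : A ==> F a = f a" "!!x y. \<bar>F x - F y\<bar> <= d x y"
proof (cases "A = {}")
 case True
 then show ?thesis using that[of "%_. 0"] pseudometricD(4)[OF d] by auto
next
 case False
 then obtain a0 where a0: "a0 : A" by blast
 define F where "F x = (INF a\<in>A. f a + d a x)" for x
 have bdd: "bdd_below ((%a. f a + d a x) ` A)" for x
 proof (rule bdd_belowI2)
  fix a assume "a : A"
  show "f a0 - d a0 x <= f a + d a x"
   using f[OF a0 \<open>a : A\<close>] pseudometricD(3)[OF d, of a0 a x] pseudometricD(2)[OF d, of a x]
   pseudometricD(3)[OF d, of a0 x a] by linarith
 qed
 have le: "F x <= F y + d x y" for x y
 proof -
  have "F x - d x y <= F y"
   unfolding F_def[of y]
  proof (rule cINF_greatest[OF False])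
   fix a assume "a : A"
   then have "F x <= f a + d a x" unfolding F_def by (rule cINF_lower[OF bdd])
   then show "F x - d x y <= f a + d a y"
    using pseudometricD(3)[OF d, of a x y] pseudometricD(3)[OF d, of a y x] pseudometricD(2)[OF d, of x y] by linarith
  qed
  then show ?thesis by linarith
 qed
 show ?thesis
 proof
  fix a assume a: "a : A"
  show "F a = f a"
  proof (rule antisym)
   have "F a <= f a + d a a" unfolding F_def by (rule cINF_lower[OF bdd a])
   then show "F a <= f a" using pseudometricD(1)[OF d] by simp
   show "f a <= F a" unfolding F_def
   proof (rule cINF_greatest[OF False])
    fix b assume "b : A"
    show "f a <= f b + d b a" using f[OF \<open>b : A\<close> a] by linarith
   qed
  qed
 next
  fix x y
  show "\<bar>F x - F y\<bar> <= d x y" using le[of x y] le[of y x] pseudometricD(2)[OF d, of x y] by linarith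
 qed
qed

lemma McShane_extension_euclidean:
 fixes f :: "'m => 'w::euclidean_space" and d :: "'m => 'm => real"
 assumes d: "pseudometric d" and f: "!!a b. a : A ==> b : A ==> norm (f a - f b) <= d a b"
 obtains F where "!!a. a : A ==> F a = f a" "!!x y. norm (F x - F y) <= real DIM('w) * d x y"
proof -
 have "EX F. (ALL a:A. F a = f a \<bullet> b) & (ALL x y. \<bar>F x - F y\<bar> <= d x y)" if "b : Basis" for b
 proof -
  have "\<bar>f x \<bullet> b - f y \<bullet> b\<bar> <= d x y" if "x : A" "y : A" for x y
   using f[OF that] Basis_le_norm[OF \<open>b : Basis\<close>, of "f x - f y"] by (simp add: inner_diff_left)
  then obtain F where "!!a. a : A ==> F a = f a \<bullet> b" "!!x y. \<bar>F x - F y\<bar> <= d x y"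
   using McShane_extension[OF d, of A "%a. f a \<bullet> b"] by blast
  then show ?thesis by blast
 qed
 then obtain F where F: "!!b a. b : Basis ==> a : A ==> F b a = f a \<bullet> b"
  "!!b x y. b : Basis ==> \<bar>F b x - F b y\<bar> <= d x y" by metis
 show ?thesis
 proof
  show "(SUM b:Basis. F b a *\<^sub>R b) = f a" if "a : A" for a using F(1)[OF _ that] by (simp add: euclidean_representation)
  fix x y
  have "norm ((SUM b:Basis. F b x *\<^sub>R b) - (SUM b:Basis. F b y *\<^sub>R b))
    = norm (SUM b:(Basis::'w set). (F b x - F b y) *\<^sub>R b)" by (simp add: sum_subtractf scaleR_diff_left)
  also have "... <= (SUM b:(Basis::'w set). d x y)" by (rule sum_norm_le) (use F(2) in auto)
  finally show "norm ((SUM b:Basis. F b x *\<^sub>R b) - (SUM b:Basis. F b y *\<^sub>R b)) <= real DIM('w) * d x y" by simp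
 qed
qed

section \<open>Finite groups of linear isometries and the local form of the orbit distance\<close>

locale isogroup =
 fixes H :: "('w::euclidean_space => 'w) set"
 assumes finite_H [simp]: "finite H"
  and id_in: "id : H"
  and lin: "h : H ==> linear h"
  and norm_h: "h : H ==> norm (h x) = norm x"
  and comp_in: "g : H ==> h : H ==> g \<circ> h : H"
  and inv_in: "h : H ==> EX g:H. ALL x. g (h x) = x & h (g x) = x"

text \<open>Moving only the second point suffices, because the group acts by isometries.\<close>

definition odist :: "('w::euclidean_space => 'w) set => 'w => 'w => real" where
 "odist H x y = Min ((%h. norm (x - h y)) ` H)"

definition stab :: "('w => 'w) set => 'w => ('w => 'w) set" where
 "stab H v = {h : H. h v = v}"

context isogroup
begin

lemma H_ne [simp]: "H ~= {}" using id_in by blast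

lemma norm_h_diff: "h : H ==> norm (h x - h y) = norm (x - y)" using linear_diff[OF lin] norm_h by metis

lemma odist_le: "h : H ==> odist H x y <= norm (x - h y)" unfolding odist_def by (rule Min_le) auto

lemma odist_attained: obtains h where "h : H" "odist H x y = norm (x - h y)"
proof -
 have "odist H x y : (%h. norm (x - h y)) ` H" unfolding odist_def by (rule Min_in) auto
 then show ?thesis using that by blast
qed

lemma odist_nonneg [simp]: "0 <= odist H x y" by (rule odist_attained[of x y]) simp

lemma odist_le_norm: "odist H x y <= norm (x - y)" using odist_le[OF id_in] by simp

lemma odist_self [simp]: "odist H x x = 0" using odist_le_norm[of x x] odist_nonneg[of x x] by (simp del: odist_nonneg)

lemma odist_commute_le: "odist H x y <= odist H y x"
proof -
 obtain h where h: "h : H" "odist H y x = norm (y - h x)" by (rule odist_attained)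
 obtain g where g: "g : H" "ALL x. g (h x) = x & h (g x) = x" using inv_in[OF h(1)] by blast
 have "odist H x y <= norm (x - g y)" by (rule odist_le[OF g(1)])
 also have "... = norm (g (h x) - g y)" using g(2) by simp
 also have "... = norm (h x - y)" by (rule norm_h_diff[OF g(1)])
 finally show ?thesis using h(2) by (simp add: norm_minus_commute)
qed

lemma odist_commute: "odist H x y = odist H y x" by (intro antisym odist_commute_le)

lemma odist_triangle: "odist H x z <= odist H x y + odist H y z"
proof -
 obtain h where h: "h : H" "odist H x y = norm (x - h y)" by (rule odist_attained)
 obtain g where g: "g : H" "odist H y z = norm (y - g z)" by (rule odist_attained)
 have "odist H x z <= norm (x - (h \<circ> g) z)" by (rule odist_le[OF comp_in[OF h(1) g(1)]])
 also have "... <= norm (x - h y) + norm (h y - h (g z))" using norm_triangle_ineq[of "x - h y" "h y - h (g z)"] by simp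
 also have "norm (h y - h (g z)) = norm (y - g z)" by (rule norm_h_diff[OF h(1)])
 finally show ?thesis using h g by simp
qed

lemma odist_orbit0: "h : H ==> odist H (h x) x = 0" using odist_le[of h "h x" x] odist_nonneg[of "h x" x] by (simp del: odist_nonneg)

lemma odist_left [simp]: "h : H ==> odist H (h x) y = odist H x y"
 using odist_orbit0[of h x] odist_triangle[of "h x" y x] odist_triangle[of x y "h x"]
  odist_commute[of x "h x"] by linarith

lemma odist_right [simp]: "h : H ==> odist H x (h y) = odist H x y" using odist_left odist_commute by metis

lemma odist_zeroD: "odist H x y = 0 ==> EX h:H. x = h y" by (rule odist_attained[of x y]) auto

lemma norm_le_odist: "\<bar>norm x - norm y\<bar> <= odist H x y"
proof -
 obtain h where h: "h : H" "odist H x y = norm (x - h y)" by (rule odist_attained)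
 show ?thesis using norm_triangle_ineq3[of x "h y"] h norm_h by simp
qed

lemma odist_zero_right: "odist H x 0 = norm x" using norm_le_odist[of x 0] odist_le_norm[of x 0] by simp

lemma odist_zero_left: "odist H 0 x = norm x" using odist_zero_right odist_commute by metis

lemma isogroup_stab: "isogroup (stab H v)"
proof (rule isogroup.intro)
 show "id : stab H v" "finite (stab H v)" using id_in by (auto simp: stab_def)
 fix h assume h: "h : stab H v"
 show "linear h" using h lin by (auto simp: stab_def)
 show "norm (h x) = norm x" for x using h norm_h by (auto simp: stab_def)
 show "EX g:stab H v. ALL x. g (h x) = x & h (g x) = x" using h inv_in[of h] unfolding stab_def by (metis (mono_tags, lifting) mem_Collect_eq)
 fix g assume g: "g : stab H v"
 show "g \<circ> h : stab H v" using h g comp_in by (auto simp: stab_def)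
qed

lemma stab_subset: "stab H v \<subseteq> H" by (auto simp: stab_def)

lemma odist_le_stab: "odist H x y <= odist (stab H v) x y"
proof -
 interpret s: isogroup "stab H v" by (rule isogroup_stab)
 show ?thesis unfolding odist_def by (rule Min_antimono) (use stab_subset in "auto simp: image_mono")
qed

lemma gap_exists:
 obtains \<gamma> where "\<gamma> > 0" "!!h. h : H ==> h v ~= v ==> \<gamma> <= norm (v - h v)"
proof -
 define N where "N = (%h. norm (v - h v)) ` {h : H. h v ~= v}"
 have "finite N" "!!x. x : N ==> 0 < x" by (auto simp: N_def)
 \<comment> \<open>The extra 1 covers the case in which the whole group fixes \<open>v\<close> and
   \<open>N\<close> is empty.\<close>
 then have "0 < Min (insert 1 N)" by (auto simp: Min_gr_iff)
 moreover have "Min (insert 1 N) <= norm (v - h v)" if "h : H" "h v ~= v" for h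
  by (rule Min_le) (use \<open>finite N\<close> that in "auto simp: N_def")
 ultimately show ?thesis using that by blast
qed

text \<open>Elements that move \<open>v\<close> do no better than the identity, and the identity
  lies in the stabiliser.\<close>

lemma odist_eq_stabI:
 assumes "!!h. h : H ==> h v ~= v ==> norm (x - y) <= norm (x - h y)"
 shows "odist H x y = odist (stab H v) x y"
proof (rule antisym[OF odist_le_stab])
 interpret s: isogroup "stab H v" by (rule isogroup_stab)
 obtain h where h: "h : H" "odist H x y = norm (x - h y)" by (rule odist_attained)
 show "odist (stab H v) x y <= odist H x y"
 proof (cases "h v = v")
  case True
  then show ?thesis using s.odist_le[of h x y] h by (auto simp: stab_def)
 next
  case False
  then show ?thesis using assms[OF h(1)] h s.odist_le_norm[of x y] by linarith
 qed
qed

text \<open>Two triangle inequalities leave \<open>norm (x - h y)\<close> at least \<gamma>/2, while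
  \<open>x\<close> and \<open>y\<close> are closer than \<gamma>/2 to each other.\<close>

lemma gap_far:
 assumes "!!h. h : H ==> h v ~= v ==> \<gamma> <= norm (v - h v)"
  and x: "norm (x - v) < \<gamma>/4" and y: "norm (y - v) < \<gamma>/4" and h: "h : H" "h v ~= v"
 shows "norm (x - y) < norm (x - h y)"
proof -
 have "norm (x - y) < \<gamma>/2" using x y norm_triangle_ineq4[of "x - v" "y - v"] by simp
 have "norm (v - h v) <= norm (v - x) + norm (x - h y) + norm (h y - h v)"
  using norm_triangle_ineq[of "v - x" "x - h y"] norm_triangle_ineq[of "(v - x) + (x - h y)" "h y - h v"] by simp
 then have "\<gamma> <= norm (x - v) + norm (x - h y) + norm (y - v)"
  using assms(1)[OF h] norm_h_diff[OF h(1), of y v] by (simp add: norm_minus_commute)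
 then show ?thesis using x y \<open>norm (x - y) < \<gamma>/2\<close> by linarith
qed

lemma odist_local:
 assumes "!!h. h : H ==> h v ~= v ==> \<gamma> <= norm (v - h v)"
  and "norm (x - v) < \<gamma>/4" "norm (y - v) < \<gamma>/4"
 shows "odist H x y = odist (stab H v) x y"
proof (rule odist_eq_stabI)
 fix h assume h: "h : H" "h v ~= v"
 show "norm (x - y) <= norm (x - h y)" by (rule less_imp_le, rule gap_far[where v = v and \<gamma> = \<gamma>]) (use assms h in auto)
qed

text \<open>Minimising \<open>norm (x - h y)\<close> over the group means maximising the inner
  product of \<open>x\<close> and \<open>h y\<close>. The maximiser is unaffected by positive
  factors on \<open>x\<close> and \<open>y\<close>, so the local comparison near \<open>v\<close>
  spreads to the whole cone around the direction \<open>v\<close>.\<close>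

lemma odist_cone:
 assumes "!!h. h : H ==> h v ~= v ==> \<gamma> <= norm (v - h v)"
  and x: "x ~= 0" "norm (x /\<^sub>R norm x - v) < \<gamma>/4" and y: "y ~= 0" "norm (y /\<^sub>R norm y - v) < \<gamma>/4"
 shows "odist H x y = odist (stab H v) x y"
proof (rule odist_eq_stabI)
 fix h assume h: "h : H" "h v ~= v"
 define x' y' where "x' = x /\<^sub>R norm x" and "y' = y /\<^sub>R norm y"
 have n: "norm x' = 1" "norm y' = 1" "norm (h y') = 1" using x y norm_h[OF h(1)] by (auto simp: x'_def y'_def)
 have hy: "h y = norm y *\<^sub>R h y'" using linear_scale[OF lin[OF h(1)], of "norm y" y'] y by (simp add: y'_def)
 have xy: "x = norm x *\<^sub>R x'" "y = norm y *\<^sub>R y'" using x y by (auto simp: x'_def y'_def)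
 have "norm (x' - y') < norm (x' - h y')"
  by (rule gap_far[where v = v and \<gamma> = \<gamma>]) (use assms(1) x(2) y(2) h in "auto simp: x'_def y'_def")
 then have "(norm (x' - y'))\<^sup>2 <= (norm (x' - h y'))\<^sup>2" by (intro power_mono) auto
 then have "x' \<bullet> h y' <= x' \<bullet> y'"
  using n[unfolded norm_eq_1] by (simp add: power2_norm_eq_inner inner_diff_left inner_diff_right inner_commute)
 then have *: "norm x * norm y * (x' \<bullet> h y') <= norm x * norm y * (x' \<bullet> y')" by (intro mult_left_mono) auto
 have 1: "x \<bullet> h y <= x \<bullet> y"
 proof -
  have "x \<bullet> h y = norm x * norm y * (x' \<bullet> h y')" by (subst xy(1), subst hy) simp
  moreover have "x \<bullet> y = norm x * norm y * (x' \<bullet> y')" by (subst xy(1), subst xy(2)) simp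
  ultimately show ?thesis using * by simp
 qed
 have "h y \<bullet> h y = y \<bullet> y" using norm_h[OF h(1), of y] by (metis power2_norm_eq_inner)
 then have "(norm (x - y))\<^sup>2 <= (norm (x - h y))\<^sup>2"
  using 1 by (simp add: power2_norm_eq_inner inner_diff_left inner_diff_right inner_commute)
 then show "norm (x - y) <= norm (x - h y)" by (rule power2_le_imp_le) simp
qed

lemma odist_add_fixed:
 assumes "!!h. h : H ==> h q = q"
 shows "odist H (p + x) (q + y) <= norm (p - q) + odist H x y"
proof -
 obtain h where h: "h : H" "odist H x y = norm (x - h y)" by (rule odist_attained)
 have "odist H (p + x) (q + y) <= norm (p + x - h (q + y))" by (rule odist_le[OF h(1)])
 also have "h (q + y) = q + h y" using linear_add[OF lin[OF h(1)]] assms[OF h(1)] by simp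
 also have "norm (p + x - (q + h y)) <= norm (p - q) + norm (x - h y)" using norm_triangle_ineq[of "p - q" "x - h y"] by (simp add: algebra_simps)
 finally show ?thesis using h by simp
qed

end

section \<open>Lipschitz extension, one conical chart at a time\<close>

lemma normalize_diff_le:
 fixes x z :: "'w::real_normed_vector"
 assumes "z ~= 0"
 shows "norm (x /\<^sub>R norm x - z /\<^sub>R norm z) <= 2 * norm (x - z) / norm z"
proof (cases "x = 0")
 case True
 then show ?thesis using assms by simp
next
 case False
 have "norm z * norm (x /\<^sub>R norm x - z /\<^sub>R norm z)
   = norm ((norm z / norm x) *\<^sub>R x - z)"
  using assms norm_scaleR[of "norm z" "x /\<^sub>R norm x - z /\<^sub>R norm z"] by (simp add: scaleR_diff_right divide_inverse)
 also have "... <= norm ((norm z / norm x) *\<^sub>R x - x) + norm (x - z)"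
  using norm_triangle_ineq[of "(norm z / norm x) *\<^sub>R x - x" "x - z"] by simp
 also have "norm ((norm z / norm x) *\<^sub>R x - x) = \<bar>norm z / norm x - 1\<bar> * norm x" by (metis norm_scaleR scaleR_diff_left scaleR_one)
 also have "... = \<bar>norm z - norm x\<bar>" using False by (simp add: abs_mult_pos left_diff_distrib abs_mult[symmetric])
 also have "... <= norm (x - z)" using norm_triangle_ineq3[of z x] by (simp add: norm_minus_commute)
 finally show ?thesis using assms by (simp add: field_simps)
qed

text \<open>The extension constant must depend on the group alone.\<close>

definition lip_retract :: "('w::euclidean_space => 'w) set => 'm itself => bool" where
 "lip_retract H (t :: 'm itself) \<longleftrightarrow> (\<exists>C\<ge>1. ALL d A f. pseudometric d -->
  (ALL a:A. ALL b:A. odist H (f a) (f b) <= d a b) -->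
  (EX F :: 'm => 'w. (ALL a:A. F a = f a) & (ALL x y. odist H (F x) (F y) <= C * d x y)))"

context isogroup
begin

text \<open>Directions count up to the group. The radius \<gamma>/8 is half of what
  \<open>odist_cone\<close> tolerates, which leaves room for the perturbation in
  \<open>chart_far\<close>.\<close>

definition charted :: "('w \<times> real) list => 'w => bool" where
 "charted vs w \<longleftrightarrow> w ~= 0 & (\<exists>(v, \<gamma>)\<in>set vs. EX h:H. norm (h w /\<^sub>R norm w - v) < \<gamma>/8)"

text \<open>Normalising doubles a relative perturbation, so \<gamma>/16 turns into the missing
  \<gamma>/8. The bound \<gamma> \<le> 2 keeps the perturbation shorter than \<open>w0\<close>, so
  that \<open>g w\<close> cannot vanish.\<close>

lemma chart_far:
 assumes "w0 ~= 0" "h : H" "norm (h w0 /\<^sub>R norm w0 - v) < \<gamma>/8" "\<gamma> <= 2"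
  and "odist H w w0 < \<gamma>/16 * norm w0"
 shows "EX g:H. g w ~= 0 & norm (g w /\<^sub>R norm w - v) < \<gamma>/4"
proof -
 obtain k where k: "k : H" "odist H w (h w0) = norm (w - k (h w0))" by (rule odist_attained)
 obtain g where g: "g : H" "!!x. g (k x) = x" using inv_in[OF k(1)] by blast
 have e: "norm (g w - h w0) < \<gamma>/16 * norm w0" using norm_h_diff[OF g(1), of w "k (h w0)"] g(2) k(2) assms(2,5) by simp
 have n: "norm (h w0) = norm w0" "norm (g w) = norm w" using assms(2) g(1) norm_h by auto
 have "norm (g w - h w0) < norm w0"
 proof -
  have "\<gamma>/16 * norm w0 <= 1 * norm w0" using assms(4) by (intro mult_right_mono) auto
  then show ?thesis using e by simp
 qed
 then have "g w ~= 0" using n by (metis norm_minus_cancel diff_0 less_irrefl)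
 moreover have "norm (g w /\<^sub>R norm w - v) < \<gamma>/4"
 proof -
  have "norm (g w /\<^sub>R norm (g w) - h w0 /\<^sub>R norm (h w0)) <= 2 * norm (g w - h w0) / norm (h w0)"
   by (rule normalize_diff_le) (use assms(1) n in auto)
  also have "... < \<gamma>/8" using e assms(1) n by (simp add: field_simps)
  finally show ?thesis
   using assms(3) n norm_triangle_ineq[of "g w /\<^sub>R norm w - h w0 /\<^sub>R norm w0" "h w0 /\<^sub>R norm w0 - v"] by simp
 qed
 ultimately show ?thesis using g(1) by blast
qed

text \<open>Induction over the charts. Values of the current extension that point into the cone of
  \<open>v\<close> are lifted into that cone, where \<open>odist_cone\<close> replaces the group by
  the stabiliser of \<open>v\<close>. The retraction property of the stabiliser extends the lift,
  and this new extension is used only near data that lie deep inside the chart. Nearness is measured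
  relative to \<open>norm (f a)\<close>, in keeping with the scaling invariance of the
  charts.\<close>

lemma partial_extension:
 assumes "\<forall>(v, \<gamma>)\<in>set vs. 0 < \<gamma> & \<gamma> <= 2 & lip_retract (stab H v) TYPE('m) &
   (ALL h:H. h v ~= v --> \<gamma> <= norm (v - h v))"
 shows "\<exists>C\<ge>1. \<exists>\<delta>>0. ALL d A f. pseudometric d -->
  (ALL a:A. ALL b:A. odist H (f a) (f b) <= d a b) -->
  (EX F :: 'm => 'w. EX D. A \<subseteq> D & (ALL a:A. F a = f a) &
    (ALL x:D. ALL y:D. odist H (F x) (F y) <= C * d x y) &
    (ALL a:A. charted vs (f a) --> (ALL x. d a x < \<delta> * norm (f a) --> x : D)))"
 (is "?P vs")
 using assms
proof (induction vs)
 case Nil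
 show ?case by (rule exI[of _ 1], simp, rule exI[of _ 1]) (auto simp: charted_def intro!: exI)
next
 case (Cons vg vs)
 obtain v \<gamma> where vg: "vg = (v, \<gamma>)" by (cases vg)
 have g: "0 < \<gamma>" "\<gamma> <= 2" "lip_retract (stab H v) TYPE('m)"
  "!!h. h : H ==> h v ~= v ==> \<gamma> <= norm (v - h v)" using Cons.prems by (auto simp: vg)
 interpret s: isogroup "stab H v" by (rule isogroup_stab)
 have IH: "?P vs" by (rule Cons.IH) (use Cons.prems in simp)
 from IH obtain C \<delta> where C1: "C \<ge> 1" and C2: "\<delta> > 0" and ext: "ALL d A f. pseudometric d -->
  (ALL a:A. ALL b:A. odist H (f a) (f b) <= d a b) -->
  (EX F :: 'm => 'w. EX D. A \<subseteq> D & (ALL a:A. F a = f a) &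
    (ALL x:D. ALL y:D. odist H (F x) (F y) <= C * d x y) &
    (ALL a:A. charted vs (f a) --> (ALL x. d a x < \<delta> * norm (f a) --> x : D)))" by (elim exE conjE)
 note C = C1 C2
 obtain Cv where Cv: "Cv \<ge> 1" and extv: "!!d A f. pseudometric d ==>
  (ALL a:A. ALL b:A. odist (stab H v) (f a) (f b) <= d a b) ==>
  (EX F :: 'm => 'w. (ALL a:A. F a = f a) & (ALL x y. odist (stab H v) (F x) (F y) <= Cv * d x y))" using g(3) unfolding lip_retract_def by blast
 \<comment> \<open>The summands of \<open>C'\<close> are the two legs of the detour through a datum
   \<open>a\<close> in \<open>mixed\<close>. The bound \<gamma> / (32 C) in \<open>\<delta>'\<close>
   makes a new point at least twice as close to its datum as any treated point outside the
   chart.\<close>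
 define C' where "C' = Cv * C + 2 * C"
 define \<delta>' where "\<delta>' = min \<delta> (\<gamma> / (32 * C))"
 have CvC: "1 <= Cv * C" using Cv C(1) mult_mono[of 1 Cv 1 C] by simp
 have C': "C' \<ge> 1" "C <= C'" "Cv * C <= C'" using Cv C(1) CvC by (auto simp: C'_def)
 have \<delta>': "\<delta>' > 0" using C g(1) by (auto simp: \<delta>'_def)
 show ?case
 proof (rule exI[of _ C'], intro conjI, rule C'(1), rule exI[of _ \<delta>'], intro conjI, rule \<delta>',
   intro allI impI)
  fix d :: "'m => 'm => real" and A f
  assume d: "pseudometric d" and f: "ALL a:A. ALL b:A. odist H (f a) (f b) <= d a b"
  note dn = pseudometricD(4)[OF d] and ds = pseudometricD(2)[OF d] and dt = pseudometricD(3)[OF d]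
  obtain F D where AD: "A \<subseteq> D" and Ff: "ALL a:A. F a = f a"
   and FL: "ALL x:D. ALL y:D. odist H (F x) (F y) <= C * d x y"
   and Fc: "ALL a:A. charted vs (f a) --> (ALL x. d a x < \<delta> * norm (f a) --> x : D)"
   using mp[OF mp[OF spec[OF spec[OF spec[OF ext]]] d] f] by (elim exE conjE)
  \<comment> \<open>These are the treated points whose values can be moved into the larger cone of
    radius \<gamma>/4; \<open>l\<close> is the value after the move.\<close>
  define Dc where "Dc = {y : D. EX h:H. h (F y) ~= 0 & norm (h (F y) /\<^sub>R norm (F y) - v) < \<gamma>/4}"
  have "ALL y:Dc. EX h. h : H & h (F y) ~= 0 & norm (h (F y) /\<^sub>R norm (F y) - v) < \<gamma>/4" by (auto simp: Dc_def)
  from bchoice[OF this] obtain h where h: "!!y. y : Dc ==> h y : H" "!!y. y : Dc ==> h y (F y) ~= 0"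
   "!!y. y : Dc ==> norm (h y (F y) /\<^sub>R norm (F y) - v) < \<gamma>/4" by auto
  define l where "l y = h y (F y)" for y
  have ol: "odist H (l y) z = odist H (F y) z" if "y : Dc" for y z using h(1)[OF that] by (simp add: l_def)
  have or: "odist H z (l y) = odist H z (F y)" if "y : Dc" for y z using h(1)[OF that] by (simp add: l_def)
  have lL: "odist (stab H v) (l x) (l y) <= C * d x y" if "x : Dc" "y : Dc" for x y
  proof -
   have "odist H (l x) (l y) = odist (stab H v) (l x) (l y)" by (rule odist_cone[where \<gamma> = \<gamma>])
     (use g h[OF that(1)] h[OF that(2)] norm_h in "auto simp: l_def")
   moreover have "odist H (l x) (l y) = odist H (F x) (F y)" using that by (simp add: ol or)
   moreover have "odist H (F x) (F y) <= C * d x y" using FL that by (simp add: Dc_def)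
   ultimately show ?thesis by linarith
  qed
  obtain \<Phi> where \<Phi>l: "!!a. a : Dc ==> \<Phi> a = l a"
   and \<Phi>L': "!!x y. odist (stab H v) (\<Phi> x) (\<Phi> y) <= Cv * (C * d x y)"
   using extv[of "%x y. C * d x y" Dc l] pseudometric_scale[OF d, of C] C lL by auto
  have \<Phi>L: "odist H (\<Phi> x) (\<Phi> y) <= Cv * C * d x y" for x y using \<Phi>L'[of x y] odist_le_stab[of "\<Phi> x" "\<Phi> y" v] by simp
  define S where "S = {a : A. f a ~= 0 & (EX h:H. norm (h (f a) /\<^sub>R norm (f a) - v) < \<gamma>/8)}"
  define D' where "D' = D Un {x. EX a:S. d a x < \<delta>' * norm (f a)}"
  define F' where "F' x = (if x : D then F x else \<Phi> x)" for x
  have SDc: "a : Dc" if aS: "a : S" for a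
  proof -
   obtain k where "k : H" "norm (k (f a) /\<^sub>R norm (f a) - v) < \<gamma>/8" "f a ~= 0" "a : A" using aS unfolding S_def by blast
   moreover from this have "k (f a) ~= 0" using norm_h[of k "f a"] by auto
   moreover have "\<gamma>/8 < \<gamma>/4" using g(1) by simp
   ultimately show ?thesis using AD Ff unfolding Dc_def by (auto intro!: bexI[of _ k])
  qed
  \<comment> \<open>If \<open>y\<close> is in the chart, both values are values of
    \<open>\<Phi>\<close>. Otherwise \<open>chart_far\<close> shows that \<open>y\<close> is far
    from the datum \<open>a\<close> near \<open>x\<close>, and the detour through \<open>a\<close>
    costs only a constant factor.\<close>
  have mixed: "odist H (\<Phi> x) (F y) <= C' * d x y" if x: "x : D'" "x ~: D" and y: "y : D" for x y
  proof (cases "y : Dc")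
   case True
   have "odist H (\<Phi> x) (F y) = odist H (\<Phi> x) (\<Phi> y)" using or[OF True] \<Phi>l[OF True] by simp
   also have "... <= Cv * C * d x y" by (rule \<Phi>L)
   also have "... <= C' * d x y" using C'(3) dn by (intro mult_right_mono) auto
   finally show ?thesis .
  next
   case False
   obtain a where a: "a : S" "d a x < \<delta>' * norm (f a)" using x by (auto simp: D'_def)
   have aA: "a : A" "f a ~= 0" using a by (auto simp: S_def)
   obtain k where k: "k : H" "norm (k (f a) /\<^sub>R norm (f a) - v) < \<gamma>/8" using a unfolding S_def by blast
   have "~ odist H (F y) (f a) < \<gamma>/16 * norm (f a)" using chart_far[OF aA(2) k g(2), of "F y"] False y by (auto simp: Dc_def)
   moreover have "odist H (F y) (F a) <= C * d y a" using FL y aA AD by blast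
   ultimately have 1: "\<gamma>/16 * norm (f a) <= C * d a y" using Ff aA ds[of a y] by auto
   have "\<delta>' * norm (f a) <= \<gamma> / (32 * C) * norm (f a)" by (rule mult_right_mono) (simp_all add: \<delta>'_def)
   then have "d a x < \<gamma> / (32 * C) * norm (f a)" using a(2) by linarith
   then have "2 * C * d a x < \<gamma>/16 * norm (f a)" using C by (simp add: field_simps)
   with 1 have "C * (2 * d a x) < C * d a y" by simp
   then have 2: "2 * d a x < d a y" using C by (simp add: mult_less_cancel_left)
   have 3: "d a y <= 2 * d x y" "d a x <= d x y" using 2 dt[of a y x] by auto
   have "odist H (\<Phi> x) (F y) <= odist H (\<Phi> x) (\<Phi> a) + odist H (\<Phi> a) (F y)" by (rule odist_triangle)
   also have "odist H (\<Phi> a) (F y) = odist H (F a) (F y)" using \<Phi>l[OF SDc[OF a(1)]] ol[OF SDc[OF a(1)]] by simp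
   also have "... <= C * d a y" using FL y aA AD by blast
   also have "... <= C * (2 * d x y)" using 3 C by (intro mult_left_mono) auto
   also have "odist H (\<Phi> x) (\<Phi> a) <= Cv * C * d x a" by (rule \<Phi>L)
   also have "... <= Cv * C * d x y" using 3 ds[of a x] CvC by (intro mult_left_mono) auto
   finally show ?thesis by (simp add: C'_def algebra_simps)
  qed
  show "EX F :: 'm => 'w. EX D. A \<subseteq> D & (ALL a:A. F a = f a) &
    (ALL x:D. ALL y:D. odist H (F x) (F y) <= C' * d x y) &
    (ALL a:A. charted (vg # vs) (f a) --> (ALL x. d a x < \<delta>' * norm (f a) --> x : D))"
  proof (rule exI[of _ F'], rule exI[of _ D'], intro conjI ballI impI allI)
   show "A \<subseteq> D'" using AD by (auto simp: D'_def)
   show "F' a = f a" if "a : A" for a using that AD Ff by (auto simp: F'_def)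
   show "odist H (F' x) (F' y) <= C' * d x y" if x: "x : D'" and y: "y : D'" for x y
   proof (cases "x : D"; cases "y : D")
    assume "x : D" "y : D"
    then have "odist H (F' x) (F' y) <= C * d x y" using FL by (simp add: F'_def)
    also have "... <= C' * d x y" using C' dn by (intro mult_right_mono) auto
    finally show ?thesis .
   next
    assume "x ~: D" "y ~: D"
    then have "odist H (F' x) (F' y) <= Cv * C * d x y" using \<Phi>L by (simp add: F'_def)
    also have "... <= C' * d x y" using C' dn by (intro mult_right_mono) auto
    finally show ?thesis .
   next
    assume "x ~: D" "y : D"
    then show ?thesis using mixed[of x y] x by (simp add: F'_def)
   next
    assume "x : D" "y ~: D"
    then show ?thesis using mixed[of y x] y odist_commute[of "F' x"] ds[of x y] by (simp add: F'_def)
   qed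
   fix a x assume a: "a : A" "charted (vg # vs) (f a)" and x: "d a x < \<delta>' * norm (f a)"
   consider "charted vs (f a)" | "a : S" using a by (auto simp: charted_def vg S_def)
   then show "x : D'"
   proof cases
    case 1
    have "\<delta>' * norm (f a) <= \<delta> * norm (f a)" by (intro mult_right_mono) (auto simp: \<delta>'_def)
    then have "d a x < \<delta> * norm (f a)" using x by simp
    then show ?thesis using Fc a(1) 1 by (auto simp: D'_def)
   next
    case 2
    then show ?thesis using x by (auto simp: D'_def)
   qed
  qed
 qed
qed

end

section \<open>From a partial extension to a global one\<close>

context isogroup
begin

lemma odist_normalize:
 assumes "y ~= 0"
 shows "odist H (x /\<^sub>R norm x) (y /\<^sub>R norm y) <= 2 * odist H x y / norm y"
proof -
 obtain h where h: "h : H" "odist H x y = norm (x - h y)" by (rule odist_attained)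
 have "h (y /\<^sub>R norm y) = h y /\<^sub>R norm (h y)" using linear_scale[OF lin[OF h(1)], of "inverse (norm y)" y] norm_h[OF h(1)] by simp
 then have "odist H (x /\<^sub>R norm x) (y /\<^sub>R norm y) <= norm (x /\<^sub>R norm x - h y /\<^sub>R norm (h y))"
  using odist_le[OF h(1), of "x /\<^sub>R norm x" "y /\<^sub>R norm y"] by simp
 also have "... <= 2 * norm (x - h y) / norm (h y)" by (rule normalize_diff_le) (use assms norm_h[OF h(1), of y] in auto)
 finally show ?thesis using h norm_h by simp
qed

lemma odist_scale: "0 <= c ==> odist H (c *\<^sub>R x) (c *\<^sub>R y) <= c * odist H x y"
proof -
 assume c: "0 <= c"
 obtain h where h: "h : H" "odist H x y = norm (x - h y)" by (rule odist_attained)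
 have "odist H (c *\<^sub>R x) (c *\<^sub>R y) <= norm (c *\<^sub>R x - h (c *\<^sub>R y))" by (rule odist_le[OF h(1)])
 also have "c *\<^sub>R x - h (c *\<^sub>R y) = c *\<^sub>R (x - h y)" using linear_scale[OF lin[OF h(1)]] by (simp add: scaleR_diff_right)
 finally show ?thesis using c h by simp
qed

text \<open>The length and the direction of the extension are chosen separately. The length
  \<open>\<psi>\<close> extends the norm of \<open>f\<close> and falls off so fast that it is
  positive only inside \<open>D\<close>; the direction is that of \<open>F\<close>, and it becomes
  irrelevant where the length reaches 0.\<close>

lemma cone_cutoff:
 assumes d: "pseudometric d" and f: "!!a b. a : A ==> b : A ==> odist H (f a) (f b) <= d a b"
  and Ff: "!!a. a : A ==> F a = f a" and C: "1 <= C" "0 < \<delta>"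
  and FL: "!!x y. x : D ==> y : D ==> odist H (F x) (F y) <= C * d x y"
  and AD: "A \<subseteq> D"
  and Fc: "!!a x. a : A ==> d a x < \<delta> * norm (f a) ==> x : D"
 shows "EX G. (ALL a:A. G a = f a) & (ALL x y. odist H (G x) (G y) <= (10 * C + 1 / \<delta>) * d x y)"
proof (cases "A = {}")
 case True
 then show ?thesis using C pseudometricD(4)[OF d] by (intro exI[of _ "%_. 0"]) auto
next
 case False
 note dn = pseudometricD(4)[OF d] and ds = pseudometricD(2)[OF d] and dt = pseudometricD(3)[OF d]
  and d0 = pseudometricD(1)[OF d]
 \<comment> \<open>The slope 1/\<delta> confines the support of \<open>\<psi>\<close> to
   \<open>D\<close>; the slope 2 C keeps \<open>norm (F x)\<close> above half of the norm of a datum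
   that contributes to \<open>\<psi> x\<close>, so normalising \<open>F\<close> is stable
   there.\<close>
 define M where "M = 2 * C + 1 / \<delta>"
 have M: "1 <= M" "2 * C <= M" "1 / \<delta> <= M" using C by (auto simp: M_def add_increasing2)
 define \<psi> where "\<psi> x = (SUP a\<in>A. max 0 (norm (f a) - M * d a x))" for x
 have nf: "norm (f a) <= norm (f b) + d a b" if "a : A" "b : A" for a b using norm_le_odist[of "f a" "f b"] f[OF that] by linarith
 have bdd: "bdd_above ((%a. max 0 (norm (f a) - M * d a x)) ` A)" for x
 proof -
  obtain b where b: "b : A" using False by blast
  show ?thesis
  proof (rule bdd_aboveI2)
   fix a assume a: "a : A"
   have "d a x <= M * d a x" using M(1) dn[of a x] mult_right_mono[of 1 M "d a x"] by simp
   then show "max 0 (norm (f a) - M * d a x) <= norm (f b) + d b x" using nf[OF a b] dt[of a b x] ds[of b x] dt[of a x b] dn[of b x] by auto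
  qed
 qed
 have \<psi>ge: "max 0 (norm (f a) - M * d a x) <= \<psi> x" if "a : A" for a x unfolding \<psi>_def by (rule cSUP_upper[OF that bdd])
 have \<psi>0: "0 <= \<psi> x" for x using \<psi>ge False by (metis all_not_in_conv max.cobounded1 order_trans)
 have \<psi>lip: "\<psi> x <= \<psi> y + M * d x y" for x y
  unfolding \<psi>_def[of x]
 proof (rule cSUP_least[OF False])
  fix a assume a: "a : A"
  have "M * d a y <= M * d a x + M * d x y" using dt[of a y x] M mult_left_mono[of "d a y" "d a x + d x y" M] by (simp add: distrib_left)
  then show "max 0 (norm (f a) - M * d a x) <= \<psi> y + M * d x y" using \<psi>ge[OF a, of y] dn[of x y] M(1) by (auto simp: mult_nonneg_nonneg)
 qed
 have \<psi>A: "\<psi> a = norm (f a)" if "a : A" for a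
 proof (rule antisym)
  show "norm (f a) <= \<psi> a" using \<psi>ge[OF that, of a] d0 by auto
  show "\<psi> a <= norm (f a)" unfolding \<psi>_def
  proof (rule cSUP_least[OF False])
   fix b assume b: "b : A"
   have "d b a <= M * d b a" using M(1) dn[of b a] mult_right_mono[of 1 M "d b a"] by simp
   then show "max 0 (norm (f b) - M * d b a) <= norm (f a)" using nf[OF b that] by auto
  qed
 qed
 have pos: "x : D & \<psi> x <= 4 * norm (F x) & F x ~= 0" if p: "0 < \<psi> x" for x
 proof -
  have "\<psi> x / 2 < \<psi> x" using p by simp
  then obtain a where a: "a : A" "\<psi> x / 2 < max 0 (norm (f a) - M * d a x)" unfolding \<psi>_def[of x] using less_cSUP_iff[OF False bdd] by blast
  have 1: "\<psi> x / 2 < norm (f a) - M * d a x" using a(2) p by (cases "0 <= norm (f a) - M * d a x") (auto simp: max_def split: if_splits)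
  then have 2: "M * d a x < norm (f a)" using p by simp
  have "1 / \<delta> * d a x <= M * d a x" using M(3) dn by (rule mult_right_mono)
  then have "1 / \<delta> * d a x < norm (f a)" using 2 by linarith
  then have "d a x < \<delta> * norm (f a)" using C by (simp add: field_simps)
  then have xD: "x : D" using Fc a by blast
  have "2 * C * d a x <= M * d a x" using M(2) dn by (rule mult_right_mono)
  then have 3: "2 * (C * d a x) < norm (f a)" using 2 by simp
  have "odist H (F a) (F x) <= C * d a x" using FL a AD xD by blast
  then have "norm (f a) - norm (F x) <= C * d a x" using norm_le_odist[of "F a" "F x"] Ff[OF a(1)] by simp
  then have "norm (f a) < 2 * norm (F x)" using 3 by simp
  moreover have "0 <= M * d a x" using M dn by simp
  ultimately show ?thesis using 1 xD p by auto
 qed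
 define G where "G x = (if 0 < \<psi> x then \<psi> x *\<^sub>R (F x /\<^sub>R norm (F x)) else 0)" for x
 have nG: "norm (G x) = \<psi> x" for x using pos[of x] \<psi>0[of x] by (auto simp: G_def)
 have GL: "odist H (G x) (G y) <= (M + 8 * C) * d x y" for x y
 proof (cases "0 < \<psi> x & 0 < \<psi> y")
  case True
  define u v where "u = F x /\<^sub>R norm (F x)" and "v = F y /\<^sub>R norm (F y)"
  have p: "x : D" "y : D" "F x ~= 0" "F y ~= 0" "\<psi> y <= 4 * norm (F y)" using pos True by auto
  have "odist H (G x) (G y) <= odist H (\<psi> x *\<^sub>R u) (\<psi> y *\<^sub>R u) + odist H (\<psi> y *\<^sub>R u) (\<psi> y *\<^sub>R v)"
   using True odist_triangle by (simp add: G_def u_def v_def)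
  also have "odist H (\<psi> x *\<^sub>R u) (\<psi> y *\<^sub>R u) <= \<bar>\<psi> x - \<psi> y\<bar>"
  proof -
   have "norm u = 1" using p by (simp add: u_def)
   then show ?thesis using odist_le_norm[of "\<psi> x *\<^sub>R u" "\<psi> y *\<^sub>R u"] by (simp add: scaleR_diff_left[symmetric])
  qed
  also have "... <= M * d x y" using \<psi>lip[of x y] \<psi>lip[of y x] ds[of x y] by (simp add: abs_le_iff)
  also have "odist H (\<psi> y *\<^sub>R u) (\<psi> y *\<^sub>R v) <= \<psi> y * odist H u v" by (rule odist_scale[OF \<psi>0])
  also have "... <= (4 * norm (F y)) * (2 * odist H (F x) (F y) / norm (F y))"
   unfolding u_def v_def using p \<psi>0 by (intro mult_mono odist_normalize) auto
  also have "... = 8 * odist H (F x) (F y)" using p by simp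
  also have "... <= 8 * (C * d x y)" using FL p by simp
  finally show ?thesis by (simp add: algebra_simps)
 next
  case False
  have "odist H (G x) (G y) <= \<bar>\<psi> x - \<psi> y\<bar>"
  proof (cases "0 < \<psi> x")
   case True
   then have "G y = 0" using False by (simp add: G_def)
   then show ?thesis using nG[of x] nG[of y] odist_zero_right \<psi>0[of x] by simp
  next
   case f: False
   then have "G x = 0" by (simp add: G_def)
   then show ?thesis using nG[of x] nG[of y] odist_zero_left \<psi>0[of y] by simp
  qed
  also have "... <= M * d x y" using \<psi>lip[of x y] \<psi>lip[of y x] ds[of x y] by (simp add: abs_le_iff)
  also have "... <= (M + 8 * C) * d x y" using C dn by (intro mult_right_mono) auto
  finally show ?thesis .
 qed
 have "G a = f a" if "a : A" for a using \<psi>A[OF that] Ff[OF that] by (auto simp: G_def)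
 moreover have "M + 8 * C = 10 * C + 1 / \<delta>" by (simp add: M_def)
 ultimately show ?thesis using GL by (intro exI[of _ G]) auto
qed

text \<open>Averaging over the group is the orthogonal projection onto the vectors that it
  fixes.\<close>

definition orbit_mean :: "'w => 'w" where
 "orbit_mean x = (SUM h:H. h x) /\<^sub>R card H"

lemma card_H_pos: "0 < card H" by (simp add: card_gt_0_iff)

lemma linear_orbit_mean: "linear orbit_mean"
proof (rule linearI)
 show "orbit_mean (x + y) = orbit_mean x + orbit_mean y" for x y
 proof -
  have "(SUM h:H. h (x + y)) = (SUM h:H. h x + h y)" by (intro sum.cong refl linear_add lin)
  then show ?thesis by (simp add: orbit_mean_def sum.distrib scaleR_add_right)
 qed
 show "orbit_mean (c *\<^sub>R x) = c *\<^sub>R orbit_mean x" for c x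
 proof -
  have "(SUM h:H. h (c *\<^sub>R x)) = (SUM h:H. c *\<^sub>R h x)" by (intro sum.cong refl linear_scale lin)
  then show ?thesis by (simp add: orbit_mean_def scaleR_sum_right[symmetric])
 qed
qed

lemma norm_orbit_mean: "norm (orbit_mean x) <= norm x"
proof -
 have "norm (SUM h:H. h x) <= (SUM h:H. norm x)" by (rule sum_norm_le) (simp add: norm_h)
 then show ?thesis using card_H_pos by (simp add: orbit_mean_def field_simps)
qed

lemma comp_bij:
 assumes "g : H"
 shows "bij_betw ((\<circ>) g) H H" "bij_betw (%h. h \<circ> g) H H"
proof -
 obtain k where k: "k : H" "!!x. k (g x) = x" "!!x. g (k x) = x" using inv_in[OF assms] by blast
 then have "k \<circ> g = id" "g \<circ> k = id" by auto
 then show "bij_betw ((\<circ>) g) H H" by (intro bij_betw_byWitness[where f' = "(\<circ>) k"])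
   (use comp_in assms k in "auto simp: o_assoc[symmetric] fun_eq_iff")
 show "bij_betw (%h. h \<circ> g) H H" by (intro bij_betw_byWitness[where f' = "%h. h \<circ> k"])
   (use comp_in assms k in "auto simp: fun_eq_iff")
qed

lemma h_orbit_mean: "g : H ==> g (orbit_mean x) = orbit_mean x"
proof -
 assume g: "g : H"
 have "(SUM h:H. h x) = (SUM h:H. (g \<circ> h) x)" using sum.reindex_bij_betw[OF comp_bij(1)[OF g], of "%h. h x"] by simp
 moreover have "g (SUM h:H. h x) = (SUM h:H. g (h x))" by (rule linear_sum[OF lin[OF g]])
 ultimately show ?thesis using linear_scale[OF lin[OF g]] by (simp add: orbit_mean_def)
qed

lemma orbit_mean_h: "g : H ==> orbit_mean (g x) = orbit_mean x"
 using sum.reindex_bij_betw[OF comp_bij(2), of g "%h. h x"] by (simp add: orbit_mean_def)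

lemma orbit_mean_fixed: "(!!h. h : H ==> h x = x) ==> orbit_mean x = x"
proof -
 assume "!!h. h : H ==> h x = x"
 then have "(SUM h:H. h x) = (SUM h:H. x)" by (intro sum.cong refl)
 then show ?thesis using card_H_pos by (simp add: orbit_mean_def sum_constant_scaleR)
qed

lemma orbit_mean_idem: "orbit_mean (orbit_mean x) = orbit_mean x" by (rule orbit_mean_fixed) (rule h_orbit_mean)

text \<open>The mean is constant on orbits, so it is a 1-Lipschitz function of the orbit with values
  in a linear space, where \<open>McShane_extension_euclidean\<close> applies.\<close>

lemma orbit_mean_odist: "norm (orbit_mean x - orbit_mean y) <= odist H x y"
proof -
 obtain h where h: "h : H" "odist H x y = norm (x - h y)" by (rule odist_attained)
 have "orbit_mean x - orbit_mean y = orbit_mean (x - h y)" using linear_diff[OF linear_orbit_mean] orbit_mean_h[OF h(1)] by simp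
 then show ?thesis using norm_orbit_mean h by simp
qed

lemma odist_centered: "odist H (x - orbit_mean x) (y - orbit_mean y) <= 2 * odist H x y"
proof -
 obtain h where h: "h : H" "odist H x y = norm (x - h y)" by (rule odist_attained)
 have "odist H (x - orbit_mean x) (y - orbit_mean y) <= norm (x - orbit_mean x - h (y - orbit_mean y))" by (rule odist_le[OF h(1)])
 also have "x - orbit_mean x - h (y - orbit_mean y) = (x - h y) - orbit_mean (x - h y)"
  using linear_diff[OF lin[OF h(1)]] linear_diff[OF linear_orbit_mean] h_orbit_mean[OF h(1)]
   orbit_mean_h[OF h(1)] by simp
 also have "norm ... <= 2 * norm (x - h y)" using norm_triangle_ineq4[of "x - h y" "orbit_mean (x - h y)"] norm_orbit_mean[of "x - h y"] by simp
 finally show ?thesis using h by simp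
qed

text \<open>A map is split into its fixed component and its centred component. The fixed one is
  extended linearly. The centred one takes values in the kernel of \<open>orbit_mean\<close>, whose
  unit sphere is compact and contains no vector fixed by the group, so finitely many charts with
  proper stabilisers cover all of its directions.\<close>

lemma lip_retract_step:
 assumes IH: "!!v. stab H v ~= H ==> lip_retract (stab H v) TYPE('m)"
 shows "lip_retract H TYPE('m)"
proof -
 define S where "S = {v. norm v = 1 & orbit_mean v = 0}"
 have "closed {v. norm v = 1}" "closed {v. orbit_mean v = 0}" by (intro closed_Collect_eq continuous_intros
    linear_continuous_on linear_conv_bounded_linear[THEN iffD1] linear_orbit_mean)+
 moreover have "bounded {v::'w. norm v = 1}" by (auto simp: bounded_iff)
 moreover have S: "S = {v. norm v = 1} Int {v. orbit_mean v = 0}" by (auto simp: S_def)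
 ultimately have "compact S" by (auto simp: compact_eq_bounded_closed bounded_Int)
 have "EX \<gamma>. 0 < \<gamma> & \<gamma> <= 2 & (ALL h:H. h v ~= v --> \<gamma> <= norm (v - h v))" for v
 proof -
  obtain \<gamma> where "\<gamma> > 0" "!!h. h : H ==> h v ~= v ==> \<gamma> <= norm (v - h v)" by (rule gap_exists[of v]) blast
  then show ?thesis by (intro exI[of _ "min \<gamma> 2"]) force
 qed
 then obtain \<gamma> where \<gamma>: "!!v. 0 < \<gamma> v" "!!v. \<gamma> v <= 2"
  "!!v h. h : H ==> h v ~= v ==> \<gamma> v <= norm (v - h v)" by metis
 have "S \<subseteq> (\<Union>v\<in>S. ball v (\<gamma> v / 8))" using \<gamma>(1) by auto
 then obtain T where T: "T \<subseteq> S" "finite T" "S \<subseteq> (\<Union>v\<in>T. ball v (\<gamma> v / 8))"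
  using compactE_image[OF \<open>compact S\<close>, of S "%v. ball v (\<gamma> v / 8)"] by auto
 obtain vs where vs: "set vs = (%v. (v, \<gamma> v)) ` T" using finite_list[of "(%v. (v, \<gamma> v)) ` T"] T(2) by auto
 have valid': "0 < c & c <= 2 & lip_retract (stab H v) TYPE('m) &
   (ALL h:H. h v ~= v --> c <= norm (v - h v))" if "(v, c) : set vs" for v c
 proof -
  have v: "v : S" "c = \<gamma> v" using that T vs by auto
  \<comment> \<open>A vector fixed by the group equals its mean, which is 0 here although
    \<open>v\<close> has norm 1.\<close>
  have "stab H v ~= H"
  proof
   assume "stab H v = H"
   then have "orbit_mean v = v" by (intro orbit_mean_fixed) (auto simp: stab_def)
   then show False using v by (auto simp: S_def)
  qed
  then show ?thesis using IH \<gamma> v by auto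
 qed
 have valid: "\<forall>(v, c)\<in>set vs. 0 < c & c <= 2 & lip_retract (stab H v) TYPE('m) &
   (ALL h:H. h v ~= v --> c <= norm (v - h v))" using valid' by blast
 obtain C \<delta> where C: "C \<ge> 1" "\<delta> > 0" and ext: "ALL d A f. pseudometric d -->
  (ALL a:A. ALL b:A. odist H (f a) (f b) <= d a b) -->
  (EX F :: 'm => 'w. EX D. A \<subseteq> D & (ALL a:A. F a = f a) &
    (ALL x:D. ALL y:D. odist H (F x) (F y) <= C * d x y) &
    (ALL a:A. charted vs (f a) --> (ALL x. d a x < \<delta> * norm (f a) --> x : D)))" using partial_extension[OF valid] by (elim exE conjE)
 have cover: "charted vs w" if w: "w ~= 0" "orbit_mean w = 0" for w
 proof -
  have "w /\<^sub>R norm w : S" using w linear_scale[OF linear_orbit_mean, of "inverse (norm w)" w] by (simp add: S_def)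
  then obtain v where "v : T" "w /\<^sub>R norm w : ball v (\<gamma> v / 8)" using T by blast
  then show ?thesis using w vs id_in unfolding charted_def by (auto intro!: bexI[of _ id] bexI[of _ v] simp: dist_norm norm_minus_commute)
 qed
 define C1 where "C1 = 10 * C + 1 / \<delta>"
 have C1: "1 <= C1" using C by (simp add: C1_def add_increasing2)
 \<comment> \<open>The dimension is the loss in the linear extension; the factor 2 is the Lipschitz
   constant of centring.\<close>
 define C2 where "C2 = real DIM('w) + C1 * 2"
 show ?thesis unfolding lip_retract_def
 proof (rule exI[of _ C2], intro conjI allI impI)
  show "1 <= C2" using C1 by (simp add: C2_def)
  fix d :: "'m => 'm => real" and A and f :: "'m => 'w"
  assume d: "pseudometric d" and f: "ALL a:A. ALL b:A. odist H (f a) (f b) <= d a b"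
  define f' where "f' a = f a - orbit_mean (f a)" for a
  have f'0: "orbit_mean (f' a) = 0" for a using linear_diff[OF linear_orbit_mean] orbit_mean_idem by (simp add: f'_def)
  have d2: "pseudometric (%x y. 2 * d x y)" using pseudometric_scale[OF d, of 2] by simp
  have f': "ALL a:A. ALL b:A. odist H (f' a) (f' b) <= 2 * d a b"
   using odist_centered f unfolding f'_def by (meson mult_left_mono order_trans zero_le_numeral)
  obtain F D where FD: "A \<subseteq> D" "ALL a:A. F a = f' a"
    "ALL x:D. ALL y:D. odist H (F x) (F y) <= C * (2 * d x y)"
    "ALL a:A. charted vs (f' a) --> (ALL x. 2 * d a x < \<delta> * norm (f' a) --> x : D)"
   using mp[OF mp[OF spec[OF spec[OF spec[OF ext]]] d2] f'] by (elim exE conjE)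
  have "EX G. (ALL a:A. G a = f' a) & (ALL x y. odist H (G x) (G y) <= (10 * C + 1 / \<delta>) * (2 * d x y))"
  proof (rule cone_cutoff[OF d2, where F = F and D = D])
   fix a x assume a: "a : A" and x: "2 * d a x < \<delta> * norm (f' a)"
   have "0 < \<delta> * norm (f' a)" using x pseudometricD(4)[OF d, of a x] by linarith
   then have "f' a ~= 0" by auto
   then show "x : D" using FD(4) a x cover f'0 by blast
  qed (use f' FD C in auto)
  then obtain G where G: "!!a. a : A ==> G a = f' a" "!!x y. odist H (G x) (G y) <= C1 * (2 * d x y)" by (auto simp: C1_def)
  have "norm (orbit_mean (f a) - orbit_mean (f b)) <= d a b" if "a : A" "b : A" for a b using orbit_mean_odist f that by (meson order_trans)
  from McShane_extension_euclidean[OF d this] obtain q where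
   q: "!!a. a : A ==> q a = orbit_mean (f a)" "!!x y. norm (q x - q y) <= real DIM('w) * d x y" by blast
  define R where "R x = orbit_mean (q x) + G x" for x
  have "R a = f a" if "a : A" for a using q(1)[OF that] G(1)[OF that] orbit_mean_idem by (simp add: R_def f'_def)
  moreover have "odist H (R x) (R y) <= C2 * d x y" for x y
  proof -
   have "odist H (R x) (R y) <= norm (orbit_mean (q x) - orbit_mean (q y)) + odist H (G x) (G y)"
    unfolding R_def by (rule odist_add_fixed) (rule h_orbit_mean)
   also have "norm (orbit_mean (q x) - orbit_mean (q y)) <= norm (q x - q y)" using norm_orbit_mean linear_diff[OF linear_orbit_mean] by metis
   also have "... <= real DIM('w) * d x y" by (rule q(2))
   finally show ?thesis using G(2)[of x y] by (simp add: C2_def algebra_simps)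
  qed
  ultimately show "EX F. (ALL a:A. F a = f a) & (ALL x y. odist H (F x) (F y) <= C2 * d x y)" by blast
 qed
qed

end

text \<open>No base case appears: for the trivial group every stabiliser is the whole group, so the
  hypothesis of \<open>lip_retract_step\<close> is vacuous.\<close>

theorem isogroup_lip_retract:
 assumes "isogroup H"
 shows "lip_retract H TYPE('m)"
 using assms
proof (induction "card H" arbitrary: H rule: less_induct)
 case less
 interpret isogroup H by fact
 show ?case
 proof (rule lip_retract_step)
  fix v assume "stab H v ~= H"
  then have "stab H v \<subset> H" using stab_subset by blast
  then have "card (stab H v) < card H" by (rule psubset_card_mono[OF finite_H])
  then show "lip_retract (stab H v) TYPE('m)" using less.hyps isogroup_stab by blast
 qed
qed

section \<open>Bilipschitz coordinates on the orbit space\<close>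

context isogroup
begin

text \<open>This is the support function of the orbit of \<open>x\<close>, evaluated at
  \<open>v\<close>.\<close>

definition template :: "'w => 'w => real" where
 "template v x = Max ((%h. h x \<bullet> v) ` H)"

lemma template_ge: "h : H ==> h x \<bullet> v <= template v x" unfolding template_def by (rule Max_ge) auto

lemma template_attained: obtains h where "h : H" "template v x = h x \<bullet> v"
proof -
 have "template v x : (%h. h x \<bullet> v) ` H" unfolding template_def by (rule Max_in) auto
 then show ?thesis using that by blast
qed

lemma template_diff_le: "template v x - template v y <= norm v * odist H x y"
proof -
 obtain h where h: "h : H" "template v x = h x \<bullet> v" by (rule template_attained)
 obtain k where k: "k : H" "odist H x y = norm (x - k y)" by (rule odist_attained)
 have "template v x - template v y <= h x \<bullet> v - (h \<circ> k) y \<bullet> v" using template_ge[OF comp_in[OF h(1) k(1)], of y v] h(2) by simp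
 also have "... = (h x - h (k y)) \<bullet> v" by (simp add: inner_diff_left)
 also have "... <= norm (h x - h (k y)) * norm v" by (rule norm_cauchy_schwarz)
 finally show ?thesis using norm_h_diff[OF h(1)] k by (simp add: mult.commute)
qed

lemma template_lipschitz: "\<bar>template v x - template v y\<bar> <= norm v * odist H x y"
 using template_diff_le[of v x y] template_diff_le[of v y x, unfolded odist_commute[of y x]] by linarith

end

text \<open>Each further vector avoids the finitely many proper subspaces spanned by fewer than
  \<open>DIM('w)\<close> earlier ones; these are negligible sets. Avoiding the old vectors as well
  makes the cardinality grow.\<close>

lemma general_position_exists:
 "EX V :: 'w::euclidean_space set. finite V & card V = n &
  (\<forall>S\<subseteq>V. card S <= DIM('w) --> independent S)"
proof (induction n)
 case 0
 show ?case by (rule exI[of _ "{}"]) (auto simp: independent_empty)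
next
 case (Suc n)
 then obtain V :: "'w set" where V: "finite V" "card V = n"
  "!!S. S \<subseteq> V ==> card S <= DIM('w) ==> independent S" by blast
 define X where "X = (\<Union>S\<in>{S. S \<subseteq> V & card S < DIM('w)}. span S)"
 have "negligible (span S)" if "S \<subseteq> V" "card S < DIM('w)" for S
 proof -
  have "finite S" using that V(1) finite_subset by blast
  then have "dim (span S) < DIM('w)" using dim_le_card'[of S] that by (simp add: dim_span)
  then show ?thesis by (rule negligible_lowdim)
 qed
 moreover have "finite {S. S \<subseteq> V & card S < DIM('w)}" using V(1) by simp
 ultimately have "negligible X" unfolding X_def by (intro negligible_Union finite_imageI) auto
 then have "negligible (X Un V)" using V(1) by (simp add: negligible_finite)
 then have "X Un V ~= UNIV" using non_negligible_UNIV by metis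
 then obtain v where v: "v ~: X" and vV: "v ~: V" by blast
 show ?case
 proof (intro exI conjI allI impI)
  show "finite (insert v V)" "card (insert v V) = Suc n" using V vV by auto
  fix S assume S: "S \<subseteq> insert v V" "card S <= DIM('w)"
  have fin: "finite S" using S(1) V(1) finite_subset by blast
  show "independent S"
  proof (cases "v : S")
   case False
   then show ?thesis using S V(3) by blast
  next
   case True
   have S': "S - {v} \<subseteq> V" "card (S - {v}) < DIM('w)" using S True fin card_Diff1_less[OF fin True] by auto
   then have "independent (S - {v})" using V(3) by auto
   moreover have "v ~: span (S - {v})" using v S' by (auto simp: X_def)
   ultimately show ?thesis using independent_insertI[of v "S - {v}"] True by (simp add: insert_absorb)
  qed
 qed
qed

text \<open>The sum vanishes only at vectors orthogonal to a spanning set, hence has a positive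
  minimum on the unit sphere; homogeneity does the rest.\<close>

lemma spanning_set_lower_bound:
 fixes S :: "'w::euclidean_space set"
 assumes "finite S" "span S = UNIV"
 shows "\<exists>c>0. ALL z. c * norm z <= (SUM v:S. \<bar>z \<bullet> v\<bar>)"
proof -
 define \<phi> where "\<phi> z = (SUM v:S. \<bar>z \<bullet> v\<bar>)" for z
 have cont: "continuous_on (sphere 0 1) \<phi>" unfolding \<phi>_def by (intro continuous_intros)
 obtain z0 where z0: "z0 : sphere 0 1" "!!z. z : sphere 0 1 ==> \<phi> z0 <= \<phi> z"
  using continuous_attains_inf[OF compact_sphere _ cont] by (auto simp del: mem_sphere)
 have "\<phi> z0 ~= 0"
 proof
  assume "\<phi> z0 = 0"
  then have "!!v. v : S ==> z0 \<bullet> v = 0" using assms(1) by (auto simp: \<phi>_def sum_nonneg_eq_0_iff)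
  then have *: "!!v. v : S ==> orthogonal z0 v" by (simp add: orthogonal_def)
  have "orthogonal z0 z0" by (rule orthogonal_to_span[where S = S]) (simp_all add: assms(2) *)
  then have "z0 = 0" by (simp add: orthogonal_self)
  then show False using z0 by simp
 qed
 then have pos: "0 < \<phi> z0" by (simp add: \<phi>_def less_le sum_nonneg)
 have "\<phi> z0 * norm z <= \<phi> z" for z
 proof (cases "z = 0")
  case False
  have "\<phi> z0 <= \<phi> (z /\<^sub>R norm z)" using False by (intro z0) auto
  also have "... = \<phi> z / norm z"
   unfolding \<phi>_def sum_divide_distrib by (intro sum.cong refl) (simp add: abs_mult divide_inverse mult.commute)
  finally show ?thesis using False by (simp add: field_simps)
 qed (simp add: \<phi>_def)
 then show ?thesis using pos unfolding \<phi>_def by blast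
qed

context isogroup
begin

text \<open>For given \<open>x\<close> and \<open>y\<close> the maximising pairs of group elements take at most \<open>(card H)\<^sup>2\<close> values,
 so some pair is shared by enough templates to span the space.\<close>

theorem template_embedding:
 obtains V c where "finite V" "0 < c" "!!x y. c * odist H x y <= (SUM v:V. \<bar>template v x - template v y\<bar>)"
proof -
 define N where "N = card (H \<times> H) * DIM('w) + 1"
 obtain V :: "'w set" where V: "finite V" "card V = N"
  and ind: "!!S. S \<subseteq> V ==> card S <= DIM('w) ==> independent S" using general_position_exists[of N] by auto
 define \<S> where "\<S> = {S. S \<subseteq> V & card S = DIM('w)}"
 have "\<exists>c>0. ALL z. c * norm z <= (SUM v:S. \<bar>z \<bullet> v\<bar>)" if "S : \<S>" for S
 proof (rule spanning_set_lower_bound)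
  show "finite S" using that V finite_subset by (auto simp: \<S>_def)
  have "S \<subseteq> V" "card S = DIM('w)" using that by (auto simp: \<S>_def)
  then have "UNIV \<subseteq> span S" by (intro card_ge_dim_independent ind) (simp_all add: dim_UNIV)
  then show "span S = UNIV" by blast
 qed
 then have "ALL S:\<S>. EX c. 0 < c & (ALL z. c * norm z <= (SUM v:S. \<bar>z \<bullet> v\<bar>))" by blast
 from bchoice[OF this] obtain c where c: "!!S. S : \<S> ==> 0 < c S"
  "!!S z. S : \<S> ==> c S * norm z <= (SUM v:S. \<bar>z \<bullet> v\<bar>)" by blast
 have fin: "finite \<S>" unfolding \<S>_def using V(1) by simp
 define c0 where "c0 = Min (insert 1 (c ` \<S>))"
 have c0: "0 < c0" "!!S. S : \<S> ==> c0 <= c S" using fin c by (auto simp: c0_def Min_gr_iff)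
 show ?thesis
 proof (rule that[OF V(1) c0(1)])
  fix x y
  have "EX p:H \<times> H. template v x = fst p x \<bullet> v & template v y = snd p y \<bullet> v" for v
   by (rule template_attained[of v x], rule template_attained[of v y]) auto
  then have "ALL v. EX p. p : H \<times> H & template v x = fst p x \<bullet> v & template v y = snd p y \<bullet> v" by blast
  from choice[OF this] obtain p where p: "!!v. p v : H \<times> H"
   "!!v. template v x = fst (p v) x \<bullet> v" "!!v. template v y = snd (p v) y \<bullet> v" by blast
  have "EX q:H \<times> H. DIM('w) < card {v : V. p v = q}"
  proof (rule ccontr)
   assume "~ ?thesis"
   then have *: "!!q. q : H \<times> H ==> card {v : V. p v = q} <= DIM('w)" by (auto simp: not_less)
   have "V = (\<Union>q\<in>H \<times> H. {v : V. p v = q})" using p(1) by blast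
   then have "card V <= (SUM q:H \<times> H. card {v : V. p v = q})" using card_UN_le[of "H \<times> H" "%q. {v : V. p v = q}"] by simp
   also have "... <= (SUM q:H \<times> H. DIM('w))" by (intro sum_mono *)
   finally show False using V by (simp add: N_def)
  qed
  then obtain q where q: "q : H \<times> H" "DIM('w) <= card {v : V. p v = q}" by (blast intro: less_imp_le)
  obtain S where S: "S \<subseteq> {v : V. p v = q}" "card S = DIM('w)" "finite S" by (rule obtain_subset_with_card_n[OF q(2)])
  then have S': "S : \<S>" by (auto simp: \<S>_def)
  obtain h k where hk: "q = (h, k)" "h : H" "k : H" using q by auto
  \<comment> \<open>Undoing \<open>h\<close> turns \<open>norm (h x - k y)\<close> into a competitor
    for the orbit distance, while the vectors of \<open>S\<close> control this norm from their inner
    products.\<close>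
  obtain g where g: "g : H" "!!z. g (h z) = z" using inv_in[OF hk(2)] by blast
  have "odist H x y <= norm (x - (g \<circ> k) y)" by (rule odist_le[OF comp_in[OF g(1) hk(3)]])
  also have "... = norm (h x - k y)" using norm_h_diff[OF g(1), of "h x" "k y"] g(2) by simp
  finally have "c0 * odist H x y <= c S * norm (h x - k y)" using c0(2)[OF S'] c(1)[OF S'] by (intro mult_mono) auto
  also have "... <= (SUM v:S. \<bar>(h x - k y) \<bullet> v\<bar>)" by (rule c(2)[OF S'])
  also have "... = (SUM v:S. \<bar>template v x - template v y\<bar>)"
  proof (intro sum.cong refl)
   fix v assume "v : S"
   then have "p v = q" using S(1) by blast
   then show "\<bar>(h x - k y) \<bullet> v\<bar> = \<bar>template v x - template v y\<bar>" unfolding p(2) p(3) by (simp add: hk(1) inner_diff_left)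
  qed
  also have "... <= (SUM v:V. \<bar>template v x - template v y\<bar>)" using S(1) V(1) by (intro sum_mono2) auto
  finally show "c0 * odist H x y <= (SUM v:V. \<bar>template v x - template v y\<bar>)" .
 qed
qed

end

section \<open>Maximal functions and points of density\<close>

lemma emeasure_Diff_cball_less:
 fixes A :: "'e::euclidean_space set"
 assumes A: "A : sets borel" "vol A < \<infinity>" and e: "0 < (e::real)"
 obtains n :: nat where "vol (A - cball 0 (real n)) < e"
proof -
 have "(%n. vol (A - cball 0 (real n))) \<longlonglongrightarrow> vol (\<Inter>n. A - cball 0 (real n))"
 proof (rule Lim_emeasure_decseq)
  show "range (%n. A - cball 0 (real n)) \<subseteq> sets lborel" using A by auto
  show "decseq (%n. A - cball 0 (real n))" by (auto simp: decseq_def)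
  fix i have "vol (A - cball 0 (real i)) <= vol A" using A by (intro emeasure_mono) auto
  then show "vol (A - cball 0 (real i)) ~= \<infinity>" using A by auto
 qed
 also have "(\<Inter>n. A - cball 0 (real n)) = {}" using real_arch_simple by (auto simp: not_le)
 finally have "(%n. vol (A - cball 0 (real n))) \<longlonglongrightarrow> 0" by simp
 then have "\<forall>\<^sub>F n in sequentially. vol (A - cball 0 (real n)) < ennreal e" by (rule order_tendstoD) (use e in simp)
 then show ?thesis using that by (auto simp: eventually_sequentially)
qed

lemma lborel_inner_compact:
 fixes A :: "'e::euclidean_space set"
 assumes A: "A : sets borel" "vol A < \<infinity>" and e: "0 < (e::real)"
 obtains K where "compact K" "K \<subseteq> A" "vol (A - K) < e"
proof -
 obtain n :: nat where n: "vol (A - cball 0 (real n)) < ennreal (e/2)" using emeasure_Diff_cball_less[OF A, of "e/2"] e by auto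
 have "A : sets lebesgue" using A by (simp add: sets_completionI_sets)
 moreover have "0 < e/2" using e by simp
 ultimately obtain T where T: "closed T" "T \<subseteq> A" "emeasure lebesgue (A - T) < ennreal (e/2)" by (rule sets_lebesgue_inner_closed)
 have T': "vol (A - T) < ennreal (e/2)" using T A by (simp add: sets_completionI_sets)
 have "vol (A - (T Int cball 0 (real n)))
   <= vol ((A - T) Un (A - cball 0 (real n)))" using A T by (intro emeasure_mono) auto
 also have "... <= vol (A - T) + vol (A - cball 0 (real n))" using A T by (intro emeasure_subadditive) auto
 also have "... < ennreal (e/2) + ennreal (e/2)" by (rule add_strict_mono[OF T' n])
 also have "... = ennreal e" using e by (subst ennreal_plus[symmetric]) auto
 finally show ?thesis using T by (intro that[of "T Int cball 0 (real n)"]) auto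
qed

lemma emeasure_lborel_translate:
 fixes A :: "'e::euclidean_space set"
 assumes [measurable]: "A : sets borel"
 shows "vol {x. x + w : A} = vol A"
proof -
 have "vol A = emeasure (distr lborel borel (%x. w + x)) A" by (simp add: lborel_distr_plus)
 also have "... = vol ((%x. w + x) -` A Int space lborel)" by (rule emeasure_distr) auto
 also have "(%x. w + x) -` A Int space lborel = {x. x + w : A}" by (auto simp: add.commute)
 finally show ?thesis by simp
qed

lemma nn_integral_lborel_translate:
 fixes f :: "'e::euclidean_space => ennreal"
 assumes [measurable]: "f : borel_measurable borel"
 shows "lint (%x. f (x + w)) = lint f"
proof -
 have "lint f = (\<integral>\<^sup>+x. f x \<partial>distr lborel borel (%x. w + x))" by (simp add: lborel_distr_plus)
 also have "... = lint (%x. f (w + x))" by (rule nn_integral_distr) auto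
 finally show ?thesis by (simp add: add.commute)
qed

text \<open>An open set barely larger than \<open>K\<close> contains every translate of
  \<open>K\<close> by a short vector. Translation invariance turns the estimate for points that
  enter \<open>K\<close> into the one for points that leave it.\<close>

lemma compact_translate_small:
 fixes K :: "'e::euclidean_space set"
 assumes K: "compact K" and e: "0 < (e::real)"
 obtains d where "0 < d" "!!w. norm w < d ==> vol {x : K. x + w ~: K} < e"
  "!!w. norm w < d ==> vol {x. x + w : K & x ~: K} < e"
proof -
 have Kb[measurable]: "K : sets borel" using K by (simp add: borel_compact)
 obtain U where U: "open U" "K \<subseteq> U" "vol (U - K) < e" using outer_regular_lborel[OF Kb e] by blast
 have Ub[measurable]: "U : sets borel" using U by simp
 obtain d where d: "0 < d" "(\<Union>x\<in>K. cball x d) \<subseteq> U" using compact_subset_open_imp_cball_epsilon_subset[OF K U(1,2)] by blast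
 have 1: "vol {x. x + w : K & x ~: K} < e" if w: "norm w < d" for w
 proof -
  have "{x. x + w : K & x ~: K} \<subseteq> U - K"
  proof safe
   fix x assume "x + w : K"
   moreover have "x : cball (x + w) d" using w by (simp add: dist_norm)
   ultimately show "x : U" using d(2) by blast
  qed
  then have "vol {x. x + w : K & x ~: K} <= vol (U - K)" by (intro emeasure_mono) auto
  then show ?thesis using U(3) by simp
 qed
 have 2: "vol {x : K. x + w ~: K} < e" if w: "norm w < d" for w
 proof -
  have "{x. x + -w : K & x ~: K} : sets borel" by measurable
  from emeasure_lborel_translate[OF this, of w]
  have "vol {x : K. x + w ~: K} = vol {x. x + -w : K & x ~: K}" by simp
  then show ?thesis using 1[of "-w"] w by simp
 qed
 show ?thesis using that[OF d(1) 2 1] by blast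
qed

lemma emeasure_ball_scale5:
 "0 < r ==> vol (ball (x::'e::euclidean_space) (5 * r)) = 5 ^ DIM('e) * vol (ball x r)"
proof -
 assume r: "0 < r"
 have "vol (ball x (5 * r)) = ennreal (unit_ball_vol DIM('e) * (5 * r) ^ DIM('e))" using r by (subst emeasure_ball) auto
 also have "... = ennreal (5 ^ DIM('e) * (unit_ball_vol DIM('e) * r ^ DIM('e)))" by (simp add: power_mult_distrib mult_ac)
 also have "... = 5 ^ DIM('e) * ennreal (unit_ball_vol DIM('e) * r ^ DIM('e))" using r by (simp add: ennreal_mult'' ennreal_power[symmetric])
 also have "ennreal (unit_ball_vol DIM('e) * r ^ DIM('e)) = vol (ball x r)" using r by (subst emeasure_ball) auto
 finally show ?thesis .
qed

text \<open>The weak type bound for the restricted Hardy-Littlewood maximal function, by the Vitali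
  covering lemma. \<open>S\<close> may fail to be measurable, so the bound is stated for a Borel
  superset \<open>T\<close>; \<open>X 1\<close> lists the disjoint balls and \<open>X 5\<close>
  their enlargements.\<close>

lemma maximal_weak_type:
 fixes a :: "'e::euclidean_space => ennreal"
 assumes a[measurable]: "a : borel_measurable borel"
  and S: "!!x. x : S ==> EX r. 0 < r & r <= 1 & c * vol (ball x r) <= sint (ball x r) a"
 obtains T where "T : sets borel" "S \<subseteq> T" "c * vol T <= 5 ^ DIM('e) * lint a"
proof -
 obtain r where r: "!!x. x : S ==> 0 < r x" "!!x. x : S ==> r x <= 1"
  "!!x. x : S ==> c * vol (ball x (r x)) <= sint (ball x (r x)) (%y. a y)" using S by metis
 have "S \<subseteq> (\<Union>i\<in>S. ball i (r i))" using r(1) by auto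
 then obtain C where C: "countable C" "C \<subseteq> S"
  and dis: "pairwise (%i j. disjnt (ball i (r i)) (ball j (r j))) C"
  and cov: "S \<subseteq> (\<Union>i\<in>C. ball i (5 * r i))" using Vitali_covering_lemma_balls[of S id r S 1] r by (auto simp: id_def)
 define X where "X s n = (if n : to_nat_on C ` C then ball (from_nat_into C n) (s * r (from_nat_into C n)) else {})"
  for s :: real and n
 have X[measurable]: "X s n : sets borel" for s n by (simp add: X_def)
 have XU: "(\<Union>n. X s n) = (\<Union>i\<in>C. ball i (s * r i))" for s using C(1) by (auto simp: X_def)
 have disX: "disjoint_family (X 1)"
  unfolding disjoint_family_on_def
 proof (intro ballI impI)
  fix m n :: nat assume "m ~= n"
  show "X 1 m Int X 1 n = {}"
  proof (cases "m : to_nat_on C ` C & n : to_nat_on C ` C")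
   case True
   then obtain i j where ij: "i : C" "j : C" "m = to_nat_on C i" "n = to_nat_on C j" by blast
   then have "i ~= j" using \<open>m ~= n\<close> by auto
   then have "ball i (r i) Int ball j (r j) = {}" using dis ij by (auto simp: pairwise_def disjnt_def)
   then show ?thesis using ij C(1) by (simp add: X_def)
  qed (auto simp: X_def)
 qed
 have scale: "c * vol (X 5 n) <= 5 ^ DIM('e) * emeasure (density lborel a) (X 1 n)" for n
 proof (cases "n : to_nat_on C ` C")
  case True
  then obtain i where i: "i : C" "n = to_nat_on C i" by blast
  then have iS: "i : S" and Xn: "X s n = ball i (s * r i)" for s using C by (auto simp: X_def)
  have "vol (X 5 n) = 5 ^ DIM('e) * vol (ball i (r i))" unfolding Xn by (rule emeasure_ball_scale5[OF r(1)[OF iS]])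
  then have "c * vol (X 5 n) = 5 ^ DIM('e) * (c * vol (ball i (r i)))" by (simp add: mult_ac)
  also have "... <= 5 ^ DIM('e) * sint (ball i (r i)) (%y. a y)" by (intro mult_left_mono r(3)[OF iS]) auto
  finally show ?thesis by (simp add: Xn emeasure_density)
 qed (simp add: X_def)
 have "(\<Sum>n. emeasure (density lborel a) (X 1 n)) = emeasure (density lborel a) (\<Union>n. X 1 n)" by (rule suminf_emeasure[OF _ disX]) auto
 also have "... <= emeasure (density lborel a) UNIV" by (rule emeasure_mono) auto
 also have "... = lint a" by (simp add: emeasure_density)
 finally have le: "(\<Sum>n. emeasure (density lborel a) (X 1 n)) <= lint a" .
 have "c * vol (\<Union>n. X 5 n) <= c * (\<Sum>n. vol (X 5 n))" by (intro mult_left_mono emeasure_subadditive_countably) auto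
 also have "... = (\<Sum>n. c * vol (X 5 n))" by simp
 also have "... <= (\<Sum>n. 5 ^ DIM('e) * emeasure (density lborel a) (X 1 n))" by (intro suminf_le scale) auto
 also have "... = 5 ^ DIM('e) * (\<Sum>n. emeasure (density lborel a) (X 1 n))" by simp
 also have "... <= 5 ^ DIM('e) * lint a" by (intro mult_left_mono le) auto
 finally have "c * vol (\<Union>n. X 5 n) <= 5 ^ DIM('e) * lint a" .
 moreover have "S \<subseteq> (\<Union>n. X 5 n)" using cov XU by simp
 ultimately show ?thesis by (intro that[of "\<Union>n. X 5 n"]) auto
qed

text \<open>The exceptional set lies in sets of measure at most a fixed finite number divided by
  \<open>l\<close>, for every \<open>l\<close>.\<close>

lemma maximal_finite_AE:
 fixes a :: "'e::euclidean_space => ennreal"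
 assumes a[measurable]: "a : borel_measurable borel" and fin: "lint a < \<infinity>"
 shows "AE x in lborel. EX l::nat. ALL r. 0 < r & r <= 1 -->
     sint (ball x r) a <= of_nat l * vol (ball x r)"
proof -
 define S where "S = {x. ALL l::nat. EX r. 0 < r & r <= 1 &
     of_nat l * vol (ball x r) < sint (ball x r) a}"
 define D where "D = 5 ^ DIM('e) * lint a"
 have "EX T. T : sets borel & S \<subseteq> T & of_nat l * vol T <= D" for l :: nat
 proof -
  have "EX r. 0 < r & r <= 1 & of_nat l * vol (ball x r) <= sint (ball x r) a"
   if "x : S" for x using that unfolding S_def by (auto intro: less_imp_le)
  then obtain T where "T : sets borel" "S \<subseteq> T"
   "of_nat l * vol T <= 5 ^ DIM('e) * lint a" by (rule maximal_weak_type[OF a])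
  then show ?thesis unfolding D_def by (intro exI[of _ T]) simp
 qed
 then obtain T where T: "!!l::nat. T l : sets borel" "!!l. S \<subseteq> T l"
  "!!l. of_nat l * vol (T l) <= D" by metis
 have D: "D < \<infinity>" using fin by (simp add: D_def ennreal_mult_less_top power_less_top_ennreal)
 define N where "N = (\<Inter>l. T l)"
 have N: "N : sets lborel" using T by (auto simp: N_def)
 have "of_nat l * vol N <= D" for l :: nat
 proof -
  have "vol N <= vol (T l)" using T by (intro emeasure_mono) (auto simp: N_def)
  then show ?thesis using T(3)[of l] by (meson mult_left_mono order_trans zero_le)
 qed
 have "vol N = 0"
 proof (rule ccontr)
  assume n0: "vol N ~= 0"
  show False
  proof (cases "vol N")
   case (real x)
   with n0 have x: "0 < x" by (auto simp: less_le)
   obtain d where d: "D = ennreal d" "0 <= d" using D by (cases D) auto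
   obtain l :: nat where "d / x < real l" using reals_Archimedean2 by blast
   then have "d < real l * x" using x by (simp add: field_simps)
   moreover have "ennreal (real l * x) <= ennreal d"
    using \<open>of_nat l * vol N <= D\<close> d x real by (simp add: ennreal_of_nat_eq_real_of_nat ennreal_mult)
   ultimately show False using d by (simp add: ennreal_le_iff)
  next
   case top
   then show False using \<open>of_nat 1 * vol N <= D\<close> D by (simp add: top_unique)
  qed
 qed
 then have "N : null_sets lborel" using N by auto
 then show ?thesis
 proof (rule AE_I')
  show "{x : space lborel. ~ (EX l::nat. ALL r. 0 < r & r <= 1 -->
     sint (ball x r) a <= of_nat l * vol (ball x r))} \<subseteq> N" using T(2) unfolding S_def N_def by (force simp: not_le)
 qed
qed

section \<open>Points of density\<close>

text \<open>\<open>S\<close> has Lebesgue density 0 at \<open>x\<close>. Intersections that are not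
  measurable contribute the value 0, as they do in \<open>approx_differential\<close>.\<close>

definition dens0 :: "'e::euclidean_space set => 'e => bool" where
 "dens0 S x \<longleftrightarrow> ((%r. measure lborel (S Int ball x r) / measure lborel (ball x r)) \<longlongrightarrow> 0) (at_right 0)"

lemma dens0_mono:
 assumes "dens0 T x" "S \<subseteq> T" "T : sets borel"
 shows "dens0 S x"
 unfolding dens0_def
proof (rule tendsto_sandwich[OF _ _ tendsto_const assms(1)[unfolded dens0_def]])
 show "\<forall>\<^sub>F r in at_right 0. 0 <= measure lborel (S Int ball x r) / measure lborel (ball x r)" by simp
 have "measure lborel (S Int ball x r) <= measure lborel (T Int ball x r)" for r
 proof (cases "S Int ball x r : sets lborel")
  case True
  then show ?thesis using assms emeasure_lborel_ball_finite[of x r]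
   by (intro measure_mono_fmeasurable) (auto simp: fmeasurable_def intro!: le_less_trans[OF emeasure_mono[of _ "ball x r"]])
 next
  case False
  then show ?thesis by (simp add: measure_notin_sets)
 qed
 then show "\<forall>\<^sub>F r in at_right 0. measure lborel (S Int ball x r) / measure lborel (ball x r)
   <= measure lborel (T Int ball x r) / measure lborel (ball x r)" by (intro always_eventually allI divide_right_mono) auto
qed

text \<open>The complement of \<open>P\<close> is exhausted by a compact set \<open>K\<close> up to
  small measure. A point of \<open>P\<close> keeps a positive distance from \<open>K\<close>, so
  small balls around it meet only the small rest of the complement, and the weak type bound limits
  the set of points where that rest is dense.\<close>

lemma lebesgue_density:
 fixes P :: "'e::euclidean_space set"
 assumes P[measurable]: "P : sets borel"
 shows "AE x\<in>P in lborel. dens0 (-P) x"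
proof -
 define bad where "bad n = {x : P Int ball 0 (real n). ~ eventually
   (%r. vol (ball x r - P) < ennreal (1 / Suc n) * vol (ball x r)) (at_right 0)}" for n
 have "EX T. T : sets borel & bad n \<subseteq> T & vol T <= ennreal (1 / Suc k)" for n k
 proof -
  define c where "c = 1 / real (Suc n)"
  \<comment> \<open>Chosen so that the weak type bound at level \<open>c\<close>, with constant
    \<open>5 ^ DIM('e)\<close>, yields exactly 1 / (k + 1).\<close>
  define e where "e = c / (real (Suc k) * 5 ^ DIM('e))"
  have ce: "0 < c" "0 < e" by (auto simp: c_def e_def)
  define T where "T = ball 0 (real n + 1) - P"
  have T[measurable]: "T : sets borel" by (simp add: T_def)
  have "vol T <= vol (ball (0::'e) (real n + 1))" by (intro emeasure_mono) (auto simp: T_def)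
  then have "vol T < \<infinity>" using emeasure_lborel_ball_finite le_less_trans by blast
  then obtain K where K: "compact K" "K \<subseteq> T" "vol (T - K) < ennreal e" using lborel_inner_compact[OF T _ ce(2)] by blast
  have [measurable]: "K : sets borel" using K by (simp add: borel_compact)
  have "EX r. 0 < r & r <= 1 & ennreal c * vol (ball x r)
    <= sint (ball x r) (%y. indicator (T - K) y)" if x: "x : bad n" for x
  proof -
   have xP: "x : P" "norm x < real n" using x by (auto simp: bad_def)
   have "x : - K" using xP K(2) by (auto simp: T_def)
   moreover have "open (- K)" using K(1) by (simp add: compact_imp_closed open_Compl)
   ultimately obtain d where d: "d > 0" "ball x d \<subseteq> - K" using open_contains_ball by blast
   have "eventually (%r. r < min d 1) (at_right (0::real))"
    using d(1) by (intro eventually_at_right_less[THEN eventually_mono] eventually_at_rightI[of _ "min d 1"]) auto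
   moreover have "\<exists>\<^sub>F r in at_right 0. ~ vol (ball x r - P) < ennreal c * vol (ball x r)"
    using x by (auto simp: bad_def c_def frequently_def)
   moreover have "eventually (%r. 0 < r) (at_right (0::real))" by (rule eventually_at_right_less)
   ultimately obtain r where r: "0 < r" "r < min d 1"
    "~ vol (ball x r - P) < ennreal c * vol (ball x r)" using frequently_ex[OF frequently_eventually_conj[OF _ eventually_conj]] by blast
   have "ball x r - P \<subseteq> ball x r Int (T - K)"
   proof
    fix y assume y: "y : ball x r - P"
    then have "y : ball x d" using r by auto
    then have "y ~: K" using d by blast
    moreover have "norm y < real n + 1" using y r xP norm_triangle_ineq2[of y x] by (auto simp: dist_norm norm_minus_commute)
    ultimately show "y : ball x r Int (T - K)" using y by (auto simp: T_def)
   qed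
   then have "vol (ball x r - P) <= vol (ball x r Int (T - K))" by (intro emeasure_mono) auto
   also have "... = lint (%y. indicator (ball x r Int (T - K)) y)" by (rule nn_integral_indicator[symmetric]) simp
   also have "... = sint (ball x r) (%y. indicator (T - K) y)" by (intro nn_integral_cong) (auto simp: indicator_def)
   finally have "ennreal c * vol (ball x r) <= sint (ball x r) (%y. indicator (T - K) y)" using r(3) unfolding not_less by (rule order_trans[rotated])
   then show ?thesis using r by (intro exI[of _ r]) simp
  qed
  then obtain T' where T': "T' : sets borel" "bad n \<subseteq> T'"
   "ennreal c * vol T' <= 5 ^ DIM('e) * lint (%y. indicator (T - K) y)" using maximal_weak_type[of "indicator (T - K)" "bad n" "ennreal c"] by auto
  have "ennreal c * vol T' <= 5 ^ DIM('e) * ennreal e" using K(3) by (intro order_trans[OF T'(3)] mult_left_mono) (auto intro: less_imp_le)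
  also have "... = ennreal (5 ^ DIM('e) * e)" using ce by (simp add: ennreal_mult ennreal_power[symmetric])
  also have "5 ^ DIM('e) * e = c * (1 / Suc k)" by (simp add: e_def)
  also have "ennreal (c * (1 / Suc k)) = ennreal c * ennreal (1 / Suc k)" using ce by (intro ennreal_mult) auto
  finally have "vol T' <= ennreal (1 / Suc k)" using ce by (subst (asm) ennreal_mult_le_mult_iff) auto
  then show ?thesis using T' by blast
 qed
 then obtain T where T: "!!n k. T n k : sets borel" "!!n k. bad n \<subseteq> T n k"
  "!!n k. vol (T n k) <= ennreal (1 / Suc k)" by metis
 have null: "(\<Inter>k. T n k) : null_sets lborel" for n
 proof (rule null_setsI)
  show "(\<Inter>k. T n k) : sets lborel" using T by auto
  have "vol (\<Inter>k. T n k) <= ennreal (1 / Suc k)" for k using T by (intro order_trans[OF emeasure_mono T(3)[of n k]]) auto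
  moreover have "(%k. ennreal (1 / Suc k)) \<longlonglongrightarrow> ennreal 0"
   using LIMSEQ_inverse_real_of_nat by (intro tendsto_ennrealI) (simp add: inverse_eq_divide)
  ultimately have "vol (\<Inter>k. T n k) <= ennreal 0" by (intro LIMSEQ_le_const) auto
  then show "vol (\<Inter>k. T n k) = 0" by simp
 qed
 have nullU: "(\<Union>n. \<Inter>k. T n k) : null_sets lborel" using null by blast
 show ?thesis
 proof (rule AE_I'[OF nullU], rule subsetI)
  fix x assume "x : {x : space lborel. ~ (x : P --> dens0 (-P) x)}"
  then have x: "x : P" "~ dens0 (-P) x" by auto
  show "x : (\<Union>n. \<Inter>k. T n k)"
  proof (rule ccontr)
   assume "x ~: (\<Union>n. \<Inter>k. T n k)"
   then have nb: "!!n. x ~: bad n" using T(2) by blast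
   have "dens0 (-P) x" unfolding dens0_def tendsto_iff
   proof (intro allI impI)
    fix e :: real assume e: "0 < e"
    obtain n where n: "norm x < real n" "1 / e < real n" using reals_Archimedean2[of "max (norm x) (1 / e)"] by auto
    have n': "1 / real (Suc n) < e" using n(2) e by (simp add: field_simps)
    have "eventually (%r. vol (ball x r - P) < ennreal (1 / Suc n) * vol (ball x r)) (at_right 0)" using nb[of n] n x by (auto simp: bad_def)
    moreover have "eventually (%r. 0 < r) (at_right (0::real))" by (rule eventually_at_right_less)
    ultimately show "\<forall>\<^sub>F r in at_right 0. dist (measure lborel (-P Int ball x r) / measure lborel (ball x r)) 0 < e"
    proof eventually_elim
     case (elim r)
     have f: "vol (ball x r) ~= \<infinity>" "vol (ball x r - P) ~= \<infinity>"
      using emeasure_lborel_ball_finite[of x r] elim(1) by (auto simp: top_unique dest: less_trans)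
     have pos: "0 < measure lborel (ball x r)" using elim(2) by (simp add: content_ball_pos)
     have "measure lborel (ball x r - P) < 1 / Suc n * measure lborel (ball x r)"
      using elim(1) f by (simp add: emeasure_eq_ennreal_measure ennreal_mult[symmetric] ennreal_less_iff)
     moreover have "-P Int ball x r = ball x r - P" by blast
     ultimately have "measure lborel (-P Int ball x r) / measure lborel (ball x r) < 1 / Suc n" using pos by (simp add: field_simps)
     then show ?case using n' by simp
    qed
   qed
   then show False using x by blast
  qed
 qed
qed

section \<open>Differentiation of Lipschitz functions of one real variable\<close>

text \<open>The identity holds on half-open intervals, which form a generator stable under
  intersection. Cutting down to a bounded interval keeps all measures finite, so that the complement
  step may cancel.\<close>

lemma interval_measure_add:
 fixes F G :: "real => real"
 assumes F: "!!x y. x <= y ==> F x <= F y" "!!a. continuous (at_right a) F"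
  and G: "!!x y. x <= y ==> G x <= G y" "!!a. continuous (at_right a) G"
  and FG: "!!x. F x + G x = c * x" and c: "0 <= c" and A: "A : sets borel"
 shows "emeasure (interval_measure F) (A Int {-real n<..real n}) +
    emeasure (interval_measure G) (A Int {-real n<..real n}) =
    ennreal c * vol (A Int {-real n<..real n})"
proof -
 define I where "I = {-real n<..real n}"
 define MF MG where "MF = interval_measure F" and "MG = interval_measure G"
 have s[simp]: "sets MF = sets borel" "sets MG = sets borel" by (simp_all add: MF_def MG_def)
 have Ioc: "emeasure MF {a<..b} + emeasure MG {a<..b} = ennreal c * vol {a<..b}" for a b :: real
 proof (cases "a <= b")
  case True
  have "F b - F a + (G b - G a) = c * (b - a)" using FG[of a] FG[of b] by (simp add: algebra_simps)
  moreover have "0 <= F b - F a" "0 <= G b - G a" using F(1)[OF True] G(1)[OF True] by auto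
  ultimately show ?thesis using True c by (simp add: MF_def MG_def emeasure_interval_measure_Ioc F G ennreal_plus[symmetric] ennreal_mult[symmetric]
     del: ennreal_plus)
 qed simp
 have Ib: "I : sets borel" by (simp add: I_def)
 have fin: "emeasure MF I ~= \<infinity>" "emeasure MG I ~= \<infinity>" "vol I ~= \<infinity>"
  by (simp_all add: I_def MF_def MG_def emeasure_interval_measure_Ioc F G)
 have fin': "emeasure MF (B Int I) ~= \<infinity>" "emeasure MG (B Int I) ~= \<infinity>" "vol (B Int I) ~= \<infinity>"
  if "B : sets borel" for B
 proof -
  have "emeasure MF (B Int I) <= emeasure MF I" "emeasure MG (B Int I) <= emeasure MG I"
   "vol (B Int I) <= vol I" using that Ib by (auto intro!: emeasure_mono)
  then show "emeasure MF (B Int I) ~= \<infinity>" "emeasure MG (B Int I) ~= \<infinity>" "vol (B Int I) ~= \<infinity>"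
   using fin by (auto simp: top_unique)
 qed
 have stable: "Int_stable (range (%(a, b). {a<..b::real}))"
 proof (rule Int_stableI, safe)
  fix a b a' b' :: real
  show "{a<..b} Int {a'<..b'} : range (%(a, b). {a<..b})" by (rule image_eqI[of _ _ "(max a a', min b b')"]) auto
 qed
 have pow: "range (%(a, b). {a<..b::real}) \<subseteq> Pow UNIV" by simp
 have "A : sigma_sets UNIV (range (%(a, b). {a<..b::real}))" using A by (simp add: borel_sigma_sets_Ioc)
 with stable pow have "emeasure MF (A Int I) + emeasure MG (A Int I) = ennreal c * vol (A Int I)"
 proof (induction rule: sigma_sets_induct_disjoint)
  case (basic A)
  then obtain a b where A: "A = {a<..b}" by auto
  have "A Int I = {max a (-real n)<..min b (real n)}" by (auto simp: A I_def)
  then show ?case using Ioc by simp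
 next
  case (compl A)
  then have Ab: "A : sets borel" by (simp add: borel_sigma_sets_Ioc)
  have *: "(UNIV - A) Int I = I - A Int I" by blast
  have 1: "emeasure M I = emeasure M ((UNIV - A) Int I) + emeasure M (A Int I)"
   if "sets M = sets borel" for M :: "real measure"
  proof -
   have "emeasure M (((UNIV - A) Int I) Un (A Int I)) = emeasure M ((UNIV - A) Int I) + emeasure M (A Int I)"
    by (rule plus_emeasure[symmetric]) (use that Ab Ib in auto)
   moreover have "((UNIV - A) Int I) Un (A Int I) = I" by blast
   ultimately show ?thesis by simp
  qed
  have "UNIV - A : sets borel" using Ab by auto
  note f = fin'[OF this] fin'[OF Ab]
  have "emeasure MF I + emeasure MG I = ennreal c * vol I" using Ioc by (simp add: I_def)
  then have "(emeasure MF (A Int I) + emeasure MG (A Int I)) + (emeasure MF ((UNIV - A) Int I) + emeasure MG ((UNIV - A) Int I))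
    = ennreal c * vol (A Int I) + ennreal c * vol ((UNIV - A) Int I)"
   unfolding 1[of MF, OF s(1)] 1[of MG, OF s(2)] 1[of lborel, OF sets_lborel] by (simp add: distrib_left add_ac)
  then show ?case using f(4-6) unfolding compl.IH[symmetric] by (auto simp: ennreal_add_left_cancel)
 next
  case (union A)
  then have Ab: "!!i. A i : sets borel" by (auto simp: borel_sigma_sets_Ioc)
  have 1: "(\<Sum>i. emeasure M (A i Int I)) = emeasure M (\<Union>(range A) Int I)"
   if "sets M = sets borel" for M :: "real measure"
  proof -
   have "(\<Sum>i. emeasure M (A i Int I)) = emeasure M (\<Union>i. A i Int I)"
   proof (rule suminf_emeasure)
    show "range (%i. A i Int I) \<subseteq> sets M" using that Ab Ib by auto
    show "disjoint_family (%i. A i Int I)" using union.hyps unfolding disjoint_family_on_def by blast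
   qed
   then show ?thesis by (simp add: Int_UN_distrib2)
  qed
  show ?case
   unfolding 1[of MF, OF s(1), symmetric] 1[of MG, OF s(2), symmetric] 1[of lborel, OF sets_lborel, symmetric]
   using union.IH by (subst suminf_add) (simp_all add: summableI)
 qed simp
 then show ?thesis by (simp add: I_def MF_def MG_def)
qed

text \<open>Adding and subtracting a linear function makes both \<open>F\<close> and
  \<open>G\<close> monotone with sum 2 L t. Their Stieltjes measures then add up to a multiple of
  Lebesgue measure, so that of \<open>F\<close> has a density \<open>k\<close>, and differentiating
  its integral gives the derivative.\<close>

lemma lipschitz_right_derivative_AE:
 fixes f :: "real => real"
 assumes f: "!!x y. \<bar>f x - f y\<bar> <= L * \<bar>x - y\<bar>"
 shows "AE t in lborel. EX D. ((%h. (f (t + h) - f t) / h) \<longlongrightarrow> D) (at_right 0)"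
proof -
 have L: "0 <= L" using f[of 0 1] by simp
 define F G where "F t = f t + L * t" and "G t = L * t - f t" for t
 have cf: "continuous_on UNIV f"
 proof (rule lipschitz_on_continuous_on[of L])
  show "L-lipschitz_on UNIV f" using f L by (intro lipschitz_onI) (auto simp: dist_real_def)
 qed
 have mF: "F x <= F y" and mG: "G x <= G y" if "x <= y" for x y
 proof -
  have "\<bar>f x - f y\<bar> <= L * (y - x)" using f[of x y] that by simp
  then show "F x <= F y" "G x <= G y" by (auto simp: F_def G_def algebra_simps abs_le_iff)
 qed
 have cF: "continuous (at_right a) F" and cG: "continuous (at_right a) G" for a
 proof -
  have *: "isCont f a" using cf by (simp add: continuous_on_eq_continuous_at)
  have "isCont F a" "isCont G a" unfolding F_def G_def by (intro continuous_intros *)+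
  then show "continuous (at_right a) F" "continuous (at_right a) G" by (simp_all add: continuous_at_imp_continuous_at_within)
 qed
 define M where "M = interval_measure F"
 have ac: "absolutely_continuous lborel M"
  unfolding absolutely_continuous_def
 proof safe
  fix N :: "real set" assume N: "N : null_sets lborel"
  then have Nb: "N : sets borel" by auto
  have "emeasure M (N Int {-real n<..real n}) = 0" for n
  proof -
   have "vol (N Int {-real n<..real n}) <= vol N" using N by (intro emeasure_mono) auto
   then have "vol (N Int {-real n<..real n}) = 0" using N by auto
   then show ?thesis
    using interval_measure_add[of F G "2 * L" N n, OF mF cF mG cG _ _ Nb] L by (simp add: F_def G_def M_def)
  qed
  then have "(\<Union>n. N Int {-real n<..real n}) : null_sets M" using Nb by (intro null_sets_UN) (auto simp: M_def)
  moreover have "(\<Union>n. N Int {-real n<..real n}) = N"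
  proof safe
   fix x assume "x : N"
   obtain n where "\<bar>x\<bar> < real n" using reals_Archimedean2 by blast
   then have "x : N Int {-real n<..real n}" using \<open>x : N\<close> by auto
   then show "x : (\<Union>n. N Int {-real n<..real n})" by blast
  qed
  ultimately show "N : null_sets M" by simp
 qed
 obtain k where k[measurable]: "k : borel_measurable lborel" and kM: "density lborel k = M"
  using sigma_finite_measure.Radon_Nikodym[OF sigma_finite_lborel ac] by (auto simp: M_def)
 have kI: "sint {a<..b} (%x. k x) = ennreal (F b - F a)" if "a <= b" for a b
 proof -
  have "sint {a<..b} (%x. k x) = emeasure M {a<..b}" unfolding kM[symmetric] by (rule emeasure_density[symmetric]) auto
  then show ?thesis using that by (simp add: M_def emeasure_interval_measure_Ioc mF cF)
 qed
 have kfin: "AE x in lborel. k x ~= \<infinity>"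
 proof -
  have "AE x in lborel. k x * indicator {-real n<..real n} x ~= \<infinity>" for n
   by (rule nn_integral_noteq_infinite) (use kI[of "-real n" "real n"] in auto)
  then have "AE x in lborel. ALL n. k x * indicator {-real n<..real n} x ~= \<infinity>" by (simp add: AE_all_countable)
  then show ?thesis
  proof eventually_elim
   case (elim x)
   obtain n where "\<bar>x\<bar> < real n" using reals_Archimedean2 by blast
   then have "x : {-real n<..real n}" by auto
   then show ?case using elim[rule_format, of n] by auto
  qed
 qed
 define kr where "kr x = enn2real (k x)" for x
 have kr[measurable]: "kr : borel_measurable borel" unfolding kr_def using k by measurable
 have hi: "(kr has_integral (F b - F a)) (cbox a b)" if ab: "a <= b" for a b
 proof -
  have "((%x. kr x * indicator {a..b} x) has_integral (F b - F a)) UNIV"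
  proof (rule nn_integral_has_integral)
   show "(%x. kr x * indicator {a..b} x) : borel_measurable borel" by measurable
   show "0 <= kr x * indicator {a..b} x" for x by (simp add: kr_def)
   show "0 <= F b - F a" using mF[OF ab] by simp
   have "lint (%x. ennreal (kr x * indicator {a..b} x)) = sint {a<..b} (%x. k x)"
   proof (rule nn_integral_cong_AE)
    show "AE x in lborel. ennreal (kr x * indicator {a..b} x) = k x * indicator {a<..b} x"
     using kfin AE_lborel_singleton[of a] by eventually_elim (auto simp: kr_def indicator_def ennreal_enn2real_if)
   qed
   then show "lint (%x. ennreal (kr x * indicator {a..b} x)) = ennreal (F b - F a)" using kI[OF ab] by simp
  qed
  then have "((%x. if x : cbox a b then kr x else 0) has_integral (F b - F a)) UNIV" by (rule has_integral_eq[rotated]) (auto simp: indicator_def)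
  then show ?thesis by (simp only: has_integral_restrict_UNIV)
 qed
 have "kr integrable_on cbox a b" for a b :: real using hi[of a b] by (cases "a <= b") (auto simp: integrable_on_def)
 \<comment> \<open>The averages run over cubes with lower corner \<open>x\<close>, that is over
   [x, x + h]; this is why right derivatives appear.\<close>
 then obtain N where N: "negligible N" "!!x e. x ~: N ==> 0 < e ==>
   \<exists>d>0. ALL h. 0 < h & h < d --> norm (integral (cbox x (x + h *\<^sub>R One)) kr /\<^sub>R h ^ DIM(real) - kr x) < e"
  using integrable_ccontinuous_explicit[of kr] by blast
 have "AE x in lebesgue. x ~: N" using N(1) by (intro AE_not_in) (simp add: negligible_iff_null_sets)
 then have "AE x in lborel. x ~: N" by (simp add: AE_completion_iff)
 then show ?thesis
 proof eventually_elim
  case (elim t)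
  have "((%h. (f (t + h) - f t) / h) \<longlongrightarrow> kr t - L) (at_right 0)"
   unfolding tendsto_iff
  proof (intro allI impI)
   fix e :: real assume "0 < e"
   from N(2)[OF elim this] obtain d where d: "d > 0" "!!h. 0 < h ==> h < d ==>
     norm (integral (cbox t (t + h *\<^sub>R One)) kr /\<^sub>R h ^ DIM(real) - kr t) < e" by blast
   have "dist ((f (t + h) - f t) / h) (kr t - L) < e" if h: "0 < h" "h < d" for h
   proof -
    have "integral (cbox t (t + h)) kr = F (t + h) - F t" using hi[of t "t + h"] h by (intro integral_unique) auto
    then have "\<bar>(F (t + h) - F t) / h - kr t\<bar> < e" using d(2)[OF h] by (simp add: divide_inverse mult.commute)
    moreover have "(F (t + h) - F t) / h = (f (t + h) - f t) / h + L" using h by (simp add: F_def field_simps)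
    ultimately show ?thesis by (simp add: dist_real_def algebra_simps)
   qed
   then show "\<forall>\<^sub>F h in at_right 0. dist ((f (t + h) - f t) / h) (kr t - L) < e" using d(1) by (auto simp: eventually_at_right_field)
  qed
  then show ?case by blast
 qed
qed

section \<open>Almost everywhere differentiability of Lipschitz maps\<close>

definition dquot :: "('e::euclidean_space => real) => 'e => real => 'e => real" where
 "dquot f v h x = (f (x + h *\<^sub>R v) - f x) / h"

text \<open>A limit along the sequence 1/(n + 1) is measurable at once;
  \<open>seq_to_right_limit\<close> recovers the limit over all small \<open>h\<close>.\<close>

definition dderiv :: "('e::euclidean_space => real) => 'e => 'e => real" where
 "dderiv f v x = lim (%n. dquot f v (1 / Suc n) x)"

text \<open>\<open>h * q h\<close> is Lipschitz in \<open>h\<close>, and some sequence point differs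
  from \<open>h\<close> by at most \<open>2 * h^2\<close>. After division by \<open>h\<close> the
  quotients at the two points differ by a multiple of \<open>h\<close>.\<close>

lemma seq_to_right_limit:
 fixes q :: "real => real"
 assumes b: "!!h. 0 < h ==> \<bar>q h\<bar> <= C"
  and l: "!!h h'. 0 < h ==> 0 < h' ==> \<bar>h * q h - h' * q h'\<bar> <= C * \<bar>h - h'\<bar>"
  and q: "(%n. q (1 / real (Suc n))) \<longlonglongrightarrow> D"
 shows "(q \<longlongrightarrow> D) (at_right 0)"
proof -
 have C: "0 <= C" using b[of 1] by simp
 \<comment> \<open>For \<open>h < 1\<close> the number \<open>N h + 1\<close> is the integer part of
   1/h, so its reciprocal is the smallest sequence point that is not below \<open>h\<close>.\<close>
 define N where "N h = nat \<lfloor>1 / h\<rfloor> - 1" for h :: real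
 have N: "\<bar>q h - q (1 / real (Suc (N h)))\<bar> <= 4 * C * h" if h: "0 < h" "h < 1" for h
 proof -
  have "1 <= 1 / h" using h by simp
  define z where "z = \<lfloor>1 / h\<rfloor>"
  have z: "1 <= z" using \<open>1 <= 1 / h\<close> by (simp add: z_def le_floor_iff)
  then have "real (Suc (N h)) = real (nat z)" by (simp add: N_def z_def[symmetric])
  then have Neq: "real (Suc (N h)) = of_int z" using z by simp
  define n where "n = real (Suc (N h))"
  have n: "n <= 1 / h" "1 / h < n + 1" "1 <= n" unfolding n_def Neq using z by (simp_all add: z_def)
  define h' where "h' = 1 / n"
  have h': "0 < h'" "h <= h'" "h' - h <= h * (1 / n)" "1 / n <= 2 * h"
  proof -
   show "0 < h'" using n by (simp add: h'_def)
   show "h <= h'" using n h by (simp add: h'_def field_simps)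
   have "1 < (n + 1) * h" using n(2) h by (simp add: field_simps)
   then have "(1 - h * n) / n <= h / n" using n by (intro divide_right_mono) (auto simp: algebra_simps)
   moreover have "h' - h = (1 - h * n) / n" using n by (simp add: h'_def diff_divide_distrib)
   ultimately show "h' - h <= h * (1 / n)" by simp
   have "1 < 2 * n * h" using \<open>1 < (n + 1) * h\<close> n(3) h by (smt (verit, best) mult_right_mono)
   then show "1 / n <= 2 * h" using n by (simp add: field_simps)
  qed
  have "h * (q h - q h') = (h * q h - h' * q h') + (h' - h) * q h'" by (simp add: algebra_simps)
  then have "\<bar>h * (q h - q h')\<bar> <= \<bar>h * q h - h' * q h'\<bar> + \<bar>(h' - h) * q h'\<bar>" by (metis abs_triangle_ineq)
  also have "... <= C * (h' - h) + (h' - h) * C"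
  proof (rule add_mono)
   show "\<bar>h * q h - h' * q h'\<bar> <= C * (h' - h)" using l[OF h(1) h'(1)] h'(2) by simp
   show "\<bar>(h' - h) * q h'\<bar> <= (h' - h) * C" unfolding abs_mult using h'(2) b[OF h'(1)] by (intro mult_mono) auto
  qed
  also have "... = 2 * C * (h' - h)" by simp
  also have "... <= 2 * C * (h * (2 * h))"
  proof (rule mult_left_mono)
   show "h' - h <= h * (2 * h)" using h'(3,4) h by (meson mult_left_mono order_trans less_imp_le)
  qed (use C in simp)
  finally have "h * \<bar>q h - q h'\<bar> <= h * (4 * C * h)" using h by (simp add: abs_mult mult_ac)
  then have "\<bar>q h - q h'\<bar> <= 4 * C * h" using h by (simp add: mult_le_cancel_left)
  then show ?thesis by (simp add: h'_def n_def)
 qed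
 have "filterlim N sequentially (at_right 0)"
  unfolding filterlim_at_top
 proof
  fix m :: nat
  have "m <= N h" if h: "0 < h" "h < 1 / (real m + 1)" for h
  proof -
   have "real m + 1 <= 1 / h" using h by (simp add: field_simps)
   then have "int (m + 1) <= \<lfloor>1 / h\<rfloor>" by (simp add: le_floor_iff)
   then show ?thesis by (simp add: N_def nat_le_iff le_diff_conv2 del: int_plus)
  qed
  then show "\<forall>\<^sub>F h in at_right 0. m <= N h" by (auto simp: eventually_at_right_field intro!: exI[of _ "1 / (real m + 1)"])
 qed
 from filterlim_compose[OF q this] have lim: "((%h. q (1 / real (Suc (N h)))) \<longlongrightarrow> D) (at_right 0)" .
 have "((%h. q h - q (1 / real (Suc (N h)))) \<longlongrightarrow> 0) (at_right 0)"
 proof (rule Lim_null_comparison)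
  have "\<forall>\<^sub>F h in at_right (0::real). h < 1" by (auto simp: eventually_at_right_field intro!: exI[of _ 1])
  moreover have "\<forall>\<^sub>F h in at_right (0::real). 0 < h" by (rule eventually_at_right_less)
  ultimately show "\<forall>\<^sub>F h in at_right 0. norm (q h - q (1 / real (Suc (N h)))) <= 4 * C * h" by eventually_elim (use N in simp)
  have "((%h::real. 4 * C * h) \<longlongrightarrow> 4 * C * 0) (at_right 0)" by (intro tendsto_intros)
  then show "((%h::real. 4 * C * h) \<longlongrightarrow> 0) (at_right 0)" by simp
 qed
 from tendsto_add[OF this lim] show ?thesis by simp
qed

lemma integrable_indicator_bounded:
 fixes g :: "'e::euclidean_space => real"
 assumes "compact K" and [measurable]: "g : borel_measurable borel" and "!!x. \<bar>g x\<bar> <= C"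
 shows "integrable lborel (%x. indicator K x * g x)"
proof (rule Bochner_Integration.integrable_bound)
 have [measurable]: "K : sets borel" using assms(1) by (simp add: borel_compact)
 show "integrable lborel (%x. C * indicator K x :: real)"
  using emeasure_compact_finite[OF assms(1)] by (intro integrable_mult_right integrable_real_indicator) auto
 show "(%x. indicator K x * g x) : borel_measurable lborel" by measurable
 have "0 <= C" using assms(3)[of undefined] by linarith
 then show "AE x in lborel. norm (indicator K x * g x) <= norm (C * indicator K x :: real)"
  using assms(3) by (intro AE_I2) (auto simp: indicator_def abs_of_nonneg)
qed

text \<open>Indicators of compact sets are test functions enough: a set of positive measure on which
  \<open>W\<close> is below a negative constant contains a compact set of positive measure.\<close>

lemma nonneg_AE_of_compact_integrals:
 fixes W :: "'e::euclidean_space => real"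
 assumes W[measurable]: "W : borel_measurable borel" and b: "!!x. \<bar>W x\<bar> <= C"
  and I: "!!K. compact K ==> 0 <= (LINT x|lborel. indicator K x * W x)"
 shows "AE x in lborel. 0 <= W x"
proof -
 define P where "P n k = {x : ball 0 (real n). W x < - (1 / real (Suc k))}" for n k
 have null: "P n k : null_sets lborel" for n k
 proof (rule ccontr)
  have P[measurable]: "P n k : sets borel" unfolding P_def by measurable
  assume "P n k ~: null_sets lborel"
  then have pos: "0 < vol (P n k)" using P by (auto simp: null_sets_def zero_less_iff_neq_zero)
  have "vol (P n k) <= vol (ball (0::'e) (real n))" by (intro emeasure_mono) (auto simp: P_def)
  then have fin: "vol (P n k) < \<infinity>" using emeasure_lborel_ball_finite le_less_trans by blast
  then obtain r where r: "vol (P n k) = ennreal r" "0 < r" using pos by (cases "vol (P n k)") auto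
  obtain K where K: "compact K" "K \<subseteq> P n k" "vol (P n k - K) < ennreal r" using lborel_inner_compact[OF P fin r(2)] by blast
  have [measurable]: "K : sets borel" using K by (simp add: borel_compact)
  have Kfin: "vol K < \<infinity>" using K(1) by (rule emeasure_compact_finite)
  have "vol K ~= 0"
  proof
   assume "vol K = 0"
   then have "vol (P n k - K) = vol (P n k)" using K P by (intro emeasure_Diff_null_set) (auto simp: null_sets_def)
   then show False using K(3) r by simp
  qed
  then have mK: "0 < measure lborel K" using Kfin by (simp add: measure_def enn2real_positive_iff less_top zero_less_iff_neq_zero)
  have "(LINT x|lborel. indicator K x * W x) <= (LINT x|lborel. indicator K x * (- (1 / real (Suc k))))"
   using K(2) by (intro integral_mono integrable_indicator_bounded[OF K(1) _ b]
     integrable_indicator_bounded[OF K(1) _ order_refl])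
    (auto simp: indicator_def P_def subset_iff intro!: less_imp_le)
  also have "... = measure lborel K * (- (1 / real (Suc k)))" by simp
  also have "... < 0" using mK by (simp add: mult_pos_neg)
  finally show False using I[OF K(1)] by simp
 qed
 have "(\<Union>n k. P n k) : null_sets lborel" using null by blast
 then show ?thesis
 proof (rule AE_I', intro subsetI)
  fix x assume "x : {x : space lborel. ~ 0 <= W x}"
  then have "W x < 0" by auto
  then obtain k where "1 / real (Suc k) < - W x" using nat_approx_posE[of "- W x"] by auto
  moreover obtain n where "norm x < real n" using reals_Archimedean2 by blast
  ultimately have "x : P n k" by (auto simp: P_def)
  then show "x : (\<Union>n k. P n k)" by blast
 qed
qed

text \<open>The shift is moved from \<open>g\<close> to the compact set, so \<open>d\<close> depends
  only on the bound of \<open>g\<close>. This uniformity matters because the difference quotients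
  inserted for \<open>g\<close> change along with the shift.\<close>

lemma compact_integral_shift_small:
 fixes K :: "'e::euclidean_space set"
 assumes K: "compact K" and e: "0 < e" and C: "0 <= C"
 obtains d where "0 < d" "!!w (g :: 'e => real). norm w < d ==> g : borel_measurable borel ==> (!!x. \<bar>g x\<bar> <= C) ==>
  \<bar>(LINT x|lborel. indicator K x * g (x + w)) - (LINT x|lborel. indicator K x * g x)\<bar> <= (e::real)"
proof -
 define e' where "e' = e / (2 * (C + 1))"
 have e': "0 < e'" using e C by (simp add: e'_def)
 obtain d where d: "0 < d" "!!w. norm w < d ==> vol {x : K. x + w ~: K} < e'"
  "!!w. norm w < d ==> vol {x. x + w : K & x ~: K} < e'" using compact_translate_small[OF K e'] by blast
 have [measurable]: "K : sets borel" using K by (simp add: borel_compact)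
 show ?thesis
 proof (rule that[OF d(1)])
  fix w :: 'e and g :: "'e => real" assume w: "norm w < d" and g[measurable]: "g : borel_measurable borel" and b: "!!x. \<bar>g x\<bar> <= C"
  define A1 A2 where "A1 = {x : K. x + - w ~: K}" and "A2 = {x. x + - w : K & x ~: K}"
  have A[measurable]: "A1 : sets borel" "A2 : sets borel" unfolding A1_def A2_def by measurable
  have em: "vol A1 < e'" "vol A2 < e'" using d(2,3)[of "-w"] w unfolding A1_def A2_def by auto
  have mA: "measure lborel A1 <= e'" "measure lborel A2 <= e'" using em e' by (auto simp: measure_def intro!: enn2real_leI)
  have "(LINT x|lborel. indicator K x * g (x + w)) = (LINT x|lborel. indicator K (x + - w) * g x)"
  proof -
   have "(LINT x|lborel. indicator K (x + - w) * g x) = (LINT x|distr lborel borel ((+) w). indicator K (x + - w) * g x)"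
    by (simp add: lborel_distr_plus)
   also have "... = (LINT x|lborel. indicator K (w + x + - w) * g (w + x))" by (rule integral_distr) measurable
   finally show ?thesis by (simp add: add.commute)
  qed
  moreover have int1: "integrable lborel (%x. indicator K (x + - w) * g x)"
  proof -
   have "integrable lborel (%x. indicator ((%y. y + w) ` K) x * g x)" by (rule integrable_indicator_bounded[OF _ g b])
     (intro compact_continuous_image K continuous_intros)
   moreover have "indicator ((%y. y + w) ` K) x = (indicator K (x + - w) :: real)" for x
    by (auto simp: indicator_def image_iff) (metis add_diff_cancel_right' diff_add_cancel)
   ultimately show ?thesis by simp
  qed
  moreover have int2: "integrable lborel (%x. indicator K x * g x)" by (rule integrable_indicator_bounded[OF K g b])
  ultimately have "\<bar>(LINT x|lborel. indicator K x * g (x + w)) - (LINT x|lborel. indicator K x * g x)\<bar>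
    = \<bar>LINT x|lborel. indicator K (x + - w) * g x - indicator K x * g x\<bar>" by simp
  also have "... <= (LINT x|lborel. C * indicator A1 x + C * indicator A2 x)"
  proof (rule integral_abs_bound_integral)
   show "integrable lborel (%x. C * indicator A1 x + C * indicator A2 x :: real)"
    using em by (intro Bochner_Integration.integrable_add integrable_mult_right integrable_real_indicator)
     (auto intro: less_trans[OF _ ennreal_less_top])
   show "integrable lborel (%x. indicator K (x + - w) * g x - indicator K x * g x)" using int1 int2 by simp
   show "\<bar>indicator K (x + - w) * g x - indicator K x * g x\<bar> <= C * indicator A1 x + C * indicator A2 x" for x
    using b[of x] C by (auto simp: indicator_def A1_def A2_def)
  qed
  also have "... = C * measure lborel A1 + C * measure lborel A2" using em by (subst Bochner_Integration.integral_add)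
    (auto intro!: integrable_mult_right integrable_real_indicator intro: less_trans[OF _ ennreal_less_top])
  also have "... <= C * e' + C * e'" using mA C by (intro add_mono mult_left_mono) auto
  also have "... <= 2 * (C + 1) * e'" using C e' by (simp add: algebra_simps)
  also have "... = e" using C by (simp add: e'_def)
  finally show "\<bar>(LINT x|lborel. indicator K x * g (x + w)) - (LINT x|lborel. indicator K x * g x)\<bar> <= e" .
 qed
qed

locale real_lipschitz =
 fixes f :: "'e::euclidean_space => real" and L :: real
 assumes L0: "0 <= L" and lip: "\<bar>f x - f y\<bar> <= L * norm (x - y)"
begin

lemma continuous_f: "continuous_on S f" by (rule lipschitz_on_continuous_on[of L])
  (use lip L0 in "auto intro!: lipschitz_onI simp: dist_real_def dist_norm")

lemma borel_f [measurable]: "f : borel_measurable borel" by (intro borel_measurable_continuous_onI continuous_f)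

lemma dquot_bound: "0 < h ==> \<bar>dquot f v h x\<bar> <= L * norm v"
proof -
 assume h: "0 < h"
 have "\<bar>f (x + h *\<^sub>R v) - f x\<bar> <= L * norm (h *\<^sub>R v)" using lip[of "x + h *\<^sub>R v" x] by simp
 then show ?thesis using h by (simp add: dquot_def field_simps)
qed

lemma dquot_scaled_lip:
 "0 < h ==> 0 < h' ==> \<bar>h * dquot f v h x - h' * dquot f v h' x\<bar> <= L * norm v * \<bar>h - h'\<bar>"
proof -
 assume h: "0 < h" "0 < h'"
 have "h * dquot f v h x - h' * dquot f v h' x = f (x + h *\<^sub>R v) - f (x + h' *\<^sub>R v)" using h by (simp add: dquot_def)
 moreover have "\<bar>f (x + h *\<^sub>R v) - f (x + h' *\<^sub>R v)\<bar> <= L * norm ((h - h') *\<^sub>R v)"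
  using lip[of "x + h *\<^sub>R v" "x + h' *\<^sub>R v"] by (simp add: scaleR_diff_left)
 ultimately show ?thesis by (simp add: mult_ac)
qed

lemma borel_dquot [measurable]: "dquot f v h : borel_measurable borel" unfolding dquot_def by measurable

lemma borel_dderiv [measurable]: "dderiv f v : borel_measurable borel" unfolding dderiv_def by measurable

definition dgood :: "'e => 'e => bool" where
 "dgood v x \<longleftrightarrow> convergent (%n. dquot f v (1 / Suc n) x)"

lemma dgood_seq: "dgood v x ==> (%n. dquot f v (1 / Suc n) x) \<longlonglongrightarrow> dderiv f v x"
 unfolding dgood_def dderiv_def by (simp add: convergent_LIMSEQ_iff)

lemma dgood_tendsto:
 "dgood v x ==> ((%h. dquot f v h x) \<longlongrightarrow> dderiv f v x) (at_right 0)"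
 by (rule seq_to_right_limit[OF dquot_bound dquot_scaled_lip dgood_seq])

lemma dgoodI: "((%h. dquot f v h x) \<longlongrightarrow> D) (at_right 0) ==> dgood v x"
 unfolding dgood_def
proof (rule convergentI)
 assume D: "((%h. dquot f v h x) \<longlongrightarrow> D) (at_right 0)"
 have "filterlim (%n. 1 / real (Suc n)) (at_right 0) sequentially"
  unfolding filterlim_at using LIMSEQ_inverse_real_of_nat by (auto simp: inverse_eq_divide)
 from filterlim_compose[OF D this] show "(%n. dquot f v (1 / Suc n) x) \<longlonglongrightarrow> D" by simp
qed

text \<open>On each line in direction \<open>v\<close> the bad parameters are null by the
  one-dimensional result. Averaging the measure of the bad set over its translates by
  \<open>t v\<close> with \<open>t\<close> in [0, 1] turns this into a statement about volume,
  without coordinates adapted to \<open>v\<close>.\<close>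

lemma dgood_AE: "AE x in lborel. dgood v x"
proof -
 define B where "B = {x. ~ dgood v x}"
 have "{x : space borel. Cauchy (%n. dquot f v (1 / Suc n) x)} : sets borel" by (rule sets_Collect_Cauchy) measurable
 then have "- {x. Cauchy (%n. dquot f v (1 / Suc n) x)} : sets borel" by auto
 moreover have "B = - {x. Cauchy (%n. dquot f v (1 / Suc n) x)}" by (auto simp: B_def dgood_def Cauchy_convergent_iff)
 ultimately have B[measurable]: "B : sets borel" by simp
 have line: "(\<integral>\<^sup>+t. indicator {0..1} t * indicator B (x + t *\<^sub>R v) \<partial>(lborel :: real measure)) = 0" for x
 proof -
  have "AE t in lborel. EX D. ((%h. (f (x + (t + h) *\<^sub>R v) - f (x + t *\<^sub>R v)) / h) \<longlongrightarrow> D) (at_right 0)"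
  proof (rule lipschitz_right_derivative_AE[where L = "L * norm v"])
   show "\<bar>f (x + s *\<^sub>R v) - f (x + t *\<^sub>R v)\<bar> <= L * norm v * \<bar>s - t\<bar>" for s t
    using lip[of "x + s *\<^sub>R v" "x + t *\<^sub>R v"] by (simp add: scaleR_diff_left[symmetric] mult_ac)
  qed
  then have "AE t in lborel. x + t *\<^sub>R v ~: B"
  proof eventually_elim
   case (elim t)
   have "(f (x + (t + h) *\<^sub>R v) - f (x + t *\<^sub>R v)) / h = dquot f v h (x + t *\<^sub>R v)" for h
    by (simp add: dquot_def scaleR_add_left add.assoc)
   then show ?case using elim dgoodI[of v "x + t *\<^sub>R v"] by (auto simp: B_def)
  qed
  then have "AE t in lborel. indicator {0..1} t * indicator B (x + t *\<^sub>R v) = (0::ennreal)" by eventually_elim (auto simp: indicator_def)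
  then have "(\<integral>\<^sup>+t. indicator {0..1} t * indicator B (x + t *\<^sub>R v) \<partial>(lborel :: real measure))
   = (\<integral>\<^sup>+t. 0 \<partial>(lborel :: real measure))" by (intro nn_integral_cong_AE)
  then show ?thesis by simp
 qed
 have "vol B = (\<integral>\<^sup>+t. indicator {0..1} t * vol B \<partial>(lborel :: real measure))" by (simp add: nn_integral_multc)
 also have "... = (\<integral>\<^sup>+t. (lint (%x. indicator {0..1} t * indicator B (x + t *\<^sub>R v))) \<partial>(lborel :: real measure))"
 proof (intro nn_integral_cong)
  fix t :: real
  have "lint (%x. indicator {0..1} t * indicator B (x + t *\<^sub>R v))
   = indicator {0..1} t * lint (%x. indicator B (x + t *\<^sub>R v))" by (intro nn_integral_cmult) measurable
  also have "lint (%x. indicator B (x + t *\<^sub>R v)) = lint (indicator B)" by (rule nn_integral_lborel_translate[of "indicator B"]) measurable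
  finally show "indicator {0..1} t * vol B = lint (%x. indicator {0..1} t * indicator B (x + t *\<^sub>R v))" by simp
 qed
 also have "... = lint (%x. (\<integral>\<^sup>+t. indicator {0..1} t * indicator B (x + t *\<^sub>R v) \<partial>(lborel :: real measure)))"
  by (rule lborel_pair.Fubini') measurable
 also have "... = 0" using line by simp
 finally have "B : null_sets lborel" by (intro null_setsI) auto
 then show ?thesis by (rule AE_I') (auto simp: B_def)
qed

lemma dderiv_bound: "dgood v x ==> \<bar>dderiv f v x\<bar> <= L * norm v"
 by (rule LIMSEQ_le_const2[OF tendsto_rabs[OF dgood_seq]]) (auto intro!: dquot_bound)

text \<open>Where the quotients diverge, \<open>dderiv\<close> is arbitrary; clipping makes it
  bounded everywhere without changing it at good points.\<close>

definition dclip :: "'e => 'e => real" where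
 "dclip v x = max (- (L * norm v)) (min (L * norm v) (dderiv f v x))"

lemma borel_dclip [measurable]: "dclip v : borel_measurable borel" unfolding dclip_def by measurable

lemma dclip_bound: "\<bar>dclip v x\<bar> <= L * norm v" using L0 by (auto simp: dclip_def min_def max_def abs_le_iff)

lemma dclip_good: "dgood v x ==> dclip v x = dderiv f v x" using dderiv_bound[of v x] by (auto simp: dclip_def min_def max_def abs_le_iff)

lemma dquot_integral_tendsto:
 assumes K: "compact K"
 shows "(%n. LINT x|lborel. indicator K x * dquot f v (1 / Suc n) x) \<longlonglongrightarrow> (LINT x|lborel. indicator K x * dclip v x)"
proof (rule integral_dominated_convergence)
 have [measurable]: "K : sets borel" using K by (simp add: borel_compact)
 show "(%x. indicator K x * dclip v x) : borel_measurable lborel" by measurable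
 show "(%x. indicator K x * dquot f v (1 / Suc n) x) : borel_measurable lborel" for n by measurable
 show "integrable lborel (%x. indicator K x * (L * norm v))" by (rule integrable_indicator_bounded[OF K _ order_refl]) measurable
 show "AE x in lborel. (%n. indicator K x * dquot f v (1 / Suc n) x) \<longlonglongrightarrow> indicator K x * dclip v x"
  using dgood_AE[of v] by eventually_elim (auto intro!: tendsto_intros dgood_seq simp: dclip_good simp del: of_nat_Suc)
 show "AE x in lborel. norm (indicator K x * dquot f v (1 / Suc n) x) <= indicator K x * (L * norm v)" for n
  by (intro AE_I2) (auto simp: indicator_def intro!: dquot_bound)
qed

text \<open>The quotient along \<open>u + v\<close> is exactly the quotient along \<open>u\<close>
  plus that along \<open>v\<close> at the point shifted by \<open>h u\<close>. Under an integral
  over a compact set this shift disappears in the limit, although it cannot be removed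
  pointwise.\<close>

lemma dclip_add_integral:
 assumes K: "compact K"
 shows "(LINT x|lborel. indicator K x * (dclip (u + v) x - dclip u x - dclip v x)) = 0"
proof -
 define I where "I g = (LINT x|lborel. indicator K x * g x)" for g :: "'e => real"
 have int: "integrable lborel (%x. indicator K x * dclip w x)" for w by (rule integrable_indicator_bounded[OF K borel_dclip dclip_bound])
 have iq: "integrable lborel (%x. indicator K x * dquot f w (1 / Suc n) (x + y))" for w n y
  by (rule integrable_indicator_bounded[OF K]) (measurable, rule dquot_bound, simp)
 have iq': "integrable lborel (%x. indicator K x * dquot f w (1 / Suc n) x)" for w n using iq[of w n 0] by simp
 have eq: "I (dquot f (u + v) (1 / Suc n)) = I (%x. dquot f v (1 / Suc n) (x + (1 / Suc n) *\<^sub>R u)) + I (dquot f u (1 / Suc n))" for n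
 proof -
  have "dquot f (u + v) h x = dquot f v h (x + h *\<^sub>R u) + dquot f u h x" for h x
   by (simp add: dquot_def scaleR_add_right add.assoc diff_divide_distrib)
  then have "I (dquot f (u + v) (1 / Suc n)) = (LINT x|lborel. indicator K x * dquot f v (1 / Suc n) (x + (1 / Suc n) *\<^sub>R u)
    + indicator K x * dquot f u (1 / Suc n) x)" by (simp add: I_def distrib_left)
  also have "... = I (%x. dquot f v (1 / Suc n) (x + (1 / Suc n) *\<^sub>R u)) + I (dquot f u (1 / Suc n))"
   unfolding I_def by (rule Bochner_Integration.integral_add[OF iq iq'])
  finally show ?thesis .
 qed
 have lim: "(%n. I (dquot f w (1 / Suc n))) \<longlonglongrightarrow> I (dclip w)" for w unfolding I_def by (rule dquot_integral_tendsto[OF K])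
 have shift: "(%n. I (%x. dquot f v (1 / Suc n) (x + (1 / Suc n) *\<^sub>R u)) - I (dquot f v (1 / Suc n))) \<longlonglongrightarrow> 0"
  unfolding tendsto_iff
 proof (intro allI impI)
  fix e :: real assume e: "0 < e"
  have Lv: "0 <= L * norm v" using L0 by simp
  have e2: "0 < e/2" using e by simp
  obtain d where d: "0 < d" "!!w (g :: 'e => real). norm w < d ==> g : borel_measurable borel ==> (!!x. \<bar>g x\<bar> <= L * norm v) ==>
   \<bar>(LINT x|lborel. indicator K x * g (x + w)) - (LINT x|lborel. indicator K x * g x)\<bar> <= e/2"
   by (rule compact_integral_shift_small[OF K e2 Lv]) blast
  have "(%n. norm ((1 / real (Suc n)) *\<^sub>R u)) \<longlonglongrightarrow> norm (0 *\<^sub>R u)"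
   using LIMSEQ_inverse_real_of_nat by (intro tendsto_intros) (simp add: inverse_eq_divide)
  then have "\<forall>\<^sub>F n in sequentially. norm ((1 / real (Suc n)) *\<^sub>R u) < d" by (rule order_tendstoD) (use d in simp)
  then show "\<forall>\<^sub>F n in sequentially. dist (I (%x. dquot f v (1 / Suc n) (x + (1 / Suc n) *\<^sub>R u)) - I (dquot f v (1 / Suc n))) 0 < e"
  proof eventually_elim
   case (elim n)
   have "\<bar>I (%x. dquot f v (1 / Suc n) (x + (1 / Suc n) *\<^sub>R u)) - I (dquot f v (1 / Suc n))\<bar> <= e/2"
    unfolding I_def by (rule d(2)[OF elim]) (measurable, rule dquot_bound, simp)
   then show ?case using e by simp
  qed
 qed
 have "(%n. I (dquot f (u + v) (1 / Suc n))) \<longlonglongrightarrow> 0 + I (dclip v) + I (dclip u)"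
  using tendsto_add[OF tendsto_add[OF shift lim[of v]] lim[of u]] by (simp add: eq del: of_nat_Suc)
 then have "I (dclip (u + v)) = I (dclip v) + I (dclip u)" using lim[of "u + v"] LIMSEQ_unique by auto
 moreover have "(LINT x|lborel. indicator K x * (dclip (u + v) x - dclip u x - dclip v x))
   = I (dclip (u + v)) - I (dclip u) - I (dclip v)" unfolding I_def using int by (simp add: right_diff_distrib)
 ultimately show ?thesis by simp
qed

lemma dderiv_add_AE: "AE x in lborel. dderiv f (u + v) x = dderiv f u x + dderiv f v x"
proof -
 define W where "W x = dclip (u + v) x - dclip u x - dclip v x" for x
 have [measurable]: "W : borel_measurable borel" unfolding W_def by measurable
 have b: "\<bar>W x\<bar> <= L * norm (u + v) + L * norm u + L * norm v" for x
  unfolding W_def using dclip_bound[of "u + v" x] dclip_bound[of u x] dclip_bound[of v x] by linarith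
 have "AE x in lborel. 0 <= W x" by (rule nonneg_AE_of_compact_integrals[OF _ b]) (auto simp: W_def dclip_add_integral)
 moreover have "AE x in lborel. 0 <= - W x"
 proof (rule nonneg_AE_of_compact_integrals[where C = "L * norm (u + v) + L * norm u + L * norm v"])
  fix K :: "'e set" assume "compact K"
  then have "(LINT x|lborel. indicator K x * W x) = 0" using dclip_add_integral[of K u v] by (simp only: W_def)
  moreover have "(LINT x|lborel. indicator K x * - W x) = - (LINT x|lborel. indicator K x * W x)" unfolding mult_minus_right by (rule integral_minus)
  ultimately show "0 <= (LINT x|lborel. indicator K x * - W x)" by linarith
 qed (use b in auto)
 ultimately show ?thesis using dgood_AE[of "u + v"] dgood_AE[of u] dgood_AE[of v] by eventually_elim (simp add: W_def dclip_good)
qed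

lemma dgood_scale:
 assumes "dgood v x" "0 <= c"
 shows "dgood (c *\<^sub>R v) x" "dderiv f (c *\<^sub>R v) x = c * dderiv f v x"
proof -
 have "((%h. dquot f (c *\<^sub>R v) h x) \<longlongrightarrow> c * dderiv f v x) (at_right 0)"
 proof (cases "c = 0")
  case True
  then show ?thesis by (simp add: dquot_def)
 next
  case False
  then have c: "0 < c" using assms by simp
  have "filterlim (%h. c * h) (at_right 0) (at_right 0)"
   using c by (intro filterlim_times_pos[of "%x. x" 0 "at_right 0" c 0]) (auto intro: filterlim_ident)
  from filterlim_compose[OF dgood_tendsto[OF assms(1)] this]
  have "((%h. c * dquot f v (c * h) x) \<longlongrightarrow> c * dderiv f v x) (at_right 0)" by (intro tendsto_intros)
  moreover have "c * dquot f v (c * h) x = dquot f (c *\<^sub>R v) h x" for h using c by (simp add: dquot_def mult.commute)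
  ultimately show ?thesis by simp
 qed
 then show g: "dgood (c *\<^sub>R v) x" by (rule dgoodI)
 show "dderiv f (c *\<^sub>R v) x = c * dderiv f v x"
  using tendsto_unique[OF _ dgood_tendsto[OF g]] \<open>((%h. dquot f (c *\<^sub>R v) h x) \<longlongrightarrow> c * dderiv f v x) (at_right 0)\<close>
  by simp
qed

text \<open>Countably many directions, dense and closed under addition, so one null set serves for
  all of them.\<close>

definition rat_vecs :: "'e set" where
 "rat_vecs = (%r. SUM b:Basis. real_of_rat (r b) *\<^sub>R b) ` (Basis \<rightarrow>\<^sub>E UNIV)"

lemma countable_rat_vecs: "countable rat_vecs" unfolding rat_vecs_def by (intro countable_image countable_PiE) auto

lemma rat_vecsI: "(SUM b:Basis. real_of_rat (r b) *\<^sub>R b) : rat_vecs" unfolding rat_vecs_def by (rule image_eqI[of _ _ "restrict r Basis"]) auto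

lemma dderiv_rat_linear:
 assumes good: "!!v. v : rat_vecs ==> dgood v x"
  and add: "!!u v. u : rat_vecs ==> v : rat_vecs ==> dderiv f (u + v) x = dderiv f u x + dderiv f v x"
  and v: "v : rat_vecs"
 shows "dderiv f v x = v \<bullet> (SUM b:Basis. dderiv f b x *\<^sub>R b)"
proof -
 obtain r where r: "v = (SUM b:Basis. real_of_rat (r b) *\<^sub>R b)" using v by (auto simp: rat_vecs_def)
 have in_rat: "(SUM b:S. real_of_rat (s b) *\<^sub>R b) : rat_vecs" if "S \<subseteq> Basis" for S and s :: "'e => rat"
 proof -
  have "(SUM b:Basis. real_of_rat (if b : S then s b else 0) *\<^sub>R b) = (SUM b:S. real_of_rat (s b) *\<^sub>R b)"
   using that by (intro sum.mono_neutral_cong_right) auto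
  then show ?thesis using rat_vecsI[of "%b. if b : S then s b else 0"] by simp
 qed
 have one: "real_of_rat c *\<^sub>R b : rat_vecs" if "b : Basis" for b c using in_rat[of "{b}" "%_. c"] that by simp
 have zero: "dderiv f 0 x = 0" using add[of 0 0] in_rat[of "{}"] by simp
 have scale: "dderiv f (real_of_rat c *\<^sub>R b) x = real_of_rat c * dderiv f b x" if b: "b : Basis" for b c
 proof (cases "0 <= c")
  case True
  then show ?thesis using dgood_scale(2)[of b x "real_of_rat c"] good[OF one[OF b, of 1]] by simp
 next
  case False
  \<comment> \<open>Quotients are one-sided, so \<open>dgood_scale\<close> covers factors
    \<open>c \<ge> 0\<close> only; negative ones follow from additivity applied to a vector and its
    negative.\<close>
  have "dderiv f (real_of_rat (-c) *\<^sub>R b) x = real_of_rat (-c) * dderiv f b x"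
   using dgood_scale(2)[of b x "real_of_rat (-c)"] good[OF one[OF b, of 1]] False by simp
  moreover have "dderiv f (real_of_rat c *\<^sub>R b + real_of_rat (-c) *\<^sub>R b) x
    = dderiv f (real_of_rat c *\<^sub>R b) x + dderiv f (real_of_rat (-c) *\<^sub>R b) x" by (rule add[OF one[OF b] one[OF b]])
  ultimately show ?thesis using zero by (simp add: of_rat_minus)
 qed
 have "dderiv f (SUM b:S. real_of_rat (r b) *\<^sub>R b) x = (SUM b:S. real_of_rat (r b) * dderiv f b x)" if "S \<subseteq> Basis" for S
  using finite_subset[OF that finite_Basis] that
 proof (induction S rule: finite_induct)
  case empty
  then show ?case using zero by simp
 next
  case (insert b S)
  then show ?case using add[OF one[of b "r b"] in_rat[of S r]] scale by simp
 qed
 from this[OF order_refl] have "dderiv f v x = (SUM b:Basis. real_of_rat (r b) * dderiv f b x)" by (simp add: r)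
 also have "... = (SUM b:Basis. dderiv f b x * (v \<bullet> b))" by (intro sum.cong refl) (simp add: r inner_sum_left_Basis)
 finally show ?thesis by (simp add: inner_sum_right)
qed

lemma rat_vecs_dense: "0 < e ==> EX w:rat_vecs. norm (v - w) < e"
proof -
 assume e: "0 < e"
 define \<epsilon> where "\<epsilon> = e / real DIM('e)"
 have \<epsilon>: "0 < \<epsilon>" using e by (simp add: \<epsilon>_def)
 have "EX q. \<bar>v \<bullet> b - real_of_rat q\<bar> < \<epsilon>" for b
 proof -
  obtain q where "v \<bullet> b < real_of_rat q" "real_of_rat q < v \<bullet> b + \<epsilon>"
   using of_rat_dense[of "v \<bullet> b" "v \<bullet> b + \<epsilon>"] \<epsilon> by auto
  then show ?thesis by (intro exI[of _ q]) simp
 qed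
 then obtain r where r: "!!b. \<bar>v \<bullet> b - real_of_rat (r b)\<bar> < \<epsilon>" by metis
 have "norm (v - (SUM b:Basis. real_of_rat (r b) *\<^sub>R b)) <= (SUM b:Basis. \<bar>(v - (SUM b:Basis. real_of_rat (r b) *\<^sub>R b)) \<bullet> b\<bar>)"
  by (rule norm_le_l1)
 also have "... = (SUM b:(Basis::'e set). \<bar>v \<bullet> b - real_of_rat (r b)\<bar>)" by (intro sum.cong refl) (simp add: inner_diff_left)
 also have "... < (SUM b:(Basis::'e set). \<epsilon>)" by (intro sum_strict_mono r) auto
 also have "... = e" by (simp add: \<epsilon>_def)
 finally show ?thesis using rat_vecsI by blast
qed

text \<open>Convergence in finitely many rational directions that are \<eta>-dense on the unit
  sphere is uniform, and the Lipschitz bound transfers it to all directions.\<close>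

lemma has_derivative_of_rat_directions:
 assumes good: "!!v. v : rat_vecs ==> dgood v x"
  and lin: "!!v. v : rat_vecs ==> dderiv f v x = v \<bullet> G"
 shows "(f has_derivative (%v. v \<bullet> G)) (at x)"
 unfolding has_derivative_within_alt
proof (intro conjI allI impI)
 show "bounded_linear (%v. v \<bullet> G)" by (rule bounded_linear_inner_left)
 fix e :: real assume e: "0 < e"
 define M where "M = L + norm G + 1"
 \<comment> \<open>Replacing a direction by one at distance \<eta> costs \<eta> L in the function
   and \<eta> |G| in the linear map; both together stay below e/2.\<close>
 define \<eta> where "\<eta> = e / (2 * M)"
 have LG: "0 < M" using L0 by (simp add: M_def add_nonneg_pos)
 have \<eta>: "0 < \<eta>" "\<eta> * (L + norm G) < e/2"
 proof -
  show "0 < \<eta>" using e LG by (simp add: \<eta>_def)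
  have "\<eta> * M = e/2" using LG by (simp add: \<eta>_def)
  then show "\<eta> * (L + norm G) < e/2" using \<open>0 < \<eta>\<close> by (simp add: M_def algebra_simps)
 qed
 have "sphere 0 1 \<subseteq> (\<Union>w\<in>rat_vecs. ball w \<eta>)" using rat_vecs_dense[OF \<eta>(1)] by (auto simp: dist_norm norm_minus_commute)
 then obtain T where T: "T \<subseteq> rat_vecs" "finite T" "sphere 0 1 \<subseteq> (\<Union>w\<in>T. ball w \<eta>)"
  using compactE_image[OF compact_sphere, of rat_vecs "%w. ball w \<eta>" 0 1] by auto
 have "ALL w:T. \<forall>\<^sub>F h in at_right 0. \<bar>dquot f w h x - w \<bullet> G\<bar> < e/2"
 proof
  fix w assume "w : T"
  then have w: "w : rat_vecs" using T by blast
  have "((%h. dquot f w h x) \<longlongrightarrow> w \<bullet> G) (at_right 0)" using dgood_tendsto[OF good[OF w]] lin[OF w] by simp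
  from tendstoD[OF this, of "e/2"] show "\<forall>\<^sub>F h in at_right 0. \<bar>dquot f w h x - w \<bullet> G\<bar> < e/2"
   using e unfolding dist_real_def by simp
 qed
 then have "\<forall>\<^sub>F h in at_right 0. ALL w:T. \<bar>dquot f w h x - w \<bullet> G\<bar> < e/2"
  using T(2) by (simp add: eventually_ball_finite)
 then obtain d where d: "0 < d" "!!h w. 0 < h ==> h < d ==> w : T ==> \<bar>dquot f w h x - w \<bullet> G\<bar> < e/2"
  by (auto simp: eventually_at_right_field)
 show "\<exists>d>0. ALL y:UNIV. norm (y - x) < d --> norm (f y - f x - (y - x) \<bullet> G) <= e * norm (y - x)"
 proof (intro exI[of _ d] conjI ballI impI d(1))
  fix y assume y: "norm (y - x) < d"
  show "norm (f y - f x - (y - x) \<bullet> G) <= e * norm (y - x)"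
  proof (cases "y = x")
   case False
   define h v where "h = norm (y - x)" and "v = (y - x) /\<^sub>R norm (y - x)"
   have h: "0 < h" "h < d" using False y by (auto simp: h_def)
   have yv: "y = x + h *\<^sub>R v" using False by (simp add: h_def v_def)
   have "v : sphere 0 1" using False by (simp add: v_def)
   then obtain w where w: "w : T" "norm (v - w) < \<eta>" using T(3) by (auto simp: dist_norm norm_minus_commute subset_iff)
   have 1: "\<bar>f (x + h *\<^sub>R w) - f x - h * (w \<bullet> G)\<bar> <= h * (e/2)"
   proof -
    have "f (x + h *\<^sub>R w) - f x - h * (w \<bullet> G) = h * (dquot f w h x - w \<bullet> G)" using h by (simp add: dquot_def field_simps)
    then show ?thesis using d(2)[OF h w(1)] h by (simp add: abs_mult)
   qed
   have 2: "\<bar>f (x + h *\<^sub>R v) - f (x + h *\<^sub>R w)\<bar> <= h * (L * \<eta>)"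
   proof -
    have "\<bar>f (x + h *\<^sub>R v) - f (x + h *\<^sub>R w)\<bar> <= L * norm (h *\<^sub>R (v - w))"
     using lip[of "x + h *\<^sub>R v" "x + h *\<^sub>R w"] by (simp add: scaleR_diff_right)
    also have "... = h * (L * norm (v - w))" using h by simp
    also have "... <= h * (L * \<eta>)" using w h L0 by (intro mult_left_mono) auto
    finally show ?thesis .
   qed
   have 3: "\<bar>h * (w \<bullet> G) - h * (v \<bullet> G)\<bar> <= h * (\<eta> * norm G)"
   proof -
    have "\<bar>(w - v) \<bullet> G\<bar> <= norm (w - v) * norm G" by (rule Cauchy_Schwarz_ineq2)
    also have "... <= \<eta> * norm G" using w(2) by (intro mult_right_mono) (auto simp: norm_minus_commute)
    finally show ?thesis using h by (simp add: inner_diff_left right_diff_distrib[symmetric] abs_mult)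
   qed
   have "\<bar>f y - f x - h * (v \<bullet> G)\<bar> <= h * (e/2) + h * (L * \<eta>) + h * (\<eta> * norm G)" unfolding yv using 1 2 3 by linarith
   also have "... = h * (e/2 + \<eta> * (L + norm G))" by (simp add: algebra_simps)
   also have "... <= h * e" using \<eta>(2) h by (intro mult_left_mono) auto
   finally have "\<bar>f y - f x - h * (v \<bullet> G)\<bar> <= e * h" by (simp add: mult.commute)
   moreover have "(y - x) \<bullet> G = h * (v \<bullet> G)" by (simp add: yv)
   ultimately show ?thesis by (simp add: h_def)
  qed simp
 qed
qed

theorem rademacher_real: "AE x in lborel. EX G. (f has_derivative (%v. v \<bullet> G)) (at x)"
proof -
 have "AE x in lborel. ALL v:rat_vecs. dgood v x" by (subst AE_ball_countable[OF countable_rat_vecs]) (use dgood_AE in auto)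
 moreover have "AE x in lborel. ALL u:rat_vecs. ALL v:rat_vecs. dderiv f (u + v) x = dderiv f u x + dderiv f v x"
  by (simp add: AE_ball_countable countable_rat_vecs dderiv_add_AE)
 ultimately show ?thesis
 proof eventually_elim
  case (elim x)
  then show ?case using has_derivative_of_rat_directions[of x, OF _ dderiv_rat_linear[of x]] by blast
 qed
qed

end

theorem rademacher:
 fixes f :: "'e::euclidean_space => 'w::euclidean_space"
 assumes "!!x y. norm (f x - f y) <= L * norm (x - y)" "0 <= L"
 shows "AE x in lborel. f differentiable (at x)"
proof -
 have "AE x in lborel. ALL b:(Basis::'w set). (%y. f y \<bullet> b) differentiable (at x)"
 proof (rule AE_finite_allI[OF finite_Basis])
  fix b :: 'w assume b: "b : Basis"
  interpret real_lipschitz "%x. f x \<bullet> b" L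
  proof
   show "\<bar>f x \<bullet> b - f y \<bullet> b\<bar> <= L * norm (x - y)" for x y
    using assms(1)[of x y] Basis_le_norm[OF b, of "f x - f y"] by (simp add: inner_diff_left)
  qed (rule assms)
  show "AE x in lborel. (%y. f y \<bullet> b) differentiable (at x)" using rademacher_real by eventually_elim (auto simp: differentiable_def)
 qed
 then show ?thesis by eventually_elim (simp add: differentiable_componentwise_within[of f])
qed

section \<open>Maps into an orbit space: density points and differentiability\<close>

lemma dens0_local:
 assumes T: "dens0 T x" "T : sets borel" and "0 < r0" "S Int ball x r0 \<subseteq> T"
 shows "dens0 S x"
 unfolding dens0_def
proof (rule tendsto_sandwich[OF _ _ tendsto_const T(1)[unfolded dens0_def]])
 show "\<forall>\<^sub>F r in at_right 0. 0 <= measure lborel (S Int ball x r) / measure lborel (ball x r)" by simp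
 have le: "measure lborel (S Int ball x r) <= measure lborel (T Int ball x r)" if "r < r0" for r
 proof (cases "S Int ball x r : sets lborel")
  case True
  have "vol (T Int ball x r) <= vol (ball x r)" by (intro emeasure_mono) auto
  then have "T Int ball x r : fmeasurable lborel" using T(2) emeasure_lborel_ball_finite[of x r] by (auto simp: fmeasurable_def intro: le_less_trans)
  moreover have "S Int ball x r \<subseteq> T Int ball x r" using assms(4) that by auto
  ultimately show ?thesis using True by (intro measure_mono_fmeasurable)
 next
  case False
  then show ?thesis by (simp add: measure_notin_sets)
 qed
 have "\<forall>\<^sub>F r in at_right 0. r < r0" using assms(3) by (auto simp: eventually_at_right_field)
 then show "\<forall>\<^sub>F r in at_right 0. measure lborel (S Int ball x r) / measure lborel (ball x r)
   <= measure lborel (T Int ball x r) / measure lborel (ball x r)" by eventually_elim (intro divide_right_mono le, auto)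
qed

lemma dens0_Un:
 assumes "dens0 S x" "dens0 T x" "S : sets borel" "T : sets borel"
 shows "dens0 (S Un T) x"
 unfolding dens0_def
proof (rule tendsto_sandwich[OF _ _ tendsto_const])
 show "\<forall>\<^sub>F r in at_right 0. 0 <= measure lborel ((S Un T) Int ball x r) / measure lborel (ball x r)" by simp
 have fm: "A Int ball x r : fmeasurable lborel" if "A : sets borel" for A r
 proof -
  have "vol (A Int ball x r) <= vol (ball x r)" by (intro emeasure_mono) auto
  then show ?thesis using that emeasure_lborel_ball_finite[of x r] by (auto simp: fmeasurable_def intro: le_less_trans)
 qed
 have "measure lborel ((S Un T) Int ball x r) <= measure lborel (S Int ball x r) + measure lborel (T Int ball x r)" for r
  unfolding Int_Un_distrib2 by (rule measure_Un_le) (use fm assms in auto)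
 then show "\<forall>\<^sub>F r in at_right 0. measure lborel ((S Un T) Int ball x r) / measure lborel (ball x r)
  <= measure lborel (S Int ball x r) / measure lborel (ball x r) + measure lborel (T Int ball x r) / measure lborel (ball x r)"
  by (intro always_eventually allI) (simp add: add_divide_distrib[symmetric] divide_right_mono)
 show "((%r. measure lborel (S Int ball x r) / measure lborel (ball x r)
   + measure lborel (T Int ball x r) / measure lborel (ball x r)) \<longlongrightarrow> 0) (at_right 0)"
  using tendsto_add[OF assms(1,2)[unfolded dens0_def]] by simp
qed

lemma measure_ball_ratio:
 "0 < r ==> 0 < s ==> measure lborel (ball (x::'e::euclidean_space) (s * r)) = s ^ DIM('e) * measure lborel (ball (y::'e) r)"
proof -
 assume "0 < r" "0 < s"
 then have "measure lborel (ball x (s * r)) = unit_ball_vol DIM('e) * (s * r) ^ DIM('e)"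
  "measure lborel (ball y r) = unit_ball_vol DIM('e) * r ^ DIM('e)"
  by (auto simp: content_ball measure_completion intro!: content_ball[symmetric, THEN sym])
 then show ?thesis by (simp add: power_mult_distrib)
qed

text \<open>If the ball around \<open>x + z\<close> lay inside \<open>S\<close>, then
  \<open>S\<close> would occupy a fixed fraction of the ball of radius 2 |z| around
  \<open>x\<close>.\<close>

lemma dens0_near:
 fixes x :: "'e::euclidean_space"
 assumes S: "dens0 S x" "S : sets borel" and e: "0 < e"
 obtains d where "0 < d" "!!z. norm z < d ==> z ~= 0 ==> EX q. q ~: S & norm (q - (x + z)) < e * norm z"
proof -
 define e' where "e' = min e 1"
 have e': "0 < e'" "e' <= 1" "e' <= e" using e by (auto simp: e'_def)
 \<comment> \<open>The volume ratio of a ball of radius \<open>e' * norm z\<close> to one of radius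
   \<open>2 * norm z\<close>.\<close>
 define c where "c = (e' / 2) ^ DIM('e)"
 have "\<forall>\<^sub>F r in at_right 0. measure lborel (S Int ball x r) / measure lborel (ball x r) < c"
  by (rule order_tendstoD(2)[OF S(1)[unfolded dens0_def]]) (use e' in "simp add: c_def")
 then obtain d where d: "0 < d" "!!r. 0 < r ==> r < d ==> measure lborel (S Int ball x r) / measure lborel (ball x r) < c"
  by (auto simp: eventually_at_right_field)
 show ?thesis
 proof (rule that[of "d / 2"])
  show "0 < d / 2" using d by simp
  fix z :: 'e assume z: "norm z < d / 2" "z ~= 0"
  define r where "r = 2 * norm z"
  have r: "0 < r" "r < d" using z by (auto simp: r_def)
  show "EX q. q ~: S & norm (q - (x + z)) < e * norm z"
  proof (rule ccontr)
   assume "~ ?thesis"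
   then have sub: "ball (x + z) (e' / 2 * r) \<subseteq> S"
   proof -
    have "q : S" if "q : ball (x + z) (e' / 2 * r)" for q
    proof -
     have "norm (q - (x + z)) < e' * norm z" using that by (simp add: dist_norm norm_minus_commute r_def)
     also have "... <= e * norm z" using e' by (intro mult_right_mono) auto
     finally show ?thesis using \<open>~ (EX q. q ~: S & norm (q - (x + z)) < e * norm z)\<close> by blast
    qed
    then show ?thesis by blast
   qed
   have "ball (x + z) (e' / 2 * r) \<subseteq> ball x r"
   proof
    fix q assume "q : ball (x + z) (e' / 2 * r)"
    then have "norm (q - (x + z)) < e' * norm z" by (simp add: dist_norm norm_minus_commute r_def)
    also have "... <= 1 * norm z" using e' by (intro mult_right_mono) auto
    finally have "norm (q - (x + z)) < norm z" by simp
    moreover have "norm (q - x) <= norm (q - (x + z)) + norm z" using norm_triangle_ineq[of "q - (x + z)" z] by simp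
    ultimately show "q : ball x r" by (simp add: r_def dist_norm norm_minus_commute)
   qed
   then have "ball (x + z) (e' / 2 * r) \<subseteq> S Int ball x r" using sub by blast
   moreover have "S Int ball x r : fmeasurable lborel"
   proof -
    have "vol (S Int ball x r) <= vol (ball x r)" by (intro emeasure_mono) auto
    then show ?thesis using S(2) emeasure_lborel_ball_finite[of x r] by (auto simp: fmeasurable_def intro: le_less_trans)
   qed
   ultimately have "measure lborel (ball (x + z) (e' / 2 * r)) <= measure lborel (S Int ball x r)" by (intro measure_mono_fmeasurable) auto
   then have "c * measure lborel (ball x r) <= measure lborel (S Int ball x r)"
    using measure_ball_ratio[of r "e' / 2" "x + z" x] r e' by (simp add: c_def)
   moreover have "0 < measure lborel (ball x r)" using r by (simp add: content_ball_pos)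
   ultimately show False using d(2)[OF r] by (simp add: field_simps)
  qed
 qed
qed

text \<open>The quotient map stays abstract; permutations of tuples enter only when
  \<open>orbit_space_vtuple\<close> instantiates it.\<close>

locale orbit_space = isogroup H for H :: "('w::euclidean_space => 'w) set" +
 fixes \<pi> :: "'w => 'z::metric_space"
 assumes dist_pi: "dist (\<pi> x) (\<pi> y) = odist H x y" and surj_pi: "surj \<pi>"
begin

lemma dist_pi_le: "dist (\<pi> x) (\<pi> y) <= norm (x - y)" by (simp add: dist_pi odist_le_norm)

lemma pi_h [simp]: "h : H ==> \<pi> (h x) = \<pi> x" using dist_pi[of "h x" x] odist_orbit0 by (simp del: odist_left)

lemma pi_eqD: "\<pi> x = \<pi> y ==> EX h:H. x = h y" using dist_pi[of x y] odist_zeroD[of x y] by simp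

lemma lift_near: obtains w where "\<pi> w = z" "norm (w - w0) = dist z (\<pi> w0)"
proof -
 obtain u where u: "z = \<pi> u" using surj_pi by (auto simp: surj_def)
 obtain h where h: "h : H" "odist H w0 u = norm (w0 - h u)" by (rule odist_attained)
 show ?thesis by (rule that[of "h u"]) (use h u in "auto simp: dist_pi norm_minus_commute odist_commute[of u w0]")
qed

text \<open>The number of symmetries of a point. Its level sets stratify the target into parts on
  which lifts are locally isometric; by \<open>nstab_pi\<close> the choice of representative is
  immaterial.\<close>

definition nstab :: "'z => nat" where
 "nstab z = card (stab H (SOME w. \<pi> w = z))"

text \<open>Conjugation carries the stabiliser of \<open>g w\<close> into that of
  \<open>w\<close>.\<close>

lemma card_stab_h: "g : H ==> card (stab H (g w)) <= card (stab H w)"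
proof -
 assume g: "g : H"
 obtain k where k: "k : H" "!!x. k (g x) = x" "!!x. g (k x) = x" using inv_in[OF g] by blast
 show ?thesis
 proof (rule card_inj_on_le[of "%h. k \<circ> h \<circ> g"])
  show "inj_on (%h. k \<circ> h \<circ> g) (stab H (g w))" by (rule inj_on_inverseI[of _ "%h. g \<circ> h \<circ> k"]) (simp add: fun_eq_iff k)
  show "(%h. k \<circ> h \<circ> g) ` stab H (g w) \<subseteq> stab H w" using k g comp_in by (auto simp: stab_def)
  show "finite (stab H w)" using stab_subset finite_H finite_subset by metis
 qed
qed

lemma nstab_pi: "nstab (\<pi> w) = card (stab H w)"
proof -
 have "\<pi> (SOME w'. \<pi> w' = \<pi> w) = \<pi> w" by (rule someI) simp
 then obtain h where h: "h : H" "(SOME w'. \<pi> w' = \<pi> w) = h w" using pi_eqD by blast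
 obtain k where k: "k : H" "!!x. k (h x) = x" using inv_in[OF h(1)] by blast
 have "card (stab H (h w)) = card (stab H w)" using card_stab_h[OF h(1), of w] card_stab_h[OF k(1), of "h w"] k(2) by simp
 then show ?thesis by (simp add: nstab_def h)
qed

text \<open>An \<open>h\<close> that fixes \<open>w\<close> moves \<open>v\<close> by at most twice
  the distance from \<open>v\<close> to \<open>w\<close>, which is below the gap.\<close>

lemma stab_near:
 assumes "ALL h:H. h v ~= v --> \<gamma> <= norm (v - h v)" "norm (w - v) < \<gamma>/4"
 shows "stab H w \<subseteq> stab H v"
proof
 fix h assume h: "h : stab H w"
 have "h v = v"
 proof (rule ccontr)
  assume n: "h v ~= v"
  have hH: "h : H" "h w = w" using h by (auto simp: stab_def)
  have 0: "0 < \<gamma>" using assms(2) norm_ge_zero[of "w - v"] by linarith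
  have "\<gamma> <= norm (v - h v)" using assms(1) hH(1) n by blast
  also have "... <= norm (v - w) + norm (h w - h v)" using norm_triangle_ineq[of "v - w" "h w - h v"] hH by simp
  also have "... = 2 * norm (w - v)" using norm_h_diff[OF hH(1)] by (simp add: norm_minus_commute)
  finally show False using assms(2) 0 by simp
 qed
 then show "h : stab H v" using h by (auto simp: stab_def)
qed

text \<open>Symmetry can only be lost nearby, so the strata are differences of open sets and hence
  Borel.\<close>

lemma open_nstab_le: "open {z. nstab z <= k}"
 unfolding open_dist
proof (intro ballI)
 fix z assume z: "z : {z. nstab z <= k}"
 obtain v where v: "z = \<pi> v" using surj_pi by (auto simp: surj_def)
 obtain \<gamma> where \<gamma>: "\<gamma> > 0" "!!h. h : H ==> h v ~= v ==> \<gamma> <= norm (v - h v)" by (rule gap_exists[of v]) blast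
 have "nstab y <= k" if y: "dist y z < \<gamma>/4" for y
 proof -
  obtain w where w: "\<pi> w = y" "norm (w - v) = dist y (\<pi> v)" by (rule lift_near)
  have "stab H w \<subseteq> stab H v" by (rule stab_near[where \<gamma> = \<gamma>]) (use w y v \<gamma> in auto)
  then have "card (stab H w) <= card (stab H v)" using finite_subset[OF stab_subset finite_H] by (intro card_mono)
  then show ?thesis using z nstab_pi w v by auto
 qed
 then show "\<exists>e>0. ALL y. dist y z < e --> y : {z. nstab z <= k}" using \<gamma>(1) by (intro exI[of _ "\<gamma>/4"]) auto
qed

text \<open>A genuine first order expansion, written with a lift of the value and a linear map
  between the linear spaces. Neither \<open>w\<close> nor \<open>L\<close> is unique.\<close>

definition tdiff :: "('e::euclidean_space => 'z) => 'e => 'w => ('e => 'w) => bool" where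
 "tdiff F x w L \<longleftrightarrow> linear L & \<pi> w = F x &
  (\<forall>e>0. \<exists>d>0. ALL z. norm z < d --> dist (F (x + z)) (\<pi> (w + L z)) <= e * norm z)"

text \<open>The lift represents \<open>F\<close> only on \<open>P\<close>. A point
  \<open>x + z\<close> outside \<open>P\<close> is replaced by a point \<open>q\<close> of
  \<open>P\<close> at distance at most \<eta> |z|, which exists at a density point; the Lipschitz
  bound of \<open>F\<close> and the bound of \<open>L\<close> pay for the replacement.\<close>

lemma tdiff_from_lift:
 fixes F :: "'e::euclidean_space => 'z" and f :: "'e => 'w"
 assumes F: "!!x y. dist (F x) (F y) <= C * norm (x - y)" "0 <= C"
  and lift: "!!y. y : P ==> F y = \<pi> (f y)" and x: "x : P"
  and P: "dens0 (- P) x" "P : sets borel" and f: "(f has_derivative L) (at x)"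
 shows "tdiff F x (f x) L"
 unfolding tdiff_def
proof (intro conjI allI impI)
 show "linear L" using f by (rule has_derivative_linear)
 show "\<pi> (f x) = F x" using lift[OF x] by simp
 obtain B where B: "0 < B" "!!z :: 'e. norm (L z) <= norm z * B" using bounded_linear.pos_bounded[OF has_derivative_bounded_linear[OF f]] by blast
 fix e :: real assume e: "0 < e"
 define \<eta> where "\<eta> = min 1 (e / (C + B + 2))"
 have CB: "0 < C + B + 2" using F(2) B by simp
 have \<eta>: "0 < \<eta>" "\<eta> <= 1" using e CB by (auto simp: \<eta>_def)
 have \<eta>e: "\<eta> * (C + B + 2) <= e"
 proof -
  have "\<eta> * (C + B + 2) <= e / (C + B + 2) * (C + B + 2)" using CB by (intro mult_right_mono) (auto simp: \<eta>_def)
  then show ?thesis using CB by simp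
 qed
 obtain d1 where d1: "0 < d1" "!!y. norm (y - x) < d1 ==> norm (f y - f x - L (y - x)) <= \<eta> * norm (y - x)"
  using f \<eta>(1) unfolding has_derivative_within_alt by auto
 have "- P : sets borel" using P(2) by auto
 then obtain d2 where d2: "0 < d2" "!!z. norm z < d2 ==> z ~= 0 ==> EX q. q ~: - P & norm (q - (x + z)) < \<eta> * norm z"
  using dens0_near[OF P(1) _ \<eta>(1)] by blast
 show "\<exists>d>0. ALL z. norm z < d --> dist (F (x + z)) (\<pi> (f x + L z)) <= e * norm z"
 proof (intro exI[of _ "min (d1/2) d2"] conjI allI impI)
  show "0 < min (d1/2) d2" using d1 d2 by simp
  fix z :: 'e assume z: "norm z < min (d1/2) d2"
  show "dist (F (x + z)) (\<pi> (f x + L z)) <= e * norm z"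
  proof (cases "z = 0")
   case True
   then show ?thesis using \<open>\<pi> (f x) = F x\<close> linear_0[OF \<open>linear L\<close>] by simp
  next
   case False
   obtain q where q: "q : P" "norm (q - (x + z)) < \<eta> * norm z" using d2(2)[of z] z False by auto
   define u where "u = q - (x + z)"
   have u: "norm u <= \<eta> * norm z" using q by (simp add: u_def)
   have "\<eta> * norm z <= 1 * norm z" using \<eta> by (intro mult_right_mono) auto
   then have qx: "norm (q - x) <= 2 * norm z" using u norm_triangle_ineq[of u z] by (simp add: u_def)
   have 1: "dist (F (x + z)) (F q) <= C * (\<eta> * norm z)"
    using F(1)[of "x + z" q] u F(2) by (auto simp: u_def norm_minus_commute intro: order_trans mult_left_mono)
   have 2: "norm (f q - f x - L (q - x)) <= \<eta> * (2 * norm z)" using d1(2)[of q] qx z \<eta> by (auto intro: order_trans mult_left_mono)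
   have 3: "norm (L u) <= \<eta> * norm z * B" using B(2)[of u] u B(1) by (auto intro: order_trans mult_right_mono)
   have "q - x = z + u" by (simp add: u_def)
   then have eq: "f q - (f x + L z) = (f q - f x - L (q - x)) + L u" using linear_add[OF \<open>linear L\<close>, of z u] by simp
   have "norm (f q - (f x + L z)) <= \<eta> * (2 * norm z) + \<eta> * norm z * B"
    unfolding eq using 2 3 norm_triangle_ineq[of "f q - f x - L (q - x)" "L u"] by linarith
   then have "dist (F q) (\<pi> (f x + L z)) <= \<eta> * (2 * norm z) + \<eta> * norm z * B"
    using dist_pi_le[of "f q" "f x + L z"] lift[OF q(1)] by simp
   then have "dist (F (x + z)) (\<pi> (f x + L z)) <= \<eta> * (C + B + 2) * norm z"
    using 1 dist_triangle[of "F (x + z)" "\<pi> (f x + L z)" "F q"] by (simp add: algebra_simps)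
   also have "... <= e * norm z" using \<eta>e by (intro mult_right_mono) auto
   finally show ?thesis .
  qed
 qed
qed

text \<open>Where the number of symmetries is constant, the lift that stays close to
  \<open>v\<close> has the same stabiliser as \<open>v\<close>. There the local orbit distance of
  two lifted values is their ordinary distance, so the lift is Lipschitz. It extends to the whole
  space, is differentiable almost everywhere, and \<open>tdiff_from_lift\<close> applies at density
  points of the stratum.\<close>

lemma rademacher_orbit:
 fixes F :: "'e::euclidean_space => 'z"
 assumes F: "!!x y. dist (F x) (F y) <= C * norm (x - y)" "0 <= C"
 shows "AE x in lborel. EX w L. tdiff F x w L"
proof -
 have cF: "continuous_on UNIV F" by (rule lipschitz_on_continuous_on[of C]) (use F in "auto intro!: lipschitz_onI simp: dist_norm")
 have "\<exists>r>0. AE x in lborel. x : ball (x0 :: 'e) r & nstab (F x) = nstab (F x0) --> (EX w L. tdiff F x w L)" for x0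
 proof -
  obtain v where v: "F x0 = \<pi> v" using surj_pi by (auto simp: surj_def)
  obtain \<gamma> where \<gamma>: "\<gamma> > 0" "!!h. h : H ==> h v ~= v ==> \<gamma> <= norm (v - h v)" by (rule gap_exists[of v]) blast
  define D where "D = C + 1"
  have D: "0 < D" using F(2) by (simp add: D_def)
  define r where "r = \<gamma> / (4 * D)"
  have r: "0 < r" "C * r < \<gamma>/4"
  proof -
   show "0 < r" using \<gamma>(1) D by (simp add: r_def)
   have "D * r = \<gamma>/4" using D by (simp add: r_def)
   then show "C * r < \<gamma>/4" using \<open>0 < r\<close> by (simp add: D_def algebra_simps)
  qed
  define k where "k = nstab (F x0)"
  define P where "P = {x : ball x0 r. nstab (F x) = k}"
  have op: "open (F -` {z. nstab z <= j})" for j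
   using open_vimage[OF open_nstab_le cF] .
  \<comment> \<open>For \<open>k = 0\<close> the truncated difference \<open>k - 1\<close> is again
    0, and subtracting that set would remove the whole stratum.\<close>
  have "P = ball x0 r Int F -` {z. nstab z <= k} - (if k = 0 then {} else F -` {z. nstab z <= k - 1})" by (auto simp: P_def)
  also have "... : sets borel" using op by auto
  finally have Pb: "P : sets borel" .
  \<comment> \<open>Among all lifts one nearest to \<open>v\<close> is chosen, which puts it in the
    range of \<open>odist_local\<close>.\<close>
  have "ALL y. EX w. \<pi> w = F y & norm (w - v) = dist (F y) (\<pi> v)" by (metis lift_near)
  then obtain f0 where f0: "!!y. \<pi> (f0 y) = F y" "!!y. norm (f0 y - v) = dist (F y) (\<pi> v)" by metis
  have near: "norm (f0 y - v) < \<gamma>/4" if "y : P" for y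
  proof -
   have "dist (F y) (\<pi> v) <= C * norm (y - x0)" using F(1) v by metis
   also have "... <= C * r" using that F(2) by (intro mult_left_mono) (auto simp: P_def dist_norm norm_minus_commute)
   finally show ?thesis using f0(2)[of y] r by simp
  qed
  have stab_eq: "stab H (f0 y) = stab H v" if "y : P" for y
  proof (rule card_subset_eq)
   show "finite (stab H v)" using finite_subset[OF stab_subset finite_H] .
   show "stab H (f0 y) \<subseteq> stab H v" by (rule stab_near[where \<gamma> = \<gamma>, OF _ near[OF that]]) (use \<gamma> in auto)
   have "nstab (F y) = card (stab H (f0 y))" using nstab_pi[of "f0 y"] f0(1) by simp
   moreover have "nstab (F x0) = card (stab H v)" using nstab_pi[of v] v by simp
   ultimately show "card (stab H (f0 y)) = card (stab H v)" using that by (simp add: P_def k_def)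
  qed
  have lip0: "norm (f0 y - f0 y') <= C * norm (y - y')" if "y : P" "y' : P" for y y'
  proof -
   interpret s: isogroup "stab H v" by (rule isogroup_stab)
   obtain h where h: "h : stab H v" "odist (stab H v) (f0 y) (f0 y') = norm (f0 y - h (f0 y'))" by (rule s.odist_attained)
   \<comment> \<open>The minimising \<open>h\<close> fixes \<open>v\<close>, and
     \<open>f0 y'\<close> has the same stabiliser as \<open>v\<close>.\<close>
   have "h (f0 y') = f0 y'" using h(1) stab_eq[OF that(2)] by (auto simp: stab_def)
   moreover have "odist H (f0 y) (f0 y') = odist (stab H v) (f0 y) (f0 y')"
    by (rule odist_local[where v = v and \<gamma> = \<gamma>]) (use \<gamma> near that in auto)
   ultimately have "norm (f0 y - f0 y') = dist (F y) (F y')" using h(2) dist_pi[of "f0 y" "f0 y'"] f0(1) by simp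
   then show ?thesis using F(1) by simp
  qed
  have "pseudometric (%x y :: 'e. C * dist x y)" by (rule pseudometric_scale[OF _ F(2)]) (simp add: pseudometric_def dist_commute dist_triangle)
  from McShane_extension_euclidean[OF this, of P f0] lip0
  obtain f where f: "!!y. y : P ==> f y = f0 y" "!!x y. norm (f x - f y) <= real DIM('w) * (C * dist x y)" by (auto simp: dist_norm)
  have "AE x in lborel. f differentiable (at x)" by (rule rademacher[of f "real DIM('w) * C"]) (use f(2) F(2) in "auto simp: dist_norm mult_ac")
  moreover note lebesgue_density[OF Pb]
  ultimately have "AE x\<in>P in lborel. (EX w L. tdiff F x w L)"
  proof eventually_elim
   case (elim x)
   show ?case
   proof
    assume x: "x : P"
    obtain L where "(f has_derivative L) (at x)" using elim by (auto simp: differentiable_def)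
    then have "tdiff F x (f x) L" using elim x f(1) f0(1) Pb by (intro tdiff_from_lift[OF F, of P f x L]) auto
    then show "EX w L. tdiff F x w L" by blast
   qed
  qed
  then show ?thesis using r(1) unfolding P_def k_def by auto
 qed
 then have "ALL x0. EX r. 0 < r & (AE x in lborel. x : ball (x0 :: 'e) r & nstab (F x) = nstab (F x0) --> (EX w L. tdiff F x w L))" by blast
 from choice[OF this] obtain r where r: "!!x. 0 < r x"
  "!!x0. AE x in lborel. x : ball x0 (r x0) & nstab (F x) = nstab (F x0) --> (EX w L. tdiff F x w L)" by blast
 have AEk: "AE x in lborel. nstab (F x) = k --> (EX w L. tdiff F x w L)" for k
 proof -
  \<comment> \<open>The result so far is local around each point of the stratum; a countable
    subcover keeps the union of exceptional sets null.\<close>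
  define \<F> where "\<F> = (%x. ball x (r x)) ` {x. nstab (F x) = k}"
  obtain \<F>' where \<F>': "\<F>' \<subseteq> \<F>" "countable \<F>'" "\<Union>\<F>' = \<Union>\<F>" using Lindelof[of \<F>] by (auto simp: \<F>_def)
  have "AE x in lborel. ALL B:\<F>'. x : B & nstab (F x) = k --> (EX w L. tdiff F x w L)"
  proof (subst AE_ball_countable[OF \<F>'(2)], intro ballI)
   fix B assume "B : \<F>'"
   then obtain x0 where "B = ball x0 (r x0)" "nstab (F x0) = k" using \<F>'(1) by (auto simp: \<F>_def)
   then show "AE x in lborel. x : B & nstab (F x) = k --> (EX w L. tdiff F x w L)" using r(2)[of x0] by auto
  qed
  then show ?thesis
  proof eventually_elim
   case (elim x)
   show ?case
   proof
    assume "nstab (F x) = k"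
    then have "x : \<Union>\<F>" using r(1)[of x] by (auto simp: \<F>_def)
    then show "EX w L. tdiff F x w L" using elim \<F>'(3) \<open>nstab (F x) = k\<close> by blast
   qed
  qed
 qed
 have "AE x in lborel. ALL k. nstab (F x) = k --> (EX w L. tdiff F x w L)" unfolding AE_all_countable using AEk by blast
 then show ?thesis by eventually_elim blast
qed

text \<open>Close to \<open>w\<close> the orbit distance is that of the stabiliser of
  \<open>w\<close>, and a stabiliser element leaves \<open>w\<close> in place. Hence the directional
  slope of the expansion \<open>w + L z\<close> is exactly \<open>norm (L v)\<close>.\<close>

lemma odist_small:
 assumes "linear L"
 obtains d where "0 < d" "!!z::'e::euclidean_space. norm z < d ==> odist H (w + L z) w = norm (L z)"
proof -
 obtain \<gamma> where \<gamma>: "\<gamma> > 0" "!!h. h : H ==> h w ~= w ==> \<gamma> <= norm (w - h w)" by (rule gap_exists[of w]) blast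
 obtain B where B: "0 < B" "!!z. norm (L z) <= norm z * B"
  using bounded_linear.pos_bounded[OF linear_conv_bounded_linear[THEN iffD1, OF assms]] by blast
 show ?thesis
 proof (rule that[of "\<gamma> / (4 * B)"])
  show "0 < \<gamma> / (4 * B)" using \<gamma> B by simp
  fix z :: 'e assume z: "norm z < \<gamma> / (4 * B)"
  have "norm z * B < \<gamma> / (4 * B) * B" using z B by (intro mult_strict_right_mono)
  then have "norm (L z) < \<gamma>/4" using B(2)[of z] B(1) by simp
  then have eq: "odist H (w + L z) w = odist (stab H w) (w + L z) w"
   by (intro odist_local[where v = w and \<gamma> = \<gamma>]) (use \<gamma> in auto)
  interpret s: isogroup "stab H w" by (rule isogroup_stab)
  obtain h where h: "h : stab H w" "odist (stab H w) (w + L z) w = norm (w + L z - h w)" by (rule s.odist_attained)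
  then show "odist H (w + L z) w = norm (L z)" using eq by (simp add: stab_def)
 qed
qed

lemma tdiff_directional:
 assumes "tdiff F x w L"
 shows "((%t. dist (F (x + t *\<^sub>R v)) (F x) / t) \<longlongrightarrow> norm (L v)) (at_right 0)"
proof (rule tendstoI)
 fix e :: real assume e: "0 < e"
 have lin: "linear L" and w: "\<pi> w = F x" using assms by (auto simp: tdiff_def)
 define \<eta> where "\<eta> = e / (2 * (norm v + 1))"
 have \<eta>: "0 < \<eta>" "\<eta> * norm v < e"
 proof -
  have nv: "0 < norm v + 1" by (simp add: add_nonneg_pos)
  show "0 < \<eta>" using e nv by (simp add: \<eta>_def)
  have "\<eta> * (norm v + 1) = e / 2" using nv unfolding \<eta>_def by (simp add: field_simps)
  then show "\<eta> * norm v < e" using \<open>0 < \<eta>\<close> e by (simp add: algebra_simps)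
 qed
 obtain d1 where d1: "0 < d1" "!!z. norm z < d1 ==> dist (F (x + z)) (\<pi> (w + L z)) <= \<eta> * norm z"
  using assms \<eta>(1) unfolding tdiff_def by blast
 obtain d2 where d2: "0 < d2" "!!z. norm z < d2 ==> odist H (w + L z) w = norm (L z)" by (rule odist_small[OF lin, of w]) blast
 define d where "d = min d1 d2 / (norm v + 1)"
 have nv: "0 < norm v + 1" by (simp add: add_nonneg_pos)
 have d: "0 < d" using d1 d2 nv by (simp add: d_def)
 have "dist (dist (F (x + t *\<^sub>R v)) (F x) / t) (norm (L v)) < e" if t: "0 < t" "t < d" for t
 proof -
  have "t * (norm v + 1) < min d1 d2" using t(2) nv by (simp add: d_def pos_less_divide_eq)
  then have tv: "norm (t *\<^sub>R v) < d1" "norm (t *\<^sub>R v) < d2" using t by (auto simp: algebra_simps)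
  have "\<bar>dist (F (x + t *\<^sub>R v)) (F x) - norm (L (t *\<^sub>R v))\<bar> <= \<eta> * norm (t *\<^sub>R v)"
   using d1(2)[OF tv(1)] d2(2)[OF tv(2)] dist_pi[of "w + L (t *\<^sub>R v)" w] w
    abs_dist_diff_le[of "F (x + t *\<^sub>R v)" "F x" "\<pi> (w + L (t *\<^sub>R v))"]
    dist_triangle[of "F (x + t *\<^sub>R v)" "F x" "\<pi> (w + L (t *\<^sub>R v))"]
    dist_triangle[of "\<pi> (w + L (t *\<^sub>R v))" "F x" "F (x + t *\<^sub>R v)"] by (simp add: dist_commute abs_le_iff)
  also have "... = t * (\<eta> * norm v)" using t by simp
  finally have "\<bar>dist (F (x + t *\<^sub>R v)) (F x) - t * norm (L v)\<bar> <= t * (\<eta> * norm v)" using t linear_scale[OF lin] by simp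
  moreover have "dist (F (x + t *\<^sub>R v)) (F x) - t * norm (L v) = t * (dist (F (x + t *\<^sub>R v)) (F x) / t - norm (L v))"
   using t by (simp add: right_diff_distrib)
  ultimately have "\<bar>dist (F (x + t *\<^sub>R v)) (F x) / t - norm (L v)\<bar> <= \<eta> * norm v" using t by (simp add: abs_mult)
  then show ?thesis using \<eta>(2) by (simp add: dist_real_def)
 qed
 then show "\<forall>\<^sub>F t in at_right 0. dist (dist (F (x + t *\<^sub>R v)) (F x) / t) (norm (L v)) < e"
  using d by (auto simp: eventually_at_right_field)
qed

end

section \<open>Metric slopes and approximate differentials\<close>

text \<open>Existence of all one-sided directional metric derivatives, in the spirit of the metric
  differential but without demanding a seminorm.\<close>

definition mdiff :: "('e::euclidean_space => 'z::metric_space) => 'e => bool" where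
 "mdiff F x \<longleftrightarrow> (ALL v. EX l. ((%t. dist (F (x + t *\<^sub>R v)) (F x) / t) \<longlongrightarrow> l) (at_right 0))"

text \<open>As for \<open>dderiv\<close>, a limit along a sequence, so that measurability is
  immediate.\<close>

definition mslope :: "('e::euclidean_space => 'z::metric_space) => 'e => 'e => real" where
 "mslope F v x = lim (%n. real (Suc n) * dist (F (x + (1 / real (Suc n)) *\<^sub>R v)) (F x))"

lemma filterlim_inverse_Suc: "filterlim (%n. 1 / real (Suc n)) (at_right 0) sequentially"
 unfolding filterlim_at using LIMSEQ_inverse_real_of_nat by (auto simp: inverse_eq_divide)

lemma mslope_eq:
 assumes "((%t. dist (F (x + t *\<^sub>R v)) (F x) / t) \<longlongrightarrow> l) (at_right 0)"
 shows "mslope F v x = l" "(%n. real (Suc n) * dist (F (x + (1 / real (Suc n)) *\<^sub>R v)) (F x)) \<longlonglongrightarrow> l"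
proof -
 have "(%n. dist (F (x + (1 / real (Suc n)) *\<^sub>R v)) (F x) / (1 / real (Suc n))) \<longlonglongrightarrow> l"
  by (rule filterlim_compose[OF assms filterlim_inverse_Suc])
 then show *: "(%n. real (Suc n) * dist (F (x + (1 / real (Suc n)) *\<^sub>R v)) (F x)) \<longlonglongrightarrow> l"
  by (simp add: mult.commute del: of_nat_Suc)
 then show "mslope F v x = l" unfolding mslope_def by (rule limI)
qed

lemma mdiff_tendsto:
 assumes "mdiff F x"
 shows "((%t. dist (F (x + t *\<^sub>R v)) (F x) / t) \<longlongrightarrow> mslope F v x) (at_right 0)"
proof -
 obtain l where l: "((%t. dist (F (x + t *\<^sub>R v)) (F x) / t) \<longlongrightarrow> l) (at_right 0)" using assms unfolding mdiff_def by blast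
 then show ?thesis using mslope_eq(1)[OF l] by simp
qed

lemma mdiff_seq:
 "mdiff F x ==> (%n. real (Suc n) * dist (F (x + (1 / real (Suc n)) *\<^sub>R v)) (F x)) \<longlonglongrightarrow> mslope F v x"
 using mslope_eq(2)[OF mdiff_tendsto] .

lemma mslope_nonneg: "mdiff F x ==> 0 <= mslope F v x" by (rule LIMSEQ_le_const[OF mdiff_seq]) auto

lemma mslope_scale:
 assumes "mdiff F x" "0 < c"
 shows "mslope F (c *\<^sub>R v) x = c * mslope F v x"
proof (rule mslope_eq(1))
 have "filterlim (%t. c * t) (at_right 0) (at_right 0)"
  using assms(2) by (intro filterlim_times_pos[of "%x. x" 0 "at_right 0" c 0]) (auto intro: filterlim_ident)
 from filterlim_compose[OF mdiff_tendsto[OF assms(1), of v] this]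
 have "((%t. c * (dist (F (x + (c * t) *\<^sub>R v)) (F x) / (c * t))) \<longlongrightarrow> c * mslope F v x) (at_right 0)" by (intro tendsto_intros)
 then show "((%t. dist (F (x + t *\<^sub>R c *\<^sub>R v)) (F x) / t) \<longlongrightarrow> c * mslope F v x) (at_right 0)"
  using assms(2) by (simp add: mult.commute)
qed

locale lipmap =
 fixes F :: "'e::euclidean_space => 'z::metric_space" and C :: real
 assumes F_lip: "dist (F x) (F y) <= C * norm (x - y)" and C0: "0 <= C"
begin

lemma continuous_F: "continuous_on S F" by (rule lipschitz_on_continuous_on[of C]) (use F_lip C0 in "auto intro!: lipschitz_onI simp: dist_norm")

lemma borel_dist_shift [measurable]: "(%x. dist (F (x + w)) (F x)) : borel_measurable borel"
 by (intro borel_measurable_continuous_onI continuous_intros continuous_on_compose2[OF continuous_F[of UNIV]]) auto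

lemma borel_mslope [measurable]: "mslope F v : borel_measurable borel" unfolding mslope_def by measurable

lemma dist_shift_le: "dist (F (x + w)) (F x) <= C * norm w" using F_lip[of "x + w" x] by simp

lemma scaled_dist_le: "real (Suc n) * dist (F (x + (1 / real (Suc n)) *\<^sub>R v)) (F x) <= C * norm v"
proof -
 have "dist (F (x + (1 / real (Suc n)) *\<^sub>R v)) (F x) <= C * norm v / real (Suc n)"
  using dist_shift_le[of x "(1 / real (Suc n)) *\<^sub>R v"] by (simp add: field_simps)
 then show ?thesis by (simp add: field_simps)
qed

lemma mslope_le: "mdiff F x ==> mslope F v x <= C * norm v" by (rule LIMSEQ_le_const2[OF mdiff_seq]) (use scaled_dist_le in auto)

lemma scaled_integral_tendsto:
 assumes md: "AE x in lborel. mdiff F x" and S[measurable]: "S : sets borel" "vol S < \<infinity>"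
 shows "(%n. sint S (%x. ennreal (real (Suc n) * dist (F (x + (1 / real (Suc n)) *\<^sub>R v)) (F x))))
  \<longlonglongrightarrow> (sint S (%x. ennreal (mslope F v x)))"
proof (rule nn_integral_dominated_convergence)
 show "lint (%x. ennreal (C * norm v) * indicator S x) < \<infinity>" using S(2) by (simp add: nn_integral_cmult ennreal_mult_less_top)
 show "AE x in lborel. ennreal (real (Suc n) * dist (F (x + (1 / real (Suc n)) *\<^sub>R v)) (F x)) * indicator S x
   <= ennreal (C * norm v) * indicator S x" for n using scaled_dist_le by (intro AE_I2 mult_right_mono ennreal_leI) auto
 show "AE x in lborel. (%n. ennreal (real (Suc n) * dist (F (x + (1 / real (Suc n)) *\<^sub>R v)) (F x)) * indicator S x)
   \<longlonglongrightarrow> ennreal (mslope F v x) * indicator S x"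
  using md
 proof eventually_elim
  case (elim x)
  have "(%n. ennreal (real (Suc n) * dist (F (x + (1 / real (Suc n)) *\<^sub>R v)) (F x))) \<longlonglongrightarrow> ennreal (mslope F v x)"
   by (intro tendsto_ennrealI mdiff_seq elim)
  then show ?case by (cases "x : S") (auto simp: indicator_def)
 qed
qed measurable

text \<open>Subdividing the segment from \<open>x\<close> to \<open>x + w\<close> and translating each piece back replaces
 integration of the slope along lines.\<close>

lemma dist_shift_integral_le:
 assumes md: "AE x in lborel. mdiff F x"
  and S[measurable]: "S : sets borel" and S'[measurable]: "S' : sets borel" "vol S' < \<infinity>"
  and seg: "!!x s. x : S ==> 0 <= s ==> s <= 1 ==> x + s *\<^sub>R w : S'"
 shows "sint S (%x. ennreal (dist (F (x + w)) (F x))) <= sint S' (%x. ennreal (mslope F w x))"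
proof -
 have "sint S (%x. ennreal (dist (F (x + w)) (F x)))
  <= sint S' (%x. ennreal (real (Suc n) * dist (F (x + (1 / real (Suc n)) *\<^sub>R w)) (F x)))" for n
 proof -
  define N where "N = real (Suc n)"
  have N: "0 < N" by (simp add: N_def)
  define q where "q y = ennreal (dist (F (y + (1 / N) *\<^sub>R w)) (F y))" for y
  have q[measurable]: "q : borel_measurable borel" unfolding q_def by measurable
  define c where "c k = (real k / N) *\<^sub>R w" for k
  have tri: "dist (F (x + c k)) (F x) <= (\<Sum>i<k. dist (F (x + c (Suc i))) (F (x + c i)))" for x k
  proof (induction k)
   case 0
   then show ?case by (simp add: c_def)
  next
   case (Suc k)
   have "dist (F (x + c (Suc k))) (F x) <= dist (F (x + c (Suc k))) (F (x + c k)) + dist (F (x + c k)) (F x)" by (rule dist_triangle)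
   then show ?case using Suc by simp
  qed
  have step: "ennreal (dist (F (x + w)) (F x)) <= (\<Sum>i<Suc n. q (x + c i))" for x
  proof -
   have "c (Suc n) = w" by (simp add: c_def N_def)
   then have "dist (F (x + w)) (F x) <= (\<Sum>i<Suc n. dist (F (x + c (Suc i))) (F (x + c i)))"
    using tri[of x "Suc n"] by (simp del: sum.lessThan_Suc)
   moreover have "x + c (Suc i) = (x + c i) + (1 / N) *\<^sub>R w" for i by (simp add: c_def add_divide_distrib scaleR_add_left)
   ultimately show ?thesis by (simp add: q_def sum_ennreal ennreal_leI del: sum.lessThan_Suc)
  qed
  have "sint S (%x. ennreal (dist (F (x + w)) (F x)))
    <= lint (%x. (\<Sum>i<Suc n. q (x + c i) * indicator S' (x + c i)))"
  proof (rule nn_integral_mono)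
   fix x
   show "ennreal (dist (F (x + w)) (F x)) * indicator S x <= (\<Sum>i<Suc n. q (x + c i) * indicator S' (x + c i))"
   proof (cases "x : S")
    case True
    have "x + c i : S'" if "i < Suc n" for i unfolding c_def using that N by (intro seg[OF True]) (auto simp: N_def)
    then have "(\<Sum>i<Suc n. q (x + c i) * indicator S' (x + c i)) = (\<Sum>i<Suc n. q (x + c i))" by (intro sum.cong) auto
    then show ?thesis using step[of x] True by simp
   qed simp
  qed
  also have "... = (\<Sum>i<Suc n. (lint (%x. q (x + c i) * indicator S' (x + c i))))" by (rule nn_integral_sum) measurable
  also have "... = (\<Sum>i<Suc n. (lint (%x. q x * indicator S' x)))"
   by (intro sum.cong refl nn_integral_lborel_translate[where f = "%x. q x * indicator S' x"]) measurable
  also have "... = ennreal N * lint (%x. q x * indicator S' x)" by (simp add: N_def ennreal_of_nat_eq_real_of_nat del: of_nat_Suc sum.lessThan_Suc)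
  also have "... = lint (%x. ennreal N * (q x * indicator S' x))" by (rule nn_integral_cmult[symmetric]) measurable
  also have "... = sint S' (%x. ennreal (N * dist (F (x + (1 / N) *\<^sub>R w)) (F x)))"
   using N by (intro nn_integral_cong) (simp add: q_def ennreal_mult mult.assoc)
  finally show ?thesis by (simp only: N_def)
 qed
 then show ?thesis by (intro LIMSEQ_le_const[OF scaled_integral_tendsto[OF md S']]) auto
qed

end

context orbit_space
begin

lemma tdiff_mdiff: "tdiff F x w L ==> mdiff F x" unfolding mdiff_def using tdiff_directional by blast

lemma tdiff_mslope: "tdiff F x w L ==> mslope F v x = norm (L v)" by (rule mslope_eq(1)[OF tdiff_directional])

lemma lip_extension:
 obtains K where "1 <= K" "!!(d :: 'm => 'm => real) A f. pseudometric d ==>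
   (!!a b. a : A ==> b : A ==> dist (f a) (f b) <= d a b) ==>
   EX F :: 'm => 'z. (ALL a:A. F a = f a) & (ALL x y. dist (F x) (F y) <= K * d x y)"
proof -
 have "isogroup H" by unfold_locales
 from isogroup_lip_retract[OF this, where 'm = 'm]
 obtain K where K: "1 <= K" and ext: "!!(d :: 'm => 'm => real) A f. pseudometric d ==>
  (ALL a:A. ALL b:A. odist H (f a) (f b) <= d a b) ==>
  (EX F :: 'm => 'w. (ALL a:A. F a = f a) & (ALL x y. odist H (F x) (F y) <= K * d x y))" unfolding lip_retract_def by blast
 have "ALL z. EX w. \<pi> w = z" using surj_pi by (metis surj_def)
 then obtain s where s: "!!z. \<pi> (s z) = z" by metis
 show ?thesis
 proof (rule that[OF K])
  fix d :: "'m => 'm => real" and A and f :: "'m => 'z"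
  assume d: "pseudometric d" and f: "!!a b. a : A ==> b : A ==> dist (f a) (f b) <= d a b"
  have "ALL a:A. ALL b:A. odist H (s (f a)) (s (f b)) <= d a b" using f by (simp add: dist_pi[symmetric] s)
  from ext[OF d this] obtain F where F: "!!a. a : A ==> F a = s (f a)"
   "!!x y. odist H (F x) (F y) <= K * d x y" by blast
  show "EX F :: 'm => 'z. (ALL a:A. F a = f a) & (ALL x y. dist (F x) (F y) <= K * d x y)"
   by (rule exI[of _ "%x. \<pi> (F x)"]) (simp add: F s dist_pi)
 qed
qed

text \<open>\<open>\<rho>\<close> extends the inverse of the embedding from its image to all
  functions \<open>'w => real\<close>. The weighted sum over \<open>V\<close> only is a pseudometric
  on these functions, and the retraction property is applied with that source.\<close>

lemma coordinates:
 obtains V :: "'w set" and \<xi> :: "'w => 'z => real" and \<rho> :: "('w => real) => 'z" and K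
 where "finite V" "1 <= K" "!!v z z'. v : V ==> \<bar>\<xi> v z - \<xi> v z'\<bar> <= K * dist z z'"
  "!!z. \<rho> (%v. \<xi> v z) = z" "!!\<phi> \<psi>. dist (\<rho> \<phi>) (\<rho> \<psi>) <= K * (SUM v:V. \<bar>\<phi> v - \<psi> v\<bar>)"
proof -
 obtain V c where V: "finite V" "0 < c"
  and emb: "!!x y. c * odist H x y <= (SUM v:V. \<bar>template v x - template v y\<bar>)" by (rule template_embedding) blast
 have "ALL z. EX w. \<pi> w = z" using surj_pi by (metis surj_def)
 then obtain s where s: "!!z. \<pi> (s z) = z" by metis
 define \<xi> where "\<xi> v z = template v (s z)" for v z
 obtain K0 where K0: "1 <= K0" "!!(d :: ('w => real) => ('w => real) => real) A f. pseudometric d ==>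
   (!!a b. a : A ==> b : A ==> dist (f a) (f b) <= d a b) ==>
   EX F :: ('w => real) => 'z. (ALL a:A. F a = f a) & (ALL x y. dist (F x) (F y) <= K0 * d x y)"
  by (rule lip_extension[where 'm = "'w => real"]) blast
 define d where "d \<phi> \<psi> = (1 / c) * (SUM v:V. \<bar>\<phi> v - \<psi> v\<bar>)" for \<phi> \<psi> :: "'w => real"
 have tri: "(SUM v:V. \<bar>\<phi> v - \<zeta> v\<bar>) <= (SUM v:V. \<bar>\<phi> v - \<psi> v\<bar>) + (SUM v:V. \<bar>\<psi> v - \<zeta> v\<bar>)" for \<phi> \<psi> \<zeta> :: "'w => real"
  unfolding sum.distrib[symmetric] by (rule sum_mono) linarith
 have pd: "pseudometric d"
  unfolding d_def
 proof (rule pseudometric_scale)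
  show "pseudometric (%\<phi> \<psi>. SUM v:V. \<bar>\<phi> v - \<psi> v\<bar>)"
   unfolding pseudometric_def by (intro conjI allI tri) (simp_all add: abs_minus_commute)
 qed (use V in simp)
 have key: "dist z z' <= d (%v. \<xi> v z) (%v. \<xi> v z')" for z z'
 proof -
  have "c * dist z z' <= (SUM v:V. \<bar>\<xi> v z - \<xi> v z'\<bar>)" using emb[of "s z" "s z'"] dist_pi[of "s z" "s z'"] by (simp add: s \<xi>_def)
  then show ?thesis using V(2) by (simp add: d_def field_simps)
 qed
 define A where "A = range (%z v. \<xi> v z)"
 \<comment> \<open>The coordinates determine the point by \<open>key\<close>, so the choice is
   unique on the image.\<close>
 define f where "f \<phi> = (SOME z. \<phi> = (%v. \<xi> v z))" for \<phi>
 have f: "f (%v. \<xi> v z) = z" for z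
 proof -
  have "(%v. \<xi> v z) = (%v. \<xi> v (f (%v. \<xi> v z)))" unfolding f_def by (rule someI) simp
  then have "dist z (f (%v. \<xi> v z)) <= d (%v. \<xi> v z) (%v. \<xi> v z)" using key by metis
  then show ?thesis using pseudometricD(1)[OF pd] by simp
 qed
 have "dist (f \<phi>) (f \<psi>) <= d \<phi> \<psi>" if "\<phi> : A" "\<psi> : A" for \<phi> \<psi> using that key f by (auto simp: A_def)
 then have "EX F. (ALL a:A. F a = f a) & (ALL x y. dist (F x) (F y) <= K0 * d x y)" by (rule K0(2)[OF pd])
 then obtain \<rho> where \<rho>0: "(ALL a:A. \<rho> a = f a) & (ALL x y. dist (\<rho> x) (\<rho> y) <= K0 * d x y)" by (rule exE)
 then have \<rho>: "!!\<phi>. \<phi> : A ==> \<rho> \<phi> = f \<phi>" "!!x y. dist (\<rho> x) (\<rho> y) <= K0 * d x y" by simp_all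
 define K where "K = max (K0 / c) (SUM v:V. norm v) + 1"
 have K: "1 <= K" "K0 / c <= K"
 proof -
  have "0 <= (SUM v:V. norm v)" by (simp add: sum_nonneg)
  then show "1 <= K" "K0 / c <= K" by (auto simp: K_def)
 qed
 have Kv: "norm v <= K" if "v : V" for v using member_le_sum[of v V norm] that V(1) by (simp add: K_def)
 show ?thesis
 proof (rule that[OF V(1) K(1), of \<xi> \<rho>])
  fix v z z' assume v: "v : V"
  have "\<bar>\<xi> v z - \<xi> v z'\<bar> <= norm v * dist z z'"
   using template_lipschitz[of v "s z" "s z'"] dist_pi[of "s z" "s z'"] by (simp add: \<xi>_def s)
  also have "... <= K * dist z z'" using Kv[OF v] by (intro mult_right_mono) auto
  finally show "\<bar>\<xi> v z - \<xi> v z'\<bar> <= K * dist z z'" .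
 next
  show "\<rho> (%v. \<xi> v z) = z" for z using \<rho>(1)[of "%v. \<xi> v z"] f by (auto simp: A_def)
 next
  fix \<phi> \<psi> :: "'w => real"
  have "dist (\<rho> \<phi>) (\<rho> \<psi>) <= K0 / c * (SUM v:V. \<bar>\<phi> v - \<psi> v\<bar>)"
   using \<rho>(2)[of \<phi> \<psi>] by (simp add: d_def)
  also have "... <= K * (SUM v:V. \<bar>\<phi> v - \<psi> v\<bar>)" using K by (intro mult_right_mono) (auto simp: sum_nonneg)
  finally show "dist (\<rho> \<phi>) (\<rho> \<psi>) <= K * (SUM v:V. \<bar>\<phi> v - \<psi> v\<bar>)" .
 qed
qed

lemma dense_sequence:
 obtains D :: "'z set" where "countable D" "!!z e. 0 < e ==> EX d:D. dist z d < e"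
proof -
 obtain D :: "'w set" where D: "countable D" "!!S. open S ==> S ~= {} ==> EX d:D. d : S" by (rule countable_dense_setE) blast
 show ?thesis
 proof (rule that[of "\<pi> ` D"])
  show "countable (\<pi> ` D)" using D(1) by simp
  fix z and e :: real assume e: "0 < e"
  obtain w where w: "z = \<pi> w" using surj_pi by (auto simp: surj_def)
  obtain d where d: "d : D" "d : ball w e" using D(2)[of "ball w e"] e by auto
  then show "EX d:\<pi> ` D. dist z d < e" using dist_pi_le[of w d] by (auto simp: w dist_norm intro: le_less_trans)
 qed
qed

text \<open>By separability the distance of \<open>f x\<close> and \<open>k x\<close> is the
  supremum over a countable dense set of the differences of their distances to one point, each of
  which is measurable.\<close>

lemma dist_greater_measurable:
 fixes f k :: "'e::euclidean_space => 'z"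
 assumes U: "U : sets borel" and f: "f : borel_measurable (restrict_space borel U)"
  and k: "k : borel_measurable (restrict_space borel U)"
  and s: "s : borel_measurable borel"
 shows "{x : U. s x < dist (f x) (k x)} : sets borel"
proof -
 obtain D :: "'z set" where D: "countable D" "!!z e. 0 < e ==> EX d:D. dist z d < e" by (rule dense_sequence) blast
 have m: "(%x. dist (g x) d) : borel_measurable (restrict_space borel U)"
  if "g : borel_measurable (restrict_space borel U)" for g d
  by (rule measurable_compose[OF that]) (intro borel_measurable_continuous_onI continuous_intros)
 have "{x : space (restrict_space borel U). s x < dist (f x) d - dist (k x) d} : sets (restrict_space borel U)" for d
  using m[OF f, of d] m[OF k, of d] measurable_restrict_space1[OF s, of U] by measurable
 then have "{x : U. s x < dist (f x) d - dist (k x) d} : sets borel" for d using U by (auto simp: sets_restrict_space_iff space_restrict_space)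
 then have "(\<Union>d\<in>D. {x : U. s x < dist (f x) d - dist (k x) d}) : sets borel" using D(1) by auto
 also have "(\<Union>d\<in>D. {x : U. s x < dist (f x) d - dist (k x) d}) = {x : U. s x < dist (f x) (k x)}"
 proof safe
  fix x d assume "s x < dist (f x) d - dist (k x) d"
  then show "s x < dist (f x) (k x)" using dist_triangle[of "f x" d "k x"] by linarith
 next
  fix x assume x: "x : U" "s x < dist (f x) (k x)"
  obtain d where d: "d : D" "dist (k x) d < (dist (f x) (k x) - s x) / 2" using D(2)[of "(dist (f x) (k x) - s x) / 2" "k x"] x by auto
  have "dist (f x) (k x) <= dist (f x) d + dist (k x) d" by (rule dist_triangle2)
  then have "s x < dist (f x) d - dist (k x) d" using d(2) by (simp add: field_simps)
  then show "x : (\<Union>d\<in>D. {x : U. s x < dist (f x) d - dist (k x) d})" using d(1) x by blast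
 qed
 finally show ?thesis .
qed

section \<open>Approximate differentials of maps into an orbit space\<close>

text \<open>The affine tuple is written around \<open>a\<close>: \<open>c\<close> collects its
  values there and \<open>L\<close> its linear parts.\<close>

definition adiff :: "'e::euclidean_space set => ('e => 'z) => 'e => 'w => ('e => 'w) => bool" where
 "adiff U f a c L \<longleftrightarrow> linear L &
  (\<forall>\<epsilon>>0. dens0 {x : U. \<epsilon> * norm (x - a) < dist (f x) (\<pi> (c + L (x - a)))} a)"

lemma continuous_affine: "linear L ==> continuous_on S (%x. c + L (x - a))"
 for L :: "'e::euclidean_space => 'w" by (intro continuous_intros continuous_on_compose2[OF linear_continuous_on[of L UNIV]])
  (auto simp: linear_conv_bounded_linear)

lemma adiff_set_borel:
 fixes f :: "'e::euclidean_space => 'z"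
 assumes U: "open U" and f: "f : borel_measurable (restrict_space borel U)" and L: "linear L"
 shows "{x : U. \<epsilon> * norm (x - a) < dist (f x) (\<pi> (c + L (x - a)))} : sets borel"
proof (rule dist_greater_measurable[OF _ f])
 show "U : sets borel" using U by simp
 have "continuous_on UNIV \<pi>" by (rule lipschitz_on_continuous_on[of 1]) (use dist_pi_le in "auto intro!: lipschitz_onI simp: dist_norm")
 then have "continuous_on UNIV (%x. \<pi> (c + L (x - a)))" using continuous_on_compose2[OF _ continuous_affine[OF L]] by blast
 then show "(%x. \<pi> (c + L (x - a))) : borel_measurable (restrict_space borel U)"
  by (intro measurable_restrict_space1 borel_measurable_continuous_onI)
qed measurable

text \<open>Near every \<open>a + z\<close> there is a point that avoids both exceptional sets, so
  the two affine models differ by o(|z|) in orbit distance. Their base points then lie in one orbit,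
  and near a base point the orbit distance to it reads off \<open>norm (L z)\<close>. These norms
  are what \<open>\<bar>Df\<bar>\<close> depends on.\<close>

lemma adiff_unique:
 fixes f :: "'e::euclidean_space => 'z"
 assumes U: "open U" "a : U" and f: "f : borel_measurable (restrict_space borel U)"
  and A: "adiff U f a c L" and A': "adiff U f a c' L'"
 shows "norm (L v) = norm (L' v)"
proof -
 have lin: "linear L" "linear L'" using A A' by (auto simp: adiff_def)
 obtain B where B: "0 < B" "!!z :: 'e. norm (L z) <= norm z * B"
  using bounded_linear.pos_bounded[OF linear_conv_bounded_linear[THEN iffD1, OF lin(1)]] by blast
 obtain B' where B': "0 < B'" "!!z :: 'e. norm (L' z) <= norm z * B'"
  using bounded_linear.pos_bounded[OF linear_conv_bounded_linear[THEN iffD1, OF lin(2)]] by blast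
 \<comment> \<open>The 4 arises because both models are within \<epsilon> |q - a| of
   \<open>f q\<close> and |q - a| is at most 2 |z|; \<open>B\<close> and \<open>B'\<close> account
   for moving from \<open>q - a\<close> to \<open>z\<close>.\<close>
 define M where "M = 4 + B + B'"
 have near: "\<exists>d>0. ALL z :: 'e. norm z < d --> z ~= 0 --> odist H (c + L z) (c' + L' z) <= \<epsilon> * M * norm z"
  if \<epsilon>: "0 < \<epsilon>" "\<epsilon> <= 1" for \<epsilon>
 proof -
  define S where "S c L = {x : U. \<epsilon> * norm (x - a) < dist (f x) (\<pi> (c + L (x - a)))}" for c L
  have Sb: "S c L : sets borel" "S c' L' : sets borel"
   unfolding S_def by (rule adiff_set_borel[OF U(1) f lin(1)], rule adiff_set_borel[OF U(1) f lin(2)])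
  have "dens0 (S c L) a" "dens0 (S c' L') a" using A A' \<epsilon>(1) unfolding adiff_def S_def by blast+
  then have "dens0 (S c L Un S c' L') a" using Sb by (intro dens0_Un)
  moreover have "S c L Un S c' L' : sets borel" using Sb by simp
  ultimately obtain d1 where d1: "0 < d1" "!!z. norm z < d1 ==> z ~= 0 ==>
    EX q. q ~: S c L Un S c' L' & norm (q - (a + z)) < \<epsilon> * norm z" using dens0_near[of _ a \<epsilon>] \<epsilon>(1) by metis
  obtain d2 where d2: "0 < d2" "ball a d2 \<subseteq> U" using U open_contains_ball by blast
  show ?thesis
  proof (intro exI[of _ "min d1 (d2/2)"] conjI allI impI)
   show "0 < min d1 (d2/2)" using d1 d2 by simp
   fix z :: 'e assume z: "norm z < min d1 (d2/2)" "z ~= 0"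
   obtain q where q: "q ~: S c L" "q ~: S c' L'" "norm (q - (a + z)) < \<epsilon> * norm z" using d1(2)[of z] z by auto
   define u where "u = q - (a + z)"
   have u: "norm u <= \<epsilon> * norm z" using q(3) by (simp add: u_def)
   have "\<epsilon> * norm z <= 1 * norm z" using \<epsilon> by (intro mult_right_mono) auto
   then have qa: "norm (q - a) <= 2 * norm z" using u norm_triangle_ineq[of u z] by (simp add: u_def)
   then have "q : U" using d2(2) z by (auto simp: dist_norm norm_minus_commute subset_iff)
   then have "dist (f q) (\<pi> (c + L (q - a))) <= \<epsilon> * norm (q - a)"
    "dist (f q) (\<pi> (c' + L' (q - a))) <= \<epsilon> * norm (q - a)" using q(1,2) by (auto simp: S_def not_less)
   then have "dist (\<pi> (c + L (q - a))) (\<pi> (c' + L' (q - a))) <= 2 * (\<epsilon> * norm (q - a))"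
    using dist_triangle3[of "\<pi> (c + L (q - a))" "\<pi> (c' + L' (q - a))" "f q"] by simp
   also have "... <= 2 * (\<epsilon> * (2 * norm z))" using qa \<epsilon> by simp
   finally have 1: "odist H (c + L (q - a)) (c' + L' (q - a)) <= 4 * \<epsilon> * norm z" by (simp add: dist_pi)
   have qz: "q - a = z + u" by (simp add: u_def)
   have "odist H (c + L z) (c + L (q - a)) <= norm (L u)"
    using odist_le_norm[of "c + L z" "c + L (q - a)"] linear_add[OF lin(1), of z u] by (simp add: qz)
   also have "... <= norm u * B" by (rule B)
   also have "... <= \<epsilon> * norm z * B" using u B(1) by (intro mult_right_mono) auto
   finally have 2: "odist H (c + L z) (c + L (q - a)) <= \<epsilon> * norm z * B" .
   have "odist H (c' + L' (q - a)) (c' + L' z) <= norm (L' u)"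
    using odist_le_norm[of "c' + L' (q - a)" "c' + L' z"] linear_add[OF lin(2), of z u] by (simp add: qz)
   also have "... <= norm u * B'" by (rule B')
   also have "... <= \<epsilon> * norm z * B'" using u B'(1) by (intro mult_right_mono) auto
   finally have 3: "odist H (c' + L' (q - a)) (c' + L' z) <= \<epsilon> * norm z * B'" .
   have "odist H (c + L z) (c' + L' z) <= odist H (c + L z) (c + L (q - a)) +
     (odist H (c + L (q - a)) (c' + L' (q - a)) + odist H (c' + L' (q - a)) (c' + L' z))"
    by (rule order_trans[OF odist_triangle[where y = "c + L (q - a)"] add_left_mono[OF odist_triangle]])
   then show "odist H (c + L z) (c' + L' z) <= \<epsilon> * M * norm z" using 1 2 3 by (simp add: M_def algebra_simps)
  qed
 qed
 obtain d3 where d3: "0 < d3" "!!z. norm z < d3 ==> odist H (c + L z) c = norm (L z)" by (rule odist_small[OF lin(1), of c]) blast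
 obtain d4 where d4: "0 < d4" "!!z. norm z < d4 ==> odist H (c' + L' z) c' = norm (L' z)" by (rule odist_small[OF lin(2), of c']) blast
 show ?thesis
 proof (cases "v = 0")
  case True
  then show ?thesis using linear_0[OF lin(1)] linear_0[OF lin(2)] by simp
 next
  case v: False
  have M: "0 < M" using B B' by (simp add: M_def)
  have cc: "odist H c c' = 0"
  proof (rule ccontr)
   assume "odist H c c' ~= 0"
   then have o: "0 < odist H c c'" using odist_nonneg[of c c'] by linarith
   obtain d where d: "0 < d" "!!z. norm z < d ==> z ~= 0 ==> odist H (c + L z) (c' + L' z) <= 1 * M * norm z" using near[of 1] by auto
   define t where "t = min (d / 2) (odist H c c' / (2 * (M + B + B'))) / norm v"
   have MB: "0 < M + B + B'" using M B B' by simp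
   have t: "0 < t" "t * norm v <= d / 2" "t * norm v <= odist H c c' / (2 * (M + B + B'))"
   proof -
    have "t * norm v = min (d / 2) (odist H c c' / (2 * (M + B + B')))" using v by (simp add: t_def)
    then show "t * norm v <= d / 2" "t * norm v <= odist H c c' / (2 * (M + B + B'))" by linarith+
    show "0 < t" using v d(1) o MB by (simp add: t_def)
   qed
   define z where "z = t *\<^sub>R v"
   have z: "norm z < d" "z ~= 0" "norm z * (2 * (M + B + B')) <= odist H c c'" using t v d(1) MB by (auto simp: z_def pos_le_divide_eq)
   have "odist H c c' <= odist H c (c + L z) + (odist H (c + L z) (c' + L' z) + odist H (c' + L' z) c')"
    by (rule order_trans[OF odist_triangle[where y = "c + L z"] add_left_mono[OF odist_triangle]])
   also have "... <= norm z * B + (1 * M * norm z + norm z * B')"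
    using odist_le_norm[of c "c + L z"] odist_le_norm[of "c' + L' z" c'] B(2)[of z] B'(2)[of z] d(2)[OF z(1,2)]
    by (intro add_mono) (auto simp: norm_minus_commute)
   also have "... = norm z * (M + B + B')" by (simp add: algebra_simps)
   also have "... <= odist H c c' / 2" using z(3) by (simp add: algebra_simps)
   finally show False using o by simp
  qed
  have le: "\<bar>norm (L v) - norm (L' v)\<bar> <= \<epsilon> * (M * norm v)" if \<epsilon>: "0 < \<epsilon>" "\<epsilon> <= 1" for \<epsilon>
  proof -
   obtain d where d: "0 < d" "!!z. norm z < d ==> z ~= 0 ==> odist H (c + L z) (c' + L' z) <= \<epsilon> * M * norm z"
    using near[OF \<epsilon>] by auto
   define t where "t = min d (min d3 d4) / (2 * norm v)"
   have t: "0 < t" using v d d3 d4 by (simp add: t_def)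
   define z where "z = t *\<^sub>R v"
   have nz: "norm z = min d (min d3 d4) / 2" using v d d3 d4 t by (simp add: z_def t_def)
   have z: "norm z < d" "norm z < d3" "norm z < d4" "z ~= 0" unfolding nz using d d3 d4 t v by (auto simp: z_def min_def)
   have "\<bar>norm (L z) - norm (L' z)\<bar> <= odist H (c + L z) (c' + L' z)"
    unfolding d3(2)[OF z(2), symmetric] d4(2)[OF z(3), symmetric]
    using odist_triangle[of "c + L z" c "c' + L' z"] odist_triangle[of "c' + L' z" c c']
     odist_triangle[of "c' + L' z" c' "c + L z"] odist_triangle[of "c + L z" c' c] cc
     odist_commute[of c c'] odist_commute[of "c + L z" "c' + L' z"] by (simp add: abs_le_iff)
   also have "... <= \<epsilon> * M * norm z" by (rule d(2)[OF z(1,4)])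
   finally have "t * \<bar>norm (L v) - norm (L' v)\<bar> <= t * (\<epsilon> * (M * norm v))"
    using t by (simp add: z_def linear_scale[OF lin(1)] linear_scale[OF lin(2)] abs_mult
      right_diff_distrib[symmetric] mult_ac)
   then show ?thesis using t by simp
  qed
  show ?thesis
  proof (rule ccontr)
   assume ne: "norm (L v) ~= norm (L' v)"
   define \<delta> where "\<delta> = \<bar>norm (L v) - norm (L' v)\<bar>"
   have \<delta>: "0 < \<delta>" using ne by (simp add: \<delta>_def)
   have Mv: "0 < M * norm v" using M v by simp
   define \<epsilon> where "\<epsilon> = min 1 (\<delta> / (2 * (M * norm v)))"
   have "\<delta> <= \<epsilon> * (M * norm v)" unfolding \<delta>_def by (rule le) (use \<delta> Mv in "auto simp: \<epsilon>_def")
   also have "... <= \<delta> / (2 * (M * norm v)) * (M * norm v)" using Mv by (intro mult_right_mono) (auto simp: \<epsilon>_def)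
   also have "... = \<delta> / 2" using Mv by (auto simp: field_simps)
   finally show False using \<delta> by simp
  qed
 qed
qed

text \<open>Near \<open>x\<close> the exceptional set of \<open>g\<close> lies in the complement of
  \<open>P\<close>, which has density 0 there.\<close>

lemma adiff_of_tdiff:
 fixes g F :: "'e::euclidean_space => 'z"
 assumes P: "P : sets borel" "dens0 (- P) x" and g: "!!y. y : P ==> g y = F y" and F: "tdiff F x w L"
 shows "adiff U g x w L"
 unfolding adiff_def
proof (intro conjI allI impI)
 show "linear L" using F by (simp add: tdiff_def)
 fix \<epsilon> :: real assume "0 < \<epsilon>"
 then obtain d where d: "0 < d" "!!z. norm z < d ==> dist (F (x + z)) (\<pi> (w + L z)) <= \<epsilon> * norm z" using F unfolding tdiff_def by blast
 show "dens0 {y : U. \<epsilon> * norm (y - x) < dist (g y) (\<pi> (w + L (y - x)))} x"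
 proof (rule dens0_local[OF P(2) _ d(1)])
  show "- P : sets borel" using P(1) by auto
  show "{y : U. \<epsilon> * norm (y - x) < dist (g y) (\<pi> (w + L (y - x)))} Int ball x d \<subseteq> - P"
  proof safe
   fix y assume y: "\<epsilon> * norm (y - x) < dist (g y) (\<pi> (w + L (y - x)))" "y : ball x d" "y : P"
   then have "dist (F (x + (y - x))) (\<pi> (w + L (y - x))) <= \<epsilon> * norm (y - x)" by (intro d(2)) (simp add: dist_norm norm_minus_commute)
   then show False using y g by simp
  qed
 qed
qed

text \<open>This is how exact values travel: a merely measurable \<open>g\<close> inherits the
  slopes of a Lipschitz map on the set where they agree.\<close>

theorem adiff_AE:
 fixes g F :: "'e::euclidean_space => 'z"
 assumes P: "P : sets borel" "P \<subseteq> U" and U: "open U" and gb: "g : borel_measurable (restrict_space borel U)"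
  and g: "!!y. y : P ==> g y = F y" and F: "!!x y. dist (F x) (F y) <= C * norm (x - y)" "0 <= C"
 shows "AE x\<in>P in lborel. (EX w L. adiff U g x w L) &
  (ALL w L v. adiff U g x w L --> norm (L v) = mslope F v x)"
 using lebesgue_density[OF P(1)] rademacher_orbit[OF F]
proof eventually_elim
 case (elim x)
 show ?case
 proof
  assume x: "x : P"
  obtain w L where t: "tdiff F x w L" using elim by blast
  have ad: "adiff U g x w L" by (rule adiff_of_tdiff[OF P(1) _ g t]) (use elim x in auto)
  have "norm (L' v) = mslope F v x" if "adiff U g x w' L'" for w' L' v
   using adiff_unique[OF U _ gb that ad, of v] tdiff_mslope[OF t, of v] x P(2) by auto
  then show "(EX w L. adiff U g x w L) & (ALL w L v. adiff U g x w L --> norm (L v) = mslope F v x)" using ad by blast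
 qed
qed

end

section \<open>Lower semicontinuity of the energy\<close>

text \<open>Not a gradient but the vector of slopes along the basis; at points of differentiability
  its norm is the Hilbert-Schmidt norm of the differential.\<close>

definition mgrad :: "('e::euclidean_space => 'z::metric_space) => 'e => 'e" where
 "mgrad F x = (SUM b:Basis. mslope F b x *\<^sub>R b)"

lemma mgrad_inner [simp]: "b : Basis ==> mgrad F x \<bullet> b = mslope F b x" by (simp add: mgrad_def)

lemma real_young:
 fixes p :: real
 assumes "1 < p" "0 <= a" "0 <= s"
 shows "s powr (p - 1) * a <= a powr p / p + (1 - 1 / p) * s powr p"
proof -
 define q where "q = p / (p - 1)"
 have q: "1 < q" "1 / p + 1 / q = 1" "1 / q = 1 - 1 / p" "(p - 1) * q = p" using assms by (auto simp: q_def field_simps)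
 have "a * s powr (p - 1) <= a powr p / p + (s powr (p - 1)) powr q / q" by (rule Youngs_inequality) (use assms q in auto)
 also have "(s powr (p - 1)) powr q / q = (1 - 1 / p) * s powr p" using q(3,4) by (simp add: powr_powr divide_inverse)
 finally show ?thesis by (simp add: mult.commute)
qed

text \<open>A pointwise substitute for Hoelder's inequality on sets of finite measure.\<close>

lemma le_eps_plus_powr:
 fixes p :: real
 assumes "1 < p" "0 <= d" "0 < \<epsilon>"
 shows "d <= \<epsilon> + \<epsilon> powr (1 - p) * d powr p"
proof (cases "d <= \<epsilon>")
 case True
 then show ?thesis by (simp add: add_increasing2)
next
 case False
 then have d: "\<epsilon> < d" "0 < d" using assms by auto
 have "d = d powr (1 - p) * d powr p" using d by (simp add: powr_add[symmetric])
 also have "d powr (1 - p) <= \<epsilon> powr (1 - p)" using assms d by (intro powr_mono2') auto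
 finally show ?thesis using assms by (simp add: mult_right_mono add_increasing)
qed

lemma L1_of_Lp_tendsto:
 fixes d :: "nat => 'e::euclidean_space => real"
 assumes p: "1 < p" and K[measurable]: "K : sets borel" "vol K < \<infinity>"
  and d[measurable]: "!!n. d n : borel_measurable borel" and d0: "!!n x. 0 <= d n x"
  and lim: "(%n. pint p K (%x. d n x)) \<longlonglongrightarrow> 0" and \<eta>: "0 < (\<eta>::real)"
 shows "\<forall>\<^sub>F n in sequentially. (sint K (%x. ennreal (d n x))) < \<eta>"
proof -
 obtain k where k: "vol K = ennreal k" "0 <= k" using K(2) by (cases "vol K") auto
 define \<epsilon> where "\<epsilon> = \<eta> / (4 * (k + 1))"
 have \<epsilon>: "0 < \<epsilon>" "\<epsilon> * k < \<eta> / 2"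
 proof -
  show "0 < \<epsilon>" using \<eta> k by (simp add: \<epsilon>_def)
  have "0 < k + 1" using k by simp
  then have "\<epsilon> * (k + 1) = \<eta> / 4" unfolding \<epsilon>_def by (auto simp: divide_simps)
  then show "\<epsilon> * k < \<eta> / 2" using \<open>0 < \<epsilon>\<close> \<eta> by (simp add: algebra_simps)
 qed
 define M where "M = \<epsilon> powr (1 - p)"
 have M: "0 < M" using \<epsilon> by (simp add: M_def)
 have "\<forall>\<^sub>F n in sequentially. (pint p K (d n)) < ennreal (\<eta> / (2 * M))" by (rule order_tendstoD(2)[OF lim]) (use \<eta> M in auto)
 then show ?thesis
 proof eventually_elim
  case (elim n)
  have "sint K (%x. ennreal (d n x)) <= lint (%x. ennreal \<epsilon> * indicator K x + ennreal M * (ennreal (d n x powr p) * indicator K x))"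
  proof (rule nn_integral_mono)
   fix x
   have "ennreal (d n x) <= ennreal (\<epsilon> + M * d n x powr p)"
    using le_eps_plus_powr[OF p d0 \<epsilon>(1)] by (intro ennreal_leI) (simp add: M_def)
   also have "... = ennreal \<epsilon> + ennreal M * ennreal (d n x powr p)" using \<epsilon> M by (simp add: ennreal_mult)
   finally show "ennreal (d n x) * indicator K x <= ennreal \<epsilon> * indicator K x + ennreal M * (ennreal (d n x powr p) * indicator K x)"
    by (simp add: indicator_def)
  qed
  also have "... = ennreal (\<epsilon> * k) + ennreal M * pint p K (d n)"
   using \<epsilon> k by (simp add: nn_integral_add nn_integral_cmult ennreal_mult)
  also have "... <= ennreal (\<epsilon> * k) + ennreal M * ennreal (\<eta> / (2 * M))" using elim by (intro add_left_mono mult_left_mono) auto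
  also have "... = ennreal (\<epsilon> * k + \<eta> / 2)"
   using M \<eta> \<epsilon> k by (simp add: ennreal_mult[symmetric] ennreal_plus[symmetric] del: ennreal_plus)
  also have "... < ennreal \<eta>" using \<epsilon> \<eta> by (intro ennreal_lessI) auto
  finally show ?case .
 qed
qed

text \<open>The slope of \<open>G\<close> is first replaced by a difference quotient at one fixed
  step. At that step \<open>G\<close> may be exchanged for \<open>F n\<close>, since only an L1
  error enters, and the increment of \<open>F n\<close> is bounded by its own slope integrated along
  the segment, which stays inside \<open>W\<close>.\<close>

lemma lsc_directional:
 fixes F :: "nat => 'e::euclidean_space => 'z::metric_space"
 assumes p: "1 < p"
  and G: "lipmap G C" "AE x in lborel. mdiff G x"
  and F: "!!n. lipmap (F n) (CF n)" "!!n. AE x in lborel. mdiff (F n) x"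
  and K: "compact K" "K \<subseteq> W" and W: "open W"
  and lim: "(%n. pint p K (%x. dist (F n x) (G x))) \<longlonglongrightarrow> 0" and \<eta>: "0 < (\<eta>::real)"
 shows "\<forall>\<^sub>F n in sequentially. (sint K (%x. ennreal (mslope G b x)))
      <= sint W (%x. ennreal (mslope (F n) b x)) + ennreal \<eta>"
proof -
 interpret G: lipmap G C by (rule G)
 interpret F: lipmap "F n" "CF n" for n by (rule F)
 have [measurable]: "K : sets borel" "W : sets borel" using K W by (auto simp: borel_compact)
 have Kfin: "vol K < \<infinity>" using K(1) by (rule emeasure_compact_finite)
 have dm[measurable]: "(%x. dist (F n x) (G x)) : borel_measurable borel" for n
  by (intro borel_measurable_continuous_onI continuous_intros F.continuous_F G.continuous_F)
 obtain \<delta> where \<delta>: "0 < \<delta>" "(\<Union>x\<in>K. cball x \<delta>) \<subseteq> W"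
  using compact_subset_open_imp_cball_epsilon_subset[OF K(1) W K(2)] by blast
 define W' where "W' = (\<Union>x\<in>K. cball x \<delta>)"
 have W'eq: "W' = (%(x, y). x + y) ` (K \<times> cball 0 \<delta>)"
 proof (intro set_eqI iffI)
  fix z assume "z : W'"
  then obtain x where "x : K" "norm (z - x) <= \<delta>" by (auto simp: W'_def dist_norm norm_minus_commute)
  then show "z : (%(x, y). x + y) ` (K \<times> cball 0 \<delta>)" by (intro image_eqI[of _ _ "(x, z - x)"]) auto
 next
  fix z assume "z : (%(x, y). x + y) ` (K \<times> cball 0 \<delta>)"
  then obtain x y where "x : K" "norm y <= \<delta>" "z = x + y" by auto
  then show "z : W'" unfolding W'_def by (intro UN_I[of x]) (simp_all add: dist_norm)
 qed
 have "compact W'" unfolding W'eq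
  by (intro compact_continuous_image compact_Times K(1) compact_cball) (auto intro!: continuous_intros simp: case_prod_unfold)
 then have W'[measurable]: "W' : sets borel" and W'fin: "vol W' < \<infinity>" using emeasure_compact_finite by (simp add: borel_compact, blast)
 define S where "S m x = real (Suc m) * dist (G (x + (1 / real (Suc m)) *\<^sub>R b)) (G x)" for m x
 have S[measurable]: "S m : borel_measurable borel" for m unfolding S_def by measurable
 define I where "I = sint K (%x. ennreal (mslope G b x))"
 have Slim: "(%m. sint K (%x. ennreal (S m x))) \<longlonglongrightarrow> I"
  unfolding S_def I_def by (rule G.scaled_integral_tendsto[OF G(2) _ Kfin]) simp
 have Ifin: "I < \<infinity>"
 proof -
  have "I <= sint K (%x. ennreal (C * norm b))"
   unfolding I_def using G(2) G.mslope_le by (intro nn_integral_mono_AE) (auto intro!: mult_right_mono ennreal_leI elim!: eventually_mono)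
  also have "... < \<infinity>" using Kfin by (simp add: nn_integral_cmult ennreal_mult_less_top)
  finally show ?thesis .
 qed
 define \<eta>' where "\<eta>' = \<eta> / (4 * (C * norm b + 1))"
 have Cb: "0 <= C * norm b" using G.C0 by simp
 have \<eta>': "0 < \<eta>'" "C * norm b * \<eta>' <= \<eta> / 4"
 proof -
  have 1: "0 < C * norm b + 1" using Cb by simp
  then show "0 < \<eta>'" using \<eta> by (simp add: \<eta>'_def)
  have "(C * norm b + 1) * \<eta>' = \<eta> / 4" using 1 unfolding \<eta>'_def by (auto simp: divide_simps)
  then show "C * norm b * \<eta>' <= \<eta> / 4" using \<open>0 < \<eta>'\<close> by (simp add: algebra_simps)
 qed
 obtain d where d: "0 < d" "!!w. norm w < d ==> vol {x : K. x + w ~: K} < ennreal \<eta>'" by (rule compact_translate_small[OF K(1) \<eta>'(1)]) blast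
 have ev1: "\<forall>\<^sub>F m in sequentially. I < sint K (%x. ennreal (S m x)) + ennreal (\<eta>/4)"
 proof -
  have "(%m. (sint K (%x. ennreal (S m x))) + ennreal (\<eta>/4)) \<longlonglongrightarrow> I + ennreal (\<eta>/4)"
   by (intro tendsto_add Slim tendsto_const)
  moreover have "I < I + ennreal (\<eta>/4)" using Ifin \<eta> by (cases I) (auto simp: ennreal_plus[symmetric] ennreal_less_iff simp del: ennreal_plus)
  ultimately show ?thesis by (rule order_tendstoD(1))
 qed
 have "(%m. norm ((1 / real (Suc m)) *\<^sub>R b)) \<longlonglongrightarrow> norm (0 *\<^sub>R b)"
  using LIMSEQ_inverse_real_of_nat by (intro tendsto_intros) (simp add: inverse_eq_divide)
 then have ev2: "\<forall>\<^sub>F m in sequentially. norm ((1 / real (Suc m)) *\<^sub>R b) < min d \<delta>"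
  by (rule order_tendstoD) (use d \<delta> in simp)
 \<comment> \<open>The step is fixed before \<open>n\<close>, so the factor \<open>N\<close> in
   front of the L1 error is a constant.\<close>
 obtain m where m: "I < sint K (%x. ennreal (S m x)) + ennreal (\<eta>/4)"
  "norm ((1 / real (Suc m)) *\<^sub>R b) < min d \<delta>" using eventually_conj[OF ev1 ev2] by (auto simp: eventually_sequentially)
 define N w where "N = real (Suc m)" and "w = (1 / N) *\<^sub>R b"
 have N: "0 < N" by (simp add: N_def)
 \<comment> \<open>Convergence is known on \<open>K\<close> only, so both ends of the step have to
   lie in \<open>K\<close>; the loss is a set of measure below \<open>\<eta>'\<close>.\<close>
 define Kt where "Kt = {x : K. x + w : K}"
 have Kt[measurable]: "Kt : sets borel" unfolding Kt_def by measurable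
 have SK: "sint K (%x. ennreal (S m x)) <= sint Kt (%x. ennreal (S m x)) + ennreal (\<eta>/4)"
 proof -
  have "sint K (%x. ennreal (S m x))
    <= lint (%x. ennreal (S m x) * indicator Kt x + ennreal (C * norm b) * indicator (K - Kt) x)"
   using G.scaled_dist_le[of m _ b] by (intro nn_integral_mono) (auto simp: indicator_def S_def Kt_def intro!: ennreal_leI)
  also have "... = sint Kt (%x. ennreal (S m x)) + ennreal (C * norm b) * vol (K - Kt)" by (simp add: nn_integral_add nn_integral_cmult)
  also have "vol (K - Kt) <= ennreal \<eta>'"
  proof -
   have "K - Kt = {x : K. x + w ~: K}" by (auto simp: Kt_def)
   then show ?thesis using d(2)[of w] m(2) by (simp add: w_def N_def)
  qed
  then have "ennreal (C * norm b) * vol (K - Kt) <= ennreal (C * norm b) * ennreal \<eta>'" by (rule mult_left_mono) simp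
  also have "... = ennreal (C * norm b * \<eta>')" using Cb \<eta>' by (simp add: ennreal_mult)
  also have "... <= ennreal (\<eta>/4)" using \<eta>' by (intro ennreal_leI)
  finally show ?thesis by (simp add: add_left_mono)
 qed
 have "0 < \<eta> / (4 * N)" using \<eta> N by simp
 from L1_of_Lp_tendsto[OF p _ Kfin dm _ lim this]
 have "\<forall>\<^sub>F n in sequentially. (sint K (%x. ennreal (dist (F n x) (G x)))) < ennreal (\<eta> / (4 * N))" by simp
 then show ?thesis
 proof eventually_elim
  case (elim n)
  define J where "J = sint K (%x. ennreal (dist (F n x) (G x)))"
  have "sint Kt (%x. ennreal (S m x)) <= lint (%x. ennreal N * (ennreal (dist (F n (x + w)) (G (x + w))) * indicator K (x + w)
    + ennreal (dist (F n x) (G x)) * indicator K x + ennreal (dist (F n (x + w)) (F n x)) * indicator K x))"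
  proof (rule nn_integral_mono)
   fix x
   show "ennreal (S m x) * indicator Kt x <= ennreal N * (ennreal (dist (F n (x + w)) (G (x + w))) * indicator K (x + w)
    + ennreal (dist (F n x) (G x)) * indicator K x + ennreal (dist (F n (x + w)) (F n x)) * indicator K x)"
   proof (cases "x : Kt")
    case True
    have "dist (G (x + w)) (G x) <= dist (F n (x + w)) (G (x + w)) + dist (F n x) (G x) + dist (F n (x + w)) (F n x)"
     using dist_triangle[of "G (x + w)" "G x" "F n (x + w)"] dist_triangle[of "F n (x + w)" "G x" "F n x"] by (simp add: dist_commute)
    then have "S m x <= N * (dist (F n (x + w)) (G (x + w)) + dist (F n x) (G x) + dist (F n (x + w)) (F n x))"
     using N by (simp add: S_def w_def N_def mult_left_mono)
    then have "ennreal (S m x) <= ennreal (N * (dist (F n (x + w)) (G (x + w)) + dist (F n x) (G x) + dist (F n (x + w)) (F n x)))"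
     by (rule ennreal_leI)
    then show ?thesis using True N by (simp add: Kt_def ennreal_mult)
   qed simp
  qed
  also have "... = ennreal N * (J + J + sint K (%x. ennreal (dist (F n (x + w)) (F n x))))"
  proof -
   have "lint (%x. ennreal (dist (F n (x + w)) (G (x + w))) * indicator K (x + w)) = J"
    unfolding J_def by (rule nn_integral_lborel_translate[where f = "%x. ennreal (dist (F n x) (G x)) * indicator K x"]) measurable
   moreover have [measurable]: "(%x. dist (F n (x + w)) (G (x + w))) : borel_measurable borel" by (rule measurable_compose[OF _ dm]) measurable
   ultimately show ?thesis by (simp add: nn_integral_cmult nn_integral_add J_def)
  qed
  also have "sint K (%x. ennreal (dist (F n (x + w)) (F n x))) <= sint W' (%x. ennreal (mslope (F n) w x))"
  proof (rule F.dist_shift_integral_le[OF F(2) _ W' W'fin])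
   fix x and s :: real assume x: "x : K" "0 <= s" "s <= 1"
   have "norm (s *\<^sub>R w) <= 1 * norm w" unfolding norm_scaleR using x by (intro mult_right_mono) auto
   also have "... <= \<delta>" using m(2) by (simp add: w_def N_def)
   finally show "x + s *\<^sub>R w : W'" using x unfolding W'_def by (auto simp: dist_norm intro!: bexI[of _ x])
  qed simp
  also have "sint W' (%x. ennreal (mslope (F n) w x)) = lint (%x. ennreal (1 / N) * (ennreal (mslope (F n) b x) * indicator W' x))"
  proof (rule nn_integral_cong_AE)
   show "AE x in lborel. ennreal (mslope (F n) w x) * indicator W' x = ennreal (1 / N) * (ennreal (mslope (F n) b x) * indicator W' x)"
    using F(2)[of n]
   proof eventually_elim
    case (elim x)
    have "mslope (F n) w x = 1 / N * mslope (F n) b x" unfolding w_def by (rule mslope_scale[OF elim]) (use N in simp)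
    then have "ennreal (mslope (F n) w x) = ennreal (1 / N) * ennreal (mslope (F n) b x)"
     using N mslope_nonneg[OF elim, of b] by (simp only: ennreal_mult[symmetric]) (simp add: ennreal_mult[symmetric])
    then show ?case by (simp add: mult.assoc)
   qed
  qed
  also have "... = ennreal (1 / N) * sint W' (%x. ennreal (mslope (F n) b x))" by (rule nn_integral_cmult) measurable
  finally have "sint Kt (%x. ennreal (S m x))
   <= ennreal N * (J + J + ennreal (1 / N) * sint W' (%x. ennreal (mslope (F n) b x)))" by (simp add: add_left_mono mult_left_mono)
  also have "... <= ennreal N * (ennreal (\<eta> / (4 * N)) + ennreal (\<eta> / (4 * N)) + ennreal (1 / N) * sint W (%x. ennreal (mslope (F n) b x)))"
  proof -
   have "J <= ennreal (\<eta> / (4 * N))" using elim by (simp add: J_def)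
   moreover have "sint W' (%x. ennreal (mslope (F n) b x)) <= sint W (%x. ennreal (mslope (F n) b x))"
    using \<delta>(2)[folded W'_def] by (intro nn_integral_mono mult_left_mono) (auto simp: indicator_def)
   ultimately show ?thesis by (intro mult_left_mono add_mono) auto
  qed
  also have "... = ennreal (\<eta>/2) + sint W (%x. ennreal (mslope (F n) b x))"
  proof -
   have "ennreal N * (ennreal (\<eta> / (4 * N)) + ennreal (\<eta> / (4 * N))) = ennreal (\<eta>/2)"
    using N \<eta> by (simp add: ennreal_mult[symmetric] ennreal_plus[symmetric] del: ennreal_plus)
   moreover have "ennreal N * (ennreal (1 / N) * X) = X" for X using N by (simp add: mult.assoc[symmetric] ennreal_mult[symmetric])
   ultimately show ?thesis by (simp add: distrib_left[of "ennreal N"])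
  qed
  finally have X: "sint Kt (%x. ennreal (S m x)) <= ennreal (\<eta>/2) + sint W (%x. ennreal (mslope (F n) b x))" .
  have "I <= sint K (%x. ennreal (S m x)) + ennreal (\<eta>/4)" using m(1) by (rule less_imp_le)
  also have "... <= (sint Kt (%x. ennreal (S m x)) + ennreal (\<eta>/4)) + ennreal (\<eta>/4)" by (rule add_right_mono[OF SK])
  also have "... <= ((ennreal (\<eta>/2) + sint W (%x. ennreal (mslope (F n) b x))) + ennreal (\<eta>/4)) + ennreal (\<eta>/4)"
   by (intro add_right_mono X)
  also have "... = sint W (%x. ennreal (mslope (F n) b x)) + (ennreal (\<eta>/2) + ennreal (\<eta>/4) + ennreal (\<eta>/4))" by (simp add: add_ac)
  also have "ennreal (\<eta>/2) + ennreal (\<eta>/4) + ennreal (\<eta>/4) = ennreal \<eta>"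
   using \<eta> by (simp add: ennreal_plus[symmetric] del: ennreal_plus)
  finally show ?case by (simp add: I_def)
 qed
qed

text \<open>Open Voronoi cells. Empty sets are left out of the comparison because
  \<open>infdist\<close> to the empty set is 0.\<close>

lemma compact_disjoint_neighbourhoods:
 fixes E :: "'i => 'e::euclidean_space set"
 assumes I: "finite I" and E: "!!i. i : I ==> compact (E i)" and dis: "disjoint_family_on E I"
 obtains W where "!!i. i : I ==> open (W i)" "!!i. i : I ==> E i \<subseteq> W i" "disjoint_family_on W I"
proof -
 define W where "W i = (if E i = {} then {} else
   (\<Inter>j\<in>{j : I - {i}. E j ~= {}}. {x. infdist x (E i) < infdist x (E j)}))" for i
 show ?thesis
 proof (rule that[of W])
  show "open (W i)" if "i : I" for i unfolding W_def using I by (auto intro!: open_INT open_Collect_less continuous_intros)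
  show "E i \<subseteq> W i" if i: "i : I" for i
  proof
   fix x assume x: "x : E i"
   have "infdist x (E i) < infdist x (E j)" if j: "j : I" "j ~= i" "E j ~= {}" for j
   proof -
    have "x ~: E j" using dis x i j by (auto simp: disjoint_family_on_def)
    then have "0 < infdist x (E j)" using E[OF j(1)] j(3) by (intro infdist_pos_not_in_closed) (auto simp: compact_imp_closed)
    then show ?thesis using x by simp
   qed
   then show "x : W i" using x by (auto simp: W_def)
  qed
  show "disjoint_family_on W I"
   unfolding disjoint_family_on_def
  proof (intro ballI impI)
   fix i j assume ij: "i : I" "j : I" "i ~= j"
   show "W i Int W j = {}"
   proof (rule ccontr)
    assume "W i Int W j ~= {}"
    then obtain x where x: "x : W i" "x : W j" by blast
    then have ne: "E i ~= {}" "E j ~= {}" by (auto simp: W_def split: if_splits)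
    have "infdist x (E i) < infdist x (E j)" using x(1) ne ij unfolding W_def by auto
    moreover have "infdist x (E j) < infdist x (E i)" using x(2) ne ij unfolding W_def by auto
    ultimately show False by simp
   qed
  qed
 qed
qed

lemma borel_mgrad: "lipmap F C ==> mgrad F : borel_measurable borel"
proof -
 assume "lipmap F C"
 then interpret lipmap F C .
 show ?thesis unfolding mgrad_def by measurable
qed

text \<open>The p-energy is recovered from the linear directional bounds by duality: with
  \<open>k i\<close> the derivative of \<open>norm\<close> to the power \<open>p\<close> at
  \<open>s i\<close>, divided by \<open>p\<close>, Young's inequality bounds the inner product of
  \<open>k i\<close> with the slope vector by an energy density plus a constant. Disjoint
  neighbourhoods of nearly the measure of \<open>E i\<close> let the local energies add up to at
  most \<open>c\<close>.\<close>

lemma lsc_step: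
 fixes F :: "nat => 'e::euclidean_space => 'z::metric_space"
 assumes p: "1 < p" and V: "open V"
  and G: "!!i. i : I ==> lipmap (G i) (CG i)" "!!i. i : I ==> AE x in lborel. mdiff (G i) x"
  and F: "!!n. lipmap (F n) (CF n)" "!!n. AE x in lborel. mdiff (F n) x"
  and I: "finite I" and E: "!!i. i : I ==> compact (E i)" "!!i. i : I ==> E i \<subseteq> V" "disjoint_family_on E I"
  and lim: "!!i. i : I ==> (%n. pint p (E i) (%x. dist (F n x) (G i x))) \<longlonglongrightarrow> 0"
  and s0: "!!i b. i : I ==> b : Basis ==> 0 <= s i \<bullet> b"
  and s: "!!i. i : I ==> AE x in lborel. x : E i --> (ALL b:Basis. s i \<bullet> b <= mslope (G i) b x)"
  and c: "\<exists>\<^sub>F n in sequentially. (pint p V (%x. norm (mgrad (F n) x))) <= ennreal c" "0 <= c"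
 shows "(SUM i:I. norm (s i) powr p * measure lborel (E i)) <= c"
proof -
 have Vb[measurable]: "V : sets borel" using V by simp
 have Eb[measurable]: "E i : sets borel" if "i : I" for i using E(1)[OF that] by (simp add: borel_compact)
 have Efin: "vol (E i) < \<infinity>" if "i : I" for i using E(1)[OF that] by (rule emeasure_compact_finite)
 have Fm[measurable]: "mgrad (F n) : borel_measurable borel" for n by (rule borel_mgrad[OF F(1)])
 have Fs[measurable]: "mslope (F n) b : borel_measurable borel" for n b by (rule lipmap.borel_mslope[OF F(1)])
 \<comment> \<open>This vector gives equality in Young's inequality at \<open>s i\<close>, so no
   constant is lost.\<close>
 define k where "k i = norm (s i) powr (p - 2) *\<^sub>R s i" for i
 have k0: "0 <= k i \<bullet> b" if "i : I" "b : Basis" for i b using s0[OF that] by (simp add: k_def)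
 have ks: "k i \<bullet> s i = norm (s i) powr p" for i
 proof (cases "s i = 0")
  case False
  have "k i \<bullet> s i = norm (s i) powr (p - 2) * norm (s i) powr 2" using False by (simp add: k_def power2_norm_eq_inner[symmetric] powr_numeral)
  also have "... = norm (s i) powr p" unfolding powr_add[symmetric] by simp
  finally show ?thesis .
 qed (simp add: k_def)
 have nk: "norm (k i) = norm (s i) powr (p - 1)" for i
 proof (cases "s i = 0")
  case False
  have "norm (k i) = norm (s i) powr (p - 2) * norm (s i) powr 1" using False by (simp add: k_def)
  also have "... = norm (s i) powr (p - 1)" unfolding powr_add[symmetric] by simp
  finally show ?thesis .
 qed (simp add: k_def)
 define M where "M = (SUM i:I. (SUM b:Basis. k i \<bullet> b) + norm (s i) powr p)"
 have key: "(SUM i:I. norm (s i) powr p * measure lborel (E i)) <= c + p * (\<eta> * M)" if \<eta>: "0 < \<eta>" for \<eta>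
 proof -
  obtain W0 where W0: "!!i. i : I ==> open (W0 i)" "!!i. i : I ==> E i \<subseteq> W0 i" "disjoint_family_on W0 I"
   by (rule compact_disjoint_neighbourhoods[OF I E(1) E(3)]) blast+
  have "EX U. open U & E i \<subseteq> U & vol (U - E i) < ennreal \<eta>" if "i : I" for i
   by (rule outer_regular_lborel[OF Eb[OF that] \<eta>]) blast
  then obtain U where U: "!!i. i : I ==> open (U i)" "!!i. i : I ==> E i \<subseteq> U i"
   "!!i. i : I ==> vol (U i - E i) < ennreal \<eta>" by metis
  define W where "W i = W0 i Int U i Int V" for i
  have W: "open (W i)" "E i \<subseteq> W i" "W i \<subseteq> V" if "i : I" for i
  proof -
   show "open (W i)" using W0(1)[OF that] U(1)[OF that] V unfolding W_def by (intro open_Int)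
   show "E i \<subseteq> W i" "W i \<subseteq> V" using W0(2)[OF that] U(2)[OF that] E(2)[OF that] unfolding W_def by blast+
  qed
  have Wb[measurable]: "W i : sets borel" if "i : I" for i using W(1)[OF that] by simp
  have disW: "disjoint_family_on W I" using W0(3) by (auto simp: W_def disjoint_family_on_def)
  have mW: "vol (W i) <= ennreal (measure lborel (E i) + \<eta>)" if i: "i : I" for i
  proof -
   have "vol (W i) <= vol (E i Un (U i - E i))" using U(1)[OF i] Eb[OF i] by (intro emeasure_mono) (auto simp: W_def)
   also have "... <= vol (E i) + vol (U i - E i)" using U(1)[OF i] Eb[OF i] by (intro emeasure_subadditive) auto
   also have "... <= ennreal (measure lborel (E i)) + ennreal \<eta>"
    using U(3)[OF i] Efin[OF i] by (intro add_mono) (auto simp: emeasure_eq_ennreal_measure less_top)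
   finally show ?thesis using \<eta> by simp
  qed
  have "ALL i:I. ALL b:(Basis::'e set). \<forall>\<^sub>F n in sequentially. (sint (E i) (%x. ennreal (mslope (G i) b x)))
      <= sint (W i) (%x. ennreal (mslope (F n) b x)) + ennreal \<eta>" using lsc_directional[OF p G F E(1) W(2) W(1) lim \<eta>] by blast
  then have "\<forall>\<^sub>F n in sequentially. ALL i:I. ALL b:(Basis::'e set). (sint (E i) (%x. ennreal (mslope (G i) b x)))
      <= sint (W i) (%x. ennreal (mslope (F n) b x)) + ennreal \<eta>" using I by (simp add: eventually_ball_finite)
  \<comment> \<open>One index \<open>n\<close> has to satisfy all the directional bounds and the
    energy bound at once; finiteness of \<open>I\<close> and of the basis makes this
    possible.\<close>
  from frequently_ex[OF frequently_eventually_conj[OF c(1) this]] obtain n where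
   n: "!!i b. i : I ==> b : Basis ==> sint (E i) (%x. ennreal (mslope (G i) b x))
      <= sint (W i) (%x. ennreal (mslope (F n) b x)) + ennreal \<eta>"
   and nc: "pint p V (%x. norm (mgrad (F n) x)) <= ennreal c" by blast
  define X where "X i = pint p (W i) (%x. norm (mgrad (F n) x))" for i
  have sumX: "(SUM i:I. X i) <= ennreal c"
  proof -
   have "(SUM i:I. X i) = lint (%x. (SUM i:I. ennreal (norm (mgrad (F n) x) powr p) * indicator (W i) x))"
    unfolding X_def by (rule nn_integral_sum[symmetric]) measurable
   also have "... <= pint p V (%x. norm (mgrad (F n) x))"
   proof (rule nn_integral_mono)
    fix x
    show "(SUM i:I. ennreal (norm (mgrad (F n) x) powr p) * indicator (W i) x)
      <= ennreal (norm (mgrad (F n) x) powr p) * indicator V x"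
    proof (cases "EX i:I. x : W i")
     case True
     then obtain i where i: "i : I" "x : W i" by blast
     have "(SUM j:I. ennreal (norm (mgrad (F n) x) powr p) * indicator (W j) x)
       = (SUM j:{i}. ennreal (norm (mgrad (F n) x) powr p) * indicator (W j) x)"
      using i I disW by (intro sum.mono_neutral_right) (auto simp: disjoint_family_on_def indicator_def)
     then show ?thesis using i W(3)[OF i(1)] by (auto simp: indicator_def)
    next
     case False
     then show ?thesis by (simp add: indicator_def cong: sum.cong)
    qed
   qed
   finally show ?thesis using nc by simp
  qed
  have Xfin: "X i < \<infinity>" if "i : I" for i
  proof -
   have "X i <= (SUM i:I. X i)" using I that by (intro member_le_sum) auto
   also have "... <= ennreal c" by (rule sumX)
   finally show ?thesis by (auto intro: le_less_trans)
  qed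
  have step: "norm (s i) powr p * measure lborel (E i) <= enn2real (X i) + p * (\<eta> * ((SUM b:Basis. k i \<bullet> b) + norm (s i) powr p))"
   if i: "i : I" for i
  proof -
   note [measurable] = Wb[OF i] Eb[OF i]
   define Sk where "Sk = (SUM b:Basis. k i \<bullet> b)"
   have Sk: "0 <= Sk" using k0[OF i] by (simp add: Sk_def sum_nonneg)
   obtain x where x: "X i = ennreal x" "0 <= x" using Xfin[OF i] by (cases "X i") auto
   define mE where "mE = measure lborel (E i)"
   have "ennreal (norm (s i) powr p * mE) = (SUM b:Basis. ennreal ((k i \<bullet> b) * (s i \<bullet> b) * mE))"
    using k0[OF i] s0[OF i] by (subst sum_ennreal)
     (auto simp: mE_def ks[symmetric] euclidean_inner[of "k i" "s i"] sum_distrib_right)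
   also have "... <= (SUM b:Basis. ennreal (k i \<bullet> b) * (sint (W i) (%x. ennreal (mslope (F n) b x)) + ennreal \<eta>))"
   proof (rule sum_mono)
    fix b :: 'e assume b: "b : Basis"
    have "ennreal ((s i \<bullet> b) * mE) = sint (E i) (%x. ennreal (s i \<bullet> b))"
     using Efin[OF i] s0[OF i b] by (simp add: nn_integral_cmult mE_def ennreal_mult emeasure_eq_ennreal_measure less_top)
    also have "... <= sint (E i) (%x. ennreal (mslope (G i) b x))"
     using s[OF i] by (intro nn_integral_mono_AE) (auto simp: indicator_def b intro!: ennreal_leI elim!: eventually_mono)
    also have "... <= sint (W i) (%x. ennreal (mslope (F n) b x)) + ennreal \<eta>" by (rule n[OF i b])
    finally have "ennreal (k i \<bullet> b) * ennreal ((s i \<bullet> b) * mE)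
     <= ennreal (k i \<bullet> b) * (sint (W i) (%x. ennreal (mslope (F n) b x)) + ennreal \<eta>)" by (rule mult_left_mono) simp
    then show "ennreal ((k i \<bullet> b) * (s i \<bullet> b) * mE)
     <= ennreal (k i \<bullet> b) * (sint (W i) (%x. ennreal (mslope (F n) b x)) + ennreal \<eta>)"
     using k0[OF i b] s0[OF i b] by (simp add: ennreal_mult'[symmetric] mult.assoc mE_def)
   qed
   also have "... = (SUM b:Basis. ennreal (k i \<bullet> b) * sint (W i) (%x. ennreal (mslope (F n) b x))) + ennreal (\<eta> * Sk)"
    using k0[OF i] \<eta> by (simp add: distrib_left sum.distrib ennreal_mult'[symmetric] sum_ennreal Sk_def sum_distrib_left mult.commute)
   also have "(SUM b:Basis. ennreal (k i \<bullet> b) * sint (W i) (%x. ennreal (mslope (F n) b x)))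
    = lint (%x. (SUM b:Basis. ennreal (k i \<bullet> b) * (ennreal (mslope (F n) b x) * indicator (W i) x)))"
    by (subst nn_integral_sum) (measurable, simp add: nn_integral_cmult)
   also have "... <= lint (%x. ennreal (1 / p) * (ennreal (norm (mgrad (F n) x) powr p) * indicator (W i) x)
      + ennreal ((1 - 1 / p) * norm (s i) powr p) * indicator (W i) x)"
   proof (rule nn_integral_mono_AE)
    show "AE x in lborel. (SUM b:Basis. ennreal (k i \<bullet> b) * (ennreal (mslope (F n) b x) * indicator (W i) x))
     <= ennreal (1 / p) * (ennreal (norm (mgrad (F n) x) powr p) * indicator (W i) x)
      + ennreal ((1 - 1 / p) * norm (s i) powr p) * indicator (W i) x"
     using F(2)[of n]
    proof eventually_elim
     case (elim x)
     have "(SUM b:Basis. (k i \<bullet> b) * mslope (F n) b x) = k i \<bullet> mgrad (F n) x" by (simp add: euclidean_inner[of "k i" "mgrad (F n) x"])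
     also have "... <= norm (k i) * norm (mgrad (F n) x)" by (rule norm_cauchy_schwarz)
     also have "... <= norm (mgrad (F n) x) powr p / p + (1 - 1 / p) * norm (s i) powr p" unfolding nk by (rule real_young[OF p]) auto
     finally have "ennreal (SUM b:Basis. (k i \<bullet> b) * mslope (F n) b x)
      <= ennreal (1 / p * norm (mgrad (F n) x) powr p + (1 - 1 / p) * norm (s i) powr p)" by (intro ennreal_leI) simp
     also have "... = ennreal (1 / p * norm (mgrad (F n) x) powr p) + ennreal ((1 - 1 / p) * norm (s i) powr p)" using p by (intro ennreal_plus) auto
     also have "ennreal (1 / p * norm (mgrad (F n) x) powr p) = ennreal (1 / p) * ennreal (norm (mgrad (F n) x) powr p)"
      using p by (intro ennreal_mult) auto
     also have "ennreal (SUM b:Basis. (k i \<bullet> b) * mslope (F n) b x) = (SUM b:Basis. ennreal (k i \<bullet> b) * ennreal (mslope (F n) b x))"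
      using k0[OF i] mslope_nonneg[OF elim] by (subst sum_ennreal[symmetric]) (auto simp: ennreal_mult)
     finally show ?case by (cases "x : W i") auto
    qed
   qed
   also have "... = ennreal (1 / p) * X i + ennreal ((1 - 1 / p) * norm (s i) powr p) * vol (W i)"
    by (simp add: nn_integral_add nn_integral_cmult X_def)
   also have "... <= ennreal (1 / p) * X i + ennreal ((1 - 1 / p) * norm (s i) powr p) * ennreal (mE + \<eta>)"
    using mW[OF i] by (intro add_left_mono mult_left_mono) (auto simp: mE_def)
   also have "... = ennreal (1 / p * x + (1 - 1 / p) * norm (s i) powr p * (mE + \<eta>))"
   proof -
    have "ennreal (1 / p) * X i = ennreal (1 / p * x)" unfolding x(1) using p x by (intro ennreal_mult[symmetric]) auto
    moreover have "ennreal ((1 - 1 / p) * norm (s i) powr p) * ennreal (mE + \<eta>)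
      = ennreal ((1 - 1 / p) * norm (s i) powr p * (mE + \<eta>))" using p \<eta> by (intro ennreal_mult[symmetric]) (auto simp: mE_def)
    ultimately show ?thesis using p x \<eta> by (simp add: mE_def del: ennreal_plus) (subst ennreal_plus, auto)
   qed
   finally have "ennreal (norm (s i) powr p * mE) <= ennreal (1 / p * x + (1 - 1 / p) * norm (s i) powr p * (mE + \<eta>)) + ennreal (\<eta> * Sk)"
    by (simp add: add_right_mono)
   then have "ennreal (norm (s i) powr p * mE) <= ennreal (1 / p * x + (1 - 1 / p) * norm (s i) powr p * (mE + \<eta>) + \<eta> * Sk)"
    using p x \<eta> Sk by (subst ennreal_plus) (auto simp: mE_def)
   then have r: "norm (s i) powr p * mE <= 1 / p * x + (1 - 1 / p) * norm (s i) powr p * (mE + \<eta>) + \<eta> * Sk"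
    using p x \<eta> Sk by (subst (asm) ennreal_le_iff) (auto simp: mE_def)
   have "(1 - 1 / p) * (norm (s i) powr p * \<eta>) <= 1 * (norm (s i) powr p * \<eta>)" using p \<eta> by (intro mult_right_mono) auto
   moreover have "(1 - 1 / p) * norm (s i) powr p * (mE + \<eta>)
     = norm (s i) powr p * mE - norm (s i) powr p * mE * (1 / p) + (1 - 1 / p) * (norm (s i) powr p * \<eta>)"
    by (simp add: algebra_simps add_divide_distrib)
   moreover have "\<eta> * (Sk + norm (s i) powr p) = \<eta> * Sk + norm (s i) powr p * \<eta>" by (simp add: algebra_simps)
   ultimately have "norm (s i) powr p * mE * (1 / p) <= 1 / p * x + \<eta> * (Sk + norm (s i) powr p)" using r by linarith
   then have "p * (norm (s i) powr p * mE * (1 / p)) <= p * (1 / p * x + \<eta> * (Sk + norm (s i) powr p))" using p by (intro mult_left_mono) auto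
   then show ?thesis using p x by (simp add: distrib_left mE_def Sk_def)
  qed
  have "(SUM i:I. norm (s i) powr p * measure lborel (E i))
    <= (SUM i:I. enn2real (X i) + p * (\<eta> * ((SUM b:Basis. k i \<bullet> b) + norm (s i) powr p)))" by (intro sum_mono step)
  also have "... = (SUM i:I. enn2real (X i)) + p * (\<eta> * M)" unfolding M_def sum_distrib_left by (rule sum.distrib)
  also have "(SUM i:I. enn2real (X i)) <= c"
  proof -
   have "ennreal (SUM i:I. enn2real (X i)) = (SUM i:I. X i)" using Xfin by (subst sum_ennreal[symmetric]) (auto intro!: sum.cong)
   then show ?thesis using sumX c(2) by (metis ennreal_le_iff)
  qed
  finally show ?thesis by simp
 qed
 have "((%\<eta>. c + p * (\<eta> * M)) \<longlongrightarrow> c + p * (0 * M)) (at_right 0)" by (intro tendsto_intros)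
 then have "((%\<eta>. c + p * (\<eta> * M)) \<longlongrightarrow> c) (at_right 0)" by simp
 then show ?thesis by (rule tendsto_lowerbound) (auto intro: eventually_mono[OF eventually_at_right_less] key)
qed

section \<open>Simple functions below the slopes\<close>

text \<open>Rounds the positive part down to the grid of mesh 1/k and truncates at \<open>k\<close>;
  the value for \<open>k = 0\<close> is 0.\<close>

definition dyad :: "nat => real => real" where
 "dyad k t = min (real k) (real_of_int \<lfloor>real k * max 0 t\<rfloor> / real k)"

lemma borel_dyad [measurable]: "dyad k : borel_measurable borel" unfolding dyad_def by measurable

lemma dyad_nonneg: "0 <= dyad k t" by (simp add: dyad_def)

lemma dyad_le: "0 <= t ==> dyad k t <= t"
proof -
 assume t: "0 <= t"
 show ?thesis
 proof (cases "k = 0")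
  case False
  have "real_of_int \<lfloor>real k * t\<rfloor> <= real k * t" by (rule of_int_floor_le)
  then have "real_of_int \<lfloor>real k * t\<rfloor> / real k <= t" using False by (simp add: field_simps)
  then show ?thesis using t by (simp add: dyad_def)
 qed (use t in "simp add: dyad_def")
qed

lemma dyad_range: "dyad k t : (%j. real j / real k) ` {..k * k}"
proof (cases "k = 0")
 case True
 then show ?thesis by (simp add: dyad_def)
next
 case False
 define j where "j = nat \<lfloor>real k * max 0 t\<rfloor>"
 have j: "real_of_int \<lfloor>real k * max 0 t\<rfloor> = real j" by (simp add: j_def)
 show ?thesis
 proof (cases "j <= k * k")
  case True
  have "real j <= real k * real k" using True by (metis of_nat_le_iff of_nat_mult)
  then have "real j / real k <= real k" using False by (simp add: field_simps)
  then show ?thesis using True by (intro image_eqI[of _ _ j]) (auto simp: dyad_def j)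
 next
  case n: False
  have "real k * real k <= real j" using n by (metis of_nat_le_iff of_nat_mult nat_le_linear)
  then have "real k <= real j / real k" using False by (simp add: field_simps)
  then show ?thesis using False by (intro image_eqI[of _ _ "k * k"]) (auto simp: dyad_def j)
 qed
qed

lemma dyad_tendsto: "0 <= t ==> (%k. dyad k t) \<longlonglongrightarrow> t"
proof -
 assume t: "0 <= t"
 have "(%k. 1 / real k) \<longlonglongrightarrow> 0" by (rule lim_1_over_n)
 moreover have "\<forall>\<^sub>F k in sequentially. norm (dyad k t - t) <= 1 / real k"
 proof -
  obtain k0 where "t < real k0" using reals_Archimedean2 by blast
  have "norm (dyad k t - t) <= 1 / real k" if "max 1 k0 <= k" for k
  proof -
   have k: "0 < real k" "t <= real k" using that \<open>t < real k0\<close> by auto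
   have 1: "real_of_int \<lfloor>real k * t\<rfloor> / real k <= t" using of_int_floor_le[of "real k * t"] k by (simp add: field_simps)
   have "real k * t < real_of_int \<lfloor>real k * t\<rfloor> + 1" by (rule real_of_int_floor_add_one_gt)
   then have "t < (real_of_int \<lfloor>real k * t\<rfloor> + 1) / real k" using k by (simp add: field_simps)
   then have 2: "t - 1 / real k <= real_of_int \<lfloor>real k * t\<rfloor> / real k" by (simp add: add_divide_distrib)
   have "dyad k t = real_of_int \<lfloor>real k * t\<rfloor> / real k" using t k 1 by (simp add: dyad_def)
   then show ?thesis using 1 2 by (simp add: abs_le_iff)
  qed
  then show ?thesis unfolding eventually_sequentially by blast
 qed
 ultimately have "(%k. dyad k t - t) \<longlonglongrightarrow> 0" by (rule Lim_null_comparison[rotated])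
 then show ?thesis by (rule Lim_null[THEN iffD2])
qed

definition dyadv :: "nat => 'e::euclidean_space => 'e" where
 "dyadv k y = (SUM b:Basis. dyad k (y \<bullet> b) *\<^sub>R b)"

lemma borel_dyadv [measurable]: "dyadv k : borel_measurable borel" unfolding dyadv_def by measurable

lemma dyadv_inner: "b : Basis ==> dyadv k y \<bullet> b = dyad k (y \<bullet> b)" by (simp add: dyadv_def)

lemma finite_range_dyadv: "finite (range (dyadv k :: 'e::euclidean_space => 'e))"
proof (rule finite_subset)
 show "range (dyadv k :: 'e => 'e) \<subseteq> (%r. SUM b:Basis. r b *\<^sub>R b) ` (Basis \<rightarrow>\<^sub>E (%j. real j / real k) ` {..k * k})"
 proof safe
  fix y :: 'e
  show "dyadv k y : (%r. SUM b:Basis. r b *\<^sub>R b) ` (Basis \<rightarrow>\<^sub>E (%j. real j / real k) ` {..k * k})"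
   by (rule image_eqI[of _ _ "restrict (%b. dyad k (y \<bullet> b)) Basis"]) (use dyad_range in "auto simp: dyadv_def")
 qed
 show "finite ((%r. SUM b:Basis. r b *\<^sub>R b) ` ((Basis :: 'e set) \<rightarrow>\<^sub>E (%j. real j / real k) ` {..k * k}))"
  by (intro finite_imageI finite_PiE) auto
qed

lemma dyadv_tendsto: "(!!b. b : Basis ==> 0 <= y \<bullet> b) ==> (%k. dyadv k y) \<longlonglongrightarrow> y"
proof -
 assume "!!b. b : Basis ==> 0 <= y \<bullet> b"
 then have "(%k. dyadv k y) \<longlonglongrightarrow> (SUM b:Basis. (y \<bullet> b) *\<^sub>R b)"
  unfolding dyadv_def by (intro tendsto_intros dyad_tendsto)
 then show ?thesis by (simp add: euclidean_representation)
qed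

text \<open>The slopes of \<open>G i\<close> on \<open>P i\<close> are approximated from below by
  finitely many constant vectors on compact sets, and \<open>lsc_step\<close> bounds the energy of
  the approximation. An energy bound that holds infinitely often, with an arbitrary
  \<open>c\<close>, is the form in which a lower limit is later used.\<close>

theorem energy_lower_semicontinuous:
 fixes F :: "nat => 'e::euclidean_space => 'z::metric_space" and e :: "'e => real"
 assumes p: "1 < p" and V: "open V"
  and G: "!!i::nat. lipmap (G i) (CG i)" "!!i. AE x in lborel. mdiff (G i) x"
  and F: "!!n. lipmap (F n) (CF n)" "!!n. AE x in lborel. mdiff (F n) x"
  and P: "!!i. P i : sets borel" "!!i. P i \<subseteq> V" "disjoint_family P"
  and lim: "!!i. (%n. pint p (P i) (%x. dist (F n x) (G i x))) \<longlonglongrightarrow> 0"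
  and e: "AE x\<in>V in lborel. (EX i. x : P i & e x = norm (mgrad (G i) x))"
  and c: "\<exists>\<^sub>F n in sequentially. (pint p V (%x. norm (mgrad (F n) x))) <= ennreal c" "0 <= c"
 shows "pint p V e <= ennreal c"
proof -
 note [measurable] = P(1)
 have Gm[measurable]: "mgrad (G i) : borel_measurable borel" for i by (rule borel_mgrad[OF G(1)])
 have dm[measurable]: "(%x. dist (F n x) (G i x)) : borel_measurable borel" for n i
  by (intro borel_measurable_continuous_onI continuous_intros lipmap.continuous_F[OF F(1)] lipmap.continuous_F[OF G(1)])
 have fin: "lint (%x. (\<Sum>i<m. ennreal (norm (dyadv k (mgrad (G i) x)) powr p) * indicator (P i Int ball 0 (real k)) x)) <= ennreal c" for m k
 proof -
  define R where "R = range (dyadv k :: 'e => 'e)"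
  have R: "finite R" unfolding R_def by (rule finite_range_dyadv)
  define I where "I = {..<m} \<times> R"
  have I: "finite I" using R by (simp add: I_def)
  \<comment> \<open>On \<open>B j\<close> the rounded slope vector is the constant
    \<open>snd j\<close>; inside, a compact set loses measure at most \<eta>, hence at most \<eta> S
    in the sum.\<close>
  define B where "B j = {x : P (fst j) Int ball 0 (real k). dyadv k (mgrad (G (fst j)) x) = snd j}" for j
  have Bm[measurable]: "B j : sets borel" for j unfolding B_def by measurable
  have Bfin: "vol (B j) < \<infinity>" for j
  proof -
   have "vol (B j) <= vol (ball (0::'e) (real k))" by (intro emeasure_mono) (auto simp: B_def)
   then show ?thesis using emeasure_lborel_ball_finite le_less_trans by blast
  qed
  define S where "S = (SUM j:I. norm (snd j) powr p)"
  have bound: "(SUM j:I. norm (snd j) powr p * measure lborel (B j)) <= c + \<eta> * S" if \<eta>: "0 < \<eta>" for \<eta>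
  proof -
   have "EX K. compact K & K \<subseteq> B j & vol (B j - K) < ennreal \<eta>" for j by (rule lborel_inner_compact[OF Bm Bfin \<eta>]) blast
   then obtain E where E: "!!j. compact (E j)" "!!j. E j \<subseteq> B j" "!!j. vol (B j - E j) < ennreal \<eta>" by metis
   have EP: "E j \<subseteq> P (fst j)" for j using E(2)[of j] by (auto simp: B_def)
   have [measurable]: "E j : sets borel" for j using E(1) by (simp add: borel_compact)
   have "(SUM j:I. norm (snd j) powr p * measure lborel (E j)) <= c"
   proof (rule lsc_step[where G = "%j. G (fst j)" and CG = "%j. CG (fst j)" and V = V and F = F and CF = CF])
    show "E j \<subseteq> V" for j using EP P(2) by blast
    show "disjoint_family_on E I"
     unfolding disjoint_family_on_def
    proof (intro ballI impI)
     fix j l assume "j : I" "l : I" and jl: "j ~= l"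
     show "E j Int E l = {}"
     proof (cases "fst j = fst l")
      case True
      then have "snd j ~= snd l" using jl by (simp add: prod_eq_iff)
      then have "B j Int B l = {}" using True by (auto simp: B_def)
      then show ?thesis using E(2)[of j] E(2)[of l] by blast
     next
      case False
      then have "P (fst j) Int P (fst l) = {}" using P(3) by (auto simp: disjoint_family_on_def)
      then show ?thesis using EP by blast
     qed
    qed
    show "(%n. pint p (E j) (%x. dist (F n x) (G (fst j) x))) \<longlonglongrightarrow> 0" for j
     by (rule tendsto_sandwich[OF _ _ tendsto_const lim[of "fst j"]])
      (use EP[of j] in "auto intro!: always_eventually nn_integral_mono mult_left_mono simp: indicator_def")
    show "0 <= snd j \<bullet> b" if "j : I" "b : Basis" for j b using that dyad_nonneg by (auto simp: I_def R_def dyadv_inner)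
    show "AE x in lborel. x : E j --> (ALL b:Basis. snd j \<bullet> b <= mslope (G (fst j)) b x)" for j
     using G(2)[of "fst j"]
    proof eventually_elim
     case (elim x)
     show ?case
     proof (intro impI ballI)
      fix b :: 'e assume x: "x : E j" and b: "b : Basis"
      have "snd j = dyadv k (mgrad (G (fst j)) x)" using x E(2)[of j] by (auto simp: B_def)
      then show "snd j \<bullet> b <= mslope (G (fst j)) b x" using dyad_le[OF mslope_nonneg[OF elim]] b by (simp add: dyadv_inner)
     qed
    qed
   qed (use p V G F E(1) I c in auto)
   moreover have "measure lborel (B j) <= measure lborel (E j) + \<eta>" for j
   proof -
    have "vol (B j) <= vol (E j Un (B j - E j))" using E(2) by (intro emeasure_mono) auto
    also have "... <= vol (E j) + vol (B j - E j)" by (intro emeasure_subadditive) auto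
    also have "... <= ennreal (measure lborel (E j)) + ennreal \<eta>"
     using E(3)[of j] emeasure_compact_finite[OF E(1)[of j]] by (intro add_mono) (auto simp: emeasure_eq_ennreal_measure less_top)
    finally have "ennreal (measure lborel (B j)) <= ennreal (measure lborel (E j) + \<eta>)"
     using Bfin[of j] \<eta> by (simp add: emeasure_eq_ennreal_measure less_top)
    then show ?thesis using \<eta> by (subst (asm) ennreal_le_iff) (auto simp: add_nonneg_nonneg)
   qed
   then have "(SUM j:I. norm (snd j) powr p * measure lborel (B j)) <= (SUM j:I. norm (snd j) powr p * (measure lborel (E j) + \<eta>))"
    by (intro sum_mono mult_left_mono) auto
   ultimately show ?thesis by (simp add: distrib_left sum.distrib S_def sum_distrib_left mult.commute)
  qed
  have "((%\<eta>. c + \<eta> * S) \<longlongrightarrow> c + 0 * S) (at_right 0)" by (intro tendsto_intros)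
  then have "((%\<eta>. c + \<eta> * S) \<longlongrightarrow> c) (at_right 0)" by simp
  then have le: "(SUM j:I. norm (snd j) powr p * measure lborel (B j)) <= c"
   by (rule tendsto_lowerbound) (auto intro: eventually_mono[OF eventually_at_right_less] bound)
  have "(\<Sum>i<m. ennreal (norm (dyadv k (mgrad (G i) x)) powr p) * indicator (P i Int ball 0 (real k)) x)
    = (SUM j:I. ennreal (norm (snd j) powr p) * indicator (B j) x)" for x
  proof -
   have "ennreal (norm (dyadv k (mgrad (G i) x)) powr p) * indicator (P i Int ball 0 (real k)) x
     = (SUM v:R. ennreal (norm v powr p) * indicator (B (i, v)) x)" for i
   proof -
    define v0 where "v0 = dyadv k (mgrad (G i) x)"
    have "(SUM v:R. ennreal (norm v powr p) * indicator (B (i, v)) x)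
      = (SUM v:{v0}. ennreal (norm v powr p) * indicator (B (i, v)) x)"
     using R by (intro sum.mono_neutral_right) (auto simp: B_def R_def v0_def indicator_def)
    then show ?thesis by (simp add: v0_def B_def indicator_def)
   qed
   then show ?thesis by (simp add: I_def sum.cartesian_product case_prod_unfold)
  qed
  then have "lint (%x. (\<Sum>i<m. ennreal (norm (dyadv k (mgrad (G i) x)) powr p) * indicator (P i Int ball 0 (real k)) x))
    = (SUM j:I. ennreal (norm (snd j) powr p) * vol (B j))" by (simp add: nn_integral_sum nn_integral_cmult)
  also have "... = (SUM j:I. ennreal (norm (snd j) powr p * measure lborel (B j)))"
   using Bfin by (intro sum.cong refl) (auto simp: ennreal_mult emeasure_eq_ennreal_measure less_top)
  also have "... = ennreal (SUM j:I. norm (snd j) powr p * measure lborel (B j))" by (intro sum_ennreal) auto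
  also have "... <= ennreal c" by (intro ennreal_leI le)
  finally show ?thesis .
 qed
 define f where "f i x = ennreal (norm (mgrad (G i) x) powr p) * indicator (P i) x" for i x
 have [measurable]: "f i : borel_measurable borel" for i unfolding f_def by measurable
 have part: "(\<Sum>i<m. lint (%x. f i x)) <= ennreal c" for m
 proof -
  \<comment> \<open>Rounding to mesh 1/k is not monotone in \<open>k\<close>, so the passage to the
    limit uses Fatou's lemma.\<close>
  define fk where "fk k x = (\<Sum>i<m. ennreal (norm (dyadv k (mgrad (G i) x)) powr p) * indicator (P i Int ball 0 (real k)) x)" for k x
  have [measurable]: "(indicator (P i Int ball 0 (real k)) :: 'e => ennreal) : borel_measurable borel" for i k
   by (rule borel_measurable_indicator) auto
  have [measurable]: "fk k : borel_measurable borel" for k unfolding fk_def by (intro borel_measurable_sum borel_measurable_times_ennreal) measurable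
  have "(\<Sum>i<m. lint (%x. f i x)) = lint (%x. (\<Sum>i<m. f i x))" by (rule nn_integral_sum[symmetric]) measurable
  also have "... <= lint (%x. liminf (%k. fk k x))"
  proof (rule nn_integral_mono_AE)
   have "AE x in lborel. ALL i. mdiff (G i) x" using G(2) by (simp add: AE_all_countable)
   then show "AE x in lborel. (\<Sum>i<m. f i x) <= liminf (%k. fk k x)"
   proof eventually_elim
    case (elim x)
    have "(%k. ennreal (norm (dyadv k (mgrad (G i) x)) powr p) * indicator (P i Int ball 0 (real k)) x) \<longlonglongrightarrow> f i x" for i
    proof -
     have "(%k. dyadv k (mgrad (G i) x)) \<longlonglongrightarrow> mgrad (G i) x" using elim mslope_nonneg by (intro dyadv_tendsto) auto
     then have "(%k. norm (dyadv k (mgrad (G i) x)) powr p) \<longlonglongrightarrow> norm (mgrad (G i) x) powr p"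
      using p by (intro tendsto_powr' tendsto_norm tendsto_const) auto
     then have l: "(%k. ennreal (norm (dyadv k (mgrad (G i) x)) powr p) * indicator (P i) x) \<longlonglongrightarrow> f i x"
      unfolding f_def by (cases "x : P i") (auto intro: tendsto_ennrealI)
     obtain k0 where "norm x < real k0" using reals_Archimedean2 by blast
     then have "\<forall>\<^sub>F k in sequentially. ennreal (norm (dyadv k (mgrad (G i) x)) powr p) * indicator (P i) x
      = ennreal (norm (dyadv k (mgrad (G i) x)) powr p) * indicator (P i Int ball 0 (real k)) x"
      unfolding eventually_sequentially by (intro exI[of _ k0]) (auto simp: indicator_def)
     then show ?thesis by (rule Lim_transform_eventually[OF l])
    qed
    then have "(%k. fk k x) \<longlonglongrightarrow> (\<Sum>i<m. f i x)" unfolding fk_def by (intro tendsto_sum)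
    then show ?case by (simp add: lim_imp_Liminf)
   qed
  qed
  also have "... <= liminf (%k. lint (%x. fk k x))" by (rule nn_integral_liminf) measurable
  also have "... <= liminf (%k::nat. ennreal c)"
  proof (intro Liminf_mono always_eventually allI)
   show "lint (fk k) <= ennreal c" for k unfolding fk_def by (rule fin)
  qed
  also have "... = ennreal c" by (simp add: Liminf_const)
  finally show ?thesis .
 qed
 have "pint p V e = lint (%x. (\<Sum>i. f i x))"
 proof (rule nn_integral_cong_AE)
  show "AE x in lborel. ennreal (e x powr p) * indicator V x = (\<Sum>i. f i x)"
   using e
  proof eventually_elim
   case (elim x)
   show ?case
   proof (cases "x : V")
    case True
    then obtain i where i: "x : P i" "e x = norm (mgrad (G i) x)" using elim by blast
    have "(\<Sum>j. f j x) = (SUM j:{i}. f j x)" using i(1) P(3) by (intro suminf_finite) (auto simp: f_def indicator_def disjoint_family_on_def)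
    then show ?thesis using i True by (simp add: f_def)
   next
    case False
    then have "!!i. f i x = 0" using P(2) by (auto simp: f_def indicator_def)
    then show ?thesis using False by simp
   qed
  qed
 qed
 also have "... = (\<Sum>i. lint (%x. f i x))" by (rule nn_integral_suminf) measurable
 also have "... <= ennreal c" by (intro suminf_le_const summableI part)
 finally show ?thesis .
qed

section \<open>Strong approximation by midpoint convexity\<close>

text \<open>The mean value theorem on the two halves of the interval, together with the strictly
  increasing derivative.\<close>

lemma powr_midpoint_strict:
 fixes p s t :: real
 assumes p: "1 < p" and s: "0 <= s" "s < t"
 shows "((s + t) / 2) powr p < (s powr p + t powr p) / 2"
proof -
 define m where "m = (s + t) / 2"
 have m: "s < m" "m < t" using s by (auto simp: m_def)
 have cont: "continuous_on {a..b} (%x. x powr p)" if "0 <= a" for a b :: real using that p by (intro continuous_on_powr' continuous_intros) auto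
 have der: "((%x. x powr p) has_real_derivative p * x powr (p - 1)) (at x)" if "0 < x" for x using that by (rule has_real_derivative_powr)
 have mvt: "EX z. a < z & z < b & b powr p - a powr p = (b - a) * (p * z powr (p - 1))"
  if ab: "0 <= a" "a < b" for a b :: real
 proof -
  have "(%x. x powr p) differentiable (at x)" if "a < x" for x using der[of x] that ab by (auto simp: real_differentiable_def)
  then obtain l z where z: "a < z" "z < b" "DERIV (%x. x powr p) z :> l" "b powr p - a powr p = (b - a) * l"
   using MVT[OF ab(2) cont[OF ab(1)]] by blast
  have "l = p * z powr (p - 1)" using DERIV_unique[OF z(3) der] z(1) ab by simp
  then show ?thesis using z by blast
 qed
 obtain z1 where z1: "m < z1" "z1 < t" "t powr p - m powr p = (t - m) * (p * z1 powr (p - 1))" using mvt[of m t] m s by auto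
 obtain z2 where z2: "s < z2" "z2 < m" "m powr p - s powr p = (m - s) * (p * z2 powr (p - 1))" using mvt[of s m] m s by auto
 have "z2 powr (p - 1) < z1 powr (p - 1)" using z1 z2 s p by (intro powr_less_mono2) auto
 then have "(m - s) * (p * z2 powr (p - 1)) < (t - m) * (p * z1 powr (p - 1))"
 proof -
  have d: "m - s = t - m" by (simp add: m_def field_simps)
  show ?thesis unfolding d using \<open>z2 powr (p - 1) < z1 powr (p - 1)\<close> p m by (intro mult_strict_left_mono) auto
 qed
 then have "m powr p - s powr p < t powr p - m powr p" using z1 z2 by simp
 then show ?thesis by (simp add: m_def)
qed

lemma powr_midpoint_le:
 fixes p s t :: real
 assumes p: "1 < p" and s: "0 <= s" "0 <= t"
 shows "((s + t) / 2) powr p <= (s powr p + t powr p) / 2"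
proof (cases s t rule: linorder_cases)
 case less
 then show ?thesis using powr_midpoint_strict[OF p s(1)] by (simp add: less_imp_le)
next
 case greater
 then show ?thesis using powr_midpoint_strict[OF p s(2), of s] by (simp add: add.commute less_imp_le)
qed simp

lemma norm_powr_midpoint_le:
 fixes a b :: "'e::real_normed_vector"
 assumes p: "1 < p"
 shows "norm ((a + b) /\<^sub>R 2) powr p <= (norm a powr p + norm b powr p) / 2"
proof -
 have "norm ((a + b) /\<^sub>R 2) powr p <= ((norm a + norm b) / 2) powr p" using p norm_triangle_ineq[of a b] by (intro powr_mono2) auto
 also have "... <= (norm a powr p + norm b powr p) / 2" by (rule powr_midpoint_le[OF p]) auto
 finally show ?thesis .
qed

text \<open>For equal norms strictness comes from the parallelogram identity, for different norms
  from the scalar inequality.\<close>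

lemma norm_powr_midpoint_strict:
 fixes a b :: "'e::euclidean_space"
 assumes p: "1 < p" and ab: "a ~= b"
 shows "norm ((a + b) /\<^sub>R 2) powr p < (norm a powr p + norm b powr p) / 2"
proof (cases "norm a = norm b")
 case True
 have "(norm (a + b))\<^sup>2 + (norm (a - b))\<^sup>2 = 4 * (norm a)\<^sup>2"
  using True by (simp add: power2_norm_eq_inner inner_add_left inner_add_right inner_diff_left inner_diff_right)
   (metis power2_norm_eq_inner True)
 moreover have "0 < (norm (a - b))\<^sup>2" using ab by simp
 moreover have "(2 * norm a)\<^sup>2 = 4 * (norm a)\<^sup>2" by (simp add: power_mult_distrib)
 ultimately have "(norm (a + b))\<^sup>2 < (2 * norm a)\<^sup>2" by linarith
 then have "norm (a + b) < 2 * norm a" by (rule power_less_imp_less_base) simp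
 then have "norm ((a + b) /\<^sub>R 2) powr p < norm a powr p" using p by (intro powr_less_mono2) auto
 then show ?thesis using True by simp
next
 case False
 have "norm ((a + b) /\<^sub>R 2) powr p <= ((norm a + norm b) / 2) powr p" using p norm_triangle_ineq[of a b] by (intro powr_mono2) auto
 also have "... < (norm a powr p + norm b powr p) / 2"
 proof (cases "norm a < norm b")
  case True
  then show ?thesis using powr_midpoint_strict[OF p _ True] by simp
 next
  case f: False
  then have ba: "norm b < norm a" using False by simp
  show ?thesis using powr_midpoint_strict[OF p _ ba] by (simp add: add.commute)
 qed
 finally show ?thesis .
qed

text \<open>By homogeneity it suffices to treat pairs on the unit sphere. Where the difference
  dominates \<epsilon> times the energy, compactness keeps the convexity defect away from 0, and a
  large \<open>C\<close> compensates.\<close>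

lemma norm_powr_uniform_convexity:
 assumes p: "1 < p" and \<epsilon>: "0 < (\<epsilon>::real)"
 shows "\<exists>C\<ge>0. ALL a b :: 'e::euclidean_space. norm (a - b) powr p <= \<epsilon> * (norm a powr p + norm b powr p)
   + C * ((norm a powr p + norm b powr p) / 2 - norm ((a + b) /\<^sub>R 2) powr p)"
proof -
 define D :: "'e \<times> 'e => real" where "D z = (norm (fst z) powr p + norm (snd z) powr p) / 2 - norm ((fst z + snd z) /\<^sub>R 2) powr p" for z
 define S where "S z = norm (fst z) powr p + norm (snd z) powr p" for z :: "'e \<times> 'e"
 define T where "T z = norm (fst z - snd z) powr p" for z :: "'e \<times> 'e"
 have D0: "0 <= D z" for z using norm_powr_midpoint_le[OF p, of "fst z" "snd z"] by (simp add: D_def)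
 have pw: "continuous_on UNIV (%z. norm (h z) powr p)" if "continuous_on UNIV h" for h :: "'e \<times> 'e => 'e"
  using that p by (intro continuous_on_powr' continuous_intros) auto
 have cD: "continuous_on UNIV D" and cS: "continuous_on UNIV S" and cT: "continuous_on UNIV T"
  unfolding D_def S_def T_def by (intro pw continuous_intros; simp)+
 define K where "K = sphere 0 1 Int {z. \<epsilon> * S z <= T z}"
 have "closed {z. \<epsilon> * S z <= T z}" by (intro closed_Collect_le continuous_intros cS cT)
 then have K: "compact K" unfolding K_def by (intro compact_Int_closed compact_sphere)
 have "\<exists>C\<ge>0. ALL z:K. T z <= C * D z"
 proof (cases "K = {}")
  case False
  obtain z0 where z0: "z0 : K" "!!z. z : K ==> D z0 <= D z" using continuous_attains_inf[OF K False continuous_on_subset[OF cD]] by auto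
  obtain z1 where z1: "z1 : K" "!!z. z : K ==> T z <= T z1" using continuous_attains_sup[OF K False continuous_on_subset[OF cT]] by auto
  have "fst z0 ~= snd z0"
  proof
   assume eq: "fst z0 = snd z0"
   then have "\<epsilon> * S z0 <= 0" using z0(1) p by (simp add: K_def T_def)
   then have "S z0 <= 0" using \<epsilon> by (simp add: mult_le_0_iff)
   then have "norm (fst z0) powr p = 0" "norm (snd z0) powr p = 0"
    unfolding S_def using powr_ge_zero[of "norm (fst z0)" p] powr_ge_zero[of "norm (snd z0)" p] by linarith+
   then have "z0 = 0" by (simp add: prod_eq_iff)
   then show False using z0(1) by (simp add: K_def)
  qed
  then have pos: "0 < D z0" using norm_powr_midpoint_strict[OF p] by (simp add: D_def)
  have T1: "0 <= T z1" by (simp add: T_def)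
  show ?thesis
  proof (intro exI[of _ "T z1 / D z0"] conjI ballI)
   show "0 <= T z1 / D z0" using pos T1 by simp
   fix z assume z: "z : K"
   have "T z <= T z1 / D z0 * D z0" using z1(2)[OF z] pos by simp
   also have "... <= T z1 / D z0 * D z" using z0(2)[OF z] pos T1 by (intro mult_left_mono) auto
   finally show "T z <= T z1 / D z0 * D z" .
  qed
 qed auto
 then obtain C where C: "0 <= C" "!!z. z : K ==> T z <= C * D z" by blast
 have sph: "T z <= \<epsilon> * S z + C * D z" if "z : sphere 0 1" for z
 proof (cases "z : K")
  case True
  have "0 <= \<epsilon> * S z" using \<epsilon> by (simp add: S_def)
  then show ?thesis using C(2)[OF True] by linarith
 next
  case False
  then have "T z <= \<epsilon> * S z" using that by (auto simp: K_def)
  moreover have "0 <= C * D z" using C(1) D0 by simp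
  ultimately show ?thesis by linarith
 qed
 have "norm (a - b) powr p <= \<epsilon> * (norm a powr p + norm b powr p)
   + C * ((norm a powr p + norm b powr p) / 2 - norm ((a + b) /\<^sub>R 2) powr p)" for a b :: 'e
 proof (cases "(a, b) = 0")
  case True
  then show ?thesis using p by (simp add: prod_eq_iff)
 next
  case False
  define r where "r = norm (a, b)"
  have r: "0 < r" using False by (simp add: r_def)
  have sc: "norm (x /\<^sub>R r) powr p = norm x powr p / r powr p" for x :: 'e
   using r by (simp add: powr_mult divide_inverse powr_minus[symmetric] inverse_powr mult.commute)
  have "norm ((a, b) /\<^sub>R r) = 1" using r unfolding norm_scaleR r_def by simp
  then have "(a, b) /\<^sub>R r : sphere 0 1" by simp
  from sph[OF this] have "norm ((a - b) /\<^sub>R r) powr p <= \<epsilon> * (norm (a /\<^sub>R r) powr p + norm (b /\<^sub>R r) powr p)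
   + C * ((norm (a /\<^sub>R r) powr p + norm (b /\<^sub>R r) powr p) / 2 - norm (((a + b) /\<^sub>R 2) /\<^sub>R r) powr p)"
   by (simp add: T_def S_def D_def scaleR_diff_right scaleR_add_right mult.commute)
  then have "norm (a - b) powr p / r powr p <= (\<epsilon> * (norm a powr p + norm b powr p)
   + C * ((norm a powr p + norm b powr p) / 2 - norm ((a + b) /\<^sub>R 2) powr p)) / r powr p"
   unfolding sc by (simp add: add_divide_distrib diff_divide_distrib distrib_left right_diff_distrib mult.commute)
  then show ?thesis using r by (simp add: divide_le_cancel)
 qed
 then show ?thesis using C(1) by blast
qed

section \<open>Gradients of real Lipschitz functions and midpoint closures\<close>

definition rlip :: "('e::euclidean_space => real) => bool" where
 "rlip f \<longleftrightarrow> (EX L. real_lipschitz f L)"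

text \<open>Defined everywhere from one-sided quotients; it is the gradient where
  \<open>rdiff\<close> holds, which is almost everywhere for Lipschitz functions.\<close>

definition rgrad :: "('e::euclidean_space => real) => 'e => 'e" where
 "rgrad f x = (SUM b:Basis. dderiv f b x *\<^sub>R b)"

definition rdiff :: "('e::euclidean_space => real) => 'e => bool" where
 "rdiff f x \<longleftrightarrow> (f has_derivative (%v. v \<bullet> rgrad f x)) (at x)"

lemma borel_rgrad: "rlip f ==> rgrad f : borel_measurable borel"
proof -
 assume "rlip f"
 then obtain L where "real_lipschitz f L" by (auto simp: rlip_def)
 then interpret real_lipschitz f L .
 show ?thesis unfolding rgrad_def by measurable
qed

lemma rlip_continuous: "rlip f ==> continuous_on S f" unfolding rlip_def using real_lipschitz.continuous_f by blast

lemma borel_rlip: "rlip f ==> f : borel_measurable borel" by (intro borel_measurable_continuous_onI rlip_continuous)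

lemma rlip_midpoint: "rlip f ==> rlip g ==> rlip (%x. (f x + g x) / 2)"
proof -
 assume "rlip f" "rlip g"
 then obtain L M where "real_lipschitz f L" "real_lipschitz g M" by (auto simp: rlip_def)
 then interpret f: real_lipschitz f L + g: real_lipschitz g M by auto
 have "real_lipschitz (%x. (f x + g x) / 2) (L + M)"
 proof
  show "0 <= L + M" using f.L0 g.L0 by simp
  fix x y
  have "\<bar>(f x + g x) / 2 - (f y + g y) / 2\<bar> <= \<bar>f x - f y\<bar> + \<bar>g x - g y\<bar>" by (simp add: field_simps abs_if)
  then show "\<bar>(f x + g x) / 2 - (f y + g y) / 2\<bar> <= (L + M) * norm (x - y)" using f.lip[of x y] g.lip[of x y] by (simp add: algebra_simps)
 qed
 then show ?thesis by (auto simp: rlip_def)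
qed

lemma dquot_tendsto:
 assumes "(f has_derivative (%v. v \<bullet> G)) (at x)"
 shows "((%h. dquot f v h x) \<longlongrightarrow> v \<bullet> G) (at_right 0)"
proof -
 have "((%h. x + h *\<^sub>R v) has_derivative (%h. h *\<^sub>R v)) (at 0)" by (auto intro!: derivative_eq_intros)
 moreover have "(f has_derivative (%v. v \<bullet> G)) (at (x + 0 *\<^sub>R v))" using assms by simp
 ultimately have "((%h. f (x + h *\<^sub>R v)) has_derivative (%h. (h *\<^sub>R v) \<bullet> G)) (at 0)" by (rule has_derivative_compose)
 then have "((%h. f (x + h *\<^sub>R v)) has_field_derivative (v \<bullet> G)) (at 0)"
  unfolding has_field_derivative_def by (rule has_derivative_eq_rhs) (simp add: fun_eq_iff mult.commute)
 then have "((%h. dquot f v h x) \<longlongrightarrow> v \<bullet> G) (at 0)" by (simp add: DERIV_def dquot_def)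
 then show ?thesis by (rule filterlim_mono) (auto simp: at_le)
qed

lemma rdiffI:
 assumes "(f has_derivative (%v. v \<bullet> G)) (at x)"
 shows "rdiff f x" "rgrad f x = G"
proof -
 have "dderiv f v x = v \<bullet> G" for v
  unfolding dderiv_def by (rule limI) (rule filterlim_compose[OF dquot_tendsto[OF assms] filterlim_inverse_Suc])
 then have "rgrad f x = (SUM b:Basis. (G \<bullet> b) *\<^sub>R b)" by (simp add: rgrad_def inner_commute)
 then show "rgrad f x = G" by (simp add: euclidean_representation)
 then show "rdiff f x" using assms by (simp add: rdiff_def)
qed

lemma rdiff_AE: "rlip f ==> AE x in lborel. rdiff f x"
proof -
 assume "rlip f"
 then obtain L where "real_lipschitz f L" by (auto simp: rlip_def)
 then interpret real_lipschitz f L .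
 show ?thesis using rademacher_real by eventually_elim (auto intro: rdiffI)
qed

lemma rdiff_midpoint:
 assumes "rdiff f x" "rdiff g x"
 shows "rdiff (%x. (f x + g x) / 2) x" "rgrad (%x. (f x + g x) / 2) x = (rgrad f x + rgrad g x) /\<^sub>R 2"
proof -
 have "((%x. (f x + g x) / 2) has_derivative (%v. v \<bullet> ((rgrad f x + rgrad g x) /\<^sub>R 2))) (at x)"
  using assms unfolding rdiff_def by (auto intro!: derivative_eq_intros simp: inner_add_right field_simps)
 from rdiffI[OF this] show "rdiff (%x. (f x + g x) / 2) x" "rgrad (%x. (f x + g x) / 2) x = (rgrad f x + rgrad g x) /\<^sub>R 2" by auto
qed

lemma rdiff_mdiff:
 assumes "rdiff f x"
 shows "mdiff f x" "mslope f v x = \<bar>v \<bullet> rgrad f x\<bar>"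
proof -
 have "((%t. dist (f (x + t *\<^sub>R v)) (f x) / t) \<longlongrightarrow> \<bar>v \<bullet> rgrad f x\<bar>) (at_right 0)" for v
 proof (rule Lim_transform_eventually)
  show "((%t. \<bar>dquot f v t x\<bar>) \<longlongrightarrow> \<bar>v \<bullet> rgrad f x\<bar>) (at_right 0)"
   by (rule tendsto_rabs[OF dquot_tendsto]) (use assms in "simp add: rdiff_def")
  show "\<forall>\<^sub>F t in at_right 0. \<bar>dquot f v t x\<bar> = dist (f (x + t *\<^sub>R v)) (f x) / t"
   using eventually_at_right_less[of 0] by eventually_elim (simp add: dquot_def dist_real_def)
 qed
 then show "mdiff f x" "mslope f v x = \<bar>v \<bullet> rgrad f x\<bar>" unfolding mdiff_def by (auto intro: mslope_eq)
qed

lemma ennreal_half_double: "ennreal (1/2) * (c + c) = c"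
proof (cases c)
 case (real r)
 then have "ennreal (1/2) * (c + c) = ennreal (1/2) * ennreal (r + r)" by (simp only: ennreal_plus[of r r])
 also have "... = ennreal (1/2 * (r + r))" using real by (intro ennreal_mult[symmetric]) auto
 finally show ?thesis using real by simp
qed (simp add: ennreal_mult_eq_top_iff)

text \<open>All coordinates are treated together: the energy sums over \<open>V\<close>, so one
  choice of midpoints serves every coordinate.\<close>

locale bounded_energy_sequence =
 fixes U :: "'e::euclidean_space set" and V :: "'i set" and p M :: real
  and h :: "nat => 'i => 'e => real" and g :: "'i => 'e => real"
 assumes V: "finite V" and U [measurable]: "U : sets borel" and p: "1 < p" and M: "0 <= M"
  and h: "!!j i. i : V ==> rlip (h j i)" and g [measurable]: "!!i. g i : borel_measurable borel"
  and bound: "!!j. (sint U (%x. ennreal (SUM i:V. norm (rgrad (h j i) x) powr p))) <= ennreal M"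
  and lim: "!!i. i : V ==> (%j. pint p U (%x. \<bar>h j i x - g i x\<bar>)) \<longlonglongrightarrow> 0"
begin

definition energy :: "('i => 'e => real) => ennreal" where
 "energy X = sint U (%x. ennreal (SUM i:V. norm (rgrad (X i) x) powr p))"

definition gap :: "('i => 'e => real) => ('i => 'e => real) => ennreal" where
 "gap X Y = sint U (%x. ennreal (SUM i:V. norm (rgrad (X i) x - rgrad (Y i) x) powr p))"

definition dev :: "('i => 'e => real) => 'i => ennreal" where
 "dev X i = pint p U (%x. \<bar>X i x - g i x\<bar>)"

definition mid :: "('i => 'e => real) => ('i => 'e => real) => 'i => 'e => real" where
 "mid X Y = (%i x. (X i x + Y i x) / 2)"

text \<open>Closing the tails of the sequence under midpoints suffices: convexity is only used through
 the midpoint inequality.\<close>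

inductive_set mhull :: "nat => ('i => 'e => real) set" for n where
 base: "n <= j ==> h j : mhull n"
| step: "X : mhull n ==> Y : mhull n ==> mid X Y : mhull n"

lemma mhull_mono: "X : mhull m ==> n <= m ==> X : mhull n" by (induction rule: mhull.induct) (auto intro: mhull.intros)

lemma mhull_rlip: "X : mhull n ==> i : V ==> rlip (X i)" by (induction rule: mhull.induct) (auto simp: mid_def intro: h rlip_midpoint)

lemma mhull_rgrad_borel: "X : mhull n ==> i : V ==> rgrad (X i) : borel_measurable borel" by (intro borel_rgrad mhull_rlip)

lemma mhull_rdiff: "X : mhull n ==> AE x in lborel. ALL i:V. rdiff (X i) x" by (intro AE_finite_allI V rdiff_AE mhull_rlip)

text \<open>The defect is added on the left, since subtraction of possibly infinite values would
  lose information.\<close>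

lemma convexity_defect:
 assumes X: "X : mhull n" and Y: "Y : mhull n"
 shows "sint U (%x. ennreal (SUM i:V. (norm (rgrad (X i) x) powr p + norm (rgrad (Y i) x) powr p) / 2
      - norm ((rgrad (X i) x + rgrad (Y i) x) /\<^sub>R 2) powr p)) + energy (mid X Y)
  = ennreal (1/2) * (energy X + energy Y)"
proof -
 note mX[measurable] = mhull_rgrad_borel[OF X] and mY[measurable] = mhull_rgrad_borel[OF Y]
 define d where "d x = (SUM i:V. (norm (rgrad (X i) x) powr p + norm (rgrad (Y i) x) powr p) / 2
      - norm ((rgrad (X i) x + rgrad (Y i) x) /\<^sub>R 2) powr p)" for x
 define m where "m x = (SUM i:V. norm ((rgrad (X i) x + rgrad (Y i) x) /\<^sub>R 2) powr p)" for x
 define eX where "eX x = (SUM i:V. norm (rgrad (X i) x) powr p)" for x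
 define eY where "eY x = (SUM i:V. norm (rgrad (Y i) x) powr p)" for x
 have [measurable]: "d : borel_measurable borel" "m : borel_measurable borel" "eX : borel_measurable borel" "eY : borel_measurable borel"
  unfolding d_def m_def eX_def eY_def by measurable
 have d0: "0 <= d x" for x unfolding d_def by (intro sum_nonneg) (use norm_powr_midpoint_le[OF p] in simp)
 have nn: "0 <= m x" "0 <= eX x" "0 <= eY x" for x by (auto simp: m_def eX_def eY_def sum_nonneg)
 have eq: "d x + m x = 1/2 * (eX x + eY x)" for x
  by (simp add: d_def m_def eX_def eY_def sum_subtractf sum.distrib sum_divide_distrib[symmetric] add_divide_distrib)
 have "energy (mid X Y) = sint U (%x. ennreal (m x))"
  unfolding energy_def
 proof (rule nn_integral_cong_AE)
  show "AE x in lborel. ennreal (SUM i:V. norm (rgrad (mid X Y i) x) powr p) * indicator U x = ennreal (m x) * indicator U x"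
   using mhull_rdiff[OF X] mhull_rdiff[OF Y] by eventually_elim (simp add: m_def mid_def rdiff_midpoint(2) cong: sum.cong)
 qed
 then have "sint U (%x. ennreal (d x)) + energy (mid X Y)
   = lint (%x. ennreal (d x) * indicator U x + ennreal (m x) * indicator U x)" by (simp add: nn_integral_add)
 also have "... = lint (%x. ennreal (1/2) * (ennreal (eX x) * indicator U x + ennreal (eY x) * indicator U x))"
 proof (intro nn_integral_cong)
  fix x
  have "ennreal (d x) + ennreal (m x) = ennreal (1/2 * (eX x + eY x))" unfolding eq[symmetric] using d0 nn by (intro ennreal_plus[symmetric])
  also have "... = ennreal (1/2) * (ennreal (eX x) + ennreal (eY x))" using nn by (subst ennreal_mult) auto
  finally show "ennreal (d x) * indicator U x + ennreal (m x) * indicator U x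
    = ennreal (1/2) * (ennreal (eX x) * indicator U x + ennreal (eY x) * indicator U x)" by (simp add: indicator_def)
 qed
 also have "... = ennreal (1/2) * (energy X + energy Y)" by (simp add: nn_integral_cmult nn_integral_add energy_def eX_def eY_def)
 finally show ?thesis by (simp add: d_def)
qed

lemma mhull_energy: "X : mhull n ==> energy X <= ennreal M"
proof (induction rule: mhull.induct)
 case (base j)
 then show ?case using bound by (simp add: energy_def)
next
 case (step X Y)
 have "energy (mid X Y) <= ennreal (1/2) * (energy X + energy Y)" unfolding convexity_defect[OF step.hyps, symmetric] by simp
 also have "... <= ennreal (1/2) * (ennreal M + ennreal M)" by (intro mult_left_mono add_mono step.IH) auto
 also have "... = ennreal M" by (rule ennreal_half_double)
 finally show ?case .
qed

lemma mhull_dev: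
 assumes "X : mhull n" "i : V" "!!j. n <= j ==> dev (h j) i <= c"
 shows "dev X i <= c"
 using assms(1)
proof (induction rule: mhull.induct)
 case (base j)
 then show ?case using assms(3) by simp
next
 case (step X Y)
 have [measurable]: "X i : borel_measurable borel" "Y i : borel_measurable borel" using step.hyps assms(2) by (auto intro: borel_rlip mhull_rlip)
 have "dev (mid X Y) i <= lint (%x. ennreal (1/2) * (ennreal (\<bar>X i x - g i x\<bar> powr p) * indicator U x
   + ennreal (\<bar>Y i x - g i x\<bar> powr p) * indicator U x))"
  unfolding dev_def
 proof (rule nn_integral_mono)
  fix x
  have m: "((X i x - g i x) + (Y i x - g i x)) /\<^sub>R 2 = mid X Y i x - g i x" by (simp add: mid_def field_simps)
  have "\<bar>mid X Y i x - g i x\<bar> powr p <= 1/2 * (\<bar>X i x - g i x\<bar> powr p + \<bar>Y i x - g i x\<bar> powr p)"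
   using norm_powr_midpoint_le[OF p, of "X i x - g i x" "Y i x - g i x"] unfolding m real_norm_def by linarith
  then have "ennreal (\<bar>mid X Y i x - g i x\<bar> powr p) <= ennreal (1/2 * (\<bar>X i x - g i x\<bar> powr p + \<bar>Y i x - g i x\<bar> powr p))"
   by (rule ennreal_leI)
  also have "... = ennreal (1/2) * (ennreal (\<bar>X i x - g i x\<bar> powr p) + ennreal (\<bar>Y i x - g i x\<bar> powr p))"
   by (subst ennreal_mult) auto
  finally show "ennreal (\<bar>mid X Y i x - g i x\<bar> powr p) * indicator U x
   <= ennreal (1/2) * (ennreal (\<bar>X i x - g i x\<bar> powr p) * indicator U x + ennreal (\<bar>Y i x - g i x\<bar> powr p) * indicator U x)"
   by (simp add: indicator_def)
 qed
 also have "... = ennreal (1/2) * (dev X i + dev Y i)" by (simp add: nn_integral_cmult nn_integral_add dev_def)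
 also have "... <= ennreal (1/2) * (c + c)" by (intro mult_left_mono add_mono step.IH) auto
 also have "... = c" by (rule ennreal_half_double)
 finally show ?case .
qed

text \<open>The infimum of the energy over the hull of the tail increases with the tail and is
  bounded, hence converges. Two late near-minimisers have their midpoint in a common hull, so its
  energy is not much below theirs. Then the convexity defect is small, and uniform convexity makes
  the gradients close. Membership in later and later hulls preserves convergence to
  \<open>g\<close>.\<close>

lemma near_minimisers:
 obtains v where "!!n. v n : mhull n"
  "!!\<eta>. 0 < \<eta> ==> EX n0. \<forall>n\<ge>n0. \<forall>m\<ge>n0. gap (v n) (v m) <= ennreal \<eta>"
proof -
 define d where "d n = (INF X\<in>mhull n. energy X)" for n
 have hn: "h n : mhull n" for n by (rule mhull.base) simp
 have dM: "d n <= ennreal M" for n unfolding d_def using mhull_energy[OF hn] by (rule INF_lower2[OF hn])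
 then have dfin: "d n < \<infinity>" for n by (rule le_less_trans) simp
 have "EX X:mhull n. energy X < d n + ennreal (1 / Suc n)" for n
 proof -
  have "d n < d n + ennreal (1 / Suc n)" using dfin[of n]
   by (cases "d n") (auto simp: ennreal_plus[symmetric] ennreal_less_iff simp del: ennreal_plus)
  then show ?thesis unfolding d_def by (simp add: INF_less_iff)
 qed
 then obtain v where v: "!!n. v n : mhull n" "!!n. energy (v n) < d n + ennreal (1 / Suc n)" by metis
 define r where "r n = enn2real (d n)" for n
 have dr: "d n = ennreal (r n)" for n using dfin[of n] by (simp add: r_def)
 have rM: "0 <= r n" "r n <= M" for n using dM[of n] M by (auto simp: r_def enn2real_leI)
 have "d n <= d m" if "n <= m" for n m unfolding d_def using mhull_mono that by (intro INF_superset_mono) auto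
 then have incr: "r n <= r m" if "n <= m" for n m using that dr rM(1) by (metis ennreal_le_iff)
 then have "incseq r" by (simp add: incseq_def)
 then have conv: "r \<longlonglongrightarrow> (SUP n. r n)" by (intro LIMSEQ_incseq_SUP bdd_aboveI2[of _ _ M] rM) auto
 define R where "R = (SUP n. r n)"
 have rR: "r n <= R" for n unfolding R_def by (intro cSUP_upper bdd_aboveI2[of _ _ M] rM) auto
 have "EX n0. \<forall>n\<ge>n0. \<forall>m\<ge>n0. gap (v n) (v m) <= ennreal \<eta>" if \<eta>: "0 < \<eta>" for \<eta>
 proof -
  \<comment> \<open>\<epsilon> multiplies the two energies, at most 2 M together, and
    \<open>C\<close> multiplies a defect of at most 2 \<theta>; each product is given half of
    \<eta>.\<close>
  define \<epsilon> where "\<epsilon> = \<eta> / (4 * (M + 1))"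
  have \<epsilon>: "0 < \<epsilon>" "\<epsilon> * (M + M) <= \<eta> / 2"
  proof -
   have M1: "0 < M + 1" using M by simp
   then show "0 < \<epsilon>" using \<eta> by (simp add: \<epsilon>_def)
   have "\<epsilon> * (M + 1) = \<eta> / 4" using M1 unfolding \<epsilon>_def by (auto simp: divide_simps)
   then show "\<epsilon> * (M + M) <= \<eta> / 2" using \<open>0 < \<epsilon>\<close> by (simp add: algebra_simps)
  qed
  obtain C where C: "0 <= C" "!!a b :: 'e. norm (a - b) powr p <= \<epsilon> * (norm a powr p + norm b powr p)
   + C * ((norm a powr p + norm b powr p) / 2 - norm ((a + b) /\<^sub>R 2) powr p)"
   using norm_powr_uniform_convexity[OF p \<epsilon>(1), where 'e = 'e] by blast
  define \<theta> where "\<theta> = \<eta> / (4 * (C + 1))"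
  have \<theta>: "0 < \<theta>" "C * (2 * \<theta>) <= \<eta> / 2"
  proof -
   have C1: "0 < C + 1" using C by simp
   then show "0 < \<theta>" using \<eta> by (simp add: \<theta>_def)
   have "\<theta> * (C + 1) = \<eta> / 4" using C1 unfolding \<theta>_def by (auto simp: divide_simps)
   then show "C * (2 * \<theta>) <= \<eta> / 2" using \<open>0 < \<theta>\<close> by (simp add: algebra_simps)
  qed
  have "\<forall>\<^sub>F n in sequentially. R - \<theta> < r n" by (rule order_tendstoD(1)[OF conv[folded R_def]]) (use \<theta> in simp)
  moreover have "\<forall>\<^sub>F n in sequentially. 1 / real (Suc n) < \<theta>"
   by (rule order_tendstoD(2)[OF LIMSEQ_inverse_real_of_nat[unfolded inverse_eq_divide]]) (use \<theta> in simp)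
  ultimately have "\<forall>\<^sub>F n in sequentially. R - \<theta> < r n & 1 / real (Suc n) < \<theta>" by (rule eventually_conj)
  from eventually_happens'[OF sequentially_bot this]
  obtain n0 where n0: "R - \<theta> < r n0" "1 / real (Suc n0) < \<theta>" by auto
  show ?thesis
  proof (intro exI[of _ n0] allI impI)
   fix n m assume nm: "n0 <= n" "n0 <= m"
   define X Y where "X = v n" and "Y = v m"
   have XY: "X : mhull n0" "Y : mhull n0" using v(1) nm mhull_mono unfolding X_def Y_def by blast+
   note [measurable] = mhull_rgrad_borel[OF XY(1)] mhull_rgrad_borel[OF XY(2)]
   define DD where "DD = sint U (%x. ennreal (SUM i:V. (norm (rgrad (X i) x) powr p + norm (rgrad (Y i) x) powr p) / 2
      - norm ((rgrad (X i) x + rgrad (Y i) x) /\<^sub>R 2) powr p))"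
   have eb: "energy (v k) <= ennreal (R + \<theta>)" if k: "n0 <= k" for k
   proof -
    have "1 / real (Suc k) <= 1 / real (Suc n0)" using k by (simp add: field_simps)
    then have "r k + 1 / real (Suc k) <= R + \<theta>" using rR[of k] n0(2) by linarith
    moreover have "energy (v k) <= ennreal (r k + 1 / real (Suc k))" using v(2)[of k] rM(1)[of k] by (simp add: dr)
    ultimately show ?thesis by (meson ennreal_leI order_trans)
   qed
   have "mid X Y : mhull n0" using XY by (rule mhull.step)
   then have "d n0 <= energy (mid X Y)" unfolding d_def by (rule INF_lower)
   moreover have "ennreal (R - \<theta>) <= d n0" unfolding dr using n0 by (intro ennreal_leI) simp
   ultimately have mlow: "ennreal (R - \<theta>) <= energy (mid X Y)" by (rule order_trans[rotated])
   have "DD + energy (mid X Y) = ennreal (1/2) * (energy X + energy Y)" unfolding DD_def by (rule convexity_defect[OF XY])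
   also have "... <= ennreal (1/2) * (ennreal (R + \<theta>) + ennreal (R + \<theta>))"
    unfolding X_def Y_def by (intro mult_left_mono add_mono eb nm) auto
   also have R0: "0 <= R" using rR[of 0] rM(1)[of 0] by linarith
   then have "ennreal (1/2) * (ennreal (R + \<theta>) + ennreal (R + \<theta>)) = ennreal (R + \<theta>)" by (simp only: ennreal_half_double)
   finally have DDm: "DD + energy (mid X Y) <= ennreal (R + \<theta>)" .
   have DD: "DD <= ennreal (2 * \<theta>)"
   proof -
    have "DD + ennreal (R - \<theta>) <= ennreal (R + \<theta>)" using add_left_mono[OF mlow, of DD] DDm by (rule order_trans)
    moreover have "DD < \<infinity>" using le_less_trans[OF order_trans[OF le_iff_add[THEN iffD2, OF exI, OF refl] DDm] ennreal_less_top] by simp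
    then obtain t where t: "DD = ennreal t" "0 <= t" by (cases DD) auto
    ultimately have "ennreal t + ennreal (R - \<theta>) <= ennreal (R + \<theta>)" by simp
    then have "t + max 0 (R - \<theta>) <= R + \<theta>" using t R0 \<theta> by (cases "0 <= R - \<theta>")
      (auto simp: ennreal_plus[symmetric] ennreal_le_iff ennreal_neg simp del: ennreal_plus)
    then have "t <= 2 * \<theta>" by simp
    then show ?thesis using t by (simp add: ennreal_leI)
   qed
   have "gap X Y <= lint (%x. (ennreal \<epsilon> * (ennreal (SUM i:V. norm (rgrad (X i) x) powr p) * indicator U x
      + ennreal (SUM i:V. norm (rgrad (Y i) x) powr p) * indicator U x)
      + ennreal C * (ennreal (SUM i:V. (norm (rgrad (X i) x) powr p + norm (rgrad (Y i) x) powr p) / 2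
      - norm ((rgrad (X i) x + rgrad (Y i) x) /\<^sub>R 2) powr p) * indicator U x)))"
    unfolding gap_def
   proof (rule nn_integral_mono)
    fix x
    define eX where "eX = (SUM i:V. norm (rgrad (X i) x) powr p)"
    define eY where "eY = (SUM i:V. norm (rgrad (Y i) x) powr p)"
    define dd where "dd = (SUM i:V. (norm (rgrad (X i) x) powr p + norm (rgrad (Y i) x) powr p) / 2
      - norm ((rgrad (X i) x + rgrad (Y i) x) /\<^sub>R 2) powr p)"
    have nn: "0 <= eX" "0 <= eY" "0 <= dd" unfolding eX_def eY_def dd_def using norm_powr_midpoint_le[OF p] by (auto intro!: sum_nonneg)
    have "(SUM i:V. norm (rgrad (X i) x - rgrad (Y i) x) powr p) <= (SUM i:V. \<epsilon> * (norm (rgrad (X i) x) powr p + norm (rgrad (Y i) x) powr p)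
      + C * ((norm (rgrad (X i) x) powr p + norm (rgrad (Y i) x) powr p) / 2 - norm ((rgrad (X i) x + rgrad (Y i) x) /\<^sub>R 2) powr p))"
     by (intro sum_mono C)
    also have "... = \<epsilon> * (eX + eY) + C * dd"
     unfolding sum.distrib sum_distrib_left[symmetric] eX_def eY_def dd_def ..
    finally have "ennreal (SUM i:V. norm (rgrad (X i) x - rgrad (Y i) x) powr p) <= ennreal (\<epsilon> * (eX + eY) + C * dd)" by (rule ennreal_leI)
    also have "... = ennreal \<epsilon> * (ennreal eX + ennreal eY) + ennreal C * ennreal dd"
     using \<epsilon> C nn by (simp add: ennreal_mult ennreal_plus[symmetric] del: ennreal_plus) (simp add: ennreal_mult)
    finally show "ennreal (SUM i:V. norm (rgrad (X i) x - rgrad (Y i) x) powr p) * indicator U x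
     <= ennreal \<epsilon> * (ennreal (SUM i:V. norm (rgrad (X i) x) powr p) * indicator U x
      + ennreal (SUM i:V. norm (rgrad (Y i) x) powr p) * indicator U x)
      + ennreal C * (ennreal (SUM i:V. (norm (rgrad (X i) x) powr p + norm (rgrad (Y i) x) powr p) / 2
      - norm ((rgrad (X i) x + rgrad (Y i) x) /\<^sub>R 2) powr p) * indicator U x)"
     unfolding eX_def[symmetric] eY_def[symmetric] dd_def[symmetric] by (simp add: indicator_def)
   qed
   also have "... = ennreal \<epsilon> * (energy X + energy Y) + ennreal C * DD" by (simp add: nn_integral_add nn_integral_cmult energy_def DD_def)
   also have "... <= ennreal \<epsilon> * (ennreal M + ennreal M) + ennreal C * ennreal (2 * \<theta>)"
    using XY mhull_energy DD by (intro add_mono mult_left_mono) auto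
   also have "... = ennreal (\<epsilon> * (M + M) + C * (2 * \<theta>))"
    using \<epsilon> C \<theta> M by (simp add: ennreal_plus[symmetric] ennreal_mult[symmetric] del: ennreal_plus)
   also have "... <= ennreal \<eta>" using \<epsilon>(2) \<theta>(2) by (intro ennreal_leI) linarith
   finally show "gap (v n) (v m) <= ennreal \<eta>" by (simp add: X_def Y_def)
  qed
 qed
 then show ?thesis using v(1) that by blast
qed

end

lemma powr_geometric_root:
 fixes t b p :: real
 assumes p: "1 < p" and t: "0 <= t" and b: "0 <= b" and le: "(2 powr p) ^ k * t powr p <= b"
 shows "t <= b powr (1/p) / 2 ^ k"
proof -
 have "(2 ^ k * t) powr p = (2 powr p) ^ k * t powr p" using t p by (simp add: powr_mult powr_realpow[symmetric] powr_powr mult.commute)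
 then have "((2 ^ k * t) powr p) powr (1/p) <= b powr (1/p)" using le p by (intro powr_mono2) auto
 then have "2 ^ k * t <= b powr (1/p)" using p t by (simp add: powr_powr)
 then show ?thesis by (simp add: field_simps)
qed

section \<open>A common majorant for the approximating gradients\<close>

context bounded_energy_sequence
begin

lemma rapid_subsequence:
 assumes q: "0 < (q::real)"
 obtains w where "!!k. w k : mhull 0" "!!k. gap (w (Suc k)) (w k) <= ennreal (q ^ k)"
  "!!k i. i : V ==> dev (w k) i <= ennreal (q ^ k)"
proof -
 obtain v where v: "!!n. v n : mhull n"
  "!!\<eta>. 0 < \<eta> ==> EX n0. \<forall>n\<ge>n0. \<forall>m\<ge>n0. gap (v n) (v m) <= ennreal \<eta>" by (rule near_minimisers) blast
 have "EX N. (\<forall>n\<ge>N. \<forall>m\<ge>N. gap (v n) (v m) <= ennreal (q ^ k)) & (\<forall>n\<ge>N. ALL i:V. dev (v n) i <= ennreal (q ^ k))" for k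
 proof -
  have qk: "0 < q ^ k" using q by simp
  obtain N1 where N1: "\<forall>n\<ge>N1. \<forall>m\<ge>N1. gap (v n) (v m) <= ennreal (q ^ k)" using v(2)[OF qk] by (elim exE)
  have "\<forall>\<^sub>F j in sequentially. ALL i:V. dev (h j) i < ennreal (q ^ k)"
   unfolding eventually_ball_finite_distrib[OF V] dev_def using qk by (intro ballI order_tendstoD(2)[OF lim]) auto
  then obtain N2 where "\<forall>j\<ge>N2. ALL i:V. dev (h j) i < ennreal (q ^ k)" unfolding eventually_sequentially by (elim exE)
  then have N2: "!!j i. N2 <= j ==> i : V ==> dev (h j) i <= ennreal (q ^ k)" by (auto simp: less_imp_le)
  have "dev (v n) i <= ennreal (q ^ k)" if "N2 <= n" "i : V" for n i using that by (intro mhull_dev[OF v(1)[of n]] N2) auto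
  then show ?thesis using N1 by (intro exI[of _ "max N1 N2"]) auto
 qed
 then obtain N where N: "!!k. (\<forall>n\<ge>N k. \<forall>m\<ge>N k. gap (v n) (v m) <= ennreal (q ^ k)) & (\<forall>n\<ge>N k. ALL i:V. dev (v n) i <= ennreal (q ^ k))"
  using choice[of "%k N. (\<forall>n\<ge>N. \<forall>m\<ge>N. gap (v n) (v m) <= ennreal (q ^ k)) & (\<forall>n\<ge>N. ALL i:V. dev (v n) i <= ennreal (q ^ k))"] by blast
 \<comment> \<open>The partial sum is at least each of its terms, so both \<open>r k\<close> and
   \<open>r (Suc k)\<close> exceed the threshold \<open>N k\<close>.\<close>
 define r where "r k = (\<Sum>j\<le>k. N j)" for k
 have r: "N k <= r k" "N k <= r (Suc k)" for k unfolding r_def by (rule member_le_sum; simp)+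
 show ?thesis
 proof (rule that[of "%k. v (r k)"])
  show "v (r k) : mhull 0" for k by (rule mhull_mono[OF v(1)]) simp
  show "gap (v (r (Suc k))) (v (r k)) <= ennreal (q ^ k)" for k using N[of k] r[of k] by blast
  show "dev (v (r k)) i <= ennreal (q ^ k)" if "i : V" for k i using N[of k] r[of k] that by blast
 qed
qed

text \<open>Convergence fast enough to be summed gives a single integrable function that dominates
  all gradients and, with factor 2^-k, all deviations from \<open>g\<close>.\<close>

lemma strong_approximation:
 obtains w a where "!!k i. i : V ==> rlip (w k i)" "a : borel_measurable borel" "!!x. 0 <= a x"
  "pint p U a < \<infinity>"
  "AE x\<in>U in lborel. (ALL k. ALL i:V. norm (rgrad (w k i) x) <= a x)"
  "AE x\<in>U in lborel. (ALL i:V. (%k. w k i x) \<longlonglongrightarrow> g i x)"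
  "!!i. i : V ==> (%k. pint p U (%x. \<bar>w k i x - g i x\<bar>)) \<longlonglongrightarrow> 0"
proof -
 \<comment> \<open>The rate 1/(2 Q) serves twice: errors weighted by \<open>Q ^ k\<close> still sum
   like 2^-k, and the weight \<open>Q ^ k\<close>, being the p-th power of \<open>2 ^ k\<close>,
   turns into decay 2^-k when roots are taken.\<close>
 define Q where "Q = 2 powr p"
 have Q: "0 < Q" "1 < Q" using p by (auto simp: Q_def intro: gr_one_powr)
 obtain w where w: "!!k. w k : mhull 0" "!!k. gap (w (Suc k)) (w k) <= ennreal ((1 / (2 * Q)) ^ k)"
  "!!k i. i : V ==> dev (w k) i <= ennreal ((1 / (2 * Q)) ^ k)" by (rule rapid_subsequence[of "1 / (2 * Q)"]) (use Q in auto)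
 define E where "E k x = (SUM i:V. norm (rgrad (w (Suc k) i) x - rgrad (w k i) x) powr p) + (SUM i:V. \<bar>w k i x - g i x\<bar> powr p)" for k x
 define e0 where "e0 x = (SUM i:V. norm (rgrad (w 0 i) x) powr p)" for x
 define B where "B x = ennreal (e0 x) * indicator U x + (\<Sum>k. ennreal (Q ^ k) * (ennreal (E k x) * indicator U x))" for x
 have [measurable]: "rgrad (w k i) : borel_measurable borel" "w k i : borel_measurable borel" if "i : V" for k i
  using mhull_rgrad_borel[OF w(1) that] borel_rlip[OF mhull_rlip[OF w(1) that]] by auto
 have [measurable]: "e0 : borel_measurable borel" "E k : borel_measurable borel" for k unfolding e0_def E_def by measurable
 have [measurable]: "B : borel_measurable borel" unfolding B_def by measurable
 have E0: "0 <= E k x" "0 <= e0 x" for k x by (auto simp: E_def e0_def intro!: add_nonneg_nonneg sum_nonneg)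
 have "sint U (%x. ennreal (E k x)) = gap (w (Suc k)) (w k) + (SUM i:V. dev (w k) i)" for k
 proof -
  have "ennreal (E k x) * indicator U x = ennreal (SUM i:V. norm (rgrad (w (Suc k) i) x - rgrad (w k i) x) powr p) * indicator U x
   + (SUM i:V. ennreal (\<bar>w k i x - g i x\<bar> powr p) * indicator U x)" for x
   by (simp add: E_def sum_nonneg distrib_right sum_ennreal[symmetric] sum_distrib_right del: sum_ennreal)
  then show ?thesis by (simp add: nn_integral_add nn_integral_sum gap_def dev_def)
 qed
 moreover have "gap (w (Suc k)) (w k) + (SUM i:V. dev (w k) i) <= ennreal ((1 / (2 * Q)) ^ k) + (SUM i:V. ennreal ((1 / (2 * Q)) ^ k))" for k
  by (intro add_mono sum_mono w)
 moreover have "ennreal c + (SUM i:V. ennreal c) = ennreal (real (Suc (card V)) * c)" if "0 <= c" for c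
  using that by (subst sum_ennreal) (simp_all add: ennreal_plus[symmetric] distrib_right del: ennreal_plus)
 ultimately have Eint: "sint U (%x. ennreal (E k x)) <= ennreal (real (Suc (card V)) * (1 / (2 * Q)) ^ k)" for k
  using Q by (simp del: of_nat_Suc sum_ennreal sum_constant)
 have "lint B = energy (w 0) + (\<Sum>k. ennreal (Q ^ k) * sint U (%x. ennreal (E k x)))"
  unfolding B_def by (simp add: nn_integral_add nn_integral_suminf nn_integral_cmult energy_def e0_def)
 also have "... <= ennreal M + (\<Sum>k. ennreal (real (Suc (card V)) * (1/2) ^ k))"
 proof (intro add_mono mhull_energy[OF w(1)] suminf_le)
  fix k
  have "ennreal (Q ^ k) * sint U (%x. ennreal (E k x)) <= ennreal (Q ^ k) * ennreal (real (Suc (card V)) * (1 / (2 * Q)) ^ k)"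
   by (intro mult_left_mono Eint) auto
  also have "... = ennreal (Q ^ k * (real (Suc (card V)) * (1 / (2 * Q)) ^ k))" using Q by (intro ennreal_mult[symmetric]) auto
  also have "Q ^ k * (real (Suc (card V)) * (1 / (2 * Q)) ^ k) = real (Suc (card V)) * (1/2) ^ k"
   using Q by (simp add: power_divide power_mult_distrib)
  finally show "ennreal (Q ^ k) * sint U (%x. ennreal (E k x)) <= ennreal (real (Suc (card V)) * (1/2) ^ k)" .
 qed auto
 also have "(\<Sum>k. ennreal (real (Suc (card V)) * (1/2) ^ k)) = ennreal (\<Sum>k. real (Suc (card V)) * (1/2) ^ k)"
  by (intro suminf_ennreal2 summable_mult summable_geometric) auto
 finally have Bint: "lint B < \<infinity>" by (rule le_less_trans) simp
 \<comment> \<open>The factor is 1 + 2: the first gradient plus the geometric series of the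
   increments.\<close>
 define a where "a x = 3 * enn2real (B x) powr (1/p)" for x
 have key: "norm (rgrad (w k i) x) <= a x & \<bar>w k i x - g i x\<bar> <= a x / 2 ^ k"
  if x: "x : U" "B x ~= \<infinity>" and i: "i : V" for x k i
 proof -
  define b where "b = enn2real (B x)"
  define s where "s = b powr (1/p)"
  have b: "B x = ennreal b" "0 <= b" "0 <= s" using x(2) by (auto simp: b_def s_def less_top)
  have "ennreal (Q ^ k * E k x) <= B x" for k
  proof -
   have "ennreal (Q ^ k * E k x) = ennreal (Q ^ k) * (ennreal (E k x) * indicator U x)" using x(1) E0 Q by (simp add: ennreal_mult)
   also have "... = (SUM j:{k}. ennreal (Q ^ j) * (ennreal (E j x) * indicator U x))" by simp
   also have "... <= (\<Sum>j. ennreal (Q ^ j) * (ennreal (E j x) * indicator U x))" by (rule sum_le_suminf) auto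
   also have "... <= B x" unfolding B_def by simp
   finally show ?thesis .
  qed
  then have Eb: "Q ^ k * E k x <= b" for k using b by simp
  have "ennreal (e0 x) <= B x" unfolding B_def using x(1) by simp
  then have e0b: "e0 x <= b" using b by simp
  have D: "norm (rgrad (w (Suc k) i) x - rgrad (w k i) x) <= s / 2 ^ k" for k
  proof -
   have "norm (rgrad (w (Suc k) i) x - rgrad (w k i) x) powr p <= (SUM i:V. norm (rgrad (w (Suc k) i) x - rgrad (w k i) x) powr p)"
    by (rule member_le_sum[OF i _ V]) simp
   also have "... <= E k x" by (simp add: E_def sum_nonneg)
   finally have "Q ^ k * norm (rgrad (w (Suc k) i) x - rgrad (w k i) x) powr p <= Q ^ k * E k x" using Q by (intro mult_left_mono) auto
   also note Eb
   finally show ?thesis unfolding s_def Q_def by (intro powr_geometric_root p b) auto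
  qed
  have d: "\<bar>w k i x - g i x\<bar> <= s / 2 ^ k"
  proof -
   have "\<bar>w k i x - g i x\<bar> powr p <= (SUM i:V. \<bar>w k i x - g i x\<bar> powr p)" by (rule member_le_sum[OF i _ V]) simp
   also have "... <= E k x" by (simp add: E_def sum_nonneg)
   finally have "Q ^ k * \<bar>w k i x - g i x\<bar> powr p <= Q ^ k * E k x" using Q by (intro mult_left_mono) auto
   also note Eb
   finally show ?thesis unfolding s_def Q_def by (intro powr_geometric_root p b) auto
  qed
  have "norm (rgrad (w 0 i) x) powr p <= e0 x" unfolding e0_def by (rule member_le_sum[OF i _ V]) simp
  then have "norm (rgrad (w 0 i) x) <= s / 2 ^ 0" unfolding s_def using e0b by (intro powr_geometric_root p b) auto
  then have "norm (rgrad (w k i) x) <= s * (3 - 2 / 2 ^ k)"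
  proof (induction k)
   case (Suc k)
   have "norm (rgrad (w (Suc k) i) x) <= norm (rgrad (w k i) x) + norm (rgrad (w (Suc k) i) x - rgrad (w k i) x)"
    using norm_triangle_ineq[of "rgrad (w k i) x" "rgrad (w (Suc k) i) x - rgrad (w k i) x"] by simp
   also have "... <= s * (3 - 2 / 2 ^ k) + s / 2 ^ k" using Suc D by (intro add_mono) auto
   also have "... = s * (3 - 2 / 2 ^ Suc k)" by (simp add: field_simps)
   finally show ?case .
  qed simp
  also have "... <= s * 3" using b(3) by (intro mult_left_mono) auto
  finally have "norm (rgrad (w k i) x) <= a x" by (simp add: a_def s_def b_def)
  moreover have "s / 2 ^ k <= a x / 2 ^ k" using b(3) by (intro divide_right_mono) (auto simp: a_def s_def b_def)
  ultimately show ?thesis using d by linarith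
 qed
 have fin: "AE x in lborel. B x ~= \<infinity>" using Bint by (intro nn_integral_noteq_infinite) auto
 show ?thesis
 proof (rule that[of w a])
  show "rlip (w k i)" if "i : V" for k i using mhull_rlip[OF w(1) that] .
  show "a : borel_measurable borel" unfolding a_def by measurable
  show "0 <= a x" for x by (simp add: a_def)
  have aB: "a x powr p = 3 powr p * enn2real (B x)" for x using p by (simp add: a_def powr_mult powr_powr)
  have "ennreal (a x powr p) * indicator U x <= ennreal (3 powr p) * B x" if "B x ~= \<infinity>" for x
  proof -
   have "ennreal (a x powr p) = ennreal (3 powr p) * ennreal (enn2real (B x))" unfolding aB by (rule ennreal_mult) auto
   also have "ennreal (enn2real (B x)) = B x" using that by (simp add: less_top)
   finally show ?thesis by (simp add: indicator_def)
  qed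
  then have "AE x in lborel. ennreal (a x powr p) * indicator U x <= ennreal (3 powr p) * B x" by (intro AE_mp[OF fin AE_I2] impI)
  then have "pint p U a <= lint (%x. ennreal (3 powr p) * B x)" by (rule nn_integral_mono_AE)
  also have "... = ennreal (3 powr p) * lint B" by (rule nn_integral_cmult) measurable
  also have "... < \<infinity>" using Bint by (simp add: ennreal_mult_less_top)
  finally show "pint p U a < \<infinity>" .
  show "AE x\<in>U in lborel. (ALL k. ALL i:V. norm (rgrad (w k i) x) <= a x)" using fin by eventually_elim (use key in blast)
  show "AE x\<in>U in lborel. (ALL i:V. (%k. w k i x) \<longlonglongrightarrow> g i x)"
   using fin
  proof eventually_elim
   fix x assume x: "B x ~= \<infinity>"
   show "x : U --> (ALL i:V. (%k. w k i x) \<longlonglongrightarrow> g i x)"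
   proof (intro impI ballI)
    fix i assume "x : U" "i : V"
    note k = key[OF \<open>x : U\<close> x \<open>i : V\<close>]
    have "(%k. a x / 2 ^ k) \<longlonglongrightarrow> 0" by (rule LIMSEQ_divide_realpow_zero) simp
    then have "(%k. w k i x - g i x) \<longlonglongrightarrow> 0" by (rule Lim_null_comparison[rotated]) (use k in simp)
    then show "(%k. w k i x) \<longlonglongrightarrow> g i x" by (simp add: LIM_zero_iff)
   qed
  qed
  fix i assume i: "i : V"
  have "(%k. ennreal ((1 / (2 * Q)) ^ k)) \<longlonglongrightarrow> ennreal 0" using Q by (intro tendsto_ennrealI LIMSEQ_realpow_zero) auto
  then have z: "(%k. ennreal ((1 / (2 * Q)) ^ k)) \<longlonglongrightarrow> 0" by simp
  have "(%k. dev (w k) i) \<longlonglongrightarrow> 0"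
  proof (rule tendsto_sandwich[OF _ _ tendsto_const z])
   show "\<forall>\<^sub>F k in sequentially. dev (w k) i <= ennreal ((1 / (2 * Q)) ^ k)" by (rule always_eventually) (use w(3) i in blast)
  qed simp
  then show "(%k. pint p U (%x. \<bar>w k i x - g i x\<bar>)) \<longlonglongrightarrow> 0" by (simp only: dev_def)
 qed
qed

end

section \<open>Lusin approximation\<close>

lemma rlip_lipmap: "rlip f ==> EX C. lipmap f C" unfolding rlip_def real_lipschitz_def lipmap_def by (auto simp: dist_real_def)

lemma emeasure_ball_scale:
 fixes x y :: "'e::euclidean_space"
 assumes "0 < r" "0 <= s"
 shows "vol (ball y (s * r)) = ennreal (s ^ DIM('e)) * vol (ball x r)"
proof -
 have "vol (ball y (s * r)) = ennreal (unit_ball_vol (real DIM('e)) * (s * r) ^ DIM('e))" using assms by (simp add: emeasure_ball ennreal_mult)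
 also have "unit_ball_vol (real DIM('e)) * (s * r) ^ DIM('e) = s ^ DIM('e) * (unit_ball_vol (real DIM('e)) * r ^ DIM('e))"
  by (simp add: power_mult_distrib)
 also have "ennreal ... = ennreal (s ^ DIM('e)) * ennreal (unit_ball_vol (real DIM('e)) * r ^ DIM('e))" using assms by (intro ennreal_mult) auto
 finally show ?thesis using assms by (simp add: emeasure_ball)
qed

section \<open>Oscillation on balls and pointwise Lipschitz bounds\<close>

text \<open>The mean oscillation of \<open>f\<close> about the constant \<open>c\<close> on the ball
  is at most \<open>A * r\<close>.\<close>

definition moc :: "('e::euclidean_space => real) => real => 'e => real => real => bool" where
 "moc f A x r c \<longleftrightarrow> (sint (ball x r) (%z. ennreal \<bar>f z - c\<bar>)) <= ennreal (A * r) * vol (ball x r)"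

text \<open>A Poincare inequality with a value of \<open>f\<close> in place of its mean: the double
  integral of the differences is estimated translation by translation, and some point of the ball
  does no worse than twice the average. Taking a value of \<open>f\<close> at a point of the ball
  lets \<open>moc_center\<close> pass to the limit by continuity alone.\<close>

lemma poincare_ball:
 fixes f :: "'e::euclidean_space => real"
 assumes f: "rlip f" and r: "0 < r" and l: "0 < l"
  and a[measurable]: "a : borel_measurable borel"
  and grad: "AE z in lborel. z : ball x r --> norm (rgrad f z) <= a z"
  and avg: "sint (ball x r) (%z. ennreal (a z)) <= ennreal l * vol (ball x r)"
 obtains z where "z : ball x r" "moc f (4 * 2 ^ DIM('e) * l) x r (f z)"
proof -
 define B where "B = ball x r"
 have [measurable]: "B : sets borel" by (simp add: B_def)
 obtain C where "lipmap f C" using rlip_lipmap[OF f] by blast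
 then interpret lipmap f C .
 have [measurable]: "f : borel_measurable borel" by (rule borel_rlip[OF f])
 have md: "AE x in lborel. mdiff f x" using rdiff_AE[OF f] by eventually_elim (rule rdiff_mdiff)
 define b where "b = vol B"
 have b: "0 < b" "b < \<infinity>" using r by (auto simp: b_def B_def emeasure_ball less_top[symmetric])
 \<comment> \<open>Two points of the ball differ by a vector shorter than 2 r, and by convexity the
   segment between them stays in the ball where the gradient bound holds.\<close>
 have inner: "lint (%y. ennreal \<bar>f (y + w) - f y\<bar> * indicator B y * indicator B (y + w))
   <= ennreal (2 * r * l) * b * indicator (ball 0 (2 * r)) w" (is "?L <= _") for w
 proof (cases "w : ball 0 (2 * r)")
  case False
  have "w : ball 0 (2 * r)" if "y : B" "y + w : B" for y
  proof -
   have "norm w <= norm ((y + w) - x) + norm (x - y)" using norm_triangle_ineq[of "(y + w) - x" "x - y"] by simp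
   also have "... < r + r" using that by (intro add_strict_mono) (auto simp: B_def dist_norm norm_minus_commute)
   finally show ?thesis by simp
  qed
  then have "indicator B y = (0::ennreal) | indicator B (y + w) = (0::ennreal)" for y using False by (auto simp: indicator_def)
  then have z: "ennreal \<bar>f (y + w) - f y\<bar> * indicator B y * indicator B (y + w) = 0" for y by (metis mult_zero_left mult_zero_right)
  show ?thesis by (simp only: z) simp
 next
  case True
  have "?L = sint {y : B. y + w : B} (%y. ennreal (dist (f (y + w)) (f y)))" by (intro nn_integral_cong) (simp add: dist_real_def indicator_def)
  also have "... <= sint B (%y. ennreal (mslope f w y))"
  proof (rule dist_shift_integral_le[OF md])
   fix y s :: real and z assume z: "z : {y : B. y + w : B}" and s: "0 <= s" "s <= 1"
   have "(1 - s) *\<^sub>R z + s *\<^sub>R (z + w) : B" using z s unfolding B_def by (intro convexD[OF convex_ball]) auto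
   then show "z + s *\<^sub>R w : B" by (simp add: algebra_simps)
  qed (use b in "simp_all add: b_def")
  also have "... <= lint (%y. ennreal (2 * r) * (ennreal (a y) * indicator B y))"
  proof (rule nn_integral_mono_AE)
   show "AE y in lborel. ennreal (mslope f w y) * indicator B y <= ennreal (2 * r) * (ennreal (a y) * indicator B y)"
    using rdiff_AE[OF f] grad
   proof eventually_elim
    case (elim y)
    show ?case
    proof (cases "y : B")
     case True
     then have g: "norm (rgrad f y) <= a y" using elim by (simp add: B_def)
     have "mslope f w y <= norm w * norm (rgrad f y)" unfolding rdiff_mdiff(2)[OF elim(1)] by (rule Cauchy_Schwarz_ineq2)
     also have "... <= 2 * r * a y" using \<open>w : ball 0 (2 * r)\<close> r g by (intro mult_mono) auto
     finally have "ennreal (mslope f w y) <= ennreal (2 * r * a y)" by (rule ennreal_leI)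
     also have "... = ennreal (2 * r) * ennreal (a y)" using r order_trans[OF norm_ge_zero g] by (intro ennreal_mult) auto
     finally show ?thesis using True by simp
    qed simp
   qed
  qed
  also have "... = ennreal (2 * r) * sint B (%y. ennreal (a y))" by (rule nn_integral_cmult) measurable
  also have "... <= ennreal (2 * r) * (ennreal l * b)" using avg unfolding B_def b_def by (rule mult_left_mono) simp
  also have "... = ennreal (2 * r * l) * b" using r l by (simp add: ennreal_mult mult.assoc)
  finally show ?thesis using True by simp
 qed
 have "sint B (%y. (sint B (%z. ennreal \<bar>f z - f y\<bar>)))
   = lint (%y. (lint (%w. ennreal \<bar>f (y + w) - f y\<bar> * indicator B y * indicator B (y + w))))"
 proof (rule nn_integral_cong)
  fix y
  have "sint B (%z. ennreal \<bar>f z - f y\<bar>) = lint (%w. ennreal \<bar>f (w + y) - f y\<bar> * indicator B (w + y))"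
   by (rule nn_integral_lborel_translate[symmetric, where f = "%z. ennreal \<bar>f z - f y\<bar> * indicator B z"]) measurable
  then show "sint B (%z. ennreal \<bar>f z - f y\<bar>) * indicator B y
    = lint (%w. ennreal \<bar>f (y + w) - f y\<bar> * indicator B y * indicator B (y + w))" by (simp add: add.commute indicator_def)
 qed
 also have "... = lint (%w. (lint (%y. ennreal \<bar>f (y + w) - f y\<bar> * indicator B y * indicator B (y + w))))"
  by (rule lborel_pair.Fubini') measurable
 also have "... <= lint (%w. ennreal (2 * r * l) * b * indicator (ball 0 (2 * r)) (w::'e))" by (intro nn_integral_mono inner)
 also have "... = ennreal (2 * r * l) * b * (ennreal (2 ^ DIM('e)) * b)"
  using emeasure_ball_scale[OF r, of 2 0 x] by (subst nn_integral_cmult_indicator) (simp_all add: b_def B_def)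
 finally have dbl: "sint B (%y. (sint B (%z. ennreal \<bar>f z - f y\<bar>))) <= ennreal (2 * r * l) * b * (ennreal (2 ^ DIM('e)) * b)" .
 \<comment> \<open>The factor 2 is the diameter in units of \<open>r\<close>;
   \<open>2 ^ DIM('e)\<close> is the volume of the ball of admissible translations relative to
   \<open>B\<close>.\<close>
 define A where "A = 2 * 2 ^ DIM('e) * l"
 have A: "0 < A" using l by (simp add: A_def)
 have "EX z:B. (sint B (%y. ennreal \<bar>f y - f z\<bar>)) <= ennreal (2 * A * r) * b"
 proof (rule ccontr)
  assume "~ ?thesis"
  then have "ennreal (2 * A * r) * b <= sint B (%z. ennreal \<bar>f z - f y\<bar>)" if "y : B" for y using that by (auto simp: not_le less_imp_le)
  then have "lint (%y. ennreal (2 * A * r) * b * indicator B y) <= sint B (%y. (sint B (%z. ennreal \<bar>f z - f y\<bar>)))"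
   by (intro nn_integral_mono) (auto simp: indicator_def)
  also note dbl
  also have "lint (%y. ennreal (2 * A * r) * b * indicator B y) = ennreal (2 * A * r) * b * b" by (simp add: nn_integral_cmult b_def)
  finally have le: "ennreal (2 * A * r) * b * b <= ennreal (2 * r * l) * b * (ennreal (2 ^ DIM('e)) * b)" .
  obtain t where t: "b = ennreal t" "0 < t" using b by (cases b) (auto simp: ennreal_less_zero_iff)
  have "2 * A * r * t * t <= 2 * r * l * t * (2 ^ DIM('e) * t)" using le t A r l by (simp add: ennreal_mult[symmetric] del: ennreal_power)
  then have "2 * (A * r * t * t) <= A * r * t * t" by (simp add: A_def algebra_simps)
  moreover have "0 < A * r * t * t" using A r t by simp
  ultimately show False by linarith
 qed
 then show ?thesis using that by (auto simp: B_def b_def A_def moc_def mult.assoc)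
qed

text \<open>Both constants are close to \<open>f\<close> on average over the smaller ball; the power
  of 2 is the ratio of the volumes.\<close>

lemma moc_compare:
 fixes f :: "'e::euclidean_space => real"
 assumes f: "rlip f" and r: "0 < r" and A: "0 < A" and sub: "ball y (r/2) \<subseteq> ball x r"
  and m: "moc f A x r c" "moc f A y (r/2) c'"
 shows "\<bar>c - c'\<bar> <= 2 * 2 ^ DIM('e) * A * r"
proof -
 have [measurable]: "f : borel_measurable borel" by (rule borel_rlip[OF f])
 have [measurable]: "ball x r : sets borel" "ball y (r/2) : sets borel" by simp_all
 define b where "b = vol (ball y (r/2))"
 obtain t where t: "b = ennreal t" "0 < t"
  using r that[of "measure lborel (ball y (r/2))"] content_ball_pos[of "r/2" y] emeasure_eq_ennreal_measure[of lborel "ball y (r/2)"]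
  using emeasure_lborel_ball_finite[of y "r/2"] by (simp add: b_def)
 have "ennreal \<bar>c - c'\<bar> * b = lint (%z. ennreal \<bar>c - c'\<bar> * indicator (ball y (r/2)) z)"
  by (subst nn_integral_cmult_indicator) (simp_all add: b_def)
 also have "... <= lint (%z. ennreal \<bar>f z - c\<bar> * indicator (ball x r) z + ennreal \<bar>f z - c'\<bar> * indicator (ball y (r/2)) z)"
 proof (rule nn_integral_mono)
  fix z
  have "ennreal \<bar>c - c'\<bar> <= ennreal (\<bar>f z - c\<bar> + \<bar>f z - c'\<bar>)" by (intro ennreal_leI) linarith
  then have "ennreal \<bar>c - c'\<bar> <= ennreal \<bar>f z - c\<bar> + ennreal \<bar>f z - c'\<bar>" by simp
  then show "ennreal \<bar>c - c'\<bar> * indicator (ball y (r/2)) z <= ennreal \<bar>f z - c\<bar> * indicator (ball x r) z + ennreal \<bar>f z - c'\<bar> * indicator (ball y (r/2)) z"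
   using sub by (cases "z : ball y (r/2)") (auto simp: subset_iff)
 qed
 also have "... = sint (ball x r) (%z. ennreal \<bar>f z - c\<bar>) + sint (ball y (r/2)) (%z. ennreal \<bar>f z - c'\<bar>)"
  by (rule nn_integral_add) measurable
 also have "... <= ennreal (A * r) * vol (ball x r) + ennreal (A * (r/2)) * b" using add_mono[OF m[unfolded moc_def]] by (simp add: b_def)
 also have "vol (ball x r) = ennreal (2 ^ DIM('e)) * b" using emeasure_ball_scale[of "r/2" 2 x y] r by (simp add: b_def)
 finally have "\<bar>c - c'\<bar> * t <= A * r * (2 ^ DIM('e) * t) + A * (r/2) * t"
  using A r t by (simp add: ennreal_mult[symmetric] ennreal_plus[symmetric] del: ennreal_plus ennreal_power)
 also have "... = (A * r * 2 ^ DIM('e) + A * r * (1/2)) * t" by (simp add: algebra_simps)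
 finally have "\<bar>c - c'\<bar> <= A * r * 2 ^ DIM('e) + A * r * (1/2)" using t by simp
 also have "... <= A * r * 2 ^ DIM('e) + A * r * 2 ^ DIM('e)"
  using A r order_trans[of "1/2::real" 1 "2 ^ DIM('e)"] by (intro add_mono mult_left_mono) auto
 finally show ?thesis by (simp add: algebra_simps)
qed

text \<open>Telescoping over balls of half the radius each time. The constants are values of
  \<open>f\<close> at points converging to \<open>x\<close>, so they converge to
  \<open>f x\<close>.\<close>

lemma moc_center:
 fixes f :: "'e::euclidean_space => real"
 assumes f: "rlip f" and A: "0 < A" and r: "0 < r" "r <= R"
  and good: "!!s. 0 < s ==> s <= R ==> EX z:ball x s. moc f A x s (f z)"
  and c: "moc f A x r c"
 shows "\<bar>f x - c\<bar> <= 4 * 2 ^ DIM('e) * A * r"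
proof -
 define D where "D = 2 * 2 ^ DIM('e) * A"
 have D: "0 < D" using A by (simp add: D_def)
 define s where "s k = r / 2 ^ k" for k :: nat
 have s: "0 < s k" "s k <= R" "s (Suc k) = s k / 2" for k
 proof -
  show "0 < s k" "s (Suc k) = s k / 2" using r by (simp_all add: s_def)
  have "s k <= r / 1" unfolding s_def using r by (intro divide_left_mono) auto
  then show "s k <= R" using r by simp
 qed
 obtain z where z: "!!k. z k : ball x (s k) & moc f A x (s k) (f (z k))"
  using choice[of "%k z. z : ball x (s k) & moc f A x (s k) (f z)"] good s by blast
 define u where "u k = (if k = 0 then c else f (z k))" for k
 have u: "moc f A x (s k) (u k)" for k using z c by (simp add: u_def s_def)
 have step: "\<bar>u k - u (Suc k)\<bar> <= D * s k" for k
  unfolding D_def by (rule moc_compare[OF f s(1) A _ u u[of "Suc k", unfolded s(3)]]) (use s(1)[of k] in "auto simp: subset_ball")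
 have "\<bar>u k - c\<bar> <= D * r * (2 - 2 / 2 ^ k)" for k
 proof (induction k)
  case 0
  then show ?case by (simp add: u_def)
 next
  case (Suc k)
  have "\<bar>u (Suc k) - c\<bar> <= D * r * (2 - 2 / 2 ^ k) + D * s k" using step[of k] Suc by linarith
  also have "... = D * r * (2 - 2 / 2 ^ Suc k)" by (simp add: s_def field_simps)
  finally show ?case .
 qed
 moreover have "D * r * (2 - 2 / 2 ^ k) <= D * r * 2" for k :: nat using D r by (intro mult_left_mono) auto
 ultimately have ub: "\<bar>u k - c\<bar> <= D * r * 2" for k by (rule order_trans)
 have "(%k. r / 2 ^ k) \<longlonglongrightarrow> 0" by (rule LIMSEQ_divide_realpow_zero) simp
 then have "(%k. z k - x) \<longlonglongrightarrow> 0" by (rule Lim_null_comparison[rotated])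
   (use z in "auto simp: s_def dist_norm norm_minus_commute intro!: always_eventually less_imp_le")
 then have "z \<longlonglongrightarrow> x" by (simp add: LIM_zero_iff)
 then have "(%k. f (z k)) \<longlonglongrightarrow> f x" by (rule continuous_on_tendsto_compose[OF rlip_continuous[OF f, of UNIV]]) auto
 then have "u \<longlonglongrightarrow> f x" by (rule Lim_transform_eventually) (auto simp: u_def eventually_sequentially intro!: exI[of _ 1])
 then have "(%k. \<bar>u k - c\<bar>) \<longlonglongrightarrow> \<bar>f x - c\<bar>" by (intro tendsto_intros)
 then have "\<bar>f x - c\<bar> <= D * r * 2" by (rule LIMSEQ_le_const2) (use ub in blast)
 then show ?thesis by (simp add: D_def algebra_simps)
qed

text \<open>The ball of radius |x - y| around \<open>y\<close> lies in the ball of radius 2 |x - y|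
  around \<open>x\<close>, so the constants for the two centres can be compared. The contributions
  to the constant are 8, 4 and 4.\<close>

lemma moc_lipschitz:
 fixes f :: "'e::euclidean_space => real"
 assumes f: "rlip f" and A: "0 < A" and xy: "2 * norm (x - y) <= R"
  and gx: "!!s. 0 < s ==> s <= R ==> EX z:ball x s. moc f A x s (f z)"
  and gy: "!!s. 0 < s ==> s <= R ==> EX z:ball y s. moc f A y s (f z)"
 shows "\<bar>f x - f y\<bar> <= 16 * 2 ^ DIM('e) * A * norm (x - y)"
proof (cases "x = y")
 case False
 define d where "d = norm (x - y)"
 have d: "0 < d" "2 * d <= R" using False xy by (auto simp: d_def)
 then have dR: "d <= R" by linarith
 obtain c where c: "moc f A x (2 * d) c" using gx[of "2 * d"] d by auto
 obtain c' where c': "moc f A y d c'" using gy[of d] d dR by auto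
 have sub: "ball y d \<subseteq> ball x (2 * d)" by (simp add: subset_ball ball_subset_ball_iff dist_norm d_def norm_minus_commute)
 have 1: "\<bar>f x - c\<bar> <= 4 * 2 ^ DIM('e) * A * (2 * d)" by (rule moc_center[OF f A _ d(2) gx c]) (use d in auto)
 have 2: "\<bar>f y - c'\<bar> <= 4 * 2 ^ DIM('e) * A * d" by (rule moc_center[OF f A d(1) dR gy c'])
 have 3: "\<bar>c - c'\<bar> <= 2 * 2 ^ DIM('e) * A * (2 * d)" by (rule moc_compare[OF f _ A _ c]) (use d sub c' in auto)
 have "\<bar>f x - f y\<bar> <= \<bar>f x - c\<bar> + \<bar>c - c'\<bar> + \<bar>f y - c'\<bar>" by linarith
 also have "... <= 16 * (2 ^ DIM('e) * A * d)" using 1 2 3 by linarith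
 finally show ?thesis by (simp add: d_def mult.assoc)
qed simp

text \<open>Finite nets turn pointwise convergence into uniform convergence, and they bound
  \<open>g\<close>. For points farther apart than \<open>R\<close> this bound already gives a
  Lipschitz estimate, so the local estimate becomes global.\<close>

lemma equi_lipschitz_limit:
 fixes w :: "nat => 'e::euclidean_space => real"
 assumes K: "compact K" and R: "0 < R" and C: "0 <= C"
  and lip: "!!k x y. x : K ==> y : K ==> norm (x - y) <= R ==> \<bar>w k x - w k y\<bar> <= C * norm (x - y)"
  and lim: "!!x. x : K ==> (%k. w k x) \<longlonglongrightarrow> g x"
 shows "EX C. ALL x:K. ALL y:K. \<bar>g x - g y\<bar> <= C * norm (x - y)"
  and "!!\<epsilon>. 0 < \<epsilon> ==> \<forall>\<^sub>F k in sequentially. ALL x:K. \<bar>w k x - g x\<bar> <= \<epsilon>"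
proof -
 have loc: "\<bar>g x - g y\<bar> <= C * norm (x - y)" if "x : K" "y : K" "norm (x - y) <= R" for x y
  by (rule LIMSEQ_le_const2[OF tendsto_rabs[OF tendsto_diff[OF lim[OF that(1)] lim[OF that(2)]]]]) (use lip[OF that] in auto)
 have cov: "EX T. finite T & T \<subseteq> K & K \<subseteq> (\<Union>t\<in>T. ball t \<delta>)" if "0 < \<delta>" for \<delta>
  using seq_compact_imp_totally_bounded[OF K[unfolded compact_eq_seq_compact_metric]] that by blast
 obtain T where T: "finite T" "T \<subseteq> K" "K \<subseteq> (\<Union>t\<in>T. ball t R)" using cov[OF R] by blast
 define M where "M = (SUM t:T. \<bar>g t\<bar>) + C * R"
 have gb: "\<bar>g x\<bar> <= M" if x: "x : K" for x
 proof -
  obtain t where t: "t : T" "dist t x < R" using T(3) x by auto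
  then have "\<bar>g x - g t\<bar> <= C * norm (x - t)" using T(2) x by (intro loc) (auto simp: dist_norm norm_minus_commute)
  also have "... <= C * R" using t C by (intro mult_left_mono) (auto simp: dist_norm norm_minus_commute)
  moreover have "\<bar>g t\<bar> <= (SUM t:T. \<bar>g t\<bar>)" by (rule member_le_sum[OF t(1) _ T(1)]) simp
  ultimately show ?thesis unfolding M_def by linarith
 qed
 show "EX C. ALL x:K. ALL y:K. \<bar>g x - g y\<bar> <= C * norm (x - y)"
 proof (intro exI[of _ "C + 2 * M / R"] ballI)
  fix x y assume xy: "x : K" "y : K"
  have M: "0 <= M" using gb[OF xy(1)] by linarith
  show "\<bar>g x - g y\<bar> <= (C + 2 * M / R) * norm (x - y)"
  proof (cases "norm (x - y) <= R")
   case True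
   have "C * norm (x - y) <= (C + 2 * M / R) * norm (x - y)" using M R by (intro mult_right_mono) auto
   then show ?thesis using loc[OF xy True] by linarith
  next
   case False
   have "\<bar>g x - g y\<bar> <= 2 * M / R * R" using gb[OF xy(1)] gb[OF xy(2)] R by simp
   also have "... <= (C + 2 * M / R) * norm (x - y)" using False M R C by (intro mult_mono) auto
   finally show ?thesis .
  qed
 qed
 fix \<epsilon> :: real assume \<epsilon>: "0 < \<epsilon>"
 define \<delta> where "\<delta> = min R (\<epsilon> / (3 * (C + 1)))"
 have \<delta>: "0 < \<delta>" "\<delta> <= R" using R \<epsilon> C by (auto simp: \<delta>_def)
 have "C * \<delta> <= (C + 1) * (\<epsilon> / (3 * (C + 1)))" using C \<delta> \<epsilon> by (intro mult_mono) (auto simp: \<delta>_def)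
 also have "... = \<epsilon> / 3" using C by (simp add: field_simps)
 finally have C\<delta>: "C * \<delta> <= \<epsilon> / 3" .
 obtain T where T: "finite T" "T \<subseteq> K" "K \<subseteq> (\<Union>t\<in>T. ball t \<delta>)" using cov[OF \<delta>(1)] by blast
 have "\<forall>\<^sub>F k in sequentially. ALL t:T. dist (w k t) (g t) < \<epsilon> / 3"
  unfolding eventually_ball_finite_distrib[OF T(1)] using T(2) \<epsilon> by (intro ballI tendstoD[OF lim]) auto
 then show "\<forall>\<^sub>F k in sequentially. ALL x:K. \<bar>w k x - g x\<bar> <= \<epsilon>"
 proof eventually_elim
  case (elim k)
  show ?case
  proof
   fix x assume x: "x : K"
   obtain t where t: "t : T" "dist t x < \<delta>" using T(3) x by auto
   have n: "norm (x - t) <= R" "C * norm (x - t) <= C * \<delta>" using t \<delta> C by (auto simp: dist_norm norm_minus_commute intro!: mult_left_mono)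
   have tK: "t : K" using t T by blast
   have "\<bar>w k t - g t\<bar> < \<epsilon> / 3" using elim t(1) by (simp add: dist_real_def)
   then show "\<bar>w k x - g x\<bar> <= \<epsilon>" using lip[OF x tK n(1), of k] loc[OF x tK n(1)] n(2) C\<delta> by linarith
  qed
 qed
qed

lemma pred_ball [measurable]: "Measurable.pred borel (%z::'e::euclidean_space. z : ball x r)" by (simp add: pred_def)

section \<open>Compact sets that exhaust the domain\<close>

text \<open>Sublevel sets of a small-scale maximal function, restricted to balls inside
  \<open>U\<close>, since gradients are controlled only there.\<close>

definition mbound :: "'e::euclidean_space set => ('e => ennreal) => nat => 'e set" where
 "mbound U b l = {x. norm x <= real l & ball x (1 / real (Suc l)) \<subseteq> U &
  (ALL r. 0 < r & r <= 1 / real (Suc l) --> sint (ball x r) b <= of_nat l * vol (ball x r))}"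

lemma mbound_mono:
 assumes "l <= m"
 shows "mbound U b l \<subseteq> mbound U b m"
proof
 fix x assume x: "x : mbound U b l"
 have r: "1 / real (Suc m) <= 1 / real (Suc l)" using assms by (intro divide_left_mono) auto
 show "x : mbound U b m" unfolding mbound_def
 proof (intro CollectI conjI allI impI)
  show "norm x <= real m" using x assms by (auto simp: mbound_def)
  show "ball x (1 / real (Suc m)) \<subseteq> U" using x subset_ball[OF r, of x] unfolding mbound_def by blast
  fix s assume s: "0 < s & s <= 1 / real (Suc m)"
  then have "sint (ball x s) b <= of_nat l * vol (ball x s)" using x r unfolding mbound_def by (auto dest: order_trans)
  also have "... <= of_nat m * vol (ball x s)" using assms by (intro mult_right_mono) auto
  finally show "sint (ball x s) b <= of_nat m * vol (ball x s)" .
 qed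
qed

text \<open>Integrals over open balls are lower semicontinuous in the centre by Fatou's lemma, and
  the volume does not depend on the centre.\<close>

lemma compact_mbound:
 fixes U :: "'e::euclidean_space set"
 assumes b[measurable]: "b : borel_measurable borel"
 shows "compact (mbound U b l)"
proof -
 define \<rho> where "\<rho> = 1 / real (Suc l)"
 have "closed (mbound U b l)" unfolding closed_sequential_limits
 proof (intro allI impI, elim conjE)
  fix x :: "nat => 'e" and y assume x: "ALL n. x n : mbound U b l" and lim: "x \<longlonglongrightarrow> y"
  have near: "\<forall>\<^sub>F n in sequentially. z : ball (x n) r" if "z : ball y r" for z r
  proof -
   have "(%n. dist (x n) z) \<longlonglongrightarrow> dist y z" by (intro tendsto_intros lim)
   then have "\<forall>\<^sub>F n in sequentially. dist (x n) z < r" by (rule order_tendstoD) (use that in simp)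
   then show ?thesis by simp
  qed
  have "ball y \<rho> \<subseteq> U"
  proof
   fix z assume "z : ball y \<rho>"
   from eventually_happens'[OF sequentially_bot near[OF this]] show "z : U" using x unfolding mbound_def \<rho>_def by blast
  qed
  moreover have "sint (ball y r) b <= of_nat l * vol (ball y r)" if r: "0 < r" "r <= \<rho>" for r
  proof -
   have bl: "vol (ball (x n) r) = vol (ball y r)" for n using emeasure_ball_scale[OF r(1), of 1 "x n" y] by simp
   have "sint (ball y r) b <= lint (%z. liminf (%n. b z * indicator (ball (x n) r) z))"
   proof (rule nn_integral_mono)
    fix z
    show "b z * indicator (ball y r) z <= liminf (%n. b z * indicator (ball (x n) r) z)"
    proof (cases "z : ball y r")
     case True
     then show ?thesis using near[OF True] by (intro Liminf_bounded) (auto elim: eventually_mono)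
    qed simp
   qed
   also have "... <= liminf (%n. sint (ball (x n) r) (%z. b z))" by (rule nn_integral_liminf) measurable
   also have "... <= liminf (%n::nat. of_nat l * vol (ball y r))"
   proof (intro Liminf_mono always_eventually allI)
    fix n
    have "sint (ball (x n) r) (%z. b z) <= of_nat l * vol (ball (x n) r)" using x[THEN spec, of n] r unfolding mbound_def \<rho>_def by blast
    then show "sint (ball (x n) r) (%z. b z) <= of_nat l * vol (ball y r)" by (simp only: bl)
   qed
   also have "... = of_nat l * vol (ball y r)" by (simp add: Liminf_const)
   finally show ?thesis .
  qed
  moreover have "norm y <= real l" by (rule LIMSEQ_le_const2[OF tendsto_norm[OF lim]]) (use x in "auto simp: mbound_def")
  ultimately show "y : mbound U b l" by (simp add: mbound_def \<rho>_def)
 qed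
 moreover have "mbound U b l \<subseteq> cball 0 (real l)" by (auto simp: mbound_def)
 ultimately show ?thesis by (metis bounded_cball bounded_subset compact_eq_bounded_closed)
qed

text \<open>The maximal function of \<open>b\<close> cut off outside \<open>U\<close> is finite
  almost everywhere; a larger index also takes care of the norm and of the distance to the
  boundary.\<close>

lemma mbound_exhausts:
 fixes U :: "'e::euclidean_space set"
 assumes U: "open U" and b[measurable]: "b : borel_measurable borel" and fin: "sint U b < \<infinity>"
 shows "AE x\<in>U in lborel. (\<forall>\<^sub>F l in sequentially. x : mbound U b l)"
proof -
 have [measurable]: "U : sets borel" using U by simp
 have "AE x in lborel. EX l::nat. ALL r. 0 < r & r <= 1 -->
     sint (ball x r) (%y. b y * indicator U y) <= of_nat l * vol (ball x r)" by (rule maximal_finite_AE) (use fin in simp_all)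
 then show ?thesis
 proof eventually_elim
  case (elim x)
  then obtain l where l: "!!r. 0 < r ==> r <= 1 ==> sint (ball x r) (%y. b y * indicator U y) <= of_nat l * vol (ball x r)" by blast
  show ?case
  proof
   assume "x : U"
   then obtain \<rho> where \<rho>: "0 < \<rho>" "ball x \<rho> \<subseteq> U" using U open_contains_ball by blast
   obtain m :: nat where m: "norm x <= real m" using real_arch_simple by blast
   obtain k :: nat where k: "1 / real (Suc k) < \<rho>" using \<rho>(1) nat_approx_posE by blast
   define L where "L = max l (max m k)"
   have LU: "ball x (1 / real (Suc L)) \<subseteq> U"
   proof -
    have "1 / real (Suc L) <= 1 / real (Suc k)" by (intro divide_left_mono) (auto simp: L_def)
    then show ?thesis using k \<rho>(2) subset_ball[of "1 / real (Suc L)" \<rho> x] by auto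
   qed
   have "x : mbound U b L" unfolding mbound_def
   proof (intro CollectI conjI allI impI LU)
    show "norm x <= real L" using m by (simp add: L_def)
    fix r assume r: "0 < r & r <= 1 / real (Suc L)"
    moreover have "1 / real (Suc L) <= 1" by simp
    ultimately have r1: "r <= 1" by linarith
    have "ball x r \<subseteq> U" using LU subset_ball[of r "1 / real (Suc L)" x] r by blast
    then have "sint (ball x r) b = sint (ball x r) (%y. b y * indicator U y)" by (intro nn_integral_cong) (auto simp: indicator_def)
    also have "... <= of_nat l * vol (ball x r)" using r r1 by (intro l) auto
    also have "... <= of_nat L * vol (ball x r)" by (intro mult_right_mono) (auto simp: L_def)
    finally show "sint (ball x r) b <= of_nat L * vol (ball x r)" .
   qed
   then show "\<forall>\<^sub>F l in sequentially. x : mbound U b l" unfolding eventually_sequentially using mbound_mono by blast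
  qed
 qed
qed

text \<open>The losses are at most 2^-l, so by Borel-Cantelli almost every point is lost only
  finitely often.\<close>

lemma inner_compact_exhausts:
 fixes S :: "nat => 'e::euclidean_space set"
 assumes S: "!!l. S l : sets borel" "!!l. vol (S l) < \<infinity>"
 obtains K where "!!l. compact (K l)" "!!l. K l \<subseteq> S l"
  "AE x in lborel. (\<forall>\<^sub>F l in sequentially. x : S l) --> (\<forall>\<^sub>F l in sequentially. x : K l)"
proof -
 have "EX K. compact K & K \<subseteq> S l & vol (S l - K) < ennreal ((1/2) ^ l)" for l by (rule lborel_inner_compact[OF S, of "(1/2) ^ l" l]) auto
 from choice[OF allI, OF this] obtain K
  where "ALL l. compact (K l) & K l \<subseteq> S l & vol (S l - K l) < ennreal ((1/2) ^ l)" ..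
 then have K: "compact (K l)" "K l \<subseteq> S l" "vol (S l - K l) < ennreal ((1/2) ^ l)" for l by simp_all
 have Km[measurable]: "S l - K l : sets lborel" for l using S(1) K by (auto simp: borel_compact)
 have "AE x in lborel. \<forall>\<^sub>F l in sequentially. x : space lborel - (S l - K l)"
 proof (rule borel_cantelli_AE1[OF Km])
  show fin: "vol (S l - K l) < \<infinity>" for l using K[of l] by (auto intro: less_trans)
  have "measure lborel (S l - K l) <= (1/2) ^ l" for l unfolding measure_def using K(3)[of l] by (intro enn2real_leI) (auto simp: less_imp_le)
  then show "summable (%l. measure lborel (S l - K l))" by (intro summable_comparison_test'[OF summable_geometric[of "1/2::real"]]) auto
 qed
 then have "AE x in lborel. (\<forall>\<^sub>F l in sequentially. x : S l) --> (\<forall>\<^sub>F l in sequentially. x : K l)"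
 proof eventually_elim
  case (elim x)
  show ?case
  proof
   assume "\<forall>\<^sub>F l in sequentially. x : S l"
   with elim show "\<forall>\<^sub>F l in sequentially. x : K l" by eventually_elim simp
  qed
 qed
 then show ?thesis by (rule that[OF K(1,2)])
qed

context bounded_energy_sequence
begin

text \<open>On sublevel sets of the maximal function of the majorant all the approximating functions
  share one Lipschitz bound at small scale, so their limit inherits it and convergence is
  uniform.\<close>

lemma lusin_sets:
 assumes opn: "open U"
 obtains w a K where "!!k i. i : V ==> rlip (w k i)" "a : borel_measurable borel" "!!x. 0 <= a x"
  "pint p U a < \<infinity>"
  "AE x\<in>U in lborel. (ALL k. ALL i:V. norm (rgrad (w k i) x) <= a x)"
  "!!i. i : V ==> (%k. pint p U (%x. \<bar>w k i x - g i x\<bar>)) \<longlonglongrightarrow> 0"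
  "!!l. compact (K l)" "!!l. K l \<subseteq> U"
  "AE x\<in>U in lborel. (\<forall>\<^sub>F l in sequentially. x : K l)"
  "!!l i. i : V ==> EX C. ALL x:K l. ALL y:K l. \<bar>g i x - g i y\<bar> <= C * norm (x - y)"
  "!!l i \<epsilon>. i : V ==> 0 < \<epsilon> ==> \<forall>\<^sub>F k in sequentially. ALL x:K l. \<bar>w k i x - g i x\<bar> <= \<epsilon>"
proof (rule strong_approximation)
 fix w a assume w: "!!k i. i : V ==> rlip (w k i)" and a[measurable]: "a : borel_measurable borel" and a0: "!!x. 0 <= a x"
  and fin: "pint p U a < \<infinity>"
  and grad: "AE x\<in>U in lborel. (ALL k. ALL i:V. norm (rgrad (w k i) x) <= a x)"
  and ptw: "AE x\<in>U in lborel. (ALL i:V. (%k. w k i x) \<longlonglongrightarrow> g i x)"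
  and conv: "!!i. i : V ==> (%k. pint p U (%x. \<bar>w k i x - g i x\<bar>)) \<longlonglongrightarrow> 0"
 obtain N where N: "{x : space lborel. ~ (x : U --> (ALL i:V. (%k. w k i x) \<longlonglongrightarrow> g i x))} \<subseteq> N"
  "vol N = 0" "N : sets lborel" by (rule AE_E[OF ptw])
 define b where "b x = ennreal (a x powr p)" for x
 have bm: "b : borel_measurable borel" unfolding b_def by measurable
 \<comment> \<open>The null set where pointwise convergence fails is removed, so that the limit is
   \<open>g\<close> at every point of \<open>K l\<close>; the inner compact sets restore
   closedness.\<close>
 define S where "S l = mbound U b l - N" for l
 have SU: "S l \<subseteq> U" for l
 proof
  fix x assume "x : S l"
  then have "ball x (1 / real (Suc l)) \<subseteq> U" unfolding S_def mbound_def by blast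
  moreover have "x : ball x (1 / real (Suc l))" by simp
  ultimately show "x : U" by blast
 qed
 have S: "S l : sets borel" "vol (S l) < \<infinity>" for l
 proof -
  show "S l : sets borel" unfolding S_def using borel_compact[OF compact_mbound[OF bm]] N(3) by (intro sets.Diff) simp_all
  have "vol (S l) <= vol (mbound U b l)" unfolding S_def using compact_mbound[OF bm] by (intro emeasure_mono) (auto simp: borel_compact)
  then show "vol (S l) < \<infinity>" using emeasure_compact_finite[OF compact_mbound[OF bm]] by (rule le_less_trans)
 qed
 obtain K where K: "!!l. compact (K l)" "!!l. K l \<subseteq> S l"
  "AE x in lborel. (\<forall>\<^sub>F l in sequentially. x : S l) --> (\<forall>\<^sub>F l in sequentially. x : K l)"
  by (rule inner_compact_exhausts[of S, OF S]) blast
 have cover: "AE x\<in>U in lborel. (\<forall>\<^sub>F l in sequentially. x : K l)"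
 proof -
  have "AE x\<in>U in lborel. (\<forall>\<^sub>F l in sequentially. x : mbound U b l)"
   by (rule mbound_exhausts[OF opn bm]) (use fin in "simp add: b_def")
  moreover have "AE x in lborel. x ~: N" using N(2,3) by (intro AE_not_in null_setsI)
  ultimately show ?thesis using K(3) by eventually_elim (auto simp: S_def)
 qed
 define A where "A l = 4 * 2 ^ DIM('e) * real (Suc l)" for l
 have A: "0 < A l" for l by (simp add: A_def)
 have moc: "EX z:ball x r. moc (w k i) (A l) x r (w k i z)"
  if x: "x : K l" and i: "i : V" and r: "0 < r" "r <= 1 / real (Suc l)" for x l k i r
 proof -
  have xm: "x : mbound U b l" using K(2) x by (auto simp: S_def)
  have sub: "ball x r \<subseteq> U" using xm subset_ball[OF r(2), of x] unfolding mbound_def by blast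
  have "sint (ball x r) (%z. ennreal (a z)) <= lint (%z. indicator (ball x r) z + b z * indicator (ball x r) z)"
  proof (rule nn_integral_mono)
   fix z
   \<comment> \<open>The maximal function controls averages of the p-th power, while the oscillation
     estimate wants averages of \<open>a\<close>; hence the level \<open>l + 1\<close>.\<close>
   have "a z <= 1 + a z powr p"
   proof (cases "a z <= 1")
    case True
    then show ?thesis by (simp add: add_increasing2)
   next
    case False
    then have "a z powr 1 <= a z powr p" using p by (intro powr_mono) auto
    then show ?thesis using False by simp
   qed
   then have "ennreal (a z) <= ennreal (1 + a z powr p)" by (rule ennreal_leI)
   also have "... = 1 + b z" by (simp add: b_def)
   finally show "ennreal (a z) * indicator (ball x r) z <= indicator (ball x r) z + b z * indicator (ball x r) z" by (simp add: indicator_def)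
  qed
  also have "... = vol (ball x r) + sint (ball x r) b" using bm by (subst nn_integral_add) auto
  also have "... <= vol (ball x r) + of_nat l * vol (ball x r)" using xm r unfolding mbound_def by (intro add_left_mono) auto
  also have "... = ennreal (real (Suc l)) * vol (ball x r)"
   by (simp add: ennreal_of_nat_eq_real_of_nat[symmetric] del: of_nat_Suc) (simp add: distrib_right)
  finally have avg: "sint (ball x r) (%z. ennreal (a z)) <= ennreal (real (Suc l)) * vol (ball x r)" .
  have gr: "AE z in lborel. z : ball x r --> norm (rgrad (w k i) z) <= a z" using grad by eventually_elim (use sub i in auto)
  obtain z where "z : ball x r" "moc (w k i) (4 * 2 ^ DIM('e) * real (Suc l)) x r (w k i z)" by (rule poincare_ball[OF w[OF i] r(1) _ a gr avg]) simp
  then show ?thesis unfolding A_def by blast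
 qed
 have lip: "\<bar>w k i x - w k i y\<bar> <= 16 * 2 ^ DIM('e) * A l * norm (x - y)"
  if "x : K l" "y : K l" "i : V" "norm (x - y) <= 1 / (2 * real (Suc l))" for x y l k i
 proof (rule moc_lipschitz[OF w[OF that(3)] A])
  show "2 * norm (x - y) <= 1 / real (Suc l)" using that(4) by (simp add: field_simps)
 qed (intro moc that; assumption)+
 have lim: "(%k. w k i x) \<longlonglongrightarrow> g i x" if "x : K l" "i : V" for x l i
 proof -
  have "x : U" "x ~: N" using that K(2)[of l] SU[of l] by (auto simp: S_def)
  from \<open>x ~: N\<close> have "x ~: {x : space lborel. ~ (x : U --> (ALL i:V. (%k. w k i x) \<longlonglongrightarrow> g i x))}" by (rule contra_subsetD[OF N(1)])
  then have "ALL i:V. (%k. w k i x) \<longlonglongrightarrow> g i x" using \<open>x : U\<close> by simp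
  then show ?thesis using \<open>x : U\<close> that(2) by blast
 qed
 have R: "0 < 1 / (2 * real (Suc l))" and C: "0 <= 16 * 2 ^ DIM('e) * A l" for l using A[of l] by auto
 show thesis
 proof (rule that[of w a K])
  show "K l \<subseteq> U" for l using K(2) SU by blast
  show "EX C. ALL x:K l. ALL y:K l. \<bar>g i x - g i y\<bar> <= C * norm (x - y)" if "i : V" for l i
   by (rule equi_lipschitz_limit(1)[OF K(1) R C, where w = "%k. w k i"]) (use lip lim that in auto)
  show "\<forall>\<^sub>F k in sequentially. ALL x:K l. \<bar>w k i x - g i x\<bar> <= \<epsilon>" if "i : V" "0 < \<epsilon>" for l i \<epsilon>
   by (rule equi_lipschitz_limit(2)[OF K(1) R C, where w = "%k. w k i"]) (use lip lim that in auto)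
 qed (use w a a0 fin grad conv K(1) cover in auto)
qed

end

section \<open>Recovery sequences\<close>

lemma powr_add_le:
 fixes s t p :: real
 assumes "0 <= s" "0 <= t" "0 <= p"
 shows "(s + t) powr p <= 2 powr p * (s powr p + t powr p)"
proof -
 have "(s + t) powr p <= (2 * max s t) powr p" using assms by (intro powr_mono2) auto
 also have "... = 2 powr p * max s t powr p" using assms by (simp add: powr_mult)
 also have "max s t powr p <= s powr p + t powr p" by (auto simp: max_def)
 finally show ?thesis by simp
qed

lemma powr_sum_le:
 fixes t :: "'i => real"
 assumes V: "finite V" and t: "!!v. v : V ==> 0 <= t v" and p: "0 <= p"
 shows "(SUM v:V. t v) powr p <= real (card V) powr p * (SUM v:V. t v powr p)"
proof (cases "V = {}")
 case False
 then have "Max (t ` V) : t ` V" using V by (intro Max_in) auto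
 then obtain u where u0: "u : V" "Max (t ` V) = t u" by auto
 have u: "u : V" "!!v. v : V ==> t v <= t u" using u0 V by (auto simp flip: u0(2))
 have "(SUM v:V. t v) powr p <= (real (card V) * t u) powr p" using sum_bounded_above[of V t "t u"] u t p by (intro powr_mono2 sum_nonneg) auto
 also have "... = real (card V) powr p * t u powr p" using t u by (simp add: powr_mult)
 also have "t u powr p <= (SUM v:V. t v powr p)" by (rule member_le_sum[OF u(1) _ V]) simp
 finally show ?thesis by (simp add: mult_left_mono)
qed simp

lemma norm_mgrad: "norm (mgrad F x) = sqrt (SUM b:Basis. (mslope F b x)\<^sup>2)"
 by (subst norm_eq_sqrt_inner, subst euclidean_inner) (simp add: power2_eq_square)

lemma mslope_le_of_bound:
 assumes F: "mdiff F x" and f: "!!v. v : V ==> rdiff (f v) x"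
  and le: "\<forall>\<^sub>F t in at_right (0::real). dist (F (x + t *\<^sub>R b)) (F x) <= k * (SUM v:V. \<bar>f v (x + t *\<^sub>R b) - f v x\<bar> + c * t)"
 shows "mslope F b x <= k * (SUM v:V. \<bar>b \<bullet> rgrad (f v) x\<bar> + c)"
proof (rule tendsto_le[OF _ _ mdiff_tendsto[OF F]])
 have "((%t. dist (f v (x + t *\<^sub>R b)) (f v x) / t) \<longlongrightarrow> \<bar>b \<bullet> rgrad (f v) x\<bar>) (at_right 0)" if "v : V" for v
  using mdiff_tendsto[OF rdiff_mdiff(1)[OF f[OF that]]] rdiff_mdiff(2)[OF f[OF that]] by metis
 then show "((%t. k * (SUM v:V. dist (f v (x + t *\<^sub>R b)) (f v x) / t + c)) \<longlongrightarrow> k * (SUM v:V. \<bar>b \<bullet> rgrad (f v) x\<bar> + c)) (at_right 0)"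
  by (intro tendsto_intros)
 show "\<forall>\<^sub>F t in at_right 0. dist (F (x + t *\<^sub>R b)) (F x) / t <= k * (SUM v:V. dist (f v (x + t *\<^sub>R b)) (f v x) / t + c)"
  using le eventually_at_right_less[of 0]
 proof eventually_elim
  case (elim t)
  have "dist (F (x + t *\<^sub>R b)) (F x) / t <= k * (SUM v:V. \<bar>f v (x + t *\<^sub>R b) - f v x\<bar> + c * t) / t"
   using elim by (intro divide_right_mono) auto
  also have "... = k * (SUM v:V. dist (f v (x + t *\<^sub>R b)) (f v x) / t + c)"
   using elim(2) unfolding times_divide_eq_right[symmetric] sum_divide_distrib by (simp add: dist_real_def add_divide_distrib)
  finally show ?case .
 qed
qed simp

text \<open>Lowering the height to \<epsilon> keeps the slope at 1 however thin \<open>N\<close> is.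
  Vanishing on a whole neighbourhood of the complement of \<open>N\<close> ensures that difference
  quotients at points outside \<open>N\<close> do not see the bump.\<close>

lemma compact_bump:
 fixes K N :: "'e::euclidean_space set"
 assumes K: "compact K" and N: "open N" "K \<subseteq> N"
 obtains \<delta> where "0 < \<delta>" "!!\<epsilon>. 0 < \<epsilon> ==> \<epsilon> <= \<delta> ==> EX \<phi> :: 'e => real. (ALL x. 0 <= \<phi> x & \<phi> x <= \<epsilon>) & (ALL x:K. \<phi> x = \<epsilon>) &
  (ALL x y. \<bar>\<phi> x - \<phi> y\<bar> <= norm (x - y)) & (ALL x y. x ~: N --> norm (y - x) < \<delta> --> \<phi> y = 0)"
proof (cases "K = {}")
 case True
 then show ?thesis by (intro that[of 1] exI[of _ "%_. 0"]) auto
next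
 case False
 obtain d where d: "0 < d" "(\<Union>x\<in>K. ball x d) \<subseteq> N" using compact_subset_open_imp_ball_epsilon_subset[OF K N] by blast
 show ?thesis
 proof (rule that[of "d / 2"])
  show "0 < d / 2" using d by simp
  fix \<epsilon> :: real assume \<epsilon>: "0 < \<epsilon>" "\<epsilon> <= d / 2"
  show "EX \<phi> :: 'e => real. (ALL x. 0 <= \<phi> x & \<phi> x <= \<epsilon>) & (ALL x:K. \<phi> x = \<epsilon>) &
    (ALL x y. \<bar>\<phi> x - \<phi> y\<bar> <= norm (x - y)) & (ALL x y. x ~: N --> norm (y - x) < d / 2 --> \<phi> y = 0)"
  proof (intro exI[of _ "%x. max 0 (\<epsilon> - infdist x K)"] conjI allI ballI impI)
   fix x y :: 'e
   show "0 <= max 0 (\<epsilon> - infdist x K)" "max 0 (\<epsilon> - infdist x K) <= \<epsilon>" using \<epsilon> by (auto simp: infdist_nonneg)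
   have "\<bar>infdist x K - infdist y K\<bar> <= norm (x - y)"
    using infdist_triangle[of x K y] infdist_triangle[of y K x] by (simp add: dist_norm norm_minus_commute abs_le_iff)
   then show "\<bar>max 0 (\<epsilon> - infdist x K) - max 0 (\<epsilon> - infdist y K)\<bar> <= norm (x - y)" by (auto simp: max_def)
   assume x: "x ~: N" and y: "norm (y - x) < d / 2"
   have "d <= dist x z" if "z : K" for z
   proof (rule ccontr)
    assume "~ d <= dist x z"
    then have "x : ball z d" by (simp add: dist_commute)
    then show False using x d(2) that by blast
   qed
   then have "d <= infdist x K" using False unfolding infdist_def by (auto intro!: cINF_greatest)
   moreover have "infdist x K <= infdist y K + dist x y" by (rule infdist_triangle)
   ultimately have "d / 2 <= infdist y K" using y by (simp add: dist_norm norm_minus_commute)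
   then show "max 0 (\<epsilon> - infdist y K) = 0" using \<epsilon> by simp
  next
   fix x assume "x : K"
   then show "max 0 (\<epsilon> - infdist x K) = \<epsilon>" using \<epsilon> by simp
  qed
 qed
qed

section \<open>The density of the energy and the lower bound\<close>

text \<open>One package of coordinates, approximations and coincidence sets for a fixed
  \<open>g\<close>, from which both inequalities are derived.\<close>

locale orbit_sobolev = orbit_space H \<pi>
 for H :: "('w::euclidean_space => 'w) set" and \<pi> :: "'w => 'z::metric_space" +
 fixes U :: "'e::euclidean_space set" and p :: real and g :: "'e => 'z"
  and V :: "'w set" and \<xi> :: "'w => 'z => real" and \<rho> :: "('w => real) => 'z" and \<kappa> :: real
  and w :: "nat => 'w => 'e => real" and a :: "'e => real" and K :: "nat => 'e set"
  and T :: "nat => 'e => 'z" and CT :: "nat => real"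
 assumes U: "open U" and p: "1 < p" and g: "g : borel_measurable (restrict_space borel U)"
  and V: "finite V" and \<kappa>: "1 <= \<kappa>" and \<xi>: "!!v z z'. v : V ==> \<bar>\<xi> v z - \<xi> v z'\<bar> <= \<kappa> * dist z z'"
  and \<rho>\<xi>: "!!z. \<rho> (%v. \<xi> v z) = z" and \<rho>: "!!\<phi> \<psi>. dist (\<rho> \<phi>) (\<rho> \<psi>) <= \<kappa> * (SUM v:V. \<bar>\<phi> v - \<psi> v\<bar>)"
  and w: "!!k v. v : V ==> rlip (w k v)" and a[measurable]: "a : borel_measurable borel" and a0: "!!x. 0 <= a x"
  and a_int: "pint p U a < \<infinity>"
  and w_grad: "AE x\<in>U in lborel. (ALL k. ALL v:V. norm (rgrad (w k v) x) <= a x)"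
  and w_lim: "!!v. v : V ==> (%k. pint p U (%x. \<bar>w k v x - \<xi> v (g x)\<bar>)) \<longlonglongrightarrow> 0"
  and K: "!!l. compact (K l)" "!!l. K l \<subseteq> U"
  and K_cover: "AE x\<in>U in lborel. (\<forall>\<^sub>F l in sequentially. x : K l)"
  and T: "!!l. lipmap (T l) (CT l)" "!!l x. x : K l ==> T l x = g x"
  and w_unif: "!!l v \<epsilon>. v : V ==> 0 < \<epsilon> ==> \<forall>\<^sub>F k in sequentially. ALL x:K l. \<bar>w k v x - \<xi> v (g x)\<bar> <= \<epsilon>"
begin

text \<open>A measurable candidate for \<open>\<bar>Dg\<bar>\<close>, read from the first compact
  set that contains the point; \<open>slope_adiff\<close> shows that almost everywhere it agrees
  with every approximate differential.\<close>

definition slope :: "'e => real" where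
 "slope x = norm (mgrad (T (LEAST l. x : K l)) x)"

lemma orbit_mdiff: "lipmap F C ==> AE x in lborel. mdiff F x" for F :: "'e => 'z"
proof -
 assume "lipmap F C"
 then interpret lipmap F C .
 show ?thesis using rademacher_orbit[OF F_lip C0] by eventually_elim (auto intro: tdiff_mdiff)
qed

lemma K_borel [measurable]: "K l : sets borel" using K by (simp add: borel_compact)

lemma mslope_agree:
 assumes "lipmap F C" "!!x. x : K l ==> F x = g x"
 shows "AE x in lborel. x : K l --> (EX c L. adiff U g x c L) & (ALL c L v. adiff U g x c L --> norm (L v) = mslope F v x)"
 using assms K by (intro adiff_AE[OF K_borel _ U g]) (auto simp: lipmap_def)

lemma slope_adiff:
 "AE x\<in>U in lborel. (EX c L. adiff U g x c L) &
  (ALL c L. adiff U g x c L --> sqrt (SUM b:Basis. (norm (L b))\<^sup>2) = slope x)"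
proof -
 have "AE x in lborel. ALL l. x : K l --> (EX c L. adiff U g x c L) & (ALL c L v. adiff U g x c L --> norm (L v) = mslope (T l) v x)"
  unfolding AE_all_countable by (rule allI, rule mslope_agree[OF T])
 with K_cover show ?thesis
 proof eventually_elim
  case (elim x)
  show ?case
  proof
   assume "x : U"
   then have "EX l. x : K l" using elim(1) eventually_happens'[OF sequentially_bot] by blast
   then have "x : K (LEAST l. x : K l)" by (rule LeastI_ex)
   then show "(EX c L. adiff U g x c L) & (ALL c L. adiff U g x c L --> sqrt (SUM b:Basis. (norm (L b))\<^sup>2) = slope x)"
    using elim(2) by (simp add: slope_def norm_mgrad)
  qed
 qed
qed

text \<open>Each \<open>T i\<close> coincides with \<open>g\<close> on its piece, so convergence to
  \<open>g\<close> is convergence to \<open>T i\<close> there.\<close>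

lemma slope_lsc:
 assumes W: "open W" "W \<subseteq> U" and F: "!!n. lipmap (F n) (C n)"
  and lim: "(%n. pint p U (%x. dist (F n x) (g x))) \<longlonglongrightarrow> 0"
  and c: "\<exists>\<^sub>F n in sequentially. (pint p W (%x. norm (mgrad (F n) x))) <= ennreal c" "0 <= c"
 shows "pint p W slope <= ennreal c"
proof (rule energy_lower_semicontinuous[OF p W(1) T(1) _ F])
 have [measurable]: "W : sets borel" using W by simp
 define P where "P i = disjointed K i Int W" for i
 have PK: "P i \<subseteq> K i" for i using disjointed_subset[of K i] by (auto simp: P_def)
 show "P i : sets borel" for i unfolding P_def by (intro sets.Int sets.range_disjointed_sets[THEN subsetD, OF _ rangeI]) auto
 show "P i \<subseteq> W" for i by (auto simp: P_def)
 show "disjoint_family P" unfolding P_def using disjoint_family_disjointed[of K] by (auto simp: disjoint_family_on_def)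
 show "(%n. pint p (P i) (%x. dist (F n x) (T i x))) \<longlonglongrightarrow> 0" for i
 proof (rule tendsto_sandwich[OF _ _ tendsto_const lim])
  show "\<forall>\<^sub>F n in sequentially. (pint p (P i) (%x. dist (F n x) (T i x))) <= pint p U (%x. dist (F n x) (g x))"
  proof (intro always_eventually allI nn_integral_mono)
   fix n x
   show "ennreal (dist (F n x) (T i x) powr p) * indicator (P i) x <= ennreal (dist (F n x) (g x) powr p) * indicator U x"
   proof (cases "x : P i")
    case True
    then have "x : K i" "x : U" using PK K(2) by auto
    then show ?thesis using T(2) True by simp
   qed simp
  qed
 qed simp
 show "AE x\<in>W in lborel. (EX i. x : P i & slope x = norm (mgrad (T i) x))"
  using K_cover
 proof eventually_elim
  case (elim x)
  show ?case
  proof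
   assume x: "x : W"
   then have "EX l. x : K l" using W elim eventually_happens'[OF sequentially_bot] by blast
   then have "x : K (LEAST l. x : K l)" by (rule LeastI_ex)
   \<comment> \<open>The disjointed pieces sort points by the first index, which is the index used
     in \<open>slope\<close>.\<close>
   then have "x : P (LEAST l. x : K l)" using x not_less_Least by (fastforce simp: P_def disjointed_def)
   then show "EX i. x : P i & slope x = norm (mgrad (T i) x)" by (auto simp: slope_def)
  qed
 qed
 show "AE x in lborel. mdiff (T i) x" "AE x in lborel. mdiff (F i) x" for i by (rule orbit_mdiff[OF T(1)], rule orbit_mdiff[OF F])
qed (use c in auto)

end

lemma tail_integral_small:
 fixes b :: "'e::euclidean_space => ennreal"
 assumes b[measurable]: "b : borel_measurable borel" and U[measurable]: "U : sets borel" and K[measurable]: "!!l. K l : sets borel"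
  and fin: "sint U b < \<infinity>"
  and cover: "AE x\<in>U in lborel. (\<forall>\<^sub>F l in sequentially. x : K l)"
 shows "(%l. sint (U - K l) (%x. b x)) \<longlonglongrightarrow> 0"
proof -
 have "(%l. lint (%x. b x * indicator (U - K l) x)) \<longlonglongrightarrow> (\<integral>\<^sup>+x. 0 \<partial>(lborel :: 'e measure))"
 proof (rule nn_integral_dominated_convergence[where w = "%x. b x * indicator U x"])
  show "AE x in lborel. b x * indicator (U - K l) x <= b x * indicator U x" for l by (auto simp: indicator_def)
  show "AE x in lborel. (%l. b x * indicator (U - K l) x) \<longlonglongrightarrow> 0"
   using cover
  proof eventually_elim
   case (elim x)
   show ?case
   proof (cases "x : U")
    case True
    then have "\<forall>\<^sub>F l in sequentially. x : K l" using elim by blast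
    then have "\<forall>\<^sub>F l in sequentially. b x * indicator (U - K l) x = 0" by eventually_elim simp
    then show ?thesis by (rule tendsto_eventually)
   qed simp
  qed
  show "lint (%x. b x * indicator U x) < \<infinity>" by (rule fin)
 qed measurable
 then show ?thesis by simp
qed

section \<open>Recovery maps and the upper bound\<close>

text \<open>The point of the interval [u - s, u + s] nearest to \<open>t\<close>: radius 0 returns
  \<open>u\<close>, a radius of at least |u - t| returns \<open>t\<close>.\<close>

definition squeeze :: "real => real => real => real" where
 "squeeze u s t = max (u - s) (min (u + s) t)"

lemma squeeze:
 assumes "0 <= s"
 shows "\<bar>squeeze u s t - u\<bar> <= s" "\<bar>u - t\<bar> <= s ==> squeeze u s t = t"
  "\<bar>squeeze u s t - squeeze u' s' t'\<bar> <= \<bar>u - u'\<bar> + \<bar>s - s'\<bar> + \<bar>t - t'\<bar>"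
 using assms unfolding squeeze_def by (simp_all add: max_def min_def abs_if split: if_splits)

context orbit_sobolev
begin

text \<open>Off \<open>K l\<close> the recovery map is the Lipschitz approximation \<open>w k\<close>; on a thin neighbourhood
 of \<open>K l\<close> its coordinates are squeezed towards those of \<open>T l\<close>, which costs a slope bounded
 independently of the neighbourhood.\<close>

lemma squeezed_map:
 assumes N: "open N" "K l \<subseteq> N"
  and \<phi>: "!!x. 0 <= \<phi> x" "!!x. \<phi> x <= \<epsilon>" "!!x. x : K l ==> \<phi> x = \<epsilon>" "!!x y. \<bar>\<phi> x - \<phi> y\<bar> <= norm (x - y)"
   "!!x y. x ~: N ==> norm (y - x) < \<delta> ==> \<phi> y = 0" and \<delta>: "0 < \<delta>"
  and wk: "!!x v. x : K l ==> v : V ==> \<bar>w k v x - \<xi> v (g x)\<bar> <= \<epsilon>"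
 obtains F C where "lipmap F C" "!!x. x : K l ==> F x = g x"
  "!!x. dist (F x) (g x) <= \<kappa> * (SUM v:V. \<bar>w k v x - \<xi> v (g x)\<bar> + \<epsilon> * indicator N x)"
  "AE x\<in>U in lborel. norm (mgrad F x) <= real DIM('e) * (\<kappa> * (real (card V) * (a x + (1 + \<kappa> * CT l) * indicator N x)))"
proof -
 define f where "f v x = squeeze (w k v x) (\<phi> x) (\<xi> v (T l x))" for v x
 define F where "F x = \<rho> (%v. f v x)" for x
 interpret T: lipmap "T l" "CT l" by (rule T)
 have TL: "\<bar>\<xi> v (T l x) - \<xi> v (T l y)\<bar> <= \<kappa> * CT l * norm (x - y)" if "v : V" for v x y
 proof -
  have "\<bar>\<xi> v (T l x) - \<xi> v (T l y)\<bar> <= \<kappa> * dist (T l x) (T l y)" by (rule \<xi>[OF that])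
  also have "... <= \<kappa> * (CT l * norm (x - y))" using T.F_lip \<kappa> by (intro mult_left_mono) auto
  finally show ?thesis by (simp add: mult.assoc)
 qed
 have fd: "\<bar>f v x - f v y\<bar> <= \<bar>w k v x - w k v y\<bar> + (1 + \<kappa> * CT l) * norm (x - y)" if "v : V" for v x y
 proof -
  have "\<bar>f v x - f v y\<bar> <= \<bar>w k v x - w k v y\<bar> + \<bar>\<phi> x - \<phi> y\<bar> + \<bar>\<xi> v (T l x) - \<xi> v (T l y)\<bar>"
   unfolding f_def by (rule squeeze(3)[OF \<phi>(1)])
  also have "... <= \<bar>w k v x - w k v y\<bar> + norm (x - y) + \<kappa> * CT l * norm (x - y)" by (intro add_mono \<phi>(4) TL that) simp
  finally show ?thesis by (simp add: algebra_simps)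
 qed
 have fK: "f v x = \<xi> v (g x)" if "x : K l" "v : V" for x v
  unfolding f_def T(2)[OF that(1)] using wk[OF that] \<phi>(3)[OF that(1)] by (intro squeeze(2)[OF \<phi>(1)]) simp
 \<comment> \<open>Around a point outside \<open>N\<close> the coordinates are exactly those of
   \<open>w k\<close>, so the slope there carries no contribution from the bump.\<close>
 have far: "f v y = w k v y" if "x ~: N" "norm (y - x) < \<delta>" for x y v
  using squeeze(1)[OF \<phi>(1), of "w k v y" y "\<xi> v (T l y)"] \<phi>(5)[OF that] by (simp add: f_def)
 obtain LW where LW: "!!v. v : V ==> real_lipschitz (w k v) (LW v)" using bchoice[of V "%v L. real_lipschitz (w k v) L"] w unfolding rlip_def by metis
 have LW0: "!!v. v : V ==> 0 <= LW v" using LW by (simp add: real_lipschitz_def)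
 have A0: "0 <= 1 + \<kappa> * CT l" using \<kappa> T.C0 by simp
 have F: "lipmap F (\<kappa> * (SUM v:V. LW v + (1 + \<kappa> * CT l)))"
 proof
  show "0 <= \<kappa> * (SUM v:V. LW v + (1 + \<kappa> * CT l))"
   using \<kappa> add_nonneg_nonneg[OF LW0 A0] by (intro mult_nonneg_nonneg sum_nonneg) auto
  fix x y
  have "dist (F x) (F y) <= \<kappa> * (SUM v:V. \<bar>f v x - f v y\<bar>)" unfolding F_def by (rule \<rho>)
  also have "... <= \<kappa> * (SUM v:V. (LW v + (1 + \<kappa> * CT l)) * norm (x - y))"
  proof (intro mult_left_mono sum_mono)
   fix v assume v: "v : V"
   have "\<bar>w k v x - w k v y\<bar> <= LW v * norm (x - y)" using LW[OF v] by (simp add: real_lipschitz_def)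
   then show "\<bar>f v x - f v y\<bar> <= (LW v + (1 + \<kappa> * CT l)) * norm (x - y)" using fd[OF v, of x y] by (simp add: algebra_simps)
  qed (use \<kappa> in auto)
  finally show "dist (F x) (F y) <= \<kappa> * (SUM v:V. LW v + (1 + \<kappa> * CT l)) * norm (x - y)" by (simp add: sum_distrib_right mult.assoc)
 qed
 have FK: "F x = g x" if "x : K l" for x
 proof -
  have "dist (F x) (\<rho> (%v. \<xi> v (g x))) <= \<kappa> * (SUM v:V. \<bar>f v x - \<xi> v (g x)\<bar>)" unfolding F_def by (rule \<rho>)
  also have "... = 0" using fK[OF that] by simp
  finally show ?thesis by (simp add: \<rho>\<xi>)
 qed
 show ?thesis
 proof (rule that[OF F FK])
  show "dist (F x) (g x) <= \<kappa> * (SUM v:V. \<bar>w k v x - \<xi> v (g x)\<bar> + \<epsilon> * indicator N x)" for x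
  proof -
   have "dist (F x) (\<rho> (%v. \<xi> v (g x))) <= \<kappa> * (SUM v:V. \<bar>f v x - \<xi> v (g x)\<bar>)" unfolding F_def by (rule \<rho>)
   also have "... <= \<kappa> * (SUM v:V. \<bar>w k v x - \<xi> v (g x)\<bar> + \<epsilon> * indicator N x)"
   proof (intro mult_left_mono sum_mono)
    fix v
    have "\<bar>f v x - w k v x\<bar> <= \<epsilon> * indicator N x"
     using far[of x x v] \<delta> squeeze(1)[OF \<phi>(1), of "w k v x" x "\<xi> v (T l x)"] \<phi>(2)[of x] by (cases "x : N") (auto simp: f_def)
    then show "\<bar>f v x - \<xi> v (g x)\<bar> <= \<bar>w k v x - \<xi> v (g x)\<bar> + \<epsilon> * indicator N x" by linarith
   qed (use \<kappa> in auto)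
   finally show ?thesis by (simp add: \<rho>\<xi>)
  qed
  have "AE x in lborel. ALL v:V. rdiff (w k v) x" by (intro AE_finite_allI V rdiff_AE w)
  then show "AE x\<in>U in lborel. norm (mgrad F x) <= real DIM('e) * (\<kappa> * (real (card V) * (a x + (1 + \<kappa> * CT l) * indicator N x)))"
   using orbit_mdiff[OF F] w_grad
  proof eventually_elim
   case (elim x)
   define c where "c = (1 + \<kappa> * CT l) * indicator N x"
   show ?case
   proof
    assume x: "x : U"
    have "mslope F b x <= \<kappa> * (real (card V) * (a x + c))" if b: "b : Basis" for b
    proof -
     have "mslope F b x <= \<kappa> * (SUM v:V. \<bar>b \<bullet> rgrad (w k v) x\<bar> + c)"
     proof (rule mslope_le_of_bound[OF elim(2)])
      show "rdiff (w k v) x" if "v : V" for v using elim(1) that by blast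
      have "\<forall>\<^sub>F t in at_right 0. t < \<delta>" using \<delta> by (auto simp: eventually_at_right_field)
      then show "\<forall>\<^sub>F t in at_right (0::real). dist (F (x + t *\<^sub>R b)) (F x) <= \<kappa> * (SUM v:V. \<bar>w k v (x + t *\<^sub>R b) - w k v x\<bar> + c * t)"
       using eventually_at_right_less[of 0]
      proof eventually_elim
       case (elim t)
       have n: "norm (t *\<^sub>R b) = t" using b elim by simp
       have "dist (F (x + t *\<^sub>R b)) (F x) <= \<kappa> * (SUM v:V. \<bar>f v (x + t *\<^sub>R b) - f v x\<bar>)" unfolding F_def by (rule \<rho>)
       also have "... <= \<kappa> * (SUM v:V. \<bar>w k v (x + t *\<^sub>R b) - w k v x\<bar> + c * t)"
       proof (intro mult_left_mono sum_mono)
        fix v assume v: "v : V"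
        show "\<bar>f v (x + t *\<^sub>R b) - f v x\<bar> <= \<bar>w k v (x + t *\<^sub>R b) - w k v x\<bar> + c * t"
        proof (cases "x : N")
         case True
         then show ?thesis using fd[OF v, of "x + t *\<^sub>R b" x] n by (simp add: c_def)
        next
         case False
         then show ?thesis using far[of x "x + t *\<^sub>R b" v] far[of x x v] n elim \<delta> by (simp add: c_def)
        qed
       qed (use \<kappa> in auto)
       finally show ?case .
      qed
     qed
     also have "... <= \<kappa> * (SUM v:V. a x + c)"
     proof (intro mult_left_mono sum_mono add_right_mono)
      fix v assume v: "v : V"
      have "\<bar>b \<bullet> rgrad (w k v) x\<bar> <= norm b * norm (rgrad (w k v) x)" by (rule Cauchy_Schwarz_ineq2)
      also have "... <= a x" using elim(3) x v b by simp
      finally show "\<bar>b \<bullet> rgrad (w k v) x\<bar> <= a x" .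
     qed (use \<kappa> in auto)
     finally show ?thesis by simp
    qed
    then have "(SUM b:Basis. \<bar>mgrad F x \<bullet> b\<bar>) <= (SUM b:(Basis::'e set). \<kappa> * (real (card V) * (a x + c)))"
     using mslope_nonneg[OF elim(2)] by (intro sum_mono) simp
    then show "norm (mgrad F x) <= real DIM('e) * (\<kappa> * (real (card V) * (a x + (1 + \<kappa> * CT l) * indicator N x)))"
     using norm_le_l1[of "mgrad F x"] by (simp add: c_def)
   qed
  qed
 qed
qed

lemma borel_slope [measurable]: "slope : borel_measurable borel"
proof -
 have [measurable]: "mgrad (T l) : borel_measurable borel" for l by (rule borel_mgrad[OF T(1)])
 show ?thesis unfolding slope_def by measurable
qed

text \<open>Both sides are computed from the same approximate differential of
  \<open>g\<close>.\<close>

lemma slope_eq: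
 assumes F: "lipmap F C" "ALL x:K l. F x = g x"
 shows "AE x in lborel. x : K l --> norm (mgrad F x) = slope x"
proof -
 have "AE x in lborel. x : K l --> (EX c L. adiff U g x c L) & (ALL c L v. adiff U g x c L --> norm (L v) = mslope F v x)"
  by (rule mslope_agree[OF F(1)]) (use F(2) in blast)
 with slope_adiff show ?thesis
 proof eventually_elim
  case (elim x)
  show ?case
  proof
   assume x: "x : K l"
   then obtain c L where L: "adiff U g x c L" "!!v. norm (L v) = mslope F v x" using elim(2) by blast
   then have "sqrt (SUM b:Basis. (norm (L b))\<^sup>2) = slope x" using elim(1) x K(2) by blast
   then show "norm (mgrad F x) = slope x" by (simp add: norm_mgrad L(2))
  qed
 qed
qed

text \<open>On \<open>K l\<close> the recovery map has exactly the slope of \<open>g\<close>;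
  elsewhere a crude bound by the majorant \<open>a\<close>, plus a constant on \<open>N\<close>, is
  integrated over sets on which it is small.\<close>

lemma slope_recovery:
 assumes \<eta>: "0 < \<eta>"
 obtains F C where "lipmap F C" "pint p U (%x. dist (F x) (g x)) <= ennreal \<eta>"
  "!!W. W : sets borel ==> W \<subseteq> U ==> pint p W (%x. norm (mgrad F x))
   <= pint p W slope + ennreal \<eta>"
proof -
 have [measurable]: "U : sets borel" using U by simp
 define m where "m = real (card V)"
 define D where "D = real DIM('e) * \<kappa> * m"
 have D: "0 <= D" using \<kappa> by (simp add: D_def m_def)
 define A where "A = D powr p * 2 powr p"
 define B where "B = \<kappa> powr p * m powr p * 2 powr p"
 have AB: "0 <= A" "0 <= B" "0 <= m" by (auto simp: A_def B_def m_def)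
 have am: "(%x. ennreal (a x powr p)) : borel_measurable borel" by measurable
 have "\<forall>\<^sub>F l in sequentially. (pint p (U - K l) a) < ennreal (\<eta> / (2 * (A + 1)))"
  by (rule order_tendstoD(2)[OF tail_integral_small[OF am _ K_borel a_int K_cover]]) (use \<eta> AB in auto)
 from eventually_happens'[OF sequentially_bot this]
 obtain l where l: "pint p (U - K l) a < ennreal (\<eta> / (2 * (A + 1)))" ..
 interpret T: lipmap "T l" "CT l" by (rule T)
 \<comment> \<open>This constant depends on \<open>l\<close> only. It is fixed before
   \<open>N\<close>, so \<open>N - K l\<close> can be made small enough to absorb it; the height
   \<epsilon> and the index \<open>k\<close> follow in this order.\<close>
 define c where "c = 1 + \<kappa> * CT l"
 have c: "1 <= c" using \<kappa> T.C0 by (simp add: c_def)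
 define E where "E = A * c powr p + B * m + 1"
 have E: "0 < E" "A * c powr p <= E" "B * m <= E" using AB by (auto simp: E_def add_nonneg_pos)
 have e1: "0 < \<eta> / (2 * E)" using \<eta> E by simp
 obtain N where N: "open N" "K l \<subseteq> N" "vol (N - K l) < ennreal (\<eta> / (2 * E))" by (rule outer_regular_lborel[OF K_borel[of l] e1])
 have [measurable]: "N : sets borel" using N by simp
 obtain \<delta> where \<delta>: "0 < \<delta>" "!!\<epsilon>. 0 < \<epsilon> ==> \<epsilon> <= \<delta> ==> EX \<phi> :: 'e => real. (ALL x. 0 <= \<phi> x & \<phi> x <= \<epsilon>) & (ALL x:K l. \<phi> x = \<epsilon>) &
  (ALL x y. \<bar>\<phi> x - \<phi> y\<bar> <= norm (x - y)) & (ALL x y. x ~: N --> norm (y - x) < \<delta> --> \<phi> y = 0)"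
  by (rule compact_bump[OF K(1)[of l] N(1,2)]) blast
 define \<epsilon> where "\<epsilon> = min \<delta> 1"
 have \<epsilon>: "0 < \<epsilon>" "\<epsilon> <= \<delta>" "\<epsilon> <= 1" using \<delta> by (auto simp: \<epsilon>_def)
 from \<delta>(2)[OF \<epsilon>(1,2)] obtain \<phi> where \<phi>: "(ALL x. 0 <= \<phi> x & \<phi> x <= \<epsilon>) & (ALL x:K l. \<phi> x = \<epsilon>) &
  (ALL x y. \<bar>\<phi> x - \<phi> y\<bar> <= norm (x - y)) & (ALL x y. x ~: N --> norm (y - x) < \<delta> --> \<phi> y = 0)" ..
 have "\<forall>\<^sub>F k in sequentially. ALL v:V. ALL x:K l. \<bar>w k v x - \<xi> v (g x)\<bar> <= \<epsilon>"
  unfolding eventually_ball_finite_distrib[OF V] using w_unif \<epsilon>(1) by blast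
 moreover have "(%k. SUM v:V. pint p U (%x. \<bar>w k v x - \<xi> v (g x)\<bar>)) \<longlonglongrightarrow> (SUM v:V. 0)" by (intro tendsto_sum w_lim)
 then have "\<forall>\<^sub>F k in sequentially. (SUM v:V. pint p U (%x. \<bar>w k v x - \<xi> v (g x)\<bar>)) < ennreal (\<eta> / (2 * (B + 1)))"
  by (rule order_tendstoD) (use \<eta> AB in auto)
 ultimately have "\<forall>\<^sub>F k in sequentially. (ALL v:V. ALL x:K l. \<bar>w k v x - \<xi> v (g x)\<bar> <= \<epsilon>) &
  (SUM v:V. pint p U (%x. \<bar>w k v x - \<xi> v (g x)\<bar>)) < ennreal (\<eta> / (2 * (B + 1)))" by (rule eventually_conj)
 from eventually_happens'[OF sequentially_bot this]
 obtain k where k: "ALL v:V. ALL x:K l. \<bar>w k v x - \<xi> v (g x)\<bar> <= \<epsilon>"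
  "(SUM v:V. pint p U (%x. \<bar>w k v x - \<xi> v (g x)\<bar>)) < ennreal (\<eta> / (2 * (B + 1)))" by (elim exE conjE)
 obtain F C where F: "lipmap F C" "!!x. x : K l ==> F x = g x"
  "!!x. dist (F x) (g x) <= \<kappa> * (SUM v:V. \<bar>w k v x - \<xi> v (g x)\<bar> + \<epsilon> * indicator N x)"
  "AE x\<in>U in lborel. norm (mgrad F x) <= real DIM('e) * (\<kappa> * (real (card V) * (a x + (1 + \<kappa> * CT l) * indicator N x)))"
  by (rule squeezed_map[OF N(1,2), of \<phi> \<epsilon> \<delta> k]) (use \<phi> \<delta>(1) k(1) in blast)+
 have small: "ennreal s * t <= ennreal (\<eta> / 2)" if "0 <= s" "s <= S" "0 < S" "t < ennreal (\<eta> / (2 * S))" for s S t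
 proof -
  have "ennreal s * t <= ennreal S * ennreal (\<eta> / (2 * S))" using that by (intro mult_mono ennreal_leI) auto
  also have "... = ennreal (\<eta> / 2)" using that \<eta> by (simp add: ennreal_mult[symmetric])
  finally show ?thesis .
 qed
 have half: "ennreal (\<eta> / 2) + ennreal (\<eta> / 2) = ennreal \<eta>" using \<eta> by (simp add: ennreal_plus[symmetric] del: ennreal_plus)
 have FK: "ALL x:K l. F x = g x" using F(2) by blast
 show ?thesis
 proof (rule that[OF F(1)])
  have gm: "(%x. ennreal (\<bar>w k v x - \<xi> v (g x)\<bar> powr p) * indicator U x) : borel_measurable borel" if v: "v : V" for v
  proof -
   have "continuous_on UNIV (\<xi> v)"
    by (rule lipschitz_on_continuous_on[of \<kappa>]) (use \<xi>[OF v] \<kappa> in "auto intro!: lipschitz_onI simp: dist_real_def")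
   then have [measurable]: "(%x. \<xi> v (g x)) : borel_measurable (restrict_space borel U)"
    using borel_measurable_continuous_onI measurable_compose[OF g] by blast
   have [measurable]: "w k v : borel_measurable (restrict_space borel U)" by (rule measurable_restrict_space1[OF borel_rlip[OF w[OF v]]])
   have "(%x. ennreal (\<bar>w k v x - \<xi> v (g x)\<bar> powr p)) : borel_measurable (restrict_space borel U)" by measurable
   then show ?thesis by (subst (asm) borel_measurable_restrict_space_iff_ennreal) simp_all
  qed
  have "pint p U (%x. dist (F x) (g x)) <= lint (%x. ennreal B * (SUM v:V. ennreal (\<bar>w k v x - \<xi> v (g x)\<bar> powr p) * indicator U x)
   + ennreal (B * m) * indicator (N - K l) x)"
  proof (rule nn_integral_mono)
   fix x
   define i where "i = (indicator N x :: real)"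
   have i: "0 <= i" "i powr p = i" using p by (auto simp: i_def indicator_def)
   show "ennreal (dist (F x) (g x) powr p) * indicator U x <= ennreal B * (SUM v:V. ennreal (\<bar>w k v x - \<xi> v (g x)\<bar> powr p) * indicator U x)
   + ennreal (B * m) * indicator (N - K l) x"
   proof (cases "x : U - K l")
    case False
    then show ?thesis using F(2)[of x] p by (cases "x : U") auto
   next
    case True
    have "dist (F x) (g x) powr p <= (\<kappa> * (SUM v:V. \<bar>w k v x - \<xi> v (g x)\<bar> + \<epsilon> * i)) powr p"
     using F(3)[of x] p by (intro powr_mono2) (auto simp: i_def)
    also have "... = \<kappa> powr p * (SUM v:V. \<bar>w k v x - \<xi> v (g x)\<bar> + \<epsilon> * i) powr p" by (rule powr_mult)
    also have "... <= \<kappa> powr p * (m powr p * (SUM v:V. (\<bar>w k v x - \<xi> v (g x)\<bar> + \<epsilon> * i) powr p))"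
     unfolding m_def using \<epsilon> i p by (intro mult_left_mono powr_sum_le V) auto
    also have "... <= \<kappa> powr p * (m powr p * (SUM v:V. 2 powr p * (\<bar>w k v x - \<xi> v (g x)\<bar> powr p + i)))"
    proof (intro mult_left_mono sum_mono)
     fix v
     have "(\<bar>w k v x - \<xi> v (g x)\<bar> + \<epsilon> * i) powr p <= (\<bar>w k v x - \<xi> v (g x)\<bar> + i) powr p"
      using \<epsilon> i p mult_right_mono[of \<epsilon> 1 i] by (intro powr_mono2) auto
     also have "... <= 2 powr p * (\<bar>w k v x - \<xi> v (g x)\<bar> powr p + i powr p)" using i p by (intro powr_add_le) auto
     finally show "(\<bar>w k v x - \<xi> v (g x)\<bar> + \<epsilon> * i) powr p <= 2 powr p * (\<bar>w k v x - \<xi> v (g x)\<bar> powr p + i)" by (simp add: i)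
    qed auto
    also have "... = B * (SUM v:V. \<bar>w k v x - \<xi> v (g x)\<bar> powr p) + B * m * i"
     by (simp add: sum_distrib_left[symmetric] sum.distrib B_def m_def algebra_simps)
    finally have "ennreal (dist (F x) (g x) powr p) <= ennreal (B * (SUM v:V. \<bar>w k v x - \<xi> v (g x)\<bar> powr p) + B * m * i)" by (rule ennreal_leI)
    also have "... = ennreal B * (SUM v:V. ennreal (\<bar>w k v x - \<xi> v (g x)\<bar> powr p)) + ennreal (B * m) * ennreal i"
     using AB i by (simp add: ennreal_mult sum_nonneg)
    finally show ?thesis using True by (cases "x : N") (simp_all add: i_def)
   qed
  qed
  also have "... = ennreal B * (SUM v:V. pint p U (%x. \<bar>w k v x - \<xi> v (g x)\<bar>)) + ennreal (B * m) * vol (N - K l)"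
   using gm by (simp add: nn_integral_add nn_integral_cmult nn_integral_sum)
  also have "... <= ennreal (\<eta> / 2) + ennreal (\<eta> / 2)" by (intro add_mono small[OF _ _ _ k(2)] small[OF _ _ _ N(3)]) (use AB E in auto)
  finally show "pint p U (%x. dist (F x) (g x)) <= ennreal \<eta>" unfolding half .
  fix W assume [measurable]: "W : sets borel" and WU: "W \<subseteq> U"
  have "pint p W (%x. norm (mgrad F x)) <= lint (%x. ennreal (slope x powr p) * indicator W x
   + (ennreal A * (ennreal (a x powr p) * indicator (U - K l) x) + ennreal (A * c powr p) * indicator (N - K l) x))"
  proof (rule nn_integral_mono_AE)
   show "AE x in lborel. ennreal (norm (mgrad F x) powr p) * indicator W x <= ennreal (slope x powr p) * indicator W x
   + (ennreal A * (ennreal (a x powr p) * indicator (U - K l) x) + ennreal (A * c powr p) * indicator (N - K l) x)"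
    using slope_eq[OF F(1) FK] F(4)
   proof eventually_elim
    case (elim x)
    define i where "i = (indicator N x :: real)"
    have i: "0 <= i" "i powr p = i" using p by (auto simp: i_def indicator_def)
    consider "x ~: W" | "x : W" "x : K l" | "x : W" "x ~: K l" by blast
    then show ?case
    proof cases
     case 2
     then show ?thesis using elim(1) by simp
    next
     case 3
     then have x: "x : U" using WU by blast
     have "norm (mgrad F x) powr p <= (D * (a x + c * i)) powr p"
      using elim(2) x p by (intro powr_mono2) (auto simp: D_def m_def c_def i_def mult.assoc)
     also have "... = D powr p * (a x + c * i) powr p" by (rule powr_mult)
     also have "... <= D powr p * (2 powr p * (a x powr p + (c * i) powr p))" using a0[of x] c i p by (intro mult_left_mono powr_add_le) auto
     also have "(c * i) powr p = c powr p * i" using c i by (simp add: powr_mult)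
     also have "D powr p * (2 powr p * (a x powr p + c powr p * i)) = A * a x powr p + A * c powr p * i" by (simp add: A_def algebra_simps)
     finally have "ennreal (norm (mgrad F x) powr p) <= ennreal (A * a x powr p + A * c powr p * i)" by (rule ennreal_leI)
     also have "... = ennreal A * ennreal (a x powr p) + ennreal (A * c powr p) * ennreal i" using AB i by (simp add: ennreal_mult)
     finally have "ennreal (norm (mgrad F x) powr p) <= ennreal A * ennreal (a x powr p) + ennreal (A * c powr p) * indicator (N - K l) x"
      using 3 by (cases "x : N") (simp_all add: i_def)
     then show ?thesis using 3 x by (simp add: add_increasing)
    qed simp
   qed
  qed
  also have "... = pint p W slope + (ennreal A * pint p (U - K l) a
    + ennreal (A * c powr p) * vol (N - K l))" by (simp add: nn_integral_add nn_integral_cmult)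
  also have "... <= pint p W slope + (ennreal (\<eta> / 2) + ennreal (\<eta> / 2))"
   by (intro add_mono order_refl small[OF _ _ _ l] small[OF _ _ _ N(3)]) (use AB E in auto)
  finally show "pint p W (%x. norm (mgrad F x)) <= pint p W slope + ennreal \<eta>" unfolding half .
 qed
qed

end

section \<open>Producing the data from a sequence of bounded energy\<close>

lemma rgrad_compose_le:
 fixes x :: "'e::euclidean_space"
 assumes f: "!!z z'. \<bar>\<xi> z - \<xi> z'\<bar> <= k * dist z z'" and F: "mdiff F x" and r: "rdiff (%x. \<xi> (F x)) x" and k: "0 <= k"
 shows "norm (rgrad (%x. \<xi> (F x)) x) <= real DIM('e) * k * norm (mgrad F x)"
proof -
 have "\<bar>rgrad (%x. \<xi> (F x)) x \<bullet> b\<bar> <= k * norm (mgrad F x)" if b: "b : Basis" for b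
 proof -
  have "mslope (%x. \<xi> (F x)) b x <= k * mslope F b x"
  proof (rule tendsto_le[OF _ tendsto_mult[OF tendsto_const mdiff_tendsto[OF F]] mdiff_tendsto[OF rdiff_mdiff(1)[OF r]]])
   show "\<forall>\<^sub>F t in at_right 0. dist (\<xi> (F (x + t *\<^sub>R b))) (\<xi> (F x)) / t <= k * (dist (F (x + t *\<^sub>R b)) (F x) / t)"
    using eventually_at_right_less[of 0] by eventually_elim (use f in "simp add: dist_real_def divide_right_mono")
  qed simp
  also have "... = k * (mgrad F x \<bullet> b)" using b by simp
  also have "... <= k * norm (mgrad F x)" using k Basis_le_norm[OF b, of "mgrad F x"] by (intro mult_left_mono) auto
  finally show ?thesis by (simp add: rdiff_mdiff(2)[OF r] inner_commute)
 qed
 then have "(SUM b:Basis. \<bar>rgrad (%x. \<xi> (F x)) x \<bullet> b\<bar>) <= (SUM b:(Basis::'e set). k * norm (mgrad F x))" by (rule sum_mono)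
 then show ?thesis using norm_le_l1[of "rgrad (%x. \<xi> (F x)) x"] by simp
qed

context orbit_space
begin

lemma lip_extension_on:
 fixes f :: "'e::euclidean_space => 'z"
 assumes "!!x y. x : S ==> y : S ==> dist (f x) (f y) <= L * norm (x - y)"
 obtains F C where "lipmap F C" "!!x. x : S ==> F x = f x"
proof -
 define d where "d x y = max 0 L * norm (x - y)" for x y :: 'e
 have "pseudometric (%x y. norm (x - y) :: real)" unfolding pseudometric_def by (metis dist_norm dist_commute dist_self dist_triangle)
 from pseudometric_scale[OF this, of "max 0 L"] have d: "pseudometric d" by (simp add: d_def[abs_def])
 obtain k where k: "1 <= k" and ext: "!!(d :: 'e => 'e => real) A f. pseudometric d ==>
   (!!a b. a : A ==> b : A ==> dist (f a) (f b) <= d a b) ==>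
   EX F :: 'e => 'z. (ALL a:A. F a = f a) & (ALL x y. dist (F x) (F y) <= k * d x y)" by (rule lip_extension) blast
 have "dist (f x) (f y) <= d x y" if "x : S" "y : S" for x y unfolding d_def by (rule order_trans[OF assms[OF that]]) (simp add: mult_right_mono)
 from ext[OF d this] obtain F where F: "ALL a:S. F a = f a" "ALL x y. dist (F x) (F y) <= k * d x y" by blast
 have "lipmap F (k * max 0 L)" using F(2) k by unfold_locales (auto simp: d_def mult.assoc)
 then show ?thesis by (rule that) (use F(1) in blast)
qed

text \<open>Composing with the \<open>\<xi> v\<close> makes a bounded-energy sequence of real
  functions, at the price of a constant. The Lipschitz bounds on \<open>K l\<close> come back to
  \<open>g\<close> through \<open>\<rho>\<close>, and the retraction property extends
  \<open>g\<close> from \<open>K l\<close> to \<open>T l\<close>.\<close>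

lemma orbit_sobolev_exists:
 fixes U :: "'e::euclidean_space set" and g :: "'e => 'z"
 assumes U: "open U" and p: "1 < p" and g: "g : borel_measurable (restrict_space borel U)"
  and G: "!!j. lipmap (G j) (C j)"
  and lim: "(%j. pint p U (%x. dist (G j x) (g x))) \<longlonglongrightarrow> 0"
  and bound: "!!j. (pint p U (%x. norm (mgrad (G j) x))) <= ennreal M"
 shows "EX V \<xi> \<rho> \<kappa> w a K T CT. orbit_sobolev H \<pi> U p g V \<xi> \<rho> \<kappa> w a K T CT"
proof (rule coordinates)
 fix V :: "'w set" and \<xi> :: "'w => 'z => real" and \<rho> and \<kappa>
 assume V: "finite V" and \<kappa>: "1 <= \<kappa>" and \<xi>: "!!v z z'. v : V ==> \<bar>\<xi> v z - \<xi> v z'\<bar> <= \<kappa> * dist z z'"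
  and \<rho>\<xi>: "!!z. \<rho> (%v. \<xi> v z) = z" and \<rho>: "!!\<phi> \<psi>. dist (\<rho> \<phi>) (\<rho> \<psi>) <= \<kappa> * (SUM v:V. \<bar>\<phi> v - \<psi> v\<bar>)"
 have Ub[measurable]: "U : sets borel" using U by simp
 \<comment> \<open>\<open>g\<close> is measurable on \<open>U\<close> only; continuing by 0 gives
   functions that are Borel on the whole space, for indices outside \<open>V\<close> as
   well.\<close>
 define \<gamma> where "\<gamma> v x = (if v : V then indicator U x *\<^sub>R \<xi> v (g x) else 0)" for v x
 have \<gamma>m: "\<gamma> v : borel_measurable borel" for v
 proof (cases "v : V")
  case True
  have "continuous_on UNIV (\<xi> v)"
   by (rule lipschitz_on_continuous_on[of \<kappa>]) (use \<xi>[OF True] \<kappa> in "auto intro!: lipschitz_onI simp: dist_real_def")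
  then have "(%x. \<xi> v (g x)) : borel_measurable (restrict_space borel U)" by (intro measurable_compose[OF g] borel_measurable_continuous_onI)
  then have "(%x. indicator U x *\<^sub>R \<xi> v (g x)) : borel_measurable borel" by (subst (asm) borel_measurable_restrict_space_iff) simp_all
  then show ?thesis using True by (simp add: \<gamma>_def[abs_def])
 qed (simp add: \<gamma>_def[abs_def])
 define h where "h j v x = \<xi> v (G j x)" for j v x
 have h: "rlip (h j v)" if v: "v : V" for j v
 proof -
  interpret lipmap "G j" "C j" by (rule G)
  have "real_lipschitz (h j v) (\<kappa> * C j)"
  proof
   show "0 <= \<kappa> * C j" using \<kappa> C0 by simp
   fix x y
   have "\<bar>h j v x - h j v y\<bar> <= \<kappa> * dist (G j x) (G j y)" unfolding h_def by (rule \<xi>[OF v])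
   also have "... <= \<kappa> * (C j * norm (x - y))" using F_lip \<kappa> by (intro mult_left_mono) auto
   finally show "\<bar>h j v x - h j v y\<bar> <= \<kappa> * C j * norm (x - y)" by (simp add: mult.assoc)
  qed
  then show ?thesis by (auto simp: rlip_def)
 qed
 define A where "A = real (card V) * (real DIM('e) * \<kappa>) powr p"
 have A: "0 <= A" by (simp add: A_def)
 have "bounded_energy_sequence U V p (A * max 0 M) h \<gamma>"
 proof
  fix j
  have md: "AE x in lborel. mdiff (G j) x"
  proof -
   interpret lipmap "G j" "C j" by (rule G)
   show ?thesis using rademacher_orbit[OF F_lip C0] by eventually_elim (auto intro: tdiff_mdiff)
  qed
  have [measurable]: "mgrad (G j) : borel_measurable borel" by (rule borel_mgrad[OF G])
  have rd: "AE x in lborel. ALL v:V. rdiff (h j v) x" by (intro AE_finite_allI V rdiff_AE h)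
  have "sint U (%x. ennreal (SUM v:V. norm (rgrad (h j v) x) powr p))
    <= lint (%x. ennreal A * (ennreal (norm (mgrad (G j) x) powr p) * indicator U x))"
  proof (rule nn_integral_mono_AE)
   show "AE x in lborel. ennreal (SUM v:V. norm (rgrad (h j v) x) powr p) * indicator U x
     <= ennreal A * (ennreal (norm (mgrad (G j) x) powr p) * indicator U x)"
    using rd md
   proof eventually_elim
    case (elim x)
    have "(SUM v:V. norm (rgrad (h j v) x) powr p) <= (SUM v:V. (real DIM('e) * \<kappa> * norm (mgrad (G j) x)) powr p)"
    proof (rule sum_mono)
     fix v assume v: "v : V"
     have "norm (rgrad (h j v) x) <= real DIM('e) * \<kappa> * norm (mgrad (G j) x)"
      unfolding h_def[abs_def] by (rule rgrad_compose_le[OF \<xi>[OF v] elim(2)]) (use elim(1) v \<kappa> in "auto simp: h_def[abs_def]")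
     then show "norm (rgrad (h j v) x) powr p <= (real DIM('e) * \<kappa> * norm (mgrad (G j) x)) powr p" using p by (intro powr_mono2) auto
    qed
    also have "... = A * norm (mgrad (G j) x) powr p" by (simp add: A_def powr_mult)
    finally have "ennreal (SUM v:V. norm (rgrad (h j v) x) powr p) <= ennreal (A * norm (mgrad (G j) x) powr p)" by (rule ennreal_leI)
    also have "... = ennreal A * ennreal (norm (mgrad (G j) x) powr p)" using A by (intro ennreal_mult) auto
    finally show ?case by (simp add: indicator_def)
   qed
  qed
  also have "... = ennreal A * pint p U (%x. norm (mgrad (G j) x))" by (rule nn_integral_cmult) measurable
  also have "... <= ennreal A * ennreal (max 0 M)" using bound[of j] by (intro mult_left_mono order_trans[OF bound] ennreal_leI) auto
  also have "... = ennreal (A * max 0 M)" using A by (intro ennreal_mult[symmetric]) auto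
  finally show "sint U (%x. ennreal (SUM v:V. norm (rgrad (h j v) x) powr p)) <= ennreal (A * max 0 M)" .
 next
  fix v assume v: "v : V"
  have "(%j. ennreal (\<kappa> powr p) * pint p U (%x. dist (G j x) (g x))) \<longlonglongrightarrow> ennreal (\<kappa> powr p) * 0"
   by (rule ennreal_tendsto_cmult[OF _ lim]) simp
  then have z: "(%j. ennreal (\<kappa> powr p) * pint p U (%x. dist (G j x) (g x))) \<longlonglongrightarrow> 0" by simp
  show "(%j. pint p U (%x. \<bar>h j v x - \<gamma> v x\<bar>)) \<longlonglongrightarrow> 0"
  proof (rule tendsto_sandwich[OF _ _ tendsto_const z])
   show "\<forall>\<^sub>F j in sequentially. (pint p U (%x. \<bar>h j v x - \<gamma> v x\<bar>))
     <= ennreal (\<kappa> powr p) * pint p U (%x. dist (G j x) (g x))"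
   proof (intro always_eventually allI)
    fix j
    have [measurable]: "h j v : borel_measurable borel" "\<gamma> v : borel_measurable borel" using borel_rlip[OF h[OF v]] \<gamma>m by auto
    have kp: "0 < \<kappa> powr p" using \<kappa> by simp
    have "pint p U (%x. \<bar>h j v x - \<gamma> v x\<bar>)
      = lint (%x. ennreal (\<kappa> powr p) * (ennreal (\<bar>h j v x - \<gamma> v x\<bar> powr p / \<kappa> powr p) * indicator U x))"
     using kp by (intro nn_integral_cong) (simp add: mult.assoc[symmetric] ennreal_mult[symmetric])
    also have "... = ennreal (\<kappa> powr p) * sint U (%x. ennreal (\<bar>h j v x - \<gamma> v x\<bar> powr p / \<kappa> powr p))"
     by (rule nn_integral_cmult) measurable
    also have "... <= ennreal (\<kappa> powr p) * pint p U (%x. dist (G j x) (g x))"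
    proof (intro mult_left_mono nn_integral_mono)
     fix x
     show "ennreal (\<bar>h j v x - \<gamma> v x\<bar> powr p / \<kappa> powr p) * indicator U x <= ennreal (dist (G j x) (g x) powr p) * indicator U x"
     proof (cases "x : U")
      case True
      have "\<bar>h j v x - \<gamma> v x\<bar> <= \<kappa> * dist (G j x) (g x)" using \<xi>[OF v] True v by (simp add: h_def \<gamma>_def)
      then have "\<bar>h j v x - \<gamma> v x\<bar> powr p <= (\<kappa> * dist (G j x) (g x)) powr p" using p by (intro powr_mono2) auto
      then have "\<bar>h j v x - \<gamma> v x\<bar> powr p / \<kappa> powr p <= dist (G j x) (g x) powr p"
       using kp by (simp add: powr_mult pos_divide_le_eq mult.commute)
      then show ?thesis using True by (simp add: ennreal_leI)
     qed simp
    qed simp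
    finally show "pint p U (%x. \<bar>h j v x - \<gamma> v x\<bar>)
     <= ennreal (\<kappa> powr p) * pint p U (%x. dist (G j x) (g x))" .
   qed
  qed simp
 qed (use V Ub p A h \<gamma>m in auto)
 then interpret B: bounded_energy_sequence U V p "A * max 0 M" h \<gamma> .
 show ?thesis
 proof (rule B.lusin_sets[OF U])
  fix w a K
  assume w: "!!k i. i : V ==> rlip (w k i)" and a: "a : borel_measurable borel" "!!x. 0 <= a x"
   "pint p U a < \<infinity>"
   "AE x\<in>U in lborel. (ALL k. ALL i:V. norm (rgrad (w k i) x) <= a x)"
   and wl: "!!i. i : V ==> (%k. pint p U (%x. \<bar>w k i x - \<gamma> i x\<bar>)) \<longlonglongrightarrow> 0"
   and K: "!!l. compact (K l)" "!!l. K l \<subseteq> U" "AE x\<in>U in lborel. (\<forall>\<^sub>F l in sequentially. x : K l)"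
   and lip: "!!l i. i : V ==> EX C. ALL x:K l. ALL y:K l. \<bar>\<gamma> i x - \<gamma> i y\<bar> <= C * norm (x - y)"
   and unif: "!!l i \<epsilon>. i : V ==> 0 < \<epsilon> ==> \<forall>\<^sub>F k in sequentially. ALL x:K l. \<bar>w k i x - \<gamma> i x\<bar> <= \<epsilon>"
  have \<gamma>U: "\<gamma> v x = \<xi> v (g x)" if "x : U" "v : V" for v x using that by (simp add: \<gamma>_def)
  have "EX T. lipmap (fst T) (snd T) & (ALL x:K l. fst T x = g x)" for l
  proof -
   have "ALL i:V. EX C. ALL x:K l. ALL y:K l. \<bar>\<gamma> i x - \<gamma> i y\<bar> <= C * norm (x - y)" using lip by blast
   from bchoice[OF this] obtain L where L: "ALL i:V. ALL x:K l. ALL y:K l. \<bar>\<gamma> i x - \<gamma> i y\<bar> <= L i * norm (x - y)" ..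
   have gl: "dist (g x) (g y) <= \<kappa> * (SUM v:V. L v) * norm (x - y)" if xy: "x : K l" "y : K l" for x y
   proof -
    have "dist (g x) (g y) = dist (\<rho> (%v. \<xi> v (g x))) (\<rho> (%v. \<xi> v (g y)))" by (simp add: \<rho>\<xi>)
    also have "... <= \<kappa> * (SUM v:V. \<bar>\<xi> v (g x) - \<xi> v (g y)\<bar>)" by (rule \<rho>)
    also have "... <= \<kappa> * (SUM v:V. L v * norm (x - y))"
    proof (intro mult_left_mono sum_mono)
     fix v assume "v : V"
     then show "\<bar>\<xi> v (g x) - \<xi> v (g y)\<bar> <= L v * norm (x - y)" using L xy K(2)[of l] \<gamma>U by (metis subsetD)
    qed (use \<kappa> in simp)
    finally show ?thesis by (simp add: sum_distrib_right mult.assoc)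
   qed
   show ?thesis
   proof (rule lip_extension_on[of "K l" g, OF gl])
    fix F C assume "lipmap F C" "!!x. x : K l ==> F x = g x"
    then show ?thesis by (intro exI[of _ "(F, C)"]) simp
   qed
  qed
  from choice[OF allI, OF this] obtain T where T: "ALL l. lipmap (fst (T l)) (snd (T l)) & (ALL x:K l. fst (T l) x = g x)" ..
  have "orbit_sobolev H \<pi> U p g V \<xi> \<rho> \<kappa> w a K (%l. fst (T l)) (%l. snd (T l))"
  proof
   fix v assume v: "v : V"
   have "pint p U (%x. \<bar>w k v x - \<xi> v (g x)\<bar>) = pint p U (%x. \<bar>w k v x - \<gamma> v x\<bar>)" for k
    using v by (intro nn_integral_cong) (simp add: \<gamma>_def indicator_def)
   then show "(%k. pint p U (%x. \<bar>w k v x - \<xi> v (g x)\<bar>)) \<longlonglongrightarrow> 0" using wl[OF v] by simp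
   fix l and \<epsilon> :: real assume "0 < \<epsilon>"
   from unif[OF v this, of l] show "\<forall>\<^sub>F k in sequentially. ALL x:K l. \<bar>w k v x - \<xi> v (g x)\<bar> <= \<epsilon>"
    by eventually_elim (use \<gamma>U[OF _ v] K(2)[of l] in "metis subsetD")
  qed (fact U p g V \<kappa> \<xi> \<rho>\<xi> \<rho> w a K | use T in "auto simp: lipmap_def")+
  then show ?thesis by blast
 qed
qed

end

section \<open>Coordinates on a finite-dimensional space\<close>

text \<open>The symmetric group acting on \<open>Q\<close>-tuples of vectors; the Euclidean norm of
  the tuple makes its orbit distance equal to \<open>G2\<close>.\<close>

definition permute_maps :: "(((real ^ 'n) ^ 'q) => (real ^ 'n) ^ 'q) set" where
 "permute_maps = (%\<sigma> w. \<chi> i. w $ \<sigma> i) ` {\<sigma>. \<sigma> permutes UNIV}"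

definition vtuple :: "(real ^ 'n) ^ 'q => (real ^ 'n, 'q::finite) utuple" where
 "vtuple w = utuple (%i. w $ i)"

lemma orbit_space_vtuple: "orbit_space permute_maps (vtuple :: (real ^ 'n) ^ 'q => (real ^ 'n, 'q::finite) utuple)"
proof (intro orbit_space.intro orbit_space_axioms.intro)
 let ?H = "permute_maps :: (((real ^ 'n) ^ 'q) => (real ^ 'n) ^ 'q) set"
 have H: "h : ?H \<longleftrightarrow> (EX \<sigma>. \<sigma> permutes UNIV & h = (%w. \<chi> i. w $ \<sigma> i))" for h by (auto simp: permute_maps_def)
 show "isogroup ?H" unfolding isogroup_def
 proof (intro conjI allI impI)
  show "finite ?H" by (simp add: permute_maps_def)
  show "id : ?H" unfolding H by (rule exI[of _ id]) (auto simp: permutes_id)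
  fix h assume "h : ?H"
  then obtain \<sigma> where \<sigma>: "\<sigma> permutes UNIV" and h: "h = (%w. \<chi> i. w $ \<sigma> i)" by (auto simp: H)
  show "linear h" unfolding h by (rule linearI) (auto simp: vec_eq_iff)
  show "norm (h x) = norm x" for x using sum.permute[OF \<sigma>, of "%i. (norm (x $ i))\<^sup>2"] by (simp add: h norm_vec_def L2_set_def comp_def)
  show "EX g:?H. ALL x. g (h x) = x & h (g x) = x"
  proof (intro bexI[of _ "%w. \<chi> i. w $ inv \<sigma> i"] allI)
   show "(%w. \<chi> i. w $ inv \<sigma> i) : ?H" using permutes_inv[OF \<sigma>] by (auto simp: H)
  qed (use permutes_inverses[OF \<sigma>] in "auto simp: h vec_eq_iff")
 next
  fix g h assume "g : ?H" "h : ?H"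
  then obtain \<sigma> \<tau> where st: "\<sigma> permutes UNIV" "\<tau> permutes UNIV" and gh: "h = (%w. \<chi> i. w $ \<sigma> i)" "g = (%w. \<chi> i. w $ \<tau> i)"
   by (auto simp: H)
  have "g \<circ> h = (%w. \<chi> i. w $ (\<sigma> \<circ> \<tau>) i)" by (simp add: gh fun_eq_iff)
  then show "g \<circ> h : ?H" using permutes_compose[OF st(2,1)] by (auto simp: H)
 qed
next
 fix x y :: "(real ^ 'n) ^ 'q"
 have "norm (x - (\<chi> i. y $ \<sigma> i)) = sqrt (SUM i:UNIV. (norm (x $ i - y $ \<sigma> i))\<^sup>2)" for \<sigma>
  by (simp add: norm_vec_def L2_set_def)
 then show "dist (vtuple x) (vtuple y) = odist permute_maps x y"
  by (simp add: vtuple_def dist_utuple_def G2.abs_eq G2_tuple_def odist_def permute_maps_def image_image)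
next
 have "EX w. z = vtuple w" for z :: "(real ^ 'n, 'q) utuple"
 proof (induction z rule: utuple.abs_induct)
  case (1 y)
  show ?case by (rule exI[of _ "\<chi> i. y i"]) (simp add: vtuple_def)
 qed
 then show "surj (vtuple :: (real ^ 'n) ^ 'q => (real ^ 'n, 'q) utuple)" by (auto simp: surj_def)
qed

text \<open>The default \<open>{0}\<close> keeps the set finite and nonempty for every vector space
  type, as the type definition below demands.\<close>

definition chosen_basis :: "'a::real_vector set" where
 "chosen_basis = (if EX B::'a set. finite_basis B & B ~= {} then SOME B. finite_basis B & B ~= {} else {0})"

lemma chosen_basis:
 fixes B :: "'a::real_vector set"
 shows "finite (chosen_basis :: 'a set)" "(chosen_basis :: 'a set) ~= {}"
  "finite_basis B ==> B ~= {} ==> finite_basis (chosen_basis :: 'a set)"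
proof -
 have s: "finite_basis (chosen_basis :: 'a set) & (chosen_basis :: 'a set) ~= {}" if "EX B::'a set. finite_basis B & B ~= {}"
  using someI_ex[OF that] that by (simp add: chosen_basis_def)
 have "finite (chosen_basis :: 'a set) & (chosen_basis :: 'a set) ~= {}"
 proof (cases "EX B::'a set. finite_basis B & B ~= {}")
  case True
  then show ?thesis using s by (auto simp: finite_basis_def)
 next
  case False
  have c0: "(chosen_basis :: 'a set) = {0}" unfolding chosen_basis_def by (rule if_not_P[OF False])
  show ?thesis unfolding c0 by simp
 qed
 then show "finite (chosen_basis :: 'a set)" "(chosen_basis :: 'a set) ~= {}" by auto
 show "finite_basis B ==> B ~= {} ==> finite_basis (chosen_basis :: 'a set)" using s by blast
qed

text \<open>A type with as many elements as \<open>'a\<close> has dimensions, so that \<open>real ^ 'a basis_index\<close> is a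
 Euclidean model of a finite-dimensional \<open>'a\<close>.\<close>

typedef (overloaded) ('a::real_vector) basis_index = "chosen_basis :: 'a set" using chosen_basis(2) by blast

instance basis_index :: (real_vector) finite
proof
 show "finite (UNIV :: 'a basis_index set)"
  unfolding type_definition.Abs_image[OF type_definition_basis_index, symmetric] by (rule finite_imageI[OF chosen_basis(1)])
qed

text \<open>The standard basis is sent onto \<open>B\<close>, so sums over \<open>B\<close> in
  \<open>tri_norm\<close> become sums over orthonormal directions.\<close>

lemma coordinate_isomorphism:
 fixes B :: "'a::real_normed_vector set"
 assumes B: "finite_basis B" "B ~= {}"
 obtains T :: "real ^ 'a basis_index => 'a" where "linear T" "bij T" "bij_betw T Basis B"
proof -
 have "finite_basis (chosen_basis :: 'a set)" by (rule chosen_basis(3)[OF B])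
 then have "card (chosen_basis :: 'a set) = card B" using B by (metis dim_eq_card_independent dim_span finite_basis_def)
 moreover have "card (chosen_basis :: 'a set) = CARD('a basis_index)" by (rule type_definition.card[OF type_definition_basis_index, symmetric])
 ultimately obtain \<beta> :: "'a basis_index => 'a" where \<beta>: "bij_betw \<beta> UNIV B"
  using finite_same_card_bij[of "UNIV :: 'a basis_index set" B] B by (auto simp: finite_basis_def)
 define T where "T x = (SUM i:UNIV. x $ i *\<^sub>R \<beta> i)" for x :: "real ^ 'a basis_index"
 have lin: "linear T" by (rule linearI) (simp_all add: T_def scaleR_add_left sum.distrib scaleR_sum_right)
 have axis: "T (axis i 1) = \<beta> i" for i by (simp add: T_def axis_def if_distrib[of "%c. c *\<^sub>R _"] cong: if_cong)
 have reindex: "(SUM b:B. u b *\<^sub>R b) = (SUM i:UNIV. u (\<beta> i) *\<^sub>R \<beta> i)" for u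
  by (rule sum.reindex_bij_betw[OF \<beta>, symmetric])
 have "x = 0" if "T x = 0" for x
 proof -
  define u where "u b = x $ (inv_into UNIV \<beta> b)" for b
  have u: "u (\<beta> i) = x $ i" for i using \<beta> by (simp add: u_def bij_betw_def)
  have "(SUM b:B. u b *\<^sub>R b) = 0" using that by (simp add: reindex u T_def)
  then have "ALL b:B. u b = 0" using B by (metis finite_basis_def independent_explicit_finite_subsets order_refl)
  then have "x $ i = 0" for i using u \<beta> by (metis UNIV_I bij_betw_apply)
  then show ?thesis by (simp add: vec_eq_iff)
 qed
 then have "inj T" using lin by (simp add: linear_injective_0)
 moreover have "EX x. y = T x" for y
 proof -
  have "range (%u. SUM b:B. u b *\<^sub>R b) = UNIV" by (rule trans[OF span_finite[symmetric]]) (use B in "auto simp: finite_basis_def")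
  then have "y : range (%u. SUM b:B. u b *\<^sub>R b)" by (simp only: UNIV_I)
  then obtain u where "y = (SUM b:B. u b *\<^sub>R b)" ..
  then have "y = T (\<chi> i. u (\<beta> i))" by (simp add: T_def reindex)
  then show ?thesis by blast
 qed
 then have "surj T" by (auto simp: surj_def)
 moreover have "bij_betw T Basis B"
 proof -
  have bas: "(Basis :: (real ^ 'a basis_index) set) = range (%i. axis i 1)" by (auto simp: Basis_vec_def)
  have "T ` Basis = B" unfolding bas using \<beta> by (simp add: axis image_image bij_betw_def)
  then show ?thesis using \<open>inj T\<close> by (auto simp: bij_betw_def intro: inj_on_subset)
 qed
 ultimately show ?thesis using lin by (intro that) (auto simp: bij_def)
qed

lemma linear_bij_bounds:
 fixes T :: "'e::euclidean_space => 'a::real_normed_vector"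
 assumes T: "linear T" "bij T"
 obtains C where "1 <= C" "!!x. norm (T x) <= C * norm x" "!!x. norm x <= C * norm (T x)"
proof -
 have bl: "bounded_linear T" using T(1) by (simp add: linear_conv_bounded_linear)
 then interpret bounded_linear T .
 obtain K where K: "!!x. norm (T x) <= K * norm x" using bounded by (auto simp: mult.commute)
 have sph: "sphere (0::'e) 1 ~= {}" by simp
 have "continuous_on (sphere 0 1) (%x. norm (T x))" by (intro continuous_intros linear_continuous_on bl)
 from continuous_attains_inf[OF compact_sphere sph this]
 obtain x0 where x0: "x0 : sphere 0 1" "!!x. x : sphere 0 1 ==> norm (T x0) <= norm (T x)" by blast
 define m where "m = norm (T x0)"
 have "T x0 ~= 0" using x0(1) T injD[of T x0 0] by (auto simp: bij_def zero)
 then have m: "0 < m" by (simp add: m_def)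
 have low: "norm x <= 1 / m * norm (T x)" for x
 proof (cases "x = 0")
  case False
  have "m <= norm (T (x /\<^sub>R norm x))" unfolding m_def using False by (intro x0) simp
  then show ?thesis using False m by (simp add: scaleR field_simps)
 qed simp
 define C where "C = max 1 (max K (1 / m))"
 show ?thesis
 proof (rule that[of C])
  show "norm (T x) <= C * norm x" for x by (rule order_trans[OF K mult_right_mono]) (auto simp: C_def)
  show "norm x <= C * norm (T x)" for x by (rule order_trans[OF low mult_right_mono]) (auto simp: C_def)
 qed (simp add: C_def)
qed

lemma nn_integral_lborel_reflect:
 fixes f :: "'e::euclidean_space => ennreal"
 assumes f[measurable]: "f : borel_measurable borel"
 shows "lint (%y. f (x - y)) = lint f"
proof -
 have "lborel = density (distr lborel borel (%y::'e. x + (- 1) *\<^sub>R y)) (%_. ennreal (\<bar>- 1\<bar> ^ DIM('e)))" by (rule lborel_affine) simp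
 then have "lint f = (\<integral>\<^sup>+y. f y \<partial>distr lborel borel (%y::'e. x + (- 1) *\<^sub>R y))" by (simp add: density_1)
 also have "... = lint (%y. f (x - y))" by (subst nn_integral_distr) simp_all
 finally show ?thesis by simp
qed

text \<open>Uniqueness of Haar measure: integrating the indicator of \<open>A\<close> at
  \<open>x\<close> times that of \<open>D\<close> at \<open>x + y\<close> over both variables gives
  two different products, according to which measure is used up first.\<close>

lemma translation_invariant_eq_lborel:
 fixes \<nu> :: "'e::euclidean_space measure"
 assumes sets: "sets \<nu> = sets borel" and fin: "!!K. compact K ==> emeasure \<nu> K < \<infinity>"
  and inv: "!!a. distr \<nu> borel (%x. a + x) = \<nu>" and nz: "emeasure \<nu> UNIV ~= 0"
 obtains c where "0 < c" "c < \<infinity>" "\<nu> = scale_measure c lborel"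
proof -
 have sp: "space \<nu> = UNIV" using sets_eq_imp_space_eq[OF sets] by simp
 have [measurable_cong]: "sets \<nu> = sets borel" by (rule sets)
 have inv_int: "(\<integral>\<^sup>+x. f (x + a) \<partial>\<nu>) = (\<integral>\<^sup>+x. f x \<partial>\<nu>)" if [measurable]: "f : borel_measurable borel" for f :: "'e => ennreal" and a
 proof -
  have "(\<integral>\<^sup>+x. f x \<partial>\<nu>) = (\<integral>\<^sup>+x. f x \<partial>distr \<nu> borel (%x. a + x))" by (simp only: inv)
  also have "... = (\<integral>\<^sup>+x. f (a + x) \<partial>\<nu>)" by (rule nn_integral_distr) measurable
  finally show ?thesis by (simp add: add.commute)
 qed
 interpret N: sigma_finite_measure \<nu>
 proof
  have "(\<Union>n. cball 0 (real n)) = (UNIV :: 'e set)" by (auto intro: real_arch_simple)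
  then show "EX A. countable A & A \<subseteq> sets \<nu> & \<Union>A = space \<nu> & (ALL a:A. emeasure \<nu> a ~= \<infinity>)"
   using fin[OF compact_cball] by (intro exI[of _ "range (%n. cball 0 (real n))"]) (auto simp: sets sp less_top)
 qed
 interpret P: pair_sigma_finite \<nu> lborel ..
 define D where "D = cball (0::'e) 1"
 have [measurable]: "D : sets borel" by (simp add: D_def)
 have key: "emeasure \<nu> A * vol D = emeasure \<nu> D * vol A" if A[measurable]: "A : sets borel" for A
 proof -
  have "emeasure \<nu> A * vol D = (\<integral>\<^sup>+x. vol D * indicator A x \<partial>\<nu>)"
   by (subst nn_integral_cmult_indicator) (simp_all add: sets mult.commute)
  also have "... = (\<integral>\<^sup>+x. (lint (%y. indicator A x * indicator D (x + y))) \<partial>\<nu>)"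
  proof (rule nn_integral_cong)
   fix x
   have "lint (%y. indicator D (x + y)) = lint (indicator D)" using nn_integral_lborel_translate[of "indicator D" x] by (simp add: add.commute)
   then show "vol D * indicator A x = lint (%y. indicator A x * indicator D (x + y))" by (simp add: nn_integral_cmult mult.commute)
  qed
  also have "... = lint (%y. (\<integral>\<^sup>+x. indicator A x * indicator D (x + y) \<partial>\<nu>))" by (rule P.Fubini'[symmetric]) measurable
  also have "... = lint (%y. (\<integral>\<^sup>+x. indicator A (x - y) * indicator D x \<partial>\<nu>))"
  proof (rule nn_integral_cong)
   fix y
   show "(\<integral>\<^sup>+x. indicator A x * indicator D (x + y) \<partial>\<nu>) = (\<integral>\<^sup>+x. indicator A (x - y) * indicator D x \<partial>\<nu>)"
    using inv_int[of "%x. indicator A (x - y) * indicator D x" y] by simp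
  qed
  also have "... = (\<integral>\<^sup>+x. (lint (%y. indicator A (x - y) * indicator D x)) \<partial>\<nu>)" by (rule P.Fubini') measurable
  also have "... = (\<integral>\<^sup>+x. vol A * indicator D x \<partial>\<nu>)"
   using nn_integral_lborel_reflect[of "indicator A"] by (intro nn_integral_cong) (simp add: nn_integral_multc)
  also have "... = vol A * emeasure \<nu> D" by (rule nn_integral_cmult_indicator) (simp add: sets)
  finally show ?thesis by (simp add: mult.commute)
 qed
 define c where "c = emeasure \<nu> D / vol D"
 have v: "0 < vol D" "vol D < \<infinity>" by (auto simp: D_def emeasure_cball ennreal_less_zero_iff)
 have "emeasure \<nu> A = c * vol A" if "A : sets borel" for A
 proof -
  have "emeasure \<nu> A = emeasure \<nu> A * vol D / vol D" using v by (simp add: ennreal_mult_divide_eq)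
  also have "... = vol A * (emeasure \<nu> D / vol D)" unfolding key[OF that] by (simp add: ennreal_times_divide mult.commute)
  finally show ?thesis by (simp add: c_def mult.commute)
 qed
 then have eq: "\<nu> = scale_measure c lborel" by (intro measure_eqI) (auto simp: sets)
 have "c ~= 0" using nz unfolding eq by auto
 moreover have "c < \<infinity>" unfolding c_def using v fin[of D] by (auto simp: D_def ennreal_divide_eq_top_iff less_top[symmetric])
 ultimately show ?thesis using eq by (intro that) (auto simp: zero_less_iff_neq_zero)
qed

section \<open>Transfer along a linear isomorphism\<close>

locale chart =
 fixes T :: "'e::euclidean_space => 'a::real_normed_vector" and R :: "'a => 'e" and C :: real
  and \<mu> :: "'a measure" and c :: ennreal
 assumes T: "linear T" and RT [simp]: "R (T x) = x" and TR [simp]: "T (R y) = y" and C: "1 <= C"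
  and T_le: "norm (T x) <= C * norm x" and R_le: "norm (R y) <= C * norm y"
  and sets_mu: "sets \<mu> = sets borel" and mu: "distr \<mu> borel R = scale_measure c lborel" and c: "0 < c" "c < \<infinity>"
begin

lemma R: "linear R"
proof (rule linearI)
 fix x y :: 'a and r :: real
 have "R (x + y) = R (T (R x + R y))" unfolding linear_add[OF T] by simp
 then show "R (x + y) = R x + R y" by simp
 have "R (r *\<^sub>R x) = R (T (r *\<^sub>R R x))" unfolding linear_scale[OF T] by simp
 then show "R (r *\<^sub>R x) = r *\<^sub>R R x" by simp
qed

lemma T_diff: "norm (T x - T y) <= C * norm (x - y)" and R_diff: "norm (R u - R v) <= C * norm (u - v)"
 using T_le[of "x - y"] R_le[of "u - v"] by (simp_all add: linear_diff[OF T] linear_diff[OF R])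

lemma continuous_T: "continuous_on S T" and continuous_R: "continuous_on S' R"
 by (rule lipschitz_on_continuous_on[of C], use T_diff R_diff C in "auto intro!: lipschitz_onI simp: dist_norm")+

lemma borel_T [measurable]: "T : borel_measurable borel" and borel_R [measurable]: "R : borel_measurable borel"
 by (intro borel_measurable_continuous_onI continuous_T continuous_R)+

lemma borel_R_mu [measurable]: "R : measurable \<mu> borel" by (subst measurable_cong_sets[OF sets_mu refl]) (rule borel_R)

lemma integral_measurable:
 assumes "h : borel_measurable borel"
 shows "(\<integral>\<^sup>+x. h (R x) \<partial>\<mu>) = c * lint h"
proof -
 have "(\<integral>\<^sup>+x. h (R x) \<partial>\<mu>) = (\<integral>\<^sup>+x. h x \<partial>distr \<mu> borel R)" by (rule nn_integral_distr[symmetric]) (use assms in auto)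
 then show ?thesis unfolding mu using assms by (simp add: nn_integral_scale_measure)
qed

text \<open>The change of variables needs no measurability of \<open>f\<close>, since a bimeasurable bijection
 matches the simple functions below \<open>f\<close> with those below \<open>f \<circ> T\<close>.\<close>

lemma integral_chart: "(\<integral>\<^sup>+x. f x \<partial>\<mu>) = c * lint (%x. f (T x))"
proof (rule antisym)
 show "(\<integral>\<^sup>+x. f x \<partial>\<mu>) <= c * lint (%x. f (T x))"
  unfolding nn_integral_def[of \<mu>]
 proof (rule SUP_least)
  fix s assume "s : {s. simple_function \<mu> s & s <= f}"
  then have s: "simple_function \<mu> s" "s <= f" by auto
  have sm: "s : borel_measurable borel" using borel_measurable_simple_function[OF s(1)] by (simp add: measurable_cong_sets[OF sets_mu refl])
  have "integral\<^sup>S \<mu> s = (\<integral>\<^sup>+x. s (T (R x)) \<partial>\<mu>)" using nn_integral_eq_simple_integral[OF s(1)] by simp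
  also have "... = c * lint (%x. s (T x))" by (rule integral_measurable) (rule measurable_compose[OF borel_T sm])
  also have "... <= c * lint (%x. f (T x))" using s(2) by (intro mult_left_mono nn_integral_mono) (auto simp: le_fun_def)
  finally show "integral\<^sup>S \<mu> s <= c * lint (%x. f (T x))" .
 qed
 show "c * lint (%x. f (T x)) <= (\<integral>\<^sup>+x. f x \<partial>\<mu>)"
  unfolding nn_integral_def[of lborel "%x. f (T x)"] SUP_mult_left_ennreal
 proof (rule SUP_least)
  fix s assume "s : {s. simple_function lborel s & s <= (%x. f (T x))}"
  then have s: "simple_function lborel s" "s <= (%x. f (T x))" by auto
  have "c * integral\<^sup>S lborel s = c * lint s" by (simp add: nn_integral_eq_simple_integral[OF s(1)])
  also have "... = (\<integral>\<^sup>+x. s (R x) \<partial>\<mu>)"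
   using borel_measurable_simple_function[OF s(1)] by (intro integral_measurable[symmetric]) simp
  also have "... <= (\<integral>\<^sup>+x. f x \<partial>\<mu>)"
  proof (rule nn_integral_mono)
   fix x
   show "s (R x) <= f x" using le_funD[OF s(2), of "R x"] by simp
  qed
  finally show "c * integral\<^sup>S lborel s <= (\<integral>\<^sup>+x. f x \<partial>\<mu>)" .
 qed
qed

lemma set_integral_chart: "(\<integral>\<^sup>+x\<in>S. f x \<partial>\<mu>) = c * sint (T -` S) (%x. f (T x))"
 unfolding integral_chart[of "%x. f x * indicator S x"] by (simp add: indicator_def)

text \<open>Measurability is preserved in both directions, so non-measurable sets get 0 on both
  sides and the identity holds for every \<open>S\<close>.\<close>

lemma measure_chart: "measure \<mu> S = enn2real c * measure lborel (T -` S)"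
proof (cases "S : sets borel")
 case True
 then have v: "T -` S : sets borel" using measurable_sets[OF borel_T] by fastforce
 have "emeasure \<mu> S = (\<integral>\<^sup>+x. indicator S x \<partial>\<mu>)" using True by (simp add: sets_mu)
 also have "... = c * lint (%x. indicator (T -` S) x)" unfolding integral_chart by (simp add: indicator_def)
 also have "... = c * vol (T -` S)" using v by simp
 finally show ?thesis by (simp add: measure_def enn2real_mult)
next
 case False
 have "T -` S ~: sets borel"
 proof
  assume "T -` S : sets borel"
  then have "R -` (T -` S) : sets borel" using measurable_sets[OF borel_R] by fastforce
  moreover have "R -` (T -` S) = S" by auto
  ultimately show False using False by simp
 qed
 then show ?thesis using False by (simp add: measure_notin_sets sets_mu)
qed

lemma ball_chart: "ball x (r / C) \<subseteq> T -` ball (T x) r" "T -` ball (T x) r \<subseteq> ball x (C * r)"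
proof -
 show "ball x (r / C) \<subseteq> T -` ball (T x) r"
 proof
  fix y assume "y : ball x (r / C)"
  then have "C * norm (x - y) < r" using C by (simp add: dist_norm field_simps)
  then show "y : T -` ball (T x) r" using T_diff[of x y] by (simp add: dist_norm)
 qed
 show "T -` ball (T x) r \<subseteq> ball x (C * r)"
 proof
  fix y assume "y : T -` ball (T x) r"
  then have "C * norm (T x - T y) < C * r" using C by (simp add: dist_norm)
  then show "y : ball x (C * r)" using R_diff[of "T x" "T y"] by (simp add: dist_norm)
 qed
qed

text \<open>Preimages of balls are trapped between Euclidean balls whose radii have ratio
  \<open>C * C\<close>, so density quotients change by at most the corresponding volume ratio, with
  the radius rescaled by \<open>C\<close>.\<close>

lemma density_chart:
 assumes S[measurable]: "S : sets borel"
 shows "((%r. measure \<mu> (T ` S Int ball (T x) r) / measure \<mu> (ball (T x) r)) \<longlongrightarrow> 0) (at_right 0) \<longleftrightarrow> dens0 S x"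
proof -
 define q where "q r = measure lborel (S Int ball x r) / measure lborel (ball x r)" for r
 define k where "k r = measure lborel (S Int T -` ball (T x) r) / measure lborel (T -` ball (T x) r)" for r
 have TB[measurable]: "T -` ball (T x) r : sets borel" for r using measurable_sets[OF borel_T, of "ball (T x) r"] by simp
 have sub: "measure lborel A <= measure lborel B" if "A \<subseteq> B" "A : sets borel" "B : sets borel" "B \<subseteq> ball x r" for A B r
 proof -
  have "vol B <= vol (ball x r)" by (rule emeasure_mono[OF that(4)]) simp
  then have "vol B < \<infinity>" using emeasure_lborel_ball_finite[of x r] by (rule le_less_trans)
  then have "B : fmeasurable lborel" using that(3) by (intro fmeasurableI) simp_all
  then show ?thesis using that(1,2) by (intro measure_mono_fmeasurable) simp_all
 qed
 have sc: "measure lborel (ball x (s * r)) = s ^ DIM('e) * measure lborel (ball x r)" if "0 < r" "0 < s" for r s by (rule measure_ball_ratio[OF that])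
 have pos: "0 < measure lborel (ball x r)" if "0 < r" for r using that by (rule content_ball_pos)
 have C0: "0 < C" using C by simp
 have d1: "measure lborel (ball x (C * r)) = (C * C) ^ DIM('e) * measure lborel (ball x (r / C))" if "0 < r" for r
  using sc[of "r / C" "C * C"] that C0 by simp
 have kq: "k r <= (C * C) ^ DIM('e) * q (C * r)" if r: "0 < r" for r
 proof -
  have "k r <= measure lborel (S Int ball x (C * r)) / measure lborel (ball x (r / C))"
   unfolding k_def using r C0 pos[of "r / C"] ball_chart[of x r] by (intro frac_le sub[of _ _ "C * r"]) auto
  also have "... = (C * C) ^ DIM('e) * q (C * r)" using d1[OF r] C0 by (simp add: q_def)
  finally show ?thesis .
 qed
 have qk: "q r <= (C * C) ^ DIM('e) * k (C * r)" if r: "0 < r" for r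
 proof -
  have r': "0 < C * r" using r C0 by simp
  have b: "ball x r \<subseteq> T -` ball (T x) (C * r)" "T -` ball (T x) (C * r) \<subseteq> ball x (C * (C * r))"
   using ball_chart[of x "C * r"] C0 by auto
  have "q r <= measure lborel (S Int T -` ball (T x) (C * r)) / measure lborel (ball x r)"
   unfolding q_def using b by (intro divide_right_mono sub[of _ _ "C * (C * r)"]) auto
  also have "... = (C * C) ^ DIM('e) * (measure lborel (S Int T -` ball (T x) (C * r)) / measure lborel (ball x (C * (C * r))))"
   using d1[OF r'] C0 by simp
  also have "... <= (C * C) ^ DIM('e) * k (C * r)"
   unfolding k_def using b C0 r less_le_trans[OF pos[OF r] sub[OF b(1) _ _ b(2)]] by (intro mult_left_mono frac_le sub[of _ _ "C * (C * r)"]) auto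
  finally show ?thesis .
 qed
 have tr: "(f \<longlongrightarrow> 0) (at_right 0)" if g: "(g \<longlongrightarrow> 0) (at_right 0)" and le: "!!r. 0 < r ==> f r <= (C * C) ^ DIM('e) * g (C * r)" "!!r. 0 <= f r" for f g :: "real => real"
 proof (rule tendsto_sandwich[OF _ _ tendsto_const])
  have "filterlim (%r. C * r) (at_right 0) (at_right 0)"
   unfolding filterlim_at using C0 eventually_at_right_less[of "0::real"] by (auto intro!: tendsto_eq_intros elim: eventually_mono)
  from tendsto_mult[OF tendsto_const filterlim_compose[OF g this]]
  show "((%r. (C * C) ^ DIM('e) * g (C * r)) \<longlongrightarrow> 0) (at_right 0)" by simp
  show "\<forall>\<^sub>F r in at_right 0. f r <= (C * C) ^ DIM('e) * g (C * r)" using eventually_at_right_less[of 0] by eventually_elim (rule le)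
 qed (use le in auto)
 have "(k \<longlongrightarrow> 0) (at_right 0) \<longleftrightarrow> (q \<longlongrightarrow> 0) (at_right 0)"
   proof
  show "(q \<longlongrightarrow> 0) (at_right 0)" if "(k \<longlongrightarrow> 0) (at_right 0)"
   by (rule tr[OF that, of q]) (use qk in "auto simp: q_def")
  show "(k \<longlongrightarrow> 0) (at_right 0)" if "(q \<longlongrightarrow> 0) (at_right 0)"
   by (rule tr[OF that, of k]) (use kq in "auto simp: k_def")
 qed
 moreover have "measure \<mu> (T ` S Int ball (T x) r) / measure \<mu> (ball (T x) r) = k r" for r
 proof -
  have "T -` (T ` S Int ball (T x) r) = S Int T -` ball (T x) r" by (auto simp: image_iff) (metis RT)
  moreover have "0 < enn2real c" using c by (simp add: enn2real_positive_iff less_top[symmetric])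
  ultimately show ?thesis by (simp add: measure_chart k_def)
 qed
 ultimately show ?thesis by (simp add: dens0_def q_def[abs_def])
qed

end

interpretation vt: orbit_space permute_maps "vtuple :: (real ^ 'n) ^ 'q => (real ^ 'n, 'q::finite) utuple" by (rule orbit_space_vtuple)

lemma ennreal_tendsto_0_iff: "(X \<longlongrightarrow> (0::ennreal)) F \<longleftrightarrow> (\<forall>e>0::real. \<forall>\<^sub>F x in F. X x < ennreal e)"
proof (intro iffI allI impI)
 fix e :: real assume "(X \<longlongrightarrow> 0) F" "0 < e"
 then show "\<forall>\<^sub>F x in F. X x < ennreal e" by (intro order_tendstoD) auto
next
 assume *: "\<forall>e>0::real. \<forall>\<^sub>F x in F. X x < ennreal e"
 show "(X \<longlongrightarrow> 0) F"
 proof (rule order_tendstoI)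
  fix a :: ennreal assume "0 < a"
  then obtain e :: real where e: "0 < e" "ennreal e <= a"
  proof (cases a)
   case (real r)
   then show ?thesis using that[of r] \<open>0 < a\<close> by simp
  qed (use that[of 1] in simp)
  show "\<forall>\<^sub>F x in F. X x < a" using *[rule_format, OF e(1)] by eventually_elim (use e(2) in simp)
 qed simp
qed

text \<open>Trades the root and the convention for infinite integrals in \<open>dp\<close> for the
  plain integral.\<close>

lemma dp_tendsto_0_iff:
 assumes p: "0 < p"
 shows "((%j. dp \<mu> p U f (F j)) \<longlonglongrightarrow> 0) \<longleftrightarrow> ((%j. \<integral>\<^sup>+x\<in>U. ennreal (dist (f x) (F j x) powr p) \<partial>\<mu>) \<longlonglongrightarrow> 0)"
proof -
 define I where "I j = (\<integral>\<^sup>+x\<in>U. ennreal (dist (f x) (F j x) powr p) \<partial>\<mu>)" for j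
 have d: "dp \<mu> p U f (F j) < ennreal e \<longleftrightarrow> I j < ennreal (e powr p)" if e: "0 < e" for j e
 proof (cases "I j")
  case (real s)
  have pw: "(s powr (1 / p)) powr p = s" "(e powr p) powr (1 / p) = e" using p e real by (auto simp: powr_powr)
  have "s powr (1 / p) < e \<longleftrightarrow> s < e powr p"
   using powr_less_mono2[of p "s powr (1 / p)" e] powr_less_mono2[of "1 / p" s "e powr p"] p real pw by auto
  then show ?thesis using real by (simp add: dp_def I_def[symmetric] Let_def ennreal_less_iff)
 qed (simp add: dp_def I_def[symmetric] Let_def)
 have "(\<forall>e>0. \<forall>\<^sub>F j in sequentially. I j < ennreal (e powr p)) \<longleftrightarrow> (\<forall>e>0. \<forall>\<^sub>F j in sequentially. I j < ennreal e)"
 proof (intro iffI allI impI)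
  fix e :: real assume *: "\<forall>e>0. \<forall>\<^sub>F j in sequentially. I j < ennreal (e powr p)" and e: "0 < e"
  have "(e powr (1 / p)) powr p = e" using e p by (simp add: powr_powr)
  then show "\<forall>\<^sub>F j in sequentially. I j < ennreal e" using *[rule_format, of "e powr (1 / p)"] e by simp
 qed auto
 then show ?thesis using d by (simp add: ennreal_tendsto_0_iff I_def[symmetric] cong: imp_cong)
qed

locale basis_chart = chart T R C \<mu> c
 for T :: "'e::euclidean_space => 'a::real_normed_vector" and R C \<mu> c +
 fixes B :: "'a set" assumes B: "bij_betw T Basis B"
begin

lemma vimage_open: "open U ==> open (T -` U)" using continuous_T[of UNIV] by (simp add: continuous_on_open_vimage)

lemma borel_on_chart:
 fixes f :: "'a => 'z::topological_space"
 assumes f: "f : borel_measurable (restrict_space borel U)"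
 shows "(%x. f (T x)) : borel_measurable (restrict_space borel (T -` U))"
 by (rule measurable_compose[OF measurable_restrict_space3[OF borel_T] f]) auto

text \<open>The two norms are comparable up to \<open>C\<close>, so the exceptional sets for
  \<epsilon> in one norm lie in those for \<epsilon> / C in the other; quantification over all
  \<epsilon> hides the difference.\<close>

lemma approx_chart:
 fixes f :: "'a => (real ^ 'n, 'q::finite) utuple"
 assumes U: "open U" and f: "f : borel_measurable (restrict_space borel U)" and L: "linear L"
  and A: "!!z. (\<chi> i. A i (T z)) = k + L (z - x)"
 shows "(\<forall>\<epsilon>>0. ((%r. measure \<mu> ({y : U. dist (f y) (utuple (%i. A i y)) > \<epsilon> * norm (y - T x)} Int ball (T x) r)
      / measure \<mu> (ball (T x) r)) \<longlongrightarrow> 0) (at_right 0))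
  \<longleftrightarrow> vt.adiff (T -` U) (%x. f (T x)) x k L"
proof -
 note U' = vimage_open[OF U] and f' = borel_on_chart[OF f]
 define S where "S \<epsilon> = {z : T -` U. \<epsilon> * norm (z - x) < dist (f (T z)) (vtuple (k + L (z - x)))}" for \<epsilon>
 define S' where "S' \<epsilon> = {z : T -` U. \<epsilon> * norm (T z - T x) < dist (f (T z)) (vtuple (k + L (z - x)))}" for \<epsilon>
 have S: "S \<epsilon> : sets borel" for \<epsilon> unfolding S_def by (rule vt.adiff_set_borel[OF U' f' L])
 have S': "S' \<epsilon> : sets borel" for \<epsilon>
  unfolding S'_def
 proof (rule vt.dist_greater_measurable[OF _ f'])
  have "continuous_on UNIV (vtuple :: (real ^ 'n) ^ 'q => (real ^ 'n, 'q::finite) utuple)"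
   by (rule lipschitz_on_continuous_on[of 1]) (use vt.dist_pi_le in "auto intro!: lipschitz_onI simp: dist_norm")
  then have "continuous_on UNIV (%z. vtuple (k + L (z - x)))" using continuous_on_compose2[OF _ vt.continuous_affine[OF L]] by blast
  then show "(%z. vtuple (k + L (z - x))) : borel_measurable (restrict_space borel (T -` U))"
   by (intro measurable_restrict_space1 borel_measurable_continuous_onI)
  show "T -` U : sets borel" using U' by simp
  have "continuous_on UNIV (%z. \<epsilon> * norm (T z - T x))" by (intro continuous_intros continuous_T)
  then show "(%z. \<epsilon> * norm (T z - T x)) : borel_measurable borel" by (rule borel_measurable_continuous_onI)
 qed
 have set: "{y : U. dist (f y) (utuple (%i. A i y)) > \<epsilon> * norm (y - T x)} = T ` S' \<epsilon>" for \<epsilon>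
 proof -
  have v: "vtuple (k + L (z - x)) = utuple (%i. A i (T z))" for z by (simp add: A[symmetric] vtuple_def)
  show ?thesis
  proof (intro equalityI subsetI)
   fix y assume y: "y : {y : U. dist (f y) (utuple (%i. A i y)) > \<epsilon> * norm (y - T x)}"
   then have "R y : S' \<epsilon>" by (simp add: S'_def v)
   then show "y : T ` S' \<epsilon>" by (rule rev_image_eqI) simp
  qed (auto simp: S'_def v)
 qed
 have "(\<forall>\<epsilon>>0. dens0 (S' \<epsilon>) x) \<longleftrightarrow> (\<forall>\<epsilon>>0. dens0 (S \<epsilon>) x)"
 proof (intro iffI allI impI)
  fix \<epsilon> :: real assume *: "\<forall>\<epsilon>>0. dens0 (S' \<epsilon>) x" and \<epsilon>: "0 < \<epsilon>"
  have "\<epsilon> / C * norm (T z - T x) <= \<epsilon> * norm (z - x)" for z using T_diff[of z x] C \<epsilon> by (simp add: field_simps)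
  then have sub: "S \<epsilon> \<subseteq> S' (\<epsilon> / C)" unfolding S_def S'_def by (auto intro: le_less_trans)
  have "dens0 (S' (\<epsilon> / C)) x" using * \<epsilon> C by simp
  then show "dens0 (S \<epsilon>) x" by (rule dens0_mono[OF _ sub S'])
 next
  fix \<epsilon> :: real assume *: "\<forall>\<epsilon>>0. dens0 (S \<epsilon>) x" and \<epsilon>: "0 < \<epsilon>"
  have "\<epsilon> / C * norm (z - x) <= \<epsilon> * norm (T z - T x)" for z using R_diff[of "T z" "T x"] C \<epsilon> by (simp add: field_simps)
  then have sub: "S' \<epsilon> \<subseteq> S (\<epsilon> / C)" unfolding S_def S'_def by (auto intro: le_less_trans)
  have "dens0 (S (\<epsilon> / C)) x" using * \<epsilon> C by simp
  then show "dens0 (S' \<epsilon>) x" by (rule dens0_mono[OF _ sub S])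
 qed
 then show ?thesis unfolding set density_chart[OF S'] using L by (simp add: vt.adiff_def S_def)
qed

lemma approx_to_adiff:
 fixes f :: "'a => (real ^ 'n, 'q::finite) utuple"
 assumes U: "open U" and ap: "approx_differential \<mu> U f (T x) A"
 shows "vt.adiff (T -` U) (%x. f (T x)) x (\<chi> i. A i (T x)) (%z. \<chi> i. A i (T z) - A i 0)"
proof -
 have f: "f : borel_measurable (restrict_space borel U)" and aff: "!!i. linear (%y. A i y - A i 0)"
  using ap by (auto simp: approx_differential_def affine_map_def)
 have lin: "linear (%z. \<chi> i. A i (T z) - A i 0)"
 proof (rule linearI)
  show "(\<chi> i. A i (T (u + v)) - A i 0) = (\<chi> i. A i (T u) - A i 0) + (\<chi> i. A i (T v) - A i 0)" for u v
   using linear_add[OF aff] by (simp add: vec_eq_iff linear_add[OF T])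
  show "(\<chi> i. A i (T (r *\<^sub>R u)) - A i 0) = r *\<^sub>R (\<chi> i. A i (T u) - A i 0)" for r u
   using linear_scale[OF aff] by (simp add: vec_eq_iff linear_scale[OF T])
 qed
 have "(\<chi> i. A i (T z)) = (\<chi> i. A i (T x)) + (\<chi> i. A i (T (z - x)) - A i 0)" for z
  using linear_diff[OF aff] by (simp add: vec_eq_iff linear_diff[OF T])
 from approx_chart[OF U f lin this] ap show ?thesis by (simp add: approx_differential_def)
qed

lemma adiff_to_approx:
 fixes f :: "'a => (real ^ 'n, 'q::finite) utuple"
 assumes U: "open U" "T x : U" and f: "f : borel_measurable (restrict_space borel U)"
  and ad: "vt.adiff (T -` U) (%x. f (T x)) x k L"
 shows "approx_differential \<mu> U f (T x) (%i y. (k + L (R y - x)) $ i)"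
proof -
 have L: "linear L" using ad by (simp add: vt.adiff_def)
 have "affine_map (%y. (k + L (R y - x)) $ i)" for i
 proof -
  have "(k + L (R y - x)) $ i - (k + L (R 0 - x)) $ i = L (R y) $ i" for y unfolding linear_diff[OF L] linear_0[OF R] linear_0[OF L] by simp
  moreover have "linear (%y. L (R y) $ i)" by (rule linearI) (simp_all add: linear_add[OF R] linear_add[OF L] linear_scale[OF R] linear_scale[OF L])
  ultimately show ?thesis by (simp add: affine_map_def)
 qed
 moreover have "(\<chi> i. (k + L (R (T z) - x)) $ i) = k + L (z - x)" for z by (simp add: vec_eq_iff)
 from approx_chart[OF U(1) f L this] ad
 have "\<forall>\<epsilon>>0. ((%r. measure \<mu> ({y : U. dist (f y) (utuple (%i. (k + L (R y - x)) $ i)) > \<epsilon> * norm (y - T x)} Int ball (T x) r)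
      / measure \<mu> (ball (T x) r)) \<longlongrightarrow> 0) (at_right 0)" by simp
 ultimately show ?thesis using f U by (simp add: approx_differential_def)
qed

text \<open>The differential chosen in \<open>Df_norm\<close> is arbitrary, so the hypothesis asks
  that all of them give the same value.\<close>

lemma Df_norm_chart:
 fixes f :: "'a => (real ^ 'n, 'q::finite) utuple"
 assumes U: "open U" "T x : U" and f: "f : borel_measurable (restrict_space borel U)"
  and ex: "EX k L. vt.adiff (T -` U) (%x. f (T x)) x k L"
  and eq: "!!k L. vt.adiff (T -` U) (%x. f (T x)) x k L ==> sqrt (SUM b:Basis. (norm (L b))\<^sup>2) = e"
 shows "Df_norm \<mu> B U f (T x) = e"
proof -
 have ex': "EX A. approx_differential \<mu> U f (T x) A" using ex adiff_to_approx[OF U f] by blast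
 define A where "A = (SOME A. approx_differential \<mu> U f (T x) A)"
 have "approx_differential \<mu> U f (T x) A" unfolding A_def by (rule someI_ex[OF ex'])
 from eq[OF approx_to_adiff[OF U(1) this]]
 have e: "sqrt (SUM b:Basis. (norm (\<chi> i. A i (T b) - A i 0))\<^sup>2) = e" .
 have "(SUM i:UNIV. (tri_norm B (%x. A i x - A i 0))\<^sup>2) = (SUM i:UNIV. SUM u:B. (norm (A i u - A i 0))\<^sup>2)"
  by (simp add: tri_norm_def sum_nonneg)
 also have "... = (SUM i:UNIV. SUM b:Basis. (norm (A i (T b) - A i 0))\<^sup>2)" by (simp add: sum.reindex_bij_betw[OF B, symmetric])
 also have "... = (SUM b:Basis. (norm (\<chi> i. A i (T b) - A i 0))\<^sup>2)" by (subst sum.swap) (simp add: norm_vec_def L2_set_def sum_nonneg)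
 finally show ?thesis using e ex' by (simp add: Df_norm_def A_def[symmetric] Let_def)
qed

text \<open>The domain \<open>U\<close> of differentiation and the domain \<open>W\<close> of
  integration are separate: the Sobolev class differentiates maps on the whole space and integrates
  over the domain, the energy differentiates on the domain and integrates over
  \<open>V\<close>.\<close>

lemma Df_integral_lipschitz:
 fixes f :: "'a => (real ^ 'n, 'q::finite) utuple"
 assumes U: "open U" "W \<subseteq> U" and G: "lipmap G K" "!!x. T x : U ==> f (T x) = G x"
 shows "Df_integral \<mu> B p U f W = c * pint p (T -` W) (%x. norm (mgrad G x))"
proof -
 interpret G: lipmap G K by (rule G)
 have "continuous_on UNIV (%y. G (R y))" by (rule continuous_on_compose2[OF G.continuous_F[of UNIV] continuous_R]) auto
 then have "(%y. G (R y)) : borel_measurable (restrict_space borel U)" by (intro measurable_restrict_space1 borel_measurable_continuous_onI)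
 moreover have "f y = G (R y)" if "y : U" for y using G(2)[of "R y"] that by simp
 ultimately have f: "f : borel_measurable (restrict_space borel U)"
  by (subst measurable_cong[where g = "%y. G (R y)"]) (auto simp: space_restrict_space)
 note U' = vimage_open[OF U(1)] and f' = borel_on_chart[OF f]
 have "AE x in lborel. x : T -` U --> (EX k L. vt.adiff (T -` U) (%x. f (T x)) x k L) &
  (ALL k L v. vt.adiff (T -` U) (%x. f (T x)) x k L --> norm (L v) = mslope G v x)"
  by (rule vt.adiff_AE[OF _ _ U' f' _ G.F_lip G.C0]) (use U' G in auto)
 then have "AE x in lborel. ennreal (Df_norm \<mu> B U f (T x) powr p) * indicator (T -` W) x = ennreal (norm (mgrad G x) powr p) * indicator (T -` W) x"
 proof eventually_elim
  case (elim x)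
  show ?case
  proof (cases "x : T -` W")
   case True
   then have x: "T x : U" using U(2) by auto
   have "Df_norm \<mu> B U f (T x) = norm (mgrad G x)" by (rule Df_norm_chart[OF U(1) x f]) (use elim x in "auto simp: norm_mgrad")
   then show ?thesis by simp
  qed simp
 qed
 then show ?thesis unfolding Df_integral_def set_integral_chart by (simp add: nn_integral_cong_AE)
qed

end

section \<open>Both inequalities in the chart\<close>

context basis_chart
begin

text \<open>Competitors for the energy are Lipschitz on \<open>U\<close> only; the retraction
  property extends them so that results for globally Lipschitz maps apply.\<close>

lemma lipschitz_chart:
 fixes f :: "'a => (real ^ 'n, 'q::finite) utuple"
 assumes "lipschitz_map W f"
 shows "EX G. lipmap (fst G) (snd G) & (ALL x. T x : W --> f (T x) = fst G x)"
proof -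
 obtain K where K: "K-lipschitz_on W f" using assms by (auto simp: lipschitz_map_def)
 have "dist (f (T x)) (f (T y)) <= K * C * norm (x - y)" if "x : T -` W" "y : T -` W" for x y
 proof -
  have "dist (f (T x)) (f (T y)) <= K * norm (T x - T y)" using lipschitz_onD[OF K] that by (simp add: dist_norm)
  also have "... <= K * (C * norm (x - y))" using T_diff lipschitz_on_nonneg[OF K] by (intro mult_left_mono)
  finally show ?thesis by (simp add: mult.assoc)
 qed
 then show ?thesis
 proof (rule vt.lip_extension_on)
  fix G L assume "lipmap G L" "!!x. x : T -` W ==> G x = f (T x)"
  then show ?thesis by (intro exI[of _ "(G, L)"]) simp
 qed
qed

definition c' :: real where "c' = enn2real c"

lemma c': "0 < c'" "ennreal c' = c" using c by (auto simp: c'_def enn2real_positive_iff less_top)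

lemma inverse_c_mult: "ennreal (1 / c') * c = 1"
proof -
 have "ennreal (1 / c') * ennreal c' = ennreal (1 / c' * c')" using c'(1) by (intro ennreal_mult[symmetric]) auto
 then show ?thesis using c'(1) by (simp add: c'(2))
qed

lemma inverse_c: "X = ennreal (1 / c') * (c * X)" by (simp only: mult.assoc[symmetric] inverse_c_mult mult_1_left)

lemma le_inverse_c: "c * X <= ennreal t ==> 0 <= t ==> X <= ennreal (t / c')"
 using mult_left_mono[of "c * X" "ennreal t" "ennreal (1 / c')"] c'(1) by (simp add: inverse_c[symmetric] ennreal_mult[symmetric])

lemma dp_chart:
 assumes p: "0 < p" and G: "!!j x. T x : U ==> F j (T x) = G j x"
 shows "((%j. dp \<mu> p U g (F j)) \<longlonglongrightarrow> 0) \<longleftrightarrow> ((%j. pint p (T -` U) (%x. dist (G j x) (g (T x)))) \<longlonglongrightarrow> 0)"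
proof -
 have eq: "(\<integral>\<^sup>+x\<in>U. ennreal (dist (g x) (F j x) powr p) \<partial>\<mu>) = c * pint p (T -` U) (%x. dist (G j x) (g (T x)))" for j
  unfolding set_integral_chart by (intro arg_cong[of _ _ "(*) c"] nn_integral_cong) (simp add: G dist_commute indicator_def)
 have "((%j. c * X j) \<longlonglongrightarrow> 0) \<longleftrightarrow> (X \<longlonglongrightarrow> 0)" for X :: "nat => ennreal"
 proof
  assume "(%j. c * X j) \<longlonglongrightarrow> 0"
  then have "(%j. ennreal (1 / c') * (c * X j)) \<longlonglongrightarrow> ennreal (1 / c') * 0" by (intro ennreal_tendsto_cmult) simp_all
  then show "X \<longlonglongrightarrow> 0" by (simp add: inverse_c[symmetric])
 next
  assume "X \<longlonglongrightarrow> 0"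
  then have "(%j. c * X j) \<longlonglongrightarrow> c * 0" using c by (intro ennreal_tendsto_cmult) simp_all
  then show "(%j. c * X j) \<longlonglongrightarrow> 0" by simp
 qed
 then show ?thesis by (simp add: dp_tendsto_0_iff[OF p] eq)
qed

text \<open>Both sides acquire the same factor \<open>c\<close> from the measure, and in the chart
  they reduce to the integral of \<open>slope\<close>: \<open>slope_lsc\<close> bounds it by the
  lower limit of every competitor, \<open>slope_recovery\<close> builds a competitor that attains
  it.\<close>

theorem p_energy_eq:
 fixes g :: "'a => (real ^ 'n, 'q::finite) utuple"
 assumes U: "open U" and p: "1 < p" and g: "g : W1p \<mu> B p U" and V: "open V" "V \<subseteq> U"
 shows "p_energy \<mu> B p U g V = (\<integral>\<^sup>+x\<in>V. ennreal (Df_norm \<mu> B U g x powr p) \<partial>\<mu>)"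
proof -
 have p0: "0 < p" using p by simp
 note U' = vimage_open[OF U] and V' = vimage_open[OF V(1)]
 have VU: "T -` V \<subseteq> T -` U" using V(2) by auto
 have gb: "g : borel_measurable (restrict_space borel U)" using g by (simp add: W1p_def Lp_Q_def)
 note g' = borel_on_chart[OF gb]
 obtain F :: "nat => 'a => (real ^ 'n, 'q) utuple" where F: "!!j. lipschitz_map UNIV (F j)"
  "(SUP j. Df_integral \<mu> B p UNIV (F j) U) < \<infinity>" "(%j. dp \<mu> p U g (F j)) \<longlonglongrightarrow> 0" using g by (auto simp: W1p_def)
 from choice[OF allI, OF lipschitz_chart[OF F(1)]]
 obtain G :: "nat => ('e => (real ^ 'n, 'q) utuple) \<times> real"
  where G0: "ALL j. lipmap (fst (G j)) (snd (G j)) & (ALL x. T x : UNIV --> F j (T x) = fst (G j) x)" ..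
 then have G: "lipmap (fst (G j)) (snd (G j))" "F j (T x) = fst (G j) x" for j x by auto
 have lim: "(%j. pint p (T -` U) (%x. dist (fst (G j) x) (g (T x)))) \<longlonglongrightarrow> 0"
  using F(3) by (subst (asm) dp_chart[where G = "%j. fst (G j)"]) (use p0 G in auto)
 have bound: "pint p (T -` U) (%x. norm (mgrad (fst (G j)) x))
   <= ennreal (enn2real (SUP j. Df_integral \<mu> B p UNIV (F j) U) / c')" for j
 proof (rule le_inverse_c)
  have "c * pint p (T -` U) (%x. norm (mgrad (fst (G j)) x)) = Df_integral \<mu> B p UNIV (F j) U"
   using G by (intro Df_integral_lipschitz[symmetric]) auto
  also have "... <= (SUP j. Df_integral \<mu> B p UNIV (F j) U)" by (rule SUP_upper) simp
  finally show "c * pint p (T -` U) (%x. norm (mgrad (fst (G j)) x))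
    <= ennreal (enn2real (SUP j. Df_integral \<mu> B p UNIV (F j) U))" using F(2) by simp
 qed simp
 obtain N \<xi> \<rho> \<kappa> w a K H CT where "orbit_sobolev permute_maps vtuple (T -` U) p (%x. g (T x)) N \<xi> \<rho> \<kappa> w a K H CT"
  using vt.orbit_sobolev_exists[OF U' p g' G(1) lim bound] by (elim exE)
 then interpret S: orbit_sobolev permute_maps vtuple "T -` U" p "%x. g (T x)" N \<xi> \<rho> \<kappa> w a K H CT .
 define I where "I = sint (T -` V) (%x. ennreal (S.slope x powr p))"
 have rhs: "(\<integral>\<^sup>+x\<in>V. ennreal (Df_norm \<mu> B U g x powr p) \<partial>\<mu>) = c * I"
 proof -
  have "AE x in lborel. ennreal (Df_norm \<mu> B U g (T x) powr p) * indicator (T -` V) x = ennreal (S.slope x powr p) * indicator (T -` V) x"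
   using S.slope_adiff
  proof eventually_elim
   case (elim x)
   show ?case
   proof (cases "x : T -` V")
    case True
    then have x: "T x : U" using V(2) by auto
    have "Df_norm \<mu> B U g (T x) = S.slope x" by (rule Df_norm_chart[OF U x gb]) (use elim x in auto)
    then show ?thesis by simp
   qed simp
  qed
  then show ?thesis unfolding set_integral_chart I_def by (simp add: nn_integral_cong_AE)
 qed
 have "c * I <= p_energy \<mu> B p U g V"
  unfolding p_energy_def
 proof (rule Inf_greatest, elim CollectE exE conjE)
  fix z and F :: "nat => 'a => (real ^ 'n, 'q) utuple"
  assume z: "z = liminf (%j. Df_integral \<mu> B p U (F j) V)" and F: "ALL j. lipschitz_map U (F j)" and d: "(%j. dp \<mu> p U g (F j)) \<longlonglongrightarrow> 0"
  from choice[OF allI, OF lipschitz_chart[OF F[rule_format]]]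
  obtain G :: "nat => ('e => (real ^ 'n, 'q) utuple) \<times> real"
   where "ALL j. lipmap (fst (G j)) (snd (G j)) & (ALL x. T x : U --> F j (T x) = fst (G j) x)" ..
  then have G: "lipmap (fst (G j)) (snd (G j))" "T x : U ==> F j (T x) = fst (G j) x" for j x by auto
  have lim: "(%j. pint p (T -` U) (%x. dist (fst (G j) x) (g (T x)))) \<longlonglongrightarrow> 0"
   using d by (subst (asm) dp_chart[where G = "%j. fst (G j)"]) (use p0 G in auto)
  have Df: "Df_integral \<mu> B p U (F j) V = c * pint p (T -` V) (%x. norm (mgrad (fst (G j)) x))" for j by (rule Df_integral_lipschitz[OF U V(2) G])
  show "c * I <= z"
  proof (rule ccontr)
   assume "~ c * I <= z"
   \<comment> \<open>A finite level strictly between the two sides: a lower limit below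
     \<open>t\<close> means that the energy falls below \<open>t\<close> infinitely often, which is
     the hypothesis of \<open>slope_lsc\<close>.\<close>
   then obtain t where t: "z < t" "t < c * I" using dense[of z "c * I"] by (auto simp: not_le)
   obtain t' where t': "t = ennreal t'" "0 <= t'" using t(2) by (cases t) auto
   have "~ (\<forall>\<^sub>F j in sequentially. t <= Df_integral \<mu> B p U (F j) V)"
   proof
    assume "\<forall>\<^sub>F j in sequentially. t <= Df_integral \<mu> B p U (F j) V"
    then have "t <= z" unfolding z by (rule Liminf_bounded)
    then show False using t(1) by simp
   qed
   then have "\<exists>\<^sub>F j in sequentially. ~ t <= Df_integral \<mu> B p U (F j) V" by (simp add: frequently_def)
   then have fr: "\<exists>\<^sub>F j in sequentially. (pint p (T -` V) (%x. norm (mgrad (fst (G j)) x))) <= ennreal (t' / c')"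
    by (rule frequently_elim1) (use t' in "auto simp: Df not_le intro!: le_inverse_c")
   have tc: "0 <= t' / c'" using t'(2) c'(1) by simp
   have "I <= ennreal (t' / c')" unfolding I_def by (rule S.slope_lsc[OF V' VU G(1) lim fr tc])
   then have "c * I <= c * ennreal (t' / c')" by (rule mult_left_mono) simp
   also have "ennreal (t' / c') = ennreal (1 / c') * ennreal t'" using t' c'(1) by (simp add: ennreal_mult[symmetric])
   also have "c * ... = t" unfolding t'(1) by (metis inverse_c mult.left_commute)
   finally show False using t(2) by simp
  qed
 qed
 moreover have "p_energy \<mu> B p U g V <= c * I"
 proof -
  have "EX F. lipmap (fst F) (snd F) & (pint p (T -` U) (%x. dist (fst F x) (g (T x)))) <= ennreal (1 / real (Suc n)) &
    (pint p (T -` V) (%x. norm (mgrad (fst F) x))) <= I + ennreal (1 / real (Suc n))" for n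
  proof (rule S.slope_recovery[of "1 / real (Suc n)"])
   fix F L
   assume F: "lipmap F L" "pint p (T -` U) (%x. dist (F x) (g (T x))) <= ennreal (1 / real (Suc n))"
    and W: "!!W. W : sets borel ==> W \<subseteq> T -` U ==> pint p W (%x. norm (mgrad F x))
     <= sint W (%x. ennreal (S.slope x powr p)) + ennreal (1 / real (Suc n))"
   show ?thesis using F W[OF _ VU] V' by (intro exI[of _ "(F, L)"]) (simp add: I_def del: of_nat_Suc)
  qed simp
  from choice[OF allI, OF this] obtain F :: "nat => ('e => (real ^ 'n, 'q) utuple) \<times> real"
   where "ALL n. lipmap (fst (F n)) (snd (F n)) & (pint p (T -` U) (%x. dist (fst (F n) x) (g (T x)))) <= ennreal (1 / real (Suc n)) &
    (pint p (T -` V) (%x. norm (mgrad (fst (F n)) x))) <= I + ennreal (1 / real (Suc n))" ..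
  then have F: "lipmap (fst (F n)) (snd (F n))" "pint p (T -` U) (%x. dist (fst (F n) x) (g (T x))) <= ennreal (1 / real (Suc n))"
    "pint p (T -` V) (%x. norm (mgrad (fst (F n)) x)) <= I + ennreal (1 / real (Suc n))" for n by blast+
  define f where "f n = (%y. fst (F n) (R y))" for n
  have fT: "f n (T x) = fst (F n) x" for n x by (simp add: f_def)
  have "(%n. 1 / real (Suc n)) \<longlonglongrightarrow> 0" using LIMSEQ_inverse_real_of_nat by (simp add: inverse_eq_divide)
  then have "(%n. ennreal (1 / real (Suc n))) \<longlonglongrightarrow> ennreal 0" by (rule tendsto_ennrealI)
  then have z: "(%n. ennreal (1 / real (Suc n))) \<longlonglongrightarrow> 0" by simp
  have lf: "lipschitz_map U (f n)" for n
  proof -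
   interpret lipmap "fst (F n)" "snd (F n)" by (rule F)
   have "(snd (F n) * C)-lipschitz_on U (f n)"
   proof (rule lipschitz_onI)
    fix u v
    have "dist (f n u) (f n v) <= snd (F n) * norm (R u - R v)" unfolding f_def by (rule F_lip)
    also have "... <= snd (F n) * (C * norm (u - v))" using R_diff C0 by (intro mult_left_mono)
    finally show "dist (f n u) (f n v) <= snd (F n) * C * dist u v" by (simp add: dist_norm mult.assoc)
   qed (use C0 C in simp)
   then show ?thesis by (auto simp: lipschitz_map_def)
  qed
  have df: "(%n. dp \<mu> p U g (f n)) \<longlonglongrightarrow> 0"
   unfolding dp_chart[where F = f and G = "%n. fst (F n)", OF p0 fT] by (rule tendsto_sandwich[OF _ _ tendsto_const z]) (use F(2) in auto)
  have "p_energy \<mu> B p U g V <= liminf (%n. Df_integral \<mu> B p U (f n) V)" unfolding p_energy_def by (rule Inf_lower) (use lf df in blast)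
  also have "... <= liminf (%n. c * (I + ennreal (1 / real (Suc n))))"
  proof (intro Liminf_mono always_eventually allI)
   fix n
   have "Df_integral \<mu> B p U (f n) V = c * pint p (T -` V) (%x. norm (mgrad (fst (F n)) x))" by (rule Df_integral_lipschitz[OF U V(2) F(1) fT])
   also have "... <= c * (I + ennreal (1 / real (Suc n)))" by (rule mult_left_mono[OF F(3)]) simp
   finally show "Df_integral \<mu> B p U (f n) V <= c * (I + ennreal (1 / real (Suc n)))" .
  qed
  also have "... = c * I"
  proof (rule lim_imp_Liminf)
   have "(%n. I + ennreal (1 / real (Suc n))) \<longlonglongrightarrow> I + 0" by (intro tendsto_add tendsto_const z)
   then show "(%n. c * (I + ennreal (1 / real (Suc n)))) \<longlonglongrightarrow> c * I" using c by (intro ennreal_tendsto_cmult) simp_all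
  qed simp
  finally show ?thesis .
 qed
 ultimately show ?thesis unfolding rhs by (rule antisym[rotated])
qed

end

text \<open>In dimension 0 the model \<open>real ^ 'a basis_index\<close> would have positive
  dimension, so this case is separate: the space is a point, all differentials vanish, and
  \<open>g\<close> is its own Lipschitz approximation.\<close>

lemma p_energy_trivial:
 fixes g :: "'a::real_normed_vector => ('y::real_normed_vector, 'q::finite) utuple"
 assumes B: "finite_basis ({} :: 'a set)" and p: "0 < p"
 shows "p_energy \<mu> {} p U g V = (\<integral>\<^sup>+x\<in>V. ennreal (Df_norm \<mu> {} U g x powr p) \<partial>\<mu>)"
proof -
 have x: "x = y" for x y :: 'a using B by (simp add: finite_basis_def) (metis UNIV_I singletonD)
 have Df: "Df_norm \<mu> {} U f x = 0" for f :: "'a => ('y, 'q) utuple" and x by (simp add: Df_norm_def tri_norm_def Let_def)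
 have "0-lipschitz_on U g" 
 proof (rule lipschitz_onI)
  show "dist (g u) (g v) <= 0 * dist u v" for u v using x[of u v] by simp
 qed simp
 moreover have "dp \<mu> p U g g = 0" using p by (simp add: dp_def)
 ultimately have "p_energy \<mu> {} p U g V <= liminf (%j::nat. Df_integral \<mu> {} p U g V)"
  unfolding p_energy_def by (intro Inf_lower CollectI exI[of _ "%_. g"]) (auto simp: lipschitz_map_def)
 also have "... = 0" by (simp add: Df_integral_def Df Liminf_const)
 finally show ?thesis by (simp add: Df)
qed

theorem proposition4p4p7:
  fixes \<mu> :: "'a::banach measure"
    and B U V :: "'a set"
    and p :: real
    and g :: "'a \<Rightarrow> (real ^ 'n, 'q::finite) utuple"
  assumes "finite_basis B"
    and "haar_measure \<mu>"
    and "U = UNIV \<or> (open U \<and> bounded U \<and> extension_property \<mu> B U)"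
    and "1 < p"
    and "g \<in> W1p \<mu> B p U"
    and "open V" and "V \<subseteq> U"
  shows "p_energy \<mu> B p U g V = (\<integral>\<^sup>+x\<in>V. ennreal (Df_norm \<mu> B U g x powr p) \<partial>\<mu>)"
proof (cases "B = {}")
  case True
  show ?thesis unfolding True by (rule p_energy_trivial) (use assms(1,4) True in auto)
next
  case False
  have U: "open U" using assms(3) by auto
  obtain T :: "real ^ 'a basis_index \<Rightarrow> 'a" where T: "linear T" "bij T" "bij_betw T Basis B"
    by (rule coordinate_isomorphism[OF assms(1) False])
  obtain C where C: "1 \<le> C" "\<And>x. norm (T x) \<le> C * norm x" "\<And>x. norm x \<le> C * norm (T x)"
    by (rule linear_bij_bounds[OF T(1,2)]) blast
  define R where "R = inv T"
  have RT: "R (T x) = x" and TR: "T (R y) = y" for x y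
    using T(2) by (simp_all add: R_def bij_is_inj bij_is_surj surj_f_inv_f)
  have R_add: "R (a + b) = R a + R b" for a b
    using RT[of "R a + R b"] by (simp add: linear_add[OF T(1)] TR)
  have sets_mu: "sets \<mu> = sets borel" using assms(2) by (simp add: haar_measure_def)
  have cR: "continuous_on UNIV R"
  proof (rule lipschitz_on_continuous_on[of C], rule lipschitz_onI)
    fix u v
    have "T (R u - R v) = u - v" by (simp add: linear_diff[OF T(1)] TR)
    then show "dist (R u) (R v) \<le> C * dist u v" using C(3)[of "R u - R v"] by (simp add: dist_norm)
  qed (use C in simp)
  then have Rb: "R \<in> borel_measurable borel" by (rule borel_measurable_continuous_onI)
  have Rm[measurable]: "R \<in> measurable \<mu> borel" by (subst measurable_cong_sets[OF sets_mu refl]) (rule Rb)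
  have cT: "continuous_on UNIV T"
  proof (rule lipschitz_on_continuous_on[of C], rule lipschitz_onI)
    show "dist (T u) (T v) \<le> C * dist u v" for u v using C(2)[of "u - v"] by (simp add: dist_norm linear_diff[OF T(1)])
  qed (use C in simp)
  \<comment> \<open>The measure is carried to the Euclidean model, where translation invariance
    identifies it up to a constant.\<close>
  define \<nu> where "\<nu> = distr \<mu> borel R"
  have em: "emeasure \<nu> A = emeasure \<mu> (T ` A)" if "A \<in> sets borel" for A
  proof -
    have "R -` A = T ` A" by (auto simp: RT image_iff) (metis TR)
    then show ?thesis using that sets_eq_imp_space_eq[OF sets_mu] by (simp add: \<nu>_def emeasure_distr)
  qed
  have "distr \<nu> borel (\<lambda>x. a + x) = \<nu>" for a
  proof -
    have "distr \<nu> borel (\<lambda>x. a + x) = distr \<mu> borel ((\<lambda>x. a + x) \<circ> R)" unfolding \<nu>_def by (rule distr_distr) measurable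
    also have "(\<lambda>x. a + x) \<circ> R = R \<circ> (\<lambda>y. T a + y)" by (simp add: fun_eq_iff R_add RT)
    also have "distr \<mu> borel (R \<circ> (\<lambda>y. T a + y)) = distr (distr \<mu> borel (\<lambda>y. T a + y)) borel R"
      by (rule distr_distr[symmetric]) (use Rb in \<open>simp_all add: measurable_cong_sets[OF sets_mu refl]\<close>)
    also have "distr \<mu> borel (\<lambda>y. T a + y) = \<mu>" using assms(2) by (simp add: haar_measure_def)
    finally show ?thesis by (simp add: \<nu>_def)
  qed
  moreover have "emeasure \<nu> K < \<infinity>" if "compact K" for K
    using assms(2) em[OF borel_compact[OF that]] compact_continuous_image[OF continuous_on_subset[OF cT] that]
    by (simp add: haar_measure_def)
  moreover have "emeasure \<nu> UNIV \<noteq> 0"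
    using assms(2) em[of UNIV] T(2) by (simp add: haar_measure_def bij_is_surj)
  moreover have "sets \<nu> = sets borel" by (simp add: \<nu>_def)
  ultimately obtain c where c: "0 < c" "c < \<infinity>" "\<nu> = scale_measure c lborel"
    using translation_invariant_eq_lborel[of \<nu>] by blast
  interpret basis_chart T R C \<mu> c B
  proof
    show "norm (R y) \<le> C * norm y" for y using C(3)[of "R y"] by (simp add: TR)
    show "distr \<mu> borel R = scale_measure c lborel" using c(3) by (simp add: \<nu>_def)
  qed (use T C RT TR sets_mu c in \<open>auto simp: linear_add[OF T(1)] linear_scale[OF T(1)]\<close>)
  show ?thesis by (rule p_energy_eq[OF U assms(4-7)])
qed

end
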